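(* Let $\nu$ be a probability measure on $[0,\infty)$, and assume that $(x_p)$ satisfies (ACI) with radial law $\nu$ through a radial reduction $(\mathcal H_p,\rho_p)$. Then the following are equivalent. (i) $R_p\Rightarrow\nu$ and (RQC) holds. (ii) $(x_p)$ has property (RMP-$\Pi$) for $(c,\nu)$. Moreover (ii) implies $R_p-\rho_p\to0$ in probability. The implication (i)$\Rightarrow$(ii) uses no hypothesis on $(\mathcal H_p,\rho_p)$ (it holds without assuming (ACI)).
   Context: Setting: $p=p_n\to\infty$ and $N=N_n$ are positive integers with $p/N\to c\in(0,\infty)$; limits are as $n\to\infty$. For each $n$, $x_p$ is a random vector in $\mathbb R^p$ and $x_1,\dots,x_N$ are independent copies. $R_p=\|x_p\|^2/p$ and $Q_p(A)=\frac{x_p^{\mathsf T}Ax_p}{p}-R_p\frac{\operatorname{tr}A}{p}$ (unnormalized trace). (RQC): $Q_p(P_p)\to0$ in probability for every deterministic sequence of orthogonal projections $P_p\in\mathbb R^{p\times p}$. Radial reduction and (ACI): a radial reduction of $(x_p)$ is a pair $(\mathcal H_p,\rho_p)$ in which $\mathcal H_p\subseteq\sigma(x_p)$ is a $\sigma$-field with $\mathbb E[\|x_p\|^2\mid\mathcal H_p]<\infty$ almost surely and $\rho_p\ge0$ is an $\mathcal H_p$-measurable random variable, such that $\Sigma_p=\mathbb E[x_px_p^{\mathsf T}\mid\mathcal H_p]$ satisfies $\frac1p\|\Sigma_p-\rho_pI_p\|_1\to0$ in probability ($\|\cdot\|_1$ is the trace norm). $(x_p)$ satisfies (ACI) with radial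 law $\nu$ if it admits a radial reduction with $\rho_p\Rightarrow\nu$. For an orthogonal projection $P$ of rank $q$, $C_P\in\mathbb R^{q\times p}$ has orthonormal rows spanning the range of $P$ and $S_P=\frac1N\sum_{j=1}^N(C_Px_j)(C_Px_j)^{\mathsf T}$. $\operatorname{ESD}$ denotes the empirical spectral distribution; weak convergence in probability to a deterministic limit means convergence in probability to $0$ of the Lévy distance. (RMP-$\Pi$) for $(c,\nu)$: for every $\alpha\in(0,1]$ and every deterministic sequence of orthogonal projections $P_p$ with $\operatorname{rank}P_p/p\to\alpha$, $\operatorname{ESD}(S_{P_p})\Rightarrow\mu_{c\alpha,\nu}$ weakly in probability. For $d>0$, $\mu_{d,\nu}$ is the unique probability measure on $[0,\infty)$ whose Stieltjes transform $s(z)=\int(\lambda-z)^{-1}\mu_{d,\nu}(\mathrm d\lambda)$ satisfies $\frac1{s(z)}+z=\int_0^\infty\frac{r}{1+d\,r\,s(z)}\nu(\mathrm dr)$ for all $z$ with $\operatorname{Im}z>0$. *)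

theory Defs
  imports "HOL-Probability.Probability" "Jordan_Normal_Form.DL_Rank" "Jordan_Normal_Form.Char_Poly"
begin

no_notation inner (infix "\<bullet>" 70)

text \<open>A random vector in $\mathbb{R}^p$ with varying $p$ is a measurable map into the product
  space of functions on the index set \<open>{..<p}\<close>; \<open>Matrix.vec p\<close> turns its values into vectors.
  All sequences are indexed by $n$, with dimension \<open>p n\<close> and sample size \<open>N n\<close>; the probability
  space \<open>M n\<close> may also vary with $n$.\<close>

abbreviation vec_borel :: "nat \<Rightarrow> (nat \<Rightarrow> real) measure" where
  "vec_borel p \<equiv> Pi\<^sub>M {..<p} (\<lambda>_. borel)"

text \<open>Convergence to 0 in probability. It is only applied to quantities that are continuous or
  Borel functions of random vectors and conditional expectations, so the events are measurable.\<close>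

definition tends_to_0_in_prob :: "(nat \<Rightarrow> 'a measure) \<Rightarrow> (nat \<Rightarrow> 'a \<Rightarrow> real) \<Rightarrow> bool" where
  "tends_to_0_in_prob M Y \<longleftrightarrow>
    (\<forall>\<epsilon>>0. (\<lambda>n. measure (M n) {\<omega> \<in> space (M n). \<epsilon> < \<bar>Y n \<omega>\<bar>}) \<longlonglongrightarrow> 0)"

definition mat_trace :: "real mat \<Rightarrow> real" where
  "mat_trace A = (\<Sum>i<dim_row A. A $$ (i, i))"

text \<open>Sum of the singular values, i.e. of the square roots of the eigenvalues of
  \<open>transpose_mat A * A\<close> counted with multiplicity.\<close>

definition trace_norm :: "real mat \<Rightarrow> real" where
  "trace_norm A = (\<Sum>l \<in># proots (char_poly (transpose_mat A * A)). sqrt l)"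

definition orth_projection :: "nat \<Rightarrow> real mat \<Rightarrow> bool" where
  "orth_projection p P \<longleftrightarrow> P \<in> carrier_mat p p \<and> P * P = P \<and> transpose_mat P = P"

abbreviation mat_rank :: "real mat \<Rightarrow> nat" where
  "mat_rank A \<equiv> vec_space.rank (dim_row A) A"

definition orthonormal_rows_of_range :: "nat \<Rightarrow> real mat \<Rightarrow> real mat \<Rightarrow> bool" where
  "orthonormal_rows_of_range p P C \<longleftrightarrow>
    C \<in> carrier_mat (mat_rank P) p \<and> C * transpose_mat C = 1\<^sub>m (mat_rank P) \<and>
    vec_space.row_space p C = vec_space.col_space p P"

definition R_val :: "nat \<Rightarrow> (nat \<Rightarrow> real) \<Rightarrow> real" where
  "R_val p x = Matrix.vec p x \<bullet> Matrix.vec p x / real p"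

definition Q_val :: "nat \<Rightarrow> real mat \<Rightarrow> (nat \<Rightarrow> real) \<Rightarrow> real" where
  "Q_val p A x = Matrix.vec p x \<bullet> (A *\<^sub>v Matrix.vec p x) / real p - R_val p x * (mat_trace A / real p)"

definition RQC :: "(nat \<Rightarrow> 'a measure) \<Rightarrow> (nat \<Rightarrow> nat) \<Rightarrow> (nat \<Rightarrow> 'a \<Rightarrow> nat \<Rightarrow> real) \<Rightarrow> bool" where
  "RQC M p x \<longleftrightarrow> (\<forall>P. (\<forall>n. orth_projection (p n) (P n)) \<longrightarrow>
     tends_to_0_in_prob M (\<lambda>n \<omega>. Q_val (p n) (P n) (x n \<omega>)))"

text \<open>The entries of \<open>x\<close> need not be square integrable. \<open>real_cond_exp\<close> is the difference of the
  conditional expectations of the positive and negative parts, both almost surely finite when the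
  conditional second moment of the norm is, so this is the generalized conditional expectation.\<close>

definition cond_second_moment ::
    "'a measure \<Rightarrow> 'a measure \<Rightarrow> nat \<Rightarrow> ('a \<Rightarrow> nat \<Rightarrow> real) \<Rightarrow> 'a \<Rightarrow> real mat" where
  "cond_second_moment M H p x \<omega> =
     Matrix.mat p p (\<lambda>(i, j). real_cond_exp M H (\<lambda>\<omega>'. x \<omega>' i * x \<omega>' j) \<omega>)"

definition radial_reduction ::
    "(nat \<Rightarrow> 'a measure) \<Rightarrow> (nat \<Rightarrow> nat) \<Rightarrow> (nat \<Rightarrow> 'a \<Rightarrow> nat \<Rightarrow> real) \<Rightarrow>
     (nat \<Rightarrow> 'a measure) \<Rightarrow> (nat \<Rightarrow> 'a \<Rightarrow> real) \<Rightarrow> bool" where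
  "radial_reduction M p x H \<rho> \<longleftrightarrow>
     (\<forall>n. subalgebra (M n) (H n) \<and>
          sets (H n) \<subseteq> sets (vimage_algebra (space (M n)) (x n) (vec_borel (p n))) \<and>
          (AE \<omega> in M n. nn_cond_exp (M n) (H n)
             (\<lambda>\<omega>'. ennreal (Matrix.vec (p n) (x n \<omega>') \<bullet> Matrix.vec (p n) (x n \<omega>'))) \<omega> < \<infinity>) \<and>
          \<rho> n \<in> borel_measurable (H n) \<and> (\<forall>\<omega> \<in> space (M n). 0 \<le> \<rho> n \<omega>)) \<and>
     tends_to_0_in_prob M (\<lambda>n \<omega>.
       trace_norm (cond_second_moment (M n) (H n) (p n) (x n) \<omega> - \<rho> n \<omega> \<cdot>\<^sub>m 1\<^sub>m (p n)) / real (p n))"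

definition ACI_through ::
    "(nat \<Rightarrow> 'a measure) \<Rightarrow> (nat \<Rightarrow> nat) \<Rightarrow> (nat \<Rightarrow> 'a \<Rightarrow> nat \<Rightarrow> real) \<Rightarrow>
     (nat \<Rightarrow> 'a measure) \<Rightarrow> (nat \<Rightarrow> 'a \<Rightarrow> real) \<Rightarrow> real measure \<Rightarrow> bool" where
  "ACI_through M p x H \<rho> \<nu> \<longleftrightarrow>
     radial_reduction M p x H \<rho> \<and> weak_conv_m (\<lambda>n. distr (M n) borel (\<rho> n)) \<nu>"

text \<open>\<open>X j\<close> is the \<open>j\<close>-th sample vector, for \<open>j < N\<close>.\<close>

definition sample_cov :: "nat \<Rightarrow> nat \<Rightarrow> real mat \<Rightarrow> (nat \<Rightarrow> nat \<Rightarrow> real) \<Rightarrow> real mat" where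
  "sample_cov p N C X = Matrix.mat (dim_row C) (dim_row C) (\<lambda>(k, l).
     (1 / real N) * (\<Sum>j<N. (C *\<^sub>v Matrix.vec p (X j)) $ k * (C *\<^sub>v Matrix.vec p (X j)) $ l))"

text \<open>Eigenvalues are counted with multiplicity. The value for a matrix of size 0 is
  unspecified.\<close>

definition ESD :: "real mat \<Rightarrow> real measure" where
  "ESD A = distr (measure_pmf (pmf_of_multiset (proots (char_poly A)))) borel (\<lambda>l. l)"

definition levy_dist :: "real measure \<Rightarrow> real measure \<Rightarrow> real" where
  "levy_dist \<mu> \<nu> = Inf {\<epsilon>. 0 < \<epsilon> \<and>
     (\<forall>t. cdf \<mu> (t - \<epsilon>) - \<epsilon> \<le> cdf \<nu> t \<and> cdf \<nu> t \<le> cdf \<mu> (t + \<epsilon>) + \<epsilon>)}"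

definition stieltjes :: "real measure \<Rightarrow> complex \<Rightarrow> complex" where
  "stieltjes \<mu> z = (LINT l|\<mu>. inverse (complex_of_real l - z))"

definition prob_on_nonneg :: "real measure \<Rightarrow> bool" where
  "prob_on_nonneg \<mu> \<longleftrightarrow> real_distribution \<mu> \<and> emeasure \<mu> {..<0} = 0"

definition mp_law :: "real \<Rightarrow> real measure \<Rightarrow> real measure" where
  "mp_law d \<nu> = (THE \<mu>. prob_on_nonneg \<mu> \<and>
     (\<forall>z. 0 < Im z \<longrightarrow>
        1 / stieltjes \<mu> z + z =
        (LINT r:{0..}|\<nu>. complex_of_real r /
           (1 + complex_of_real d * complex_of_real r * stieltjes \<mu> z))))"

text \<open>\<open>C n\<close> ranges over all admissible choices of coordinates on the range of \<open>P n\<close>.\<close>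

definition RMP_Pi ::
    "(nat \<Rightarrow> 'a measure) \<Rightarrow> (nat \<Rightarrow> nat) \<Rightarrow> (nat \<Rightarrow> nat) \<Rightarrow> (nat \<Rightarrow> nat \<Rightarrow> 'a \<Rightarrow> nat \<Rightarrow> real) \<Rightarrow>
     real \<Rightarrow> real measure \<Rightarrow> bool" where
  "RMP_Pi M p N X c \<nu> \<longleftrightarrow>
     (\<forall>\<alpha> P C. 0 < \<alpha> \<and> \<alpha> \<le> 1 \<and>
        (\<forall>n. orth_projection (p n) (P n) \<and> orthonormal_rows_of_range (p n) (P n) (C n)) \<and>
        (\<lambda>n. real (mat_rank (P n)) / real (p n)) \<longlonglongrightarrow> \<alpha> \<longrightarrow>
        tends_to_0_in_prob M (\<lambda>n \<omega>.
          levy_dist (ESD (sample_cov (p n) (N n) (C n) (\<lambda>j. X n j \<omega>))) (mp_law (c * \<alpha>) \<nu>)))"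

end

theory Submission
  imports Defs "HOL-Complex_Analysis.Complex_Analysis"
begin

text \<open>Write \<open>\<phi> B\<close> for the mean of \<open>u / (1 + u)\<close> with \<open>u = y\<^sup>T B y / N\<close> and \<open>y\<close> a projected sample.
  The resolvent trace \<open>m\<close> at \<open>-t\<close> satisfies \<open>q (1 - t m) = \<Sum>\<^sub>j a\<^sub>j / (1 + a\<^sub>j)\<close>, where \<open>a\<^sub>j\<close> is the form
  of the leave-one-out resolvent in the sample \<open>j\<close>, independent of that sample; its conditional
  mean is \<open>\<phi>\<close> of the leave-one-out resolvent. If \<open>\<phi> B\<close> is uniformly close to
  \<open>\<integral> r s / (1 + r s) \<nu>(dr)\<close> at \<open>s = tr B / N\<close>, then \<open>t E (m - m\<^sup>*)\<^sup>2\<close> is small by monotonicity of this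
  function, without any variance estimate. Under (RQC) this closeness follows by slicing contractions into
  projections; applied to random sign vectors with random radii it also yields the existence of the
  limit law. Conversely, under (ACI) Jensen's inequality for \<open>u / (1 + u)\<close> gives the one-sided bound
  \<open>\<phi> B \<le> \<integral> r s / (1 + r s) \<nu>(dr) + o(1)\<close> for all \<open>B\<close>, and the limit of the spectral laws forces near equality
  for some deterministic \<open>B\<close>. Then the quadratic form of \<open>B\<close> concentrates at its conditional mean; letting \<open>t\<close>
  tend to infinity, \<open>t B\<close> exhausts the projection up to a small trace.\<close>

text \<open>The vectors need not have any moments, and \<nu> may have infinite mean. This shapes the
  proof: every estimate passes through the bounded function \<open>u / (1 + u)\<close>, and
  \<open>mp_modulus\<close>, a mean of truncated linear functions, takes the place of Lipschitz
  constants. Only negative spectral parameters \<open>-t\<close> are used. There resolvents are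
  positive, and \<open>t\<close> times a resolvent is a contraction, so order relations replace
  complex estimates; the complex plane enters only to identify limits with \<open>mp_law\<close>, a
  definite description that says nothing until existence and uniqueness are known. (RQC) concerns
  deterministic matrices, while leave-one-out resolvents are random. Independence allows them to be
  frozen, and choosing worst projections makes (RQC) uniform for each \<open>n\<close>, so that
  freezing costs nothing. In the converse the spectral laws reveal averages only: for each
  \<open>t\<close> they yield one deterministic matrix with a small Jensen gap. Its distance to the
  projection is governed by \<open>1 - t * ms t\<close>, which tends to 0 because the limit law has
  no mass at infinity.\<close>

no_notation inner (infix "\<bullet>" 70)
no_notation vec_nth (infixl "$" 90)
no_notation fps_nth (infixl "$" 75)
no_notation fls_nth (infixl "$$" 75)

section \<open>Spectral theory of real symmetric matrices\<close>

lemma scalar_prod_real_nonneg: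
  fixes v :: "real Matrix.vec"
  shows "0 \<le> v \<bullet> v"
  by (auto simp: scalar_prod_def intro: sum_nonneg)

lemma scalar_prod_real_eq_0:
  fixes v :: "real Matrix.vec"
  assumes "v \<in> carrier_vec n"
  shows "v \<bullet> v = 0 \<longleftrightarrow> v = 0\<^sub>v n"
proof
  assume "v \<bullet> v = 0"
  then have "\<forall>i\<in>{0..<dim_vec v}. v $ i * v $ i = 0"
    unfolding scalar_prod_def by (subst (asm) sum_nonneg_eq_0_iff) auto
  then show "v = 0\<^sub>v n" using assms by (intro eq_vecI) auto
qed (use assms in auto)

lemma symmetric_mat_scalar_prod:
  fixes A :: "real mat"
  assumes "A \<in> carrier_mat n n" "transpose_mat A = A" "u \<in> carrier_vec n" "v \<in> carrier_vec n"
  shows "u \<bullet> (A *\<^sub>v v) = (A *\<^sub>v u) \<bullet> v"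
  using transpose_vec_mult_scalar[OF assms(1,4,3)] assms(2) by simp

text \<open>The fundamental theorem of algebra supplies a complex eigenvector. Pairing its real and
  imaginary parts through the symmetric form forces the eigenvalue to be real, and then a nonzero
  one of the two parts is a real eigenvector.\<close>

lemma real_symmetric_eigenvector:
  fixes A :: "real mat"
  assumes A: "A \<in> carrier_mat n n" "transpose_mat A = A" and n: "0 < n"
  obtains l v where "v \<in> carrier_vec n" "v \<bullet> v = 1" "A *\<^sub>v v = l \<cdot>\<^sub>v v"
proof -
  let ?Ac = "map_mat complex_of_real A"
  have Ac: "?Ac \<in> carrier_mat n n" using A by auto
  have "Polynomial.degree (char_poly ?Ac) = n" using degree_monic_char_poly[OF Ac] by simp
  then obtain \<mu> where "poly (char_poly ?Ac) \<mu> = 0"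
    using Fundamental_Theorem_Algebra.fundamental_theorem_of_algebra[of "char_poly ?Ac"] n
    by (metis constant_degree not_less_zero bot_nat_0.not_eq_extremum)
  then have "eigenvalue ?Ac \<mu>" using eigenvalue_root_char_poly[OF Ac] by simp
  then obtain w where w: "w \<in> carrier_vec n" "w \<noteq> 0\<^sub>v n" "?Ac *\<^sub>v w = \<mu> \<cdot>\<^sub>v w"
    unfolding eigenvalue_def eigenvector_def using Ac by auto
  define a where "a = map_vec Re w"
  define b where "b = map_vec Im w"
  have ab: "a \<in> carrier_vec n" "b \<in> carrier_vec n" using w by (auto simp: a_def b_def)
  have eq: "(\<Sum>j<n. complex_of_real (A $$ (i, j)) * w $ j) = \<mu> * w $ i" if "i < n" for i
  proof -
    have "(?Ac *\<^sub>v w) $ i = (\<mu> \<cdot>\<^sub>v w) $ i" using w by simp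
    then show ?thesis using that w(1) A by (simp add: scalar_prod_def atLeast0LessThan)
  qed
  have Aa: "A *\<^sub>v a = Re \<mu> \<cdot>\<^sub>v a - Im \<mu> \<cdot>\<^sub>v b"
  proof (rule eq_vecI)
    fix i assume "i < dim_vec (Re \<mu> \<cdot>\<^sub>v a - Im \<mu> \<cdot>\<^sub>v b)"
    then have i: "i < n" using ab by auto
    from arg_cong[OF eq[OF i], of Re] show "(A *\<^sub>v a) $ i = (Re \<mu> \<cdot>\<^sub>v a - Im \<mu> \<cdot>\<^sub>v b) $ i"
      using i A w ab by (simp add: scalar_prod_def atLeast0LessThan a_def b_def)
  qed (use A ab in auto)
  have Ab: "A *\<^sub>v b = Im \<mu> \<cdot>\<^sub>v a + Re \<mu> \<cdot>\<^sub>v b"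
  proof (rule eq_vecI)
    fix i assume "i < dim_vec (Im \<mu> \<cdot>\<^sub>v a + Re \<mu> \<cdot>\<^sub>v b)"
    then have i: "i < n" using ab by auto
    from arg_cong[OF eq[OF i], of Im] show "(A *\<^sub>v b) $ i = (Im \<mu> \<cdot>\<^sub>v a + Re \<mu> \<cdot>\<^sub>v b) $ i"
      using i A w ab by (simp add: scalar_prod_def atLeast0LessThan a_def b_def algebra_simps)
  qed (use A ab in auto)
  have "a \<bullet> (A *\<^sub>v b) = (A *\<^sub>v a) \<bullet> b" using symmetric_mat_scalar_prod[OF A ab] .
  then have "Im \<mu> * (a \<bullet> a + b \<bullet> b) = 0" using ab
    unfolding Aa Ab
    by (simp add: scalar_prod_add_distrib[of _ n] minus_scalar_prod_distrib[of _ n] algebra_simps)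
  moreover have nz: "a \<noteq> 0\<^sub>v n \<or> b \<noteq> 0\<^sub>v n"
  proof (rule ccontr)
    assume "\<not> ?thesis"
    then have "\<forall>i<n. Re (w $ i) = 0 \<and> Im (w $ i) = 0" using w unfolding a_def b_def
      by (metis carrier_vecD index_map_vec(1) index_zero_vec(1))
    then have "w = 0\<^sub>v n" using w by (intro eq_vecI) (auto simp: complex_eq_iff)
    with w show False by simp
  qed
  then have "a \<bullet> a + b \<bullet> b \<noteq> 0" 
    using scalar_prod_real_eq_0[OF ab(1)] scalar_prod_real_eq_0[OF ab(2)] 
      scalar_prod_real_nonneg[of a] scalar_prod_real_nonneg[of b] by linarith
  ultimately have "Im \<mu> = 0" by simp
  with Aa Ab ab have E: "A *\<^sub>v a = Re \<mu> \<cdot>\<^sub>v a" "A *\<^sub>v b = Re \<mu> \<cdot>\<^sub>v b" 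
    by (auto intro!: eq_vecI)
  obtain c where c: "c \<in> carrier_vec n" "c \<noteq> 0\<^sub>v n" "A *\<^sub>v c = Re \<mu> \<cdot>\<^sub>v c"
    using nz E ab by blast
  define s where "s = sqrt (c \<bullet> c)"
  have s: "0 < s" using c scalar_prod_real_eq_0[OF c(1)] scalar_prod_real_nonneg[of c]
    by (simp add: s_def less_le)
  have ss: "s * s = c \<bullet> c" using scalar_prod_real_nonneg[of c] by (simp add: s_def)
  show ?thesis
  proof (rule that[of "(1/s) \<cdot>\<^sub>v c" "Re \<mu>"])
    show "((1/s) \<cdot>\<^sub>v c) \<bullet> ((1/s) \<cdot>\<^sub>v c) = 1" using c s by (simp flip: ss)
    show "A *\<^sub>v ((1/s) \<cdot>\<^sub>v c) = Re \<mu> \<cdot>\<^sub>v ((1/s) \<cdot>\<^sub>v c)"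
      using c A by (simp add: mult_mat_vec[of _ n n] smult_smult_assoc mult.commute)
  qed (use c in auto)
qed

text \<open>A Householder reflection exchanges the first unit vector with \<open>v\<close> and is
  its own inverse. The identity matrix covers the case in which the two coincide.\<close>

lemma orthogonal_completion:
  fixes v :: "real Matrix.vec"
  assumes v: "v \<in> carrier_vec n" "v \<bullet> v = 1" and n: "0 < n"
  obtains W where "W \<in> carrier_mat n n" "transpose_mat W * W = 1\<^sub>m n" "W * transpose_mat W = 1\<^sub>m n" "col W 0 = v"
proof (cases "v = unit_vec n 0")
  case True
  show ?thesis by (rule that[of "1\<^sub>m n"]) (use True n in auto)
next
  case False
  define w where "w = unit_vec n 0 - v"
  have w: "w \<in> carrier_vec n" using v by (auto simp: w_def)
  have "w \<noteq> 0\<^sub>v n" 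
  proof
    assume "w = 0\<^sub>v n"
    then have "\<forall>i<n. w $ i = 0" by simp
    then have "v = unit_vec n 0" using v w unfolding w_def by (intro eq_vecI) auto
    then show False using False by simp
  qed
  then have w0: "w \<bullet> w \<noteq> 0" using scalar_prod_real_eq_0[OF w] by simp
  \<comment> \<open>Both vectors have norm 1. This identity gives \<open>c * w $ 0 = 1\<close>
    below, which is why the first column of the reflection is \<open>v\<close>.\<close>
  have w1: "w \<bullet> w = 2 * w $ 0"
    using v n unfolding w_def 
    by (simp add: minus_scalar_prod_distrib[of _ n] scalar_prod_minus_distrib[of _ n] )
  define c where "c = 2 / (w \<bullet> w)"
  define W where "W = Matrix.mat n n (\<lambda>(i,j). (if i = j then 1 else 0) - c * w $ i * w $ j)"
  have W: "W \<in> carrier_mat n n" by (simp add: W_def)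
  have T: "transpose_mat W = W" by (rule eq_matI) (auto simp: W_def)
  have "W * W = 1\<^sub>m n"
  proof (rule eq_matI)
    fix i j assume "i < dim_row (1\<^sub>m n)" "j < dim_col (1\<^sub>m n)"
    then have ij: "i < n" "j < n" by auto
    have "(W * W) $$ (i, j) = (\<Sum>k<n. ((if i = k then 1 else 0) - c * w $ i * w $ k) * ((if k = j then 1 else 0) - c * w $ k * w $ j))"
      using ij by (simp add: W_def scalar_prod_def atLeast0LessThan)
    also have "\<dots> = (\<Sum>k<n. (if i = k then (if k = j then 1 else 0) - c * w $ k * w $ j else 0)
        - (if k = j then c * w $ i * w $ k else 0) + c * c * w $ i * w $ j * (w $ k * w $ k))"
      by (rule sum.cong) (auto simp: algebra_simps)
    also have "\<dots> = (if i = j then 1 else 0) - c * w $ i * w $ j - c * w $ i * w $ j + c * c * w $ i * w $ j * (w \<bullet> w)"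
      using ij w by (simp add: sum.distrib sum_subtractf sum_distrib_left scalar_prod_def atLeast0LessThan)
    also have "\<dots> = (if i = j then 1 else 0)" using w0 by (simp add: c_def field_simps)
    finally show "(W * W) $$ (i, j) = 1\<^sub>m n $$ (i, j)" using ij by simp
  qed (use W in auto)
  moreover have "col W 0 = v"
  proof (rule eq_vecI)
    fix i assume "i < dim_vec v"
    then have i: "i < n" using v by simp
    have "c * w $ 0 = 1" using w0 w1 by (simp add: c_def field_simps)
    then have "c * w $ i * w $ 0 = w $ i" by (metis mult.assoc mult.commute mult.right_neutral)
    moreover have "col W 0 $ i = (if i = 0 then 1 else 0) - c * w $ i * w $ 0" using i n by (simp add: W_def)
    moreover have "w $ i = (if i = 0 then 1 else 0) - v $ i" using i v by (simp add: w_def)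
    ultimately show "col W 0 $ i = v $ i" by linarith
  qed (use v W in auto)
  ultimately show ?thesis using that[of W] W T by simp
qed

lemma four_block_diag_mult:
  fixes A A' B B' :: "real mat"
  assumes "A \<in> carrier_mat m m" "A' \<in> carrier_mat m m" "B \<in> carrier_mat n n" "B' \<in> carrier_mat n n"
  shows "four_block_mat A (0\<^sub>m m n) (0\<^sub>m n m) B * four_block_mat A' (0\<^sub>m m n) (0\<^sub>m n m) B'
    = four_block_mat (A * A') (0\<^sub>m m n) (0\<^sub>m n m) (B * B')"
  by (subst mult_four_block_mat[of _ m m _ n _ n _ _ m _ n]) (use assms in auto)

text \<open>Induction by deflation: in an orthonormal basis that starts with an eigenvector, the
  first column is a multiple of the first unit vector, and by symmetry so is the first row. The
  remaining block is symmetric and smaller.\<close>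

lemma real_spectral_theorem:
  fixes A :: "real mat"
  assumes "A \<in> carrier_mat n n" "transpose_mat A = A"
  obtains U d where "U \<in> carrier_mat n n" "transpose_mat U * U = 1\<^sub>m n" "U * transpose_mat U = 1\<^sub>m n"
    "A = U * mat_diag n d * transpose_mat U"
  using assms
proof (induction n arbitrary: A thesis)
  case 0
  show ?case by (rule 0(1)[of "1\<^sub>m 0" "\<lambda>_. 0"]) (use 0 in auto)
next
  case (Suc n)
  obtain l v where v: "v \<in> carrier_vec (Suc n)" "v \<bullet> v = 1" "A *\<^sub>v v = l \<cdot>\<^sub>v v"
    using real_symmetric_eigenvector[OF Suc.prems(2,3) zero_less_Suc] by blast
  obtain W where W: "W \<in> carrier_mat (Suc n) (Suc n)" "transpose_mat W * W = 1\<^sub>m (Suc n)"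
      "W * transpose_mat W = 1\<^sub>m (Suc n)" "col W 0 = v"
    using orthogonal_completion[OF v(1,2)] by auto
  let ?WT = "transpose_mat W"
  define B where "B = ?WT * A * W"
  have B: "B \<in> carrier_mat (Suc n) (Suc n)" using W Suc.prems by (auto simp: B_def)
  have BT: "transpose_mat B = B"
    using W Suc.prems unfolding B_def
    by (simp add: transpose_mult[of _ "Suc n" "Suc n" _ "Suc n"] assoc_mult_mat[of _ "Suc n" "Suc n" _ "Suc n" _ "Suc n"])
  have A: "A = W * B * ?WT"
  proof -
    have "W * B * ?WT = (W * ?WT) * A * (W * ?WT)"
      using W(1) Suc.prems unfolding B_def by (simp add: assoc_mult_mat[of _ "Suc n" "Suc n" _ "Suc n" _ "Suc n"])
    then show ?thesis using W Suc.prems by simp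
  qed
  have B0: "B $$ (i, 0) = (if i = 0 then l else 0)" if "i < Suc n" for i
  proof -
    have "B = ?WT * (A * W)" unfolding B_def
      by (rule assoc_mult_mat[of _ "Suc n" "Suc n" _ "Suc n" _ "Suc n"]) (use W(1) Suc.prems(2) in auto)
    then have "col B 0 = ?WT *\<^sub>v col (A * W) 0"
      using col_mult2[of ?WT "Suc n" "Suc n" "A * W" "Suc n" 0] W(1) Suc.prems(2) by simp
    also have "col (A * W) 0 = A *\<^sub>v col W 0"
      using col_mult2[of A "Suc n" "Suc n" W "Suc n" 0] W(1) Suc.prems(2) by simp
    finally have "col B 0 = ?WT *\<^sub>v (A *\<^sub>v col W 0)" .
    also have "?WT *\<^sub>v (A *\<^sub>v col W 0) = l \<cdot>\<^sub>v (?WT *\<^sub>v col W 0)" using W v by (simp add: mult_mat_vec[of _ "Suc n" "Suc n"])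
    also have "?WT *\<^sub>v col W 0 = col (?WT * W) 0" using W(1) col_mult2[of ?WT "Suc n" "Suc n" W "Suc n" 0] by simp
    also have "\<dots> = unit_vec (Suc n) 0" using W by simp
    finally have "col B 0 $ i = (l \<cdot>\<^sub>v unit_vec (Suc n) 0) $ i" by simp
    then show ?thesis using that B by simp
  qed
  have B0': "B $$ (0, i) = (if i = 0 then l else 0)" if "i < Suc n" for i
    using B0[OF that] BT B that by (metis carrier_matD index_transpose_mat(1) zero_less_Suc)
  define D where "D = Matrix.mat n n (\<lambda>(i,j). B $$ (Suc i, Suc j))"
  have D: "D \<in> carrier_mat n n" by (simp add: D_def)
  have DT: "transpose_mat D = D"
  proof (rule eq_matI)
    fix i j assume "i < dim_row D" "j < dim_col D"
    then have ij: "i < n" "j < n" by (auto simp: D_def)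
    have "transpose_mat B $$ (Suc i, Suc j) = B $$ (Suc i, Suc j)" using BT by simp
    then show "transpose_mat D $$ (i, j) = D $$ (i, j)" using ij B by (simp add: D_def)
  qed (auto simp: D_def)
  obtain U d where U: "U \<in> carrier_mat n n" "transpose_mat U * U = 1\<^sub>m n" "U * transpose_mat U = 1\<^sub>m n"
    "D = U * mat_diag n d * transpose_mat U" using Suc.IH[OF _ D DT] by blast
  let ?UT = "transpose_mat U"
  let ?one = "1\<^sub>m 1 :: real mat"
  let ?l = "Matrix.mat 1 1 (\<lambda>_. l)"
  define V where "V = four_block_mat ?one (0\<^sub>m 1 n) (0\<^sub>m n 1) U"
  have V: "V \<in> carrier_mat (Suc n) (Suc n)" using U by (auto simp: V_def)
  have VT: "transpose_mat V = four_block_mat ?one (0\<^sub>m 1 n) (0\<^sub>m n 1) ?UT"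
    unfolding V_def by (subst transpose_four_block_mat[of _ 1 1 _ n _ n]) (use U in auto)
  have BB: "B = four_block_mat ?l (0\<^sub>m 1 n) (0\<^sub>m n 1) D"
  proof (rule eq_matI)
    fix i j assume "i < dim_row (four_block_mat ?l (0\<^sub>m 1 n) (0\<^sub>m n 1) D)" "j < dim_col (four_block_mat ?l (0\<^sub>m 1 n) (0\<^sub>m n 1) D)"
    then have "i < Suc n" "j < Suc n" using D by auto
    then show "B $$ (i, j) = four_block_mat ?l (0\<^sub>m 1 n) (0\<^sub>m n 1) D $$ (i, j)"
      using B0 B0' D by (cases i; cases j) (auto simp: D_def)
  qed (use B D in auto)
  define d' where "d' = case_nat l d"
  have dd: "mat_diag (Suc n) d' = four_block_mat ?l (0\<^sub>m 1 n) (0\<^sub>m n 1) (mat_diag n d)"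
  proof (rule eq_matI)
    fix i j assume "i < dim_row (four_block_mat ?l (0\<^sub>m 1 n) (0\<^sub>m n 1) (mat_diag n d))" 
      "j < dim_col (four_block_mat ?l (0\<^sub>m 1 n) (0\<^sub>m n 1) (mat_diag n d))"
    then have "i < Suc n" "j < Suc n" by (auto simp: mat_diag_def)
    then show "mat_diag (Suc n) d' $$ (i, j) = four_block_mat ?l (0\<^sub>m 1 n) (0\<^sub>m n 1) (mat_diag n d) $$ (i, j)"
      by (cases i; cases j) (auto simp: mat_diag_def d'_def)
  qed (auto simp: mat_diag_def)
  have l: "?l \<in> carrier_mat 1 1" by simp
  have eqB: "B = V * mat_diag (Suc n) d' * transpose_mat V"
    unfolding VT BB dd unfolding V_def
    using U l by (simp add: four_block_diag_mult mult_carrier_mat[of _ n n _ n])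
  have VV: "transpose_mat V * V = 1\<^sub>m (Suc n)" "V * transpose_mat V = 1\<^sub>m (Suc n)"
    unfolding VT unfolding V_def using U by (simp_all add: four_block_diag_mult)
  have WVT: "transpose_mat (W * V) = transpose_mat V * ?WT" using W V by (simp add: transpose_mult)
  note asc = assoc_mult_mat[of _ "Suc n" "Suc n" _ "Suc n" _ "Suc n"]
  show ?case
  proof (rule Suc.prems(1)[of "W * V" d'])
    show "W * V \<in> carrier_mat (Suc n) (Suc n)" using W V by simp
    have "transpose_mat (W * V) * (W * V) = transpose_mat V * (?WT * W) * V"
      unfolding WVT using W(1) V by (simp add: asc mult_carrier_mat[of _ "Suc n" "Suc n" _ "Suc n"])
    then show "transpose_mat (W * V) * (W * V) = 1\<^sub>m (Suc n)" using W V VV by simp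
    have "(W * V) * transpose_mat (W * V) = W * (V * transpose_mat V) * ?WT"
      unfolding WVT using W(1) V by (simp add: asc mult_carrier_mat[of _ "Suc n" "Suc n" _ "Suc n"])
    then show "(W * V) * transpose_mat (W * V) = 1\<^sub>m (Suc n)" using W V VV by simp
    have "A = W * (V * mat_diag (Suc n) d' * transpose_mat V) * ?WT" using A eqB by simp
    also have "\<dots> = (W * V) * mat_diag (Suc n) d' * transpose_mat (W * V)"
      unfolding WVT using W(1) V by (simp add: asc mult_carrier_mat[of _ "Suc n" "Suc n" _ "Suc n"])
    finally show "A = (W * V) * mat_diag (Suc n) d' * transpose_mat (W * V)" .
  qed
qed

section \<open>Calculus of matrices that are diagonal in an orthonormal basis\<close>

lemma orth_diag_product:
  fixes U :: "real mat"
  assumes U: "U \<in> carrier_mat n n" "transpose_mat U * U = 1\<^sub>m n"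
  shows "(U * mat_diag n f * transpose_mat U) * (U * mat_diag n g * transpose_mat U)
    = U * mat_diag n (\<lambda>i. f i * g i) * transpose_mat U"
proof -
  have "(U * mat_diag n f * transpose_mat U) * (U * mat_diag n g * transpose_mat U)
      = U * (mat_diag n f * (transpose_mat U * U) * mat_diag n g) * transpose_mat U"
    using U(1) by (simp add: assoc_mult_mat[of _ n n _ n _ n] mult_carrier_mat[of _ n n _ n])
  then show ?thesis using U by (simp add: right_mult_one_mat[of _ n n])
qed

lemma transpose_mat_diag [simp]: "transpose_mat (mat_diag n f) = mat_diag n f"
  by (rule eq_matI) (auto simp: mat_diag_def)

lemma orth_diag_transpose:
  fixes U :: "real mat"
  assumes U: "U \<in> carrier_mat n n"
  shows "transpose_mat (U * mat_diag n f * transpose_mat U) = U * mat_diag n f * transpose_mat U"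
  using U by (simp add: transpose_mult[of _ n n _ n] assoc_mult_mat[of _ n n _ n _ n] mult_carrier_mat[of _ n n _ n])

lemma mat_trace_mult:
  fixes A B :: "real mat"
  assumes "A \<in> carrier_mat n m" "B \<in> carrier_mat m n"
  shows "mat_trace (A * B) = mat_trace (B * A)"
proof -
  have "mat_trace (A * B) = (\<Sum>i<n. \<Sum>j<m. A $$ (i,j) * B $$ (j,i))"
    using assms by (simp add: mat_trace_def scalar_prod_def atLeast0LessThan)
  also have "\<dots> = (\<Sum>j<m. \<Sum>i<n. B $$ (j,i) * A $$ (i,j))"
    by (subst sum.swap) (simp add: mult.commute)
  also have "\<dots> = mat_trace (B * A)"
    using assms by (simp add: mat_trace_def scalar_prod_def atLeast0LessThan)
  finally show ?thesis .
qed

lemma mat_trace_orth_diag: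
  fixes U :: "real mat"
  assumes U: "U \<in> carrier_mat n n" "transpose_mat U * U = 1\<^sub>m n"
  shows "mat_trace (U * mat_diag n f * transpose_mat U) = (\<Sum>i<n. f i)"
proof -
  have "mat_trace (U * mat_diag n f * transpose_mat U) = mat_trace (transpose_mat U * (U * mat_diag n f))"
    by (rule mat_trace_mult[of _ n n]) (use U in auto)
  also have "transpose_mat U * (U * mat_diag n f) = (transpose_mat U * U) * mat_diag n f"
    by (rule assoc_mult_mat[symmetric, of _ n n _ n _ n]) (use U in auto)
  also have "\<dots> = mat_diag n f" using U by (simp add: left_mult_one_mat[of _ n n])
  finally show ?thesis by (simp add: mat_trace_def mat_diag_def)
qed

text \<open>\<open>ESD\<close> and \<open>trace_norm\<close> are defined through roots of
  characteristic polynomials; similarity to a diagonal matrix turns both into sums over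
  \<open>f\<close>.\<close>

lemma proots_char_poly_orth_diag:
  fixes U :: "real mat"
  assumes U: "U \<in> carrier_mat n n" "transpose_mat U * U = 1\<^sub>m n" "U * transpose_mat U = 1\<^sub>m n"
  shows "proots (char_poly (U * mat_diag n f * transpose_mat U)) = image_mset f (mset_set {..<n})"
proof -
  have "similar_mat (U * mat_diag n f * transpose_mat U) (mat_diag n f)"
    by (rule similar_matI[of _ _ U "transpose_mat U" n]) (use U in auto)
  then have "char_poly (U * mat_diag n f * transpose_mat U) = char_poly (mat_diag n f)"
    by (rule char_poly_similar)
  also have "\<dots> = (\<Prod>a\<leftarrow>diag_mat (mat_diag n f). [:- a, 1:])"
    by (rule char_poly_upper_triangular) (auto simp: mat_diag_def)
  also have "diag_mat (mat_diag n f) = map f [0..<n]" by (auto simp: diag_mat_def mat_diag_def)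
  finally have "char_poly (U * mat_diag n f * transpose_mat U) = (\<Prod>i\<leftarrow>[0..<n]. [:- f i, 1:])"
    by (simp add: comp_def)
  also have "\<dots> = (\<Prod>i<n. [:- f i, 1:])" 
    by (simp add: prod.list_conv_set_nth atLeast0LessThan)
  finally have "proots (char_poly (U * mat_diag n f * transpose_mat U)) = (\<Sum>i<n. {#f i#})"
    by (simp add: proots_prod)
  also have "\<dots> = image_mset f (mset_set {..<n})"
    by (induction n) (auto simp: lessThan_Suc)
  finally show ?thesis .
qed

text \<open>Symmetry is required separately, since a nonnegative quadratic form does not imply it
  over the reals.\<close>

definition psd_mat :: "nat \<Rightarrow> real mat \<Rightarrow> bool" where
  "psd_mat n A \<longleftrightarrow> A \<in> carrier_mat n n \<and> transpose_mat A = A \<and>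
     (\<forall>v\<in>carrier_vec n. 0 \<le> v \<bullet> (A *\<^sub>v v))"

definition psd_contraction :: "nat \<Rightarrow> real mat \<Rightarrow> bool" where
  "psd_contraction n A \<longleftrightarrow> psd_mat n A \<and> (\<forall>v\<in>carrier_vec n. v \<bullet> (A *\<^sub>v v) \<le> v \<bullet> v)"

lemma orth_diag_eigenvector:
  fixes U :: "real mat"
  assumes U: "U \<in> carrier_mat n n" "transpose_mat U * U = 1\<^sub>m n" and i: "i < n"
  shows "col U i \<in> carrier_vec n" "col U i \<bullet> col U i = 1"
    "(U * mat_diag n f * transpose_mat U) *\<^sub>v col U i = f i \<cdot>\<^sub>v col U i"
proof -
  show c: "col U i \<in> carrier_vec n" using U i by auto
  have "(transpose_mat U * U) $$ (i, i) = 1" using U i by simp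
  then show "col U i \<bullet> col U i = 1" using U(1) i by simp
  have "(U * mat_diag n f * transpose_mat U) *\<^sub>v col U i = U *\<^sub>v (mat_diag n f *\<^sub>v (transpose_mat U *\<^sub>v col U i))"
    using U(1) c by (simp add: assoc_mult_mat_vec[of _ n n _ n])
  also have "transpose_mat U *\<^sub>v col U i = col (transpose_mat U * U) i"
    using col_mult2[of "transpose_mat U" n n U n i] U(1) i by simp
  also have "\<dots> = unit_vec n i" using U i by simp
  also have "mat_diag n f *\<^sub>v unit_vec n i = f i \<cdot>\<^sub>v unit_vec n i"
    using i by (intro eq_vecI) (auto simp: mat_diag_def)
  also have "U *\<^sub>v (f i \<cdot>\<^sub>v unit_vec n i) = f i \<cdot>\<^sub>v (U *\<^sub>v unit_vec n i)"
    using U by (simp add: mult_mat_vec[of _ n n])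
  also have "U *\<^sub>v unit_vec n i = col U i"
    using U i by (intro eq_vecI) auto
  finally show "(U * mat_diag n f * transpose_mat U) *\<^sub>v col U i = f i \<cdot>\<^sub>v col U i" .
qed

lemma psd_mat_spectral:
  assumes "psd_mat n A"
  obtains U d where "U \<in> carrier_mat n n" "transpose_mat U * U = 1\<^sub>m n" "U * transpose_mat U = 1\<^sub>m n"
    "A = U * mat_diag n d * transpose_mat U" "\<And>i. i < n \<Longrightarrow> 0 \<le> d i"
proof -
  obtain U d where U: "U \<in> carrier_mat n n" "transpose_mat U * U = 1\<^sub>m n" "U * transpose_mat U = 1\<^sub>m n"
    "A = U * mat_diag n d * transpose_mat U" 
    using real_spectral_theorem[of A n] assms unfolding psd_mat_def by blast
  have "0 \<le> d i" if i: "i < n" for i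
    using orth_diag_eigenvector[OF U(1,2) i] assms U(4) unfolding psd_mat_def
    by (metis mult.right_neutral scalar_prod_smult_distrib)
  then show ?thesis using that U by blast
qed

lemma psd_contraction_spectral:
  assumes "psd_contraction n A"
  obtains U d where "U \<in> carrier_mat n n" "transpose_mat U * U = 1\<^sub>m n" "U * transpose_mat U = 1\<^sub>m n"
    "A = U * mat_diag n d * transpose_mat U" "\<And>i. i < n \<Longrightarrow> 0 \<le> d i" "\<And>i. i < n \<Longrightarrow> d i \<le> 1"
proof -
  obtain U d where U: "U \<in> carrier_mat n n" "transpose_mat U * U = 1\<^sub>m n" "U * transpose_mat U = 1\<^sub>m n"
    "A = U * mat_diag n d * transpose_mat U" "\<And>i. i < n \<Longrightarrow> 0 \<le> d i"
    using psd_mat_spectral[of n A] assms unfolding psd_contraction_def by blast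
  have "d i \<le> 1" if i: "i < n" for i
    using orth_diag_eigenvector[OF U(1,2) i] assms U(4) unfolding psd_contraction_def
    by (metis mult.right_neutral scalar_prod_smult_distrib)
  then show ?thesis using that U by blast
qed

text \<open>The empirical law is uniform on the diagonal entries. Positivity of \<open>n\<close> is
  assumed because \<open>pmf_of_multiset\<close> is unspecified on the empty multiset.\<close>

lemma integral_ESD_orth_diag:
  fixes U :: "real mat" and g :: "real \<Rightarrow> real"
  assumes U: "U \<in> carrier_mat n n" "transpose_mat U * U = 1\<^sub>m n" "U * transpose_mat U = 1\<^sub>m n"
    and n: "0 < n" and g: "g \<in> borel_measurable borel"
  shows "(LINT l|ESD (U * mat_diag n d * transpose_mat U). g l) = (\<Sum>i<n. g (d i)) / n"
proof -
  have ne: "{..<n} \<noteq> {}" using n by auto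
  have "ESD (U * mat_diag n d * transpose_mat U) = distr (measure_pmf (map_pmf d (pmf_of_set {..<n}))) borel (\<lambda>l. l)"
    unfolding ESD_def proots_char_poly_orth_diag[OF U] by (simp add: map_pmf_of_set[OF _ ne])
  then have "(LINT l|ESD (U * mat_diag n d * transpose_mat U). g l) = measure_pmf.expectation (map_pmf d (pmf_of_set {..<n})) g"
    using g by (simp add: integral_distr)
  also have "\<dots> = measure_pmf.expectation (pmf_of_set {..<n}) (\<lambda>i. g (d i))" by simp
  also have "\<dots> = (\<Sum>i<n. g (d i)) / n" using ne by (simp add: integral_pmf_of_set)
  finally show ?thesis .
qed

lemma real_distribution_ESD: "real_distribution (ESD A)"
  unfolding ESD_def real_distribution_def real_distribution_axioms_def
  by (auto intro: prob_space.prob_space_distr prob_space_measure_pmf)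

lemma prob_on_nonneg_ESD:
  assumes A: "psd_mat n A" and n: "0 < n"
  shows "prob_on_nonneg (ESD A)"
proof -
  obtain U d where U: "U \<in> carrier_mat n n" "transpose_mat U * U = 1\<^sub>m n" "U * transpose_mat U = 1\<^sub>m n"
    "A = U * mat_diag n d * transpose_mat U" and d: "\<And>i. i < n \<Longrightarrow> 0 \<le> d i"
    using psd_mat_spectral[OF A] by blast
  have ne: "{..<n} \<noteq> {}" using n by auto
  have "ESD A = distr (measure_pmf (map_pmf d (pmf_of_set {..<n}))) borel (\<lambda>l. l)"
    unfolding ESD_def U(4) proots_char_poly_orth_diag[OF U(1-3)] by (simp add: map_pmf_of_set[OF _ ne])
  then have "emeasure (ESD A) {..<0} = emeasure (measure_pmf (map_pmf d (pmf_of_set {..<n}))) {..<0}"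
    by (simp add: emeasure_distr)
  also have "\<dots> = 0"
  proof -
    have "set_pmf (map_pmf d (pmf_of_set {..<n})) \<inter> {..<0} = {}" using d ne by auto (use leD in blast)
    then show ?thesis by (simp only: measure_pmf_zero_iff[symmetric] measure_pmf.emeasure_eq_measure) simp
  qed
  finally show ?thesis unfolding prob_on_nonneg_def using real_distribution_ESD by simp
qed

lemma mat_trace_orthonormal_sum:
  fixes B U :: "real mat"
  assumes B: "B \<in> carrier_mat n n" and U: "U \<in> carrier_mat n n" "U * transpose_mat U = 1\<^sub>m n"
  shows "mat_trace B = (\<Sum>i<n. col U i \<bullet> (B *\<^sub>v col U i))"
proof -
  have "mat_trace B = mat_trace ((B * U) * transpose_mat U)" 
    using B U by (simp add: assoc_mult_mat[of _ n n _ n _ n])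
  also have "\<dots> = mat_trace (transpose_mat U * (B * U))"
    by (rule mat_trace_mult[of _ n n]) (use U B in auto)
  also have "\<dots> = (\<Sum>i<n. col U i \<bullet> col (B * U) i)"
    using U(1) B by (simp add: mat_trace_def)
  also have "\<dots> = (\<Sum>i<n. col U i \<bullet> (B *\<^sub>v col U i))"
    using col_mult2[OF B U(1)] by simp
  finally show ?thesis .
qed

text \<open>In an eigenbasis of \<open>A\<close> each eigenvalue is weighted by a diagonal entry of
  \<open>B\<close>, which lies between 0 and 1. This is how the trace norm in (ACI) controls means
  of quadratic forms, uniformly over contractions.\<close>

lemma trace_norm_symmetric_duality:
  fixes A B :: "real mat"
  assumes A: "A \<in> carrier_mat n n" "transpose_mat A = A" and B: "psd_contraction n B"
  shows "\<bar>mat_trace (A * B)\<bar> \<le> trace_norm A"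
proof -
  obtain U d where U: "U \<in> carrier_mat n n" "transpose_mat U * U = 1\<^sub>m n" "U * transpose_mat U = 1\<^sub>m n"
    "A = U * mat_diag n d * transpose_mat U" using real_spectral_theorem[OF A] by blast
  have Bc: "B \<in> carrier_mat n n" using B by (auto simp: psd_contraction_def psd_mat_def)
  have "transpose_mat A * A = U * mat_diag n (\<lambda>i. d i * d i) * transpose_mat U"
    unfolding A(2) unfolding U(4) using orth_diag_product[OF U(1,2)] by simp
  then have tn: "trace_norm A = (\<Sum>i<n. \<bar>d i\<bar>)"
    unfolding trace_norm_def by (simp add: proots_char_poly_orth_diag[OF U(1-3)] image_mset.compositionality comp_def
      flip: sum_unfold_sum_mset)
  have "mat_trace (A * B) = (\<Sum>i<n. col U i \<bullet> ((A * B) *\<^sub>v col U i))"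
    by (rule mat_trace_orthonormal_sum) (use A Bc U in auto)
  also have "\<dots> = (\<Sum>i<n. d i * (col U i \<bullet> (B *\<^sub>v col U i)))"
  proof (rule sum.cong)
    fix i assume "i \<in> {..<n}"
    then have i: "i < n" by simp
    note e = orth_diag_eigenvector(1,2)[OF U(1,2) i] orth_diag_eigenvector(3)[OF U(1,2) i, of d, folded U(4)]
    have "col U i \<bullet> ((A * B) *\<^sub>v col U i) = col U i \<bullet> (A *\<^sub>v (B *\<^sub>v col U i))"
      using assoc_mult_mat_vec[OF A(1) Bc e(1)] by simp
    also have "\<dots> = (A *\<^sub>v col U i) \<bullet> (B *\<^sub>v col U i)"
      by (rule symmetric_mat_scalar_prod[OF A e(1)]) (use Bc e in auto)
    finally show "col U i \<bullet> ((A * B) *\<^sub>v col U i) = d i * (col U i \<bullet> (B *\<^sub>v col U i))"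
      using e Bc by simp
  qed simp
  finally have tr: "mat_trace (A * B) = (\<Sum>i<n. d i * (col U i \<bullet> (B *\<^sub>v col U i)))" .
  show ?thesis unfolding tr tn
  proof (rule order_trans[OF sum_abs], rule sum_mono)
    fix i assume "i \<in> {..<n}"
    then have i: "i < n" by simp
    have "0 \<le> col U i \<bullet> (B *\<^sub>v col U i)" "col U i \<bullet> (B *\<^sub>v col U i) \<le> 1"
      using B orth_diag_eigenvector(1,2)[OF U(1,2) i] unfolding psd_contraction_def psd_mat_def by force+
    then show "\<bar>d i * (col U i \<bullet> (B *\<^sub>v col U i))\<bar> \<le> \<bar>d i\<bar>"
      by (simp add: abs_mult mult_left_le)
  qed
qed

text \<open>Exhibiting the spectrum of \<open>transpose_mat A * A\<close> as squares makes the trace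
  norm an integral of the square root against an empirical law; measurability of the trace norm
  rests on this.\<close>

lemma trace_norm_eq_ESD_sum:
  assumes A: "A \<in> carrier_mat n n" "transpose_mat A = A"
  obtains U d where "U \<in> carrier_mat n n" "transpose_mat U * U = 1\<^sub>m n" "U * transpose_mat U = 1\<^sub>m n"
    "transpose_mat A * A = U * mat_diag n (\<lambda>i. d i * d i) * transpose_mat U" "trace_norm A = (\<Sum>i<n. \<bar>d i\<bar>)"
proof -
  obtain U d where U: "U \<in> carrier_mat n n" "transpose_mat U * U = 1\<^sub>m n" "U * transpose_mat U = 1\<^sub>m n"
    "A = U * mat_diag n d * transpose_mat U" using real_spectral_theorem[OF A] by blast
  have "transpose_mat A * A = U * mat_diag n (\<lambda>i. d i * d i) * transpose_mat U"
    unfolding A(2) unfolding U(4) using orth_diag_product[OF U(1,2)] by simp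
  moreover from this have tn: "trace_norm A = (\<Sum>i<n. \<bar>d i\<bar>)"
    unfolding trace_norm_def by (simp add: proots_char_poly_orth_diag[OF U(1-3)] image_mset.compositionality comp_def
      flip: sum_unfold_sum_mset)
  ultimately show ?thesis using that U by blast
qed

section \<open>Resolvents and Gram matrices\<close>

lemma mat_trace_smult: "A \<in> carrier_mat n n \<Longrightarrow> mat_trace (c \<cdot>\<^sub>m A) = c * mat_trace A"
  by (simp add: mat_trace_def sum_distrib_left)

lemma mat_trace_minus:
  "A \<in> carrier_mat n n \<Longrightarrow> B \<in> carrier_mat n n \<Longrightarrow> mat_trace (A - B) = mat_trace A - mat_trace B"
  by (simp add: mat_trace_def sum_subtractf)

lemma mat_trace_one [simp]: "mat_trace (1\<^sub>m n) = n"
  by (simp add: mat_trace_def)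

lemma psd_mat_trace_nonneg:
  assumes "psd_mat n A"
  shows "0 \<le> mat_trace A"
proof -
  have "mat_trace A = (\<Sum>i<n. unit_vec n i \<bullet> (A *\<^sub>v unit_vec n i))"
    using mat_trace_orthonormal_sum[of A n "1\<^sub>m n"] assms unfolding psd_mat_def by simp
  also have "\<dots> \<ge> 0"
    by (rule sum_nonneg) (use assms unit_vec_carrier in \<open>unfold psd_mat_def, blast\<close>)
  finally show ?thesis .
qed

lemma psd_contraction_trace_le: 
  assumes "psd_contraction n A" 
  shows "mat_trace A \<le> n"
proof -
  have "mat_trace A = (\<Sum>i<n. unit_vec n i \<bullet> (A *\<^sub>v unit_vec n i))"
    using mat_trace_orthonormal_sum[of A n "1\<^sub>m n"] assms unfolding psd_contraction_def psd_mat_def by simp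
  also have "\<dots> \<le> (\<Sum>i<n. unit_vec n i \<bullet> unit_vec n i)"
    using assms unfolding psd_contraction_def by (intro sum_mono) (meson unit_vec_carrier)
  finally show ?thesis by simp
qed

text \<open>This is the inverse of \<open>S + t I\<close>, the resolvent at \<open>-t\<close>. By
  the adjugate formula its entries are rational functions of the entries of \<open>S\<close>, so
  measurability in the samples follows directly.\<close>

definition resolvent :: "real \<Rightarrow> real mat \<Rightarrow> real mat" where
  "resolvent t S = (let B = S + t \<cdot>\<^sub>m 1\<^sub>m (dim_row S) in inverse (det B) \<cdot>\<^sub>m adj_mat B)"

lemma smult_mat_mult_vec:
  fixes A :: "real mat"
  assumes "A \<in> carrier_mat n m" "v \<in> carrier_vec m"
  shows "(c \<cdot>\<^sub>m A) *\<^sub>v v = c \<cdot>\<^sub>v (A *\<^sub>v v)"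
  using assms by (intro eq_vecI) (auto simp: scalar_prod_def sum_distrib_left mult.assoc)

lemma shift_mult_vec:
  fixes S :: "real mat"
  assumes "S \<in> carrier_mat n n" "v \<in> carrier_vec n"
  shows "(S + t \<cdot>\<^sub>m 1\<^sub>m n) *\<^sub>v v = S *\<^sub>v v + t \<cdot>\<^sub>v v"
  using assms by (simp add: add_mult_distrib_mat_vec[of _ n n] smult_mat_mult_vec[of _ n n])

lemma
  assumes S: "psd_mat n S" and t: "0 < t"
  shows resolvent_carrier: "resolvent t S \<in> carrier_mat n n"
    and resolvent_right_inverse: "(S + t \<cdot>\<^sub>m 1\<^sub>m n) * resolvent t S = 1\<^sub>m n"
    and resolvent_left_inverse: "resolvent t S * (S + t \<cdot>\<^sub>m 1\<^sub>m n) = 1\<^sub>m n"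
proof -
  let ?B = "S + t \<cdot>\<^sub>m 1\<^sub>m n"
  have Sc: "S \<in> carrier_mat n n" using S by (auto simp: psd_mat_def)
  have B: "?B \<in> carrier_mat n n" using Sc by auto
  have "det ?B \<noteq> 0"
  proof
    assume "det ?B = 0"
    then obtain v where v: "v \<in> carrier_vec n" "v \<noteq> 0\<^sub>v n" "?B *\<^sub>v v = 0\<^sub>v n"
      using det_0_iff_vec_prod_zero[OF B] by auto
    have "v \<bullet> (?B *\<^sub>v v) = v \<bullet> (S *\<^sub>v v) + t * (v \<bullet> v)"
      using v(1) Sc by (simp add: shift_mult_vec scalar_prod_add_distrib[of _ n])
    moreover have "0 < v \<bullet> v" using v scalar_prod_real_eq_0[OF v(1)] scalar_prod_real_nonneg[of v] by simp
    moreover have "0 \<le> v \<bullet> (S *\<^sub>v v)" using S v by (auto simp: psd_mat_def)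
    moreover have "v \<bullet> (?B *\<^sub>v v) = 0" using v by simp
    ultimately show False using t by (smt (verit) mult_pos_pos)
  qed
  moreover have R: "resolvent t S = inverse (det ?B) \<cdot>\<^sub>m adj_mat ?B" using Sc by (simp add: resolvent_def Let_def)
  moreover note adj = adj_mat[OF B]
  ultimately show "resolvent t S \<in> carrier_mat n n" "?B * resolvent t S = 1\<^sub>m n" "resolvent t S * ?B = 1\<^sub>m n"
    using B by (simp_all add: mult_smult_distrib[of _ n n _ n] mult_smult_assoc_mat[of _ n n _ n] adj) auto
qed

lemma resolvent_apply:
  assumes S: "psd_mat n S" and t: "0 < t" and v: "v \<in> carrier_vec n"
  shows "S *\<^sub>v (resolvent t S *\<^sub>v v) + t \<cdot>\<^sub>v (resolvent t S *\<^sub>v v) = v"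
proof -
  have Sc: "S \<in> carrier_mat n n" using S by (auto simp: psd_mat_def)
  note R = resolvent_carrier[OF S t]
  have "S *\<^sub>v (resolvent t S *\<^sub>v v) + t \<cdot>\<^sub>v (resolvent t S *\<^sub>v v) = (S + t \<cdot>\<^sub>m 1\<^sub>m n) *\<^sub>v (resolvent t S *\<^sub>v v)"
    using Sc R v by (simp add: shift_mult_vec)
  also have "\<dots> = ((S + t \<cdot>\<^sub>m 1\<^sub>m n) * resolvent t S) *\<^sub>v v"
    by (rule assoc_mult_mat_vec[symmetric, of _ n n _ n]) (use Sc R v in auto)
  also have "\<dots> = v" using resolvent_right_inverse[OF S t] v by simp
  finally show ?thesis .
qed

text \<open>Resolvents of updated or diagonalized matrices are found by checking a candidate vector
  in the linear equation.\<close>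

lemma resolvent_unique:
  assumes S: "psd_mat n S" and t: "0 < t" and v: "v \<in> carrier_vec n" and w: "w \<in> carrier_vec n"
    and eq: "S *\<^sub>v w + t \<cdot>\<^sub>v w = v"
  shows "resolvent t S *\<^sub>v v = w"
proof -
  have Sc: "S \<in> carrier_mat n n" using S by (auto simp: psd_mat_def)
  note R = resolvent_carrier[OF S t]
  have "resolvent t S *\<^sub>v v = resolvent t S *\<^sub>v ((S + t \<cdot>\<^sub>m 1\<^sub>m n) *\<^sub>v w)"
    using Sc w by (simp add: shift_mult_vec eq)
  also have "\<dots> = (resolvent t S * (S + t \<cdot>\<^sub>m 1\<^sub>m n)) *\<^sub>v w"
    by (rule assoc_mult_mat_vec[symmetric, of _ n n _ n]) (use Sc R w in auto)
  finally show ?thesis using resolvent_left_inverse[OF S t] w by simp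
qed

lemma resolvent_transpose:
  assumes S: "psd_mat n S" and t: "0 < t"
  shows "transpose_mat (resolvent t S) = resolvent t S"
proof -
  have Sc: "S \<in> carrier_mat n n" and ST: "transpose_mat S = S" using S by (auto simp: psd_mat_def)
  note R = resolvent_carrier[OF S t]
  let ?B = "S + t \<cdot>\<^sub>m 1\<^sub>m n"
  have BT: "transpose_mat ?B = ?B" 
    using Sc by (intro eq_matI) (auto, metis ST Sc carrier_matD index_transpose_mat(1))
  have "transpose_mat (resolvent t S) * ?B = transpose_mat (?B * resolvent t S)"
    using R Sc BT by (simp add: transpose_mult[of _ n n _ n])
  also have "\<dots> = 1\<^sub>m n" using resolvent_right_inverse[OF S t] by simp
  finally have "transpose_mat (resolvent t S) * ?B * resolvent t S = resolvent t S" using R by simp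
  moreover have "transpose_mat (resolvent t S) * ?B * resolvent t S = transpose_mat (resolvent t S) * (?B * resolvent t S)"
    by (rule assoc_mult_mat[of _ n n _ n _ n]) (use R Sc in auto)
  ultimately show ?thesis using R resolvent_right_inverse[OF S t] by simp
qed

lemma resolvent_quadratic:
  assumes S: "psd_mat n S" and t: "0 < t" and v: "v \<in> carrier_vec n"
  defines "w \<equiv> resolvent t S *\<^sub>v v"
  shows "t * (w \<bullet> w) \<le> v \<bullet> w"
proof -
  have Sc: "S \<in> carrier_mat n n" using S by (auto simp: psd_mat_def)
  note R = resolvent_carrier[OF S t]
  have w: "w \<in> carrier_vec n" using R v by (auto simp: w_def)
  have "v \<bullet> w = (S *\<^sub>v w + t \<cdot>\<^sub>v w) \<bullet> w" using resolvent_apply[OF S t v] by (simp add: w_def)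
  also have "\<dots> = w \<bullet> (S *\<^sub>v w) + t * (w \<bullet> w)"
    using w Sc comm_scalar_prod[of "S *\<^sub>v w" n w] by (simp add: add_scalar_prod_distrib[of _ n])
  finally show ?thesis using S w by (simp add: psd_mat_def)
qed

text \<open>Put \<open>w = resolvent t S *\<^sub>v v\<close>. The lower bound is
  \<open>resolvent_quadratic\<close>; for the upper one, expand the squared norm of
  \<open>v - t w\<close> and use \<open>resolvent_quadratic\<close> once more.\<close>

lemma psd_contraction_smult_resolvent:
  assumes S: "psd_mat n S" and t: "0 < t"
  shows "psd_contraction n (t \<cdot>\<^sub>m resolvent t S)"
proof -
  note R = resolvent_carrier[OF S t]
  have mv: "(t \<cdot>\<^sub>m resolvent t S) *\<^sub>v v = t \<cdot>\<^sub>v (resolvent t S *\<^sub>v v)" if "v \<in> carrier_vec n" for v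
    using R that by (simp add: smult_mat_mult_vec[of _ n n])
  have "transpose_mat (t \<cdot>\<^sub>m resolvent t S) = t \<cdot>\<^sub>m resolvent t S"
    using resolvent_transpose[OF S t] R
    by (intro eq_matI) (auto, metis carrier_matD index_transpose_mat(1))
  moreover have "0 \<le> v \<bullet> (t \<cdot>\<^sub>v (resolvent t S *\<^sub>v v)) \<and> v \<bullet> (t \<cdot>\<^sub>v (resolvent t S *\<^sub>v v)) \<le> v \<bullet> v" 
    if v: "v \<in> carrier_vec n" for v
  proof -
    define w where "w = resolvent t S *\<^sub>v v"
    have w: "w \<in> carrier_vec n" using R v by (auto simp: w_def)
    have q: "t * (w \<bullet> w) \<le> v \<bullet> w" using resolvent_quadratic[OF S t v] by (simp add: w_def)
    have "0 \<le> v \<bullet> w" using q t scalar_prod_real_nonneg[of w] by (smt (verit) mult_nonneg_nonneg)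
    moreover have "0 \<le> (v - t \<cdot>\<^sub>v w) \<bullet> (v - t \<cdot>\<^sub>v w)" by (rule scalar_prod_real_nonneg)
    then have "0 \<le> v \<bullet> v - 2 * t * (v \<bullet> w) + t * (t * (w \<bullet> w))"
      using v w by (simp add: minus_scalar_prod_distrib[of _ n] scalar_prod_minus_distrib[of _ n] comm_scalar_prod[of w n v] algebra_simps)
    moreover have "t * (t * (w \<bullet> w)) \<le> t * (v \<bullet> w)" using q t by (intro mult_left_mono) auto
    ultimately have "0 \<le> t * (v \<bullet> w)" "t * (v \<bullet> w) \<le> v \<bullet> v" using t by (simp, linarith)
    then show ?thesis using v w unfolding w_def[symmetric] by simp
  qed
  ultimately show ?thesis unfolding psd_contraction_def psd_mat_def using R by (auto simp: mv)
qed

lemma mat_trace_resolvent_orth_diag: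
  assumes S: "psd_mat n S" and t: "0 < t"
    and U: "U \<in> carrier_mat n n" "transpose_mat U * U = 1\<^sub>m n" "U * transpose_mat U = 1\<^sub>m n"
    and eq: "S = U * mat_diag n d * transpose_mat U" and d: "\<And>i. i < n \<Longrightarrow> 0 \<le> d i"
  shows "mat_trace (resolvent t S) = (\<Sum>i<n. 1 / (d i + t))"
proof -
  note R = resolvent_carrier[OF S t]
  have "mat_trace (resolvent t S) = (\<Sum>i<n. col U i \<bullet> (resolvent t S *\<^sub>v col U i))"
    by (rule mat_trace_orthonormal_sum) (use R U in auto)
  also have "\<dots> = (\<Sum>i<n. 1 / (d i + t))"
  proof (rule sum.cong)
    fix i assume "i \<in> {..<n}"
    then have i: "i < n" by simp
    note e = orth_diag_eigenvector(1,2)[OF U(1,2) i] orth_diag_eigenvector(3)[OF U(1,2) i, of d, folded eq]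
    have dt: "d i + t > 0" using d[OF i] t by simp
    have mix: "1 / (d i + t) * (d i * z) + t * (1 / (d i + t) * z) = z" for z
    proof -
      have "1 / (d i + t) * (d i * z) + t * (1 / (d i + t) * z) = (1 / (d i + t) * (d i + t)) * z"
        by (simp only: algebra_simps)
      then show ?thesis using dt by simp
    qed
    have "resolvent t S *\<^sub>v col U i = (1 / (d i + t)) \<cdot>\<^sub>v col U i"
    proof (rule resolvent_unique[OF S t])
      have "S *\<^sub>v ((1 / (d i + t)) \<cdot>\<^sub>v col U i) = (1 / (d i + t)) \<cdot>\<^sub>v (d i \<cdot>\<^sub>v col U i)"
        using e S by (simp add: mult_mat_vec[of _ n n] psd_mat_def)
      then show "S *\<^sub>v ((1 / (d i + t)) \<cdot>\<^sub>v col U i) + t \<cdot>\<^sub>v ((1 / (d i + t)) \<cdot>\<^sub>v col U i) = col U i"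
        using e(1) mix by (intro eq_vecI) auto
    qed (use e in auto)
    then show "col U i \<bullet> (resolvent t S *\<^sub>v col U i) = 1 / (d i + t)" using e by simp
  qed simp
  finally show ?thesis .
qed

text \<open>The bridge between empirical laws and matrix algebra: a spectral integral becomes a
  rational function of the samples.\<close>

lemma mat_trace_resolvent_ESD:
  assumes S: "psd_mat n S" and t: "0 < t" and n: "0 < n"
  shows "(LINT l|ESD S. 1 / (l + t)) = mat_trace (resolvent t S) / n"
proof -
  obtain U d where U: "U \<in> carrier_mat n n" "transpose_mat U * U = 1\<^sub>m n" "U * transpose_mat U = 1\<^sub>m n"
    "S = U * mat_diag n d * transpose_mat U" "\<And>i. i < n \<Longrightarrow> 0 \<le> d i"
    using psd_mat_spectral[OF S] by blast
  have "(LINT l|ESD S. 1 / (l + t)) = (\<Sum>i<n. 1 / (d i + t)) / n"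
    unfolding U(4) using integral_ESD_orth_diag[OF U(1-3) n, of "\<lambda>l. 1 / (l + t)"] by simp
  then show ?thesis using mat_trace_resolvent_orth_diag[OF S t U] by simp
qed

section \<open>Gram matrices and the removal of one sample\<close>

definition gram_mat :: "nat \<Rightarrow> nat \<Rightarrow> nat set \<Rightarrow> (nat \<Rightarrow> real Matrix.vec) \<Rightarrow> real mat" where
  "gram_mat q N J Y = Matrix.mat q q (\<lambda>(k, l). (1 / real N) * (\<Sum>j\<in>J. Y j $ k * Y j $ l))"

lemma sample_cov_eq_gram_mat:
  "sample_cov p N C X = gram_mat (dim_row C) N {..<N} (\<lambda>j. C *\<^sub>v Matrix.vec p (X j))"
  by (simp add: sample_cov_def gram_mat_def)

lemma gram_mat_carrier [simp]: "gram_mat q N J Y \<in> carrier_mat q q"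
  by (simp add: gram_mat_def)

lemma gram_mat_mult_vec_index:
  assumes "k < q" "v \<in> carrier_vec q" "\<And>j. j \<in> J \<Longrightarrow> Y j \<in> carrier_vec q"
  shows "(gram_mat q N J Y *\<^sub>v v) $ k = (\<Sum>j\<in>J. (Y j \<bullet> v) * Y j $ k) / N"
proof -
  have "(gram_mat q N J Y *\<^sub>v v) $ k = (\<Sum>l<q. (1 / real N) * (\<Sum>j\<in>J. Y j $ k * Y j $ l) * v $ l)"
    using assms by (simp add: gram_mat_def scalar_prod_def atLeast0LessThan)
  also have "\<dots> = (\<Sum>l<q. \<Sum>j\<in>J. Y j $ k * Y j $ l * v $ l / N)"
    by (simp add: sum_distrib_left sum_distrib_right)
  also have "\<dots> = (\<Sum>j\<in>J. \<Sum>l<q. Y j $ k * Y j $ l * v $ l / N)" by (rule sum.swap)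
  also have "\<dots> = (\<Sum>j\<in>J. (Y j \<bullet> v) * Y j $ k / N)"
    using assms by (intro sum.cong) (auto simp: scalar_prod_def atLeast0LessThan sum_distrib_left sum_distrib_right sum_divide_distrib algebra_simps)
  finally show ?thesis by (simp add: sum_divide_distrib)
qed

lemma psd_gram_mat:
  assumes "\<And>j. j \<in> J \<Longrightarrow> Y j \<in> carrier_vec q"
  shows "psd_mat q (gram_mat q N J Y)"
  unfolding psd_mat_def
proof (intro conjI ballI)
  show "transpose_mat (gram_mat q N J Y) = gram_mat q N J Y"
    by (rule eq_matI) (auto simp: gram_mat_def mult.commute)
  fix v :: "real Matrix.vec" assume v: "v \<in> carrier_vec q"
  have "v \<bullet> (gram_mat q N J Y *\<^sub>v v) = (\<Sum>k<q. v $ k * ((\<Sum>j\<in>J. (Y j \<bullet> v) * Y j $ k) / N))"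
    using gram_mat_mult_vec_index[OF _ v assms, where N=N and J=J]
    by (simp add: scalar_prod_def[of v] atLeast0LessThan gram_mat_def)
  also have "\<dots> = (\<Sum>k<q. \<Sum>j\<in>J. (Y j \<bullet> v) * (Y j $ k * v $ k) / N)"
    by (simp add: sum_distrib_left sum_divide_distrib algebra_simps)
  also have "\<dots> = (\<Sum>j\<in>J. (Y j \<bullet> v) * (Y j \<bullet> v) / N)"
    using v by (subst sum.swap) (auto intro!: sum.cong simp: scalar_prod_def atLeast0LessThan sum_distrib_left sum_divide_distrib)
  finally show "0 \<le> v \<bullet> (gram_mat q N J Y *\<^sub>v v)" by (simp add: sum_nonneg)
qed simp

lemma gram_mat_insert_mult_vec:
  assumes "finite J" "j \<notin> J" "v \<in> carrier_vec q" "\<And>i. i \<in> insert j J \<Longrightarrow> Y i \<in> carrier_vec q"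
  shows "gram_mat q N (insert j J) Y *\<^sub>v v = gram_mat q N J Y *\<^sub>v v + ((Y j \<bullet> v) / N) \<cdot>\<^sub>v Y j"
proof (rule eq_vecI)
  have Yj: "Y j \<in> carrier_vec q" using assms(4) by simp
  then show "dim_vec (gram_mat q N (insert j J) Y *\<^sub>v v) = dim_vec (gram_mat q N J Y *\<^sub>v v + ((Y j \<bullet> v) / N) \<cdot>\<^sub>v Y j)"
    by (simp add: gram_mat_def)
  fix k assume "k < dim_vec (gram_mat q N J Y *\<^sub>v v + ((Y j \<bullet> v) / N) \<cdot>\<^sub>v Y j)"
  then have k: "k < q" using Yj by simp
  have 1: "(gram_mat q N (insert j J) Y *\<^sub>v v) $ k = (\<Sum>i\<in>insert j J. (Y i \<bullet> v) * Y i $ k) / N"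
    by (rule gram_mat_mult_vec_index) (use k assms in auto)
  have 2: "(gram_mat q N J Y *\<^sub>v v) $ k = (\<Sum>i\<in>J. (Y i \<bullet> v) * Y i $ k) / N"
    by (rule gram_mat_mult_vec_index) (use k assms in auto)
  show "(gram_mat q N (insert j J) Y *\<^sub>v v) $ k = (gram_mat q N J Y *\<^sub>v v + ((Y j \<bullet> v) / N) \<cdot>\<^sub>v Y j) $ k"
    using k Yj 1 2 assms(1,2) by (simp add: add_divide_distrib del: index_mult_mat_vec)
qed

text \<open>The Sherman--Morrison formula for the update \<open>S' = S + b y y\<^sup>T\<close>.\<close>

lemma
  assumes S: "psd_mat n S" and S': "psd_mat n S'" and t: "0 < t" and b: "0 \<le> b" and y: "y \<in> carrier_vec n"
    and upd: "\<And>v. v \<in> carrier_vec n \<Longrightarrow> S' *\<^sub>v v = S *\<^sub>v v + (b * (y \<bullet> v)) \<cdot>\<^sub>v y"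
  defines "a \<equiv> b * (y \<bullet> (resolvent t S *\<^sub>v y))"
  shows resolvent_rank_one_nonneg: "0 \<le> a"
    and resolvent_rank_one_quadratic: "b * (y \<bullet> (resolvent t S' *\<^sub>v y)) = a / (1 + a)"
    and resolvent_rank_one_trace: "\<bar>mat_trace (resolvent t S) - mat_trace (resolvent t S')\<bar> \<le> 1 / t"
proof -
  note R = resolvent_carrier[OF S t] and R' = resolvent_carrier[OF S' t]
  have Sc: "S \<in> carrier_mat n n" using S by (auto simp: psd_mat_def)
  define w where "w = resolvent t S *\<^sub>v y"
  have w: "w \<in> carrier_vec n" using R y by (auto simp: w_def)
  have aw: "a = b * (y \<bullet> w)" by (simp add: a_def w_def)
  have q: "t * (w \<bullet> w) \<le> y \<bullet> w" using resolvent_quadratic[OF S t y] by (simp add: w_def)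
  have yw: "0 \<le> y \<bullet> w" using q t scalar_prod_real_nonneg[of w] by (smt (verit) mult_nonneg_nonneg)
  show a0: "0 \<le> a" unfolding aw using yw b by simp
  have main: "resolvent t S' *\<^sub>v v = resolvent t S *\<^sub>v v - (b * (y \<bullet> (resolvent t S *\<^sub>v v)) / (1 + a)) \<cdot>\<^sub>v w"
    if v: "v \<in> carrier_vec n" for v
  proof (rule resolvent_unique[OF S' t v])
    define u where "u = resolvent t S *\<^sub>v v"
    \<comment> \<open>The correction has to be a multiple \<open>c\<close> of \<open>w\<close>, the
      old resolvent applied to \<open>y\<close>. Inserting \<open>u - c w\<close> into the updated
      equation leaves the condition \<open>c (1 + a) = b (y \<bullet> u)\<close>.\<close>
    define c where "c = b * (y \<bullet> u) / (1 + a)"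
    have u: "u \<in> carrier_vec n" using R v by (auto simp: u_def)
    show "u - c \<cdot>\<^sub>v w \<in> carrier_vec n" using u w by auto
    have 1: "S *\<^sub>v u + t \<cdot>\<^sub>v u = v" "S *\<^sub>v w + t \<cdot>\<^sub>v w = y" 
      using resolvent_apply[OF S t v] resolvent_apply[OF S t y] by (simp_all add: u_def w_def)
    have "c * (1 + a) = b * (y \<bullet> u)" using a0 unfolding c_def by simp
    then have c1: "c + c * a = b * (y \<bullet> u)" by (simp add: distrib_left)
    have 2: "S *\<^sub>v (u - c \<cdot>\<^sub>v w) = S *\<^sub>v u - c \<cdot>\<^sub>v (S *\<^sub>v w)"
      using u w Sc by (simp add: mult_minus_distrib_mat_vec[of _ n n] mult_mat_vec[of _ n n])
    have 3: "b * (y \<bullet> (u - c \<cdot>\<^sub>v w)) = c"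
      using c1 u w y by (simp add: scalar_prod_minus_distrib[of _ n] aw algebra_simps)
    have "S' *\<^sub>v (u - c \<cdot>\<^sub>v w) + t \<cdot>\<^sub>v (u - c \<cdot>\<^sub>v w) = (S *\<^sub>v u - c \<cdot>\<^sub>v (S *\<^sub>v w) + c \<cdot>\<^sub>v y) + t \<cdot>\<^sub>v (u - c \<cdot>\<^sub>v w)"
      using upd[of "u - c \<cdot>\<^sub>v w"] u w 2 3 by simp
    also have "\<dots> = (S *\<^sub>v u + t \<cdot>\<^sub>v u) - c \<cdot>\<^sub>v (S *\<^sub>v w + t \<cdot>\<^sub>v w) + c \<cdot>\<^sub>v y"
    proof (rule eq_vecI)
      define Su where "Su = S *\<^sub>v u"
      define Sw where "Sw = S *\<^sub>v w"
      have ss: "Su \<in> carrier_vec n" "Sw \<in> carrier_vec n" using Sc u w by (auto simp: Su_def Sw_def)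
      fix i assume "i < dim_vec ((S *\<^sub>v u + t \<cdot>\<^sub>v u) - c \<cdot>\<^sub>v (S *\<^sub>v w + t \<cdot>\<^sub>v w) + c \<cdot>\<^sub>v y)"
      then have "i < n" using y by simp
      then show "((S *\<^sub>v u - c \<cdot>\<^sub>v (S *\<^sub>v w) + c \<cdot>\<^sub>v y) + t \<cdot>\<^sub>v (u - c \<cdot>\<^sub>v w)) $ i = 
          ((S *\<^sub>v u + t \<cdot>\<^sub>v u) - c \<cdot>\<^sub>v (S *\<^sub>v w + t \<cdot>\<^sub>v w) + c \<cdot>\<^sub>v y) $ i"
        unfolding Su_def[symmetric] Sw_def[symmetric] using u w y ss by (simp add: algebra_simps)
    qed (use u w y Sc in auto)
    also have "\<dots> = v - c \<cdot>\<^sub>v y + c \<cdot>\<^sub>v y" using 1 by simp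
    also have "\<dots> = v" using v y by (intro eq_vecI) auto
    finally show "S' *\<^sub>v (u - c \<cdot>\<^sub>v w) + t \<cdot>\<^sub>v (u - c \<cdot>\<^sub>v w) = v" .
  qed
  have "b * (y \<bullet> (resolvent t S' *\<^sub>v y)) = b * (y \<bullet> (w - (a / (1 + a)) \<cdot>\<^sub>v w))"
    using main[OF y] by (simp add: w_def aw)
  also have "\<dots> = a - a * (a / (1 + a))" 
    using w y by (simp add: scalar_prod_minus_distrib[of _ n] aw algebra_simps)
  also have "\<dots> = a / (1 + a)" using a0 by (simp add: field_simps)
  finally show "b * (y \<bullet> (resolvent t S' *\<^sub>v y)) = a / (1 + a)" .
  have idx: "(resolvent t S' *\<^sub>v unit_vec n i) $ i = (resolvent t S *\<^sub>v unit_vec n i) $ i - b / (1 + a) * (w $ i * w $ i)" if i: "i < n" for i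
  proof -
    have "y \<bullet> (resolvent t S *\<^sub>v unit_vec n i) = w $ i"
      using symmetric_mat_scalar_prod[OF R resolvent_transpose[OF S t] y, of "unit_vec n i"] i w by (simp add: w_def)
    then show ?thesis using main[of "unit_vec n i"] i w by simp
  qed
  have "mat_trace (resolvent t S') = (\<Sum>i<n. (resolvent t S' *\<^sub>v unit_vec n i) $ i)"
    using mat_trace_orthonormal_sum[OF R', of "1\<^sub>m n"] R' by simp
  also have "\<dots> = (\<Sum>i<n. (resolvent t S *\<^sub>v unit_vec n i) $ i) - b / (1 + a) * (\<Sum>i<n. w $ i * w $ i)"
    by (simp add: idx sum_subtractf sum_distrib_left)
  also have "(\<Sum>i<n. (resolvent t S *\<^sub>v unit_vec n i) $ i) = mat_trace (resolvent t S)"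
    using mat_trace_orthonormal_sum[OF R, of "1\<^sub>m n"] R by simp
  also have "(\<Sum>i<n. w $ i * w $ i) = w \<bullet> w" using w by (simp add: scalar_prod_def atLeast0LessThan)
  finally have tr: "mat_trace (resolvent t S) - mat_trace (resolvent t S') = b * (w \<bullet> w) / (1 + a)" by simp
  \<comment> \<open>The update \<open>y\<close> may be arbitrarily large:
    \<open>t * b * (w \<bullet> w)\<close> is at most \<open>a\<close>, and the denominator
    \<open>1 + a\<close> absorbs it.\<close>
  have "t * (b * (w \<bullet> w)) \<le> 1 + a" using mult_left_mono[OF q b] by (simp add: aw algebra_simps)
  then have "b * (w \<bullet> w) / (1 + a) \<le> 1 / t" using a0 t by (simp add: field_simps)
  moreover have "0 \<le> b * (w \<bullet> w) / (1 + a)" using a0 b scalar_prod_real_nonneg[of w] by simp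
  ultimately show "\<bar>mat_trace (resolvent t S) - mat_trace (resolvent t S')\<bar> \<le> 1 / t" unfolding tr by linarith
qed

text \<open>The normalization stays at \<open>1 / N\<close> after the sample is removed, so the full
  Gram matrix is a rank-one update with weight \<open>1 / N\<close>.\<close>

definition loo_resolvent :: "nat \<Rightarrow> nat \<Rightarrow> real \<Rightarrow> (nat \<Rightarrow> real Matrix.vec) \<Rightarrow> nat \<Rightarrow> real mat" where
  "loo_resolvent q N t Y j = resolvent t (gram_mat q N ({..<N} - {j}) Y)"

lemma
  assumes Y: "\<And>j. j < N \<Longrightarrow> Y j \<in> carrier_vec q" and t: "0 < t" and j: "j < N"
  shows loo_form_nonneg: "0 \<le> (Y j \<bullet> (loo_resolvent q N t Y j *\<^sub>v Y j)) / N"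
    and loo_trace_diff: "\<bar>mat_trace (loo_resolvent q N t Y j) - mat_trace (resolvent t (gram_mat q N {..<N} Y))\<bar> \<le> 1 / t"
    and loo_form: "(Y j \<bullet> (resolvent t (gram_mat q N {..<N} Y) *\<^sub>v Y j)) / N
      = (let a = (Y j \<bullet> (loo_resolvent q N t Y j *\<^sub>v Y j)) / N in a / (1 + a))"
proof -
  let ?J = "{..<N} - {j}"
  have ins: "insert j ?J = {..<N}" using j by auto
  have S: "psd_mat q (gram_mat q N ?J Y)" "psd_mat q (gram_mat q N {..<N} Y)"
    by (intro psd_gram_mat; use Y in simp)+
  have upd: "gram_mat q N {..<N} Y *\<^sub>v v = gram_mat q N ?J Y *\<^sub>v v + (1 / N * (Y j \<bullet> v)) \<cdot>\<^sub>v Y j" 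
    if "v \<in> carrier_vec q" for v
    using gram_mat_insert_mult_vec[of ?J j v q Y N] that Y j unfolding ins by auto
  note SM = S t _ Y[OF j] upd
  show "0 \<le> (Y j \<bullet> (loo_resolvent q N t Y j *\<^sub>v Y j)) / N"
    using resolvent_rank_one_nonneg[OF SM] by (simp add: loo_resolvent_def)
  show "\<bar>mat_trace (loo_resolvent q N t Y j) - mat_trace (resolvent t (gram_mat q N {..<N} Y))\<bar> \<le> 1 / t"
    using resolvent_rank_one_trace[OF SM] by (simp add: loo_resolvent_def)
  show "(Y j \<bullet> (resolvent t (gram_mat q N {..<N} Y) *\<^sub>v Y j)) / N
      = (let a = (Y j \<bullet> (loo_resolvent q N t Y j *\<^sub>v Y j)) / N in a / (1 + a))"
    using resolvent_rank_one_quadratic[OF SM] by (simp add: loo_resolvent_def Let_def)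
qed

text \<open>Take the trace in \<open>S R + t R = 1\<close>. Writing \<open>S\<close> as a sum of
  rank-one matrices gives the forms of \<open>R\<close> in the samples, and Sherman--Morrison
  expresses each of them by the leave-one-out form.\<close>

lemma resolvent_trace_identity:
  assumes Y: "\<And>j. j < N \<Longrightarrow> Y j \<in> carrier_vec q" and t: "0 < t"
  shows "q - t * mat_trace (resolvent t (gram_mat q N {..<N} Y)) =
    (\<Sum>j<N. let a = (Y j \<bullet> (loo_resolvent q N t Y j *\<^sub>v Y j)) / N in a / (1 + a))"
proof -
  let ?S = "gram_mat q N {..<N} Y"
  define R where "R = resolvent t ?S"
  have S: "psd_mat q ?S" by (intro psd_gram_mat; use Y in simp)
  have R: "R \<in> carrier_mat q q" using resolvent_carrier[OF S t] by (simp add: R_def)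
  have "1 - t * (R *\<^sub>v unit_vec q i) $ i = (\<Sum>j<N. (R *\<^sub>v Y j) $ i * Y j $ i) / N" if i: "i < q" for i
  proof -
    have Rv: "R *\<^sub>v unit_vec q i \<in> carrier_vec q" using R by auto
    have "?S *\<^sub>v (R *\<^sub>v unit_vec q i) + t \<cdot>\<^sub>v (R *\<^sub>v unit_vec q i) = unit_vec q i"
      using resolvent_apply[OF S t, of "unit_vec q i"] by (simp add: R_def)
    then have "(?S *\<^sub>v (R *\<^sub>v unit_vec q i)) $ i + t * (R *\<^sub>v unit_vec q i) $ i = 1"
      using i R Rv by (metis index_add_vec(1) index_smult_vec(1) index_unit_vec(1) carrier_vecD smult_carrier_vec)
    moreover have "(?S *\<^sub>v (R *\<^sub>v unit_vec q i)) $ i = (\<Sum>j<N. (Y j \<bullet> (R *\<^sub>v unit_vec q i)) * Y j $ i) / N"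
      by (rule gram_mat_mult_vec_index) (use i Rv Y in auto)
    moreover have "Y j \<bullet> (R *\<^sub>v unit_vec q i) = (R *\<^sub>v Y j) $ i" if "j < N" for j
    proof -
      have "R *\<^sub>v Y j \<in> carrier_vec q" using R Y[OF that] by auto
      then show ?thesis
        using symmetric_mat_scalar_prod[OF R _ Y[OF that], of "unit_vec q i"] resolvent_transpose[OF S t] i 
        by (simp add: R_def)
    qed
    ultimately show ?thesis by (simp add: algebra_simps)
  qed
  then have "(\<Sum>i<q. 1 - t * (R *\<^sub>v unit_vec q i) $ i) = (\<Sum>i<q. (\<Sum>j<N. (R *\<^sub>v Y j) $ i * Y j $ i) / N)" by simp
  also have "\<dots> = (\<Sum>j<N. (\<Sum>i<q. Y j $ i * (R *\<^sub>v Y j) $ i) / N)"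
    unfolding sum_divide_distrib by (subst sum.swap) (simp add: mult.commute)
  also have "\<dots> = (\<Sum>j<N. (Y j \<bullet> (R *\<^sub>v Y j)) / N)"
  proof (rule sum.cong)
    fix j assume "j \<in> {..<N}"
    have "Y j \<bullet> (R *\<^sub>v Y j) = (\<Sum>i<q. Y j $ i * (R *\<^sub>v Y j) $ i)"
      using R by (simp only: scalar_prod_def[of _ "R *\<^sub>v Y j"] dim_mult_mat_vec carrier_matD atLeast0LessThan)
    then show "(\<Sum>i<q. Y j $ i * (R *\<^sub>v Y j) $ i) / N = (Y j \<bullet> (R *\<^sub>v Y j)) / N" by simp
  qed simp
  also have "\<dots> = (\<Sum>j<N. let a = (Y j \<bullet> (loo_resolvent q N t Y j *\<^sub>v Y j)) / N in a / (1 + a))"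
    unfolding R_def using loo_form[OF Y t] by (intro sum.cong) auto
  finally have "(\<Sum>i<q. 1 - t * (R *\<^sub>v unit_vec q i) $ i) = (\<Sum>j<N. let a = (Y j \<bullet> (loo_resolvent q N t Y j *\<^sub>v Y j)) / N in a / (1 + a))" .
  moreover have "mat_trace R = (\<Sum>i<q. (R *\<^sub>v unit_vec q i) $ i)"
    using mat_trace_orthonormal_sum[OF R, of "1\<^sub>m q"] R by simp
  ultimately show ?thesis by (simp add: R_def sum_subtractf sum_distrib_left)
qed

section \<open>Orthogonal projections and coordinates on their ranges\<close>

lemma orth_projection_orth_diag:
  fixes U :: "real mat"
  assumes U: "U \<in> carrier_mat n n" "transpose_mat U * U = 1\<^sub>m n" and d: "\<And>i. d i * d i = d i"
  shows "orth_projection n (U * mat_diag n d * transpose_mat U)"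
  unfolding orth_projection_def using U orth_diag_product[OF U, of d d] orth_diag_transpose[OF U(1)] d by auto

lemma orth_projection_quadratic:
  assumes P: "orth_projection n P" and v: "v \<in> carrier_vec n"
  shows "v \<bullet> (P *\<^sub>v v) = (P *\<^sub>v v) \<bullet> (P *\<^sub>v v)"
proof -
  have Pc: "P \<in> carrier_mat n n" "P * P = P" "transpose_mat P = P" using P by (auto simp: orth_projection_def)
  have "v \<bullet> (P *\<^sub>v v) = v \<bullet> (P *\<^sub>v (P *\<^sub>v v))" using assoc_mult_mat_vec[OF Pc(1) Pc(1) v] Pc by simp
  also have "\<dots> = (P *\<^sub>v v) \<bullet> (P *\<^sub>v v)" by (rule symmetric_mat_scalar_prod[OF Pc(1,3) v]) (use Pc v in auto)
  finally show ?thesis .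
qed

lemma orth_projection_psd_contraction:
  assumes P: "orth_projection n P"
  shows "psd_contraction n P"
proof -
  have Pc: "P \<in> carrier_mat n n" "P * P = P" "transpose_mat P = P" using P by (auto simp: orth_projection_def)
  have "0 \<le> v \<bullet> (P *\<^sub>v v) \<and> v \<bullet> (P *\<^sub>v v) \<le> v \<bullet> v" if v: "v \<in> carrier_vec n" for v
  proof -
    define w where "w = P *\<^sub>v v"
    have w: "w \<in> carrier_vec n" using Pc v by (auto simp: w_def)
    have "v \<bullet> w = w \<bullet> w" using orth_projection_quadratic[OF P v] by (simp add: w_def)
    moreover have "0 \<le> (v - w) \<bullet> (v - w)" by (rule scalar_prod_real_nonneg)
    then have "0 \<le> v \<bullet> v - 2 * (v \<bullet> w) + w \<bullet> w"
      using v w by (simp add: minus_scalar_prod_distrib[of _ n] scalar_prod_minus_distrib[of _ n] comm_scalar_prod[of w n v])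
    ultimately show ?thesis using scalar_prod_real_nonneg[of w] unfolding w_def[symmetric] by simp
  qed
  then show ?thesis unfolding psd_contraction_def psd_mat_def using Pc by auto
qed

lemma orth_projection_complement:
  assumes P: "orth_projection n P"
  shows "orth_projection n (1\<^sub>m n - P)"
proof -
  have Pc: "P \<in> carrier_mat n n" "P * P = P" "transpose_mat P = P" using P by (auto simp: orth_projection_def)
  have "(1\<^sub>m n - P) * (1\<^sub>m n - P) = 1\<^sub>m n * (1\<^sub>m n - P) - P * (1\<^sub>m n - P)"
    by (rule minus_mult_distrib_mat[of _ n n _ _ n]) (use Pc in auto)
  also have "P * (1\<^sub>m n - P) = P * 1\<^sub>m n - P * P"
    by (rule mult_minus_distrib_mat[of _ n n _ n]) (use Pc in auto)
  also have "1\<^sub>m n * (1\<^sub>m n - P) - (P * 1\<^sub>m n - P * P) = 1\<^sub>m n - P" using Pc by (intro eq_matI) auto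
  finally have "(1\<^sub>m n - P) * (1\<^sub>m n - P) = 1\<^sub>m n - P" .
  moreover have "transpose_mat (1\<^sub>m n - P) = 1\<^sub>m n - P"
    using Pc by (intro eq_matI) (auto, metis Pc(1,3) carrier_matD index_transpose_mat(1))
  ultimately show ?thesis unfolding orth_projection_def using Pc by auto
qed

lemma orth_projection_spectral:
  assumes P: "orth_projection n P"
  obtains U d where "U \<in> carrier_mat n n" "transpose_mat U * U = 1\<^sub>m n" "U * transpose_mat U = 1\<^sub>m n"
    "P = U * mat_diag n d * transpose_mat U" "\<And>i. i < n \<Longrightarrow> d i = 0 \<or> d i = 1"
proof -
  have Pc: "P \<in> carrier_mat n n" "P * P = P" "transpose_mat P = P" using P by (auto simp: orth_projection_def)
  obtain U d where U: "U \<in> carrier_mat n n" "transpose_mat U * U = 1\<^sub>m n" "U * transpose_mat U = 1\<^sub>m n"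
    "P = U * mat_diag n d * transpose_mat U" using real_spectral_theorem[OF Pc(1,3)] by blast
  have "d i = 0 \<or> d i = 1" if i: "i < n" for i
  proof -
    note e = orth_diag_eigenvector(1,2)[OF U(1,2) i] orth_diag_eigenvector(3)[OF U(1,2) i, of d, folded U(4)]
    have "d i = d i * d i" using orth_projection_quadratic[OF P e(1)] e by simp
    then show ?thesis by simp
  qed
  then show ?thesis using that U by blast
qed

text \<open>The rows are the eigenvectors with eigenvalue 1. Counting them identifies trace and
  rank, so limits of relative ranks can be read off from traces.\<close>

lemma orth_projection_rows:
  assumes P: "orth_projection p P"
  obtains C where "orthonormal_rows_of_range p P C" "transpose_mat C * C = P" "mat_trace P = mat_rank P"
proof -
  have Pc: "P \<in> carrier_mat p p" using P by (auto simp: orth_projection_def)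
  obtain U d where U: "U \<in> carrier_mat p p" "transpose_mat U * U = 1\<^sub>m p" "U * transpose_mat U = 1\<^sub>m p"
    "P = U * mat_diag p d * transpose_mat U" and d: "\<And>i. i < p \<Longrightarrow> d i = 0 \<or> d i = 1"
    using orth_projection_spectral[OF P] by blast
  define js where "js = filter (\<lambda>i. d i = 1) [0..<p]"
  define k where "k = length js"
  have js: "distinct js" "set js = {i. i < p \<and> d i = 1}" by (auto simp: js_def)
  have jsp: "js ! a < p" if "a < k" for a using js(2) that nth_mem unfolding k_def by fastforce
  define C where "C = Matrix.mat k p (\<lambda>(a, j). U $$ (j, js ! a))"
  have C: "C \<in> carrier_mat k p" by (simp add: C_def)
  have CC: "C * transpose_mat C = 1\<^sub>m k"
  proof (rule eq_matI)
    fix a b assume "a < dim_row (1\<^sub>m k)" "b < dim_col (1\<^sub>m k)"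
    then have ab: "a < k" "b < k" by auto
    have "(C * transpose_mat C) $$ (a, b) = (\<Sum>j<p. U $$ (j, js ! a) * U $$ (j, js ! b))"
      using ab by (simp add: C_def scalar_prod_def atLeast0LessThan)
    also have "\<dots> = (transpose_mat U * U) $$ (js ! a, js ! b)"
      using U(1) jsp ab by (simp add: scalar_prod_def atLeast0LessThan)
    also have "\<dots> = (if a = b then 1 else 0)"
      unfolding U(2) using jsp ab js(1) by (simp add: nth_eq_iff_index_eq k_def)
    finally show "(C * transpose_mat C) $$ (a, b) = 1\<^sub>m k $$ (a, b)" using ab by simp
  qed (use C in auto)
  have PC: "transpose_mat C * C = P"
  proof (rule eq_matI)
    fix i j assume "i < dim_row P" "j < dim_col P"
    then have ij: "i < p" "j < p" using Pc by auto
    have "(transpose_mat C * C) $$ (i, j) = (\<Sum>a<k. U $$ (i, js ! a) * U $$ (j, js ! a))"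
      using ij by (simp add: C_def scalar_prod_def atLeast0LessThan)
    also have "\<dots> = (\<Sum>m\<in>set js. U $$ (i, m) * U $$ (j, m))"
      using js(1) unfolding k_def by (simp add: sum.distinct_set_conv_list sum_list_sum_nth atLeast0LessThan)
    also have "\<dots> = (\<Sum>m<p. d m * (U $$ (i, m) * U $$ (j, m)))"
      by (rule sum.mono_neutral_cong_left) (use js d in auto)
    also have "\<dots> = P $$ (i, j)"
      unfolding U(4) using ij U(1) by (simp add: mat_diag_mult_right[of _ p p] scalar_prod_def atLeast0LessThan algebra_simps)
    finally show "(transpose_mat C * C) $$ (i, j) = P $$ (i, j)" .
  qed (use C Pc in auto)
  interpret V: vec_space "TYPE(real)" p .
  let ?T = "transpose_mat C"
  have T: "?T \<in> carrier_mat p k" using C by simp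
  have TC: "?T *\<^sub>v v \<in> carrier_vec p" if "v \<in> carrier_vec k" for v using T that by auto
  have sp: "V.col_space P = V.col_space ?T"
  proof (intro equalityI subsetI)
    fix y assume "y \<in> V.col_space P"
    then obtain x where x: "x \<in> carrier_vec p" "y = P *\<^sub>v x" using V.col_space_eq[OF Pc] Pc by auto
    then have "y = ?T *\<^sub>v (C *\<^sub>v x)" using assoc_mult_mat_vec[OF T C x(1)] PC by simp
    then show "y \<in> V.col_space ?T" using V.col_space_eq[OF T] T C x by auto
  next
    fix y assume "y \<in> V.col_space ?T"
    then obtain x where x: "x \<in> carrier_vec k" "y = ?T *\<^sub>v x" using V.col_space_eq[OF T] T by auto
    have "P *\<^sub>v y = ?T *\<^sub>v (C *\<^sub>v (?T *\<^sub>v x))"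
      unfolding PC[symmetric] x(2) using assoc_mult_mat_vec[OF T C TC[OF x(1)]] .
    also have "C *\<^sub>v (?T *\<^sub>v x) = x" using assoc_mult_mat_vec[OF C T x(1)] CC x by simp
    finally have "y = P *\<^sub>v y" using x by simp
    moreover have "y \<in> carrier_vec p" using x TC by auto
    ultimately show "y \<in> V.col_space P" using V.col_space_eq[OF Pc] Pc by (metis (mono_tags, lifting) carrier_matD mem_Collect_eq)
  qed
  have dist: "distinct (cols ?T)"
  proof (subst distinct_conv_nth, intro allI impI)
    fix a b assume "a < length (cols ?T)" "b < length (cols ?T)" and ab': "a \<noteq> b"
    then have ab: "a < k" "b < k" using C by auto
    show "cols ?T ! a \<noteq> cols ?T ! b"
    proof
      assume "cols ?T ! a = cols ?T ! b"
      then have "row C a = row C b" using ab C by simp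
      then have "(C * ?T) $$ (a, b) = (C * ?T) $$ (a, a)" using ab C by simp
      then show False unfolding CC using ab ab' by simp
    qed
  qed
  have "V.rank ?T = k"
  proof (rule V.lin_indpt_full_rank[OF T dist])
    show "V.lin_indpt (set (cols ?T))"
    proof
      assume "V.lin_dep (set (cols ?T))"
      then obtain v where v: "v \<in> carrier_vec k" "v \<noteq> 0\<^sub>v k" "?T *\<^sub>v v = 0\<^sub>v p"
        using V.lin_depE[OF T _ dist] by blast
      have "v = (C * ?T) *\<^sub>v v" using CC v by simp
      also have "\<dots> = C *\<^sub>v (?T *\<^sub>v v)" using assoc_mult_mat_vec[OF C T v(1)] .
      also have "\<dots> = 0\<^sub>v k" using v C by (intro eq_vecI) auto
      finally show False using v by simp
    qed
  qed
  moreover have "V.rank P = V.rank ?T"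
    using sp unfolding V.rank_def V.col_space_def by simp
  ultimately have rk: "mat_rank P = k" using Pc by simp
  have "mat_trace P = (\<Sum>i<p. d i)" unfolding U(4) by (rule mat_trace_orth_diag[OF U(1,2)])
  also have "\<dots> = (\<Sum>i\<in>set js. 1)" by (rule sum.mono_neutral_cong_right) (use js d in auto)
  also have "\<dots> = k" using js(1) by (simp add: k_def distinct_card)
  finally have tr: "mat_trace P = mat_rank P" using rk by simp
  show ?thesis
  proof (rule that[of C])
    show "orthonormal_rows_of_range p P C"
      unfolding orthonormal_rows_of_range_def rk using C CC sp V.row_space_eq_col_space_transpose by auto
  qed (use PC tr in auto)
qed

lemma orth_projection_trace: "orth_projection p P \<Longrightarrow> mat_trace P = mat_rank P"
  using orth_projection_rows by blast

lemma orth_projection_one: "orth_projection p (1\<^sub>m p)"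
  by (simp add: orth_projection_def)

text \<open>Fillers of prescribed rank: they complete a subsequence of projections to a full
  sequence whose relative ranks converge.\<close>

definition coord_projection :: "nat \<Rightarrow> nat \<Rightarrow> real mat" where
  "coord_projection p k = mat_diag p (\<lambda>i. if i < k then 1 else 0)"

lemma orth_projection_coord_projection: "orth_projection p (coord_projection p k)"
proof -
  have "orth_projection p (1\<^sub>m p * mat_diag p (\<lambda>i. if i < k then 1 else 0) * transpose_mat (1\<^sub>m p))"
    by (rule orth_projection_orth_diag) auto
  then show ?thesis by (simp add: coord_projection_def left_mult_one_mat[of _ p p] right_mult_one_mat[of _ p p])
qed

lemma mat_trace_coord_projection: "k \<le> p \<Longrightarrow> mat_trace (coord_projection p k) = k"
proof -
  assume k: "k \<le> p"
  have "mat_trace (coord_projection p k) = (\<Sum>i<p. if i < k then 1 else 0)"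
    by (simp add: mat_trace_def coord_projection_def mat_diag_def)
  also have "\<dots> = (\<Sum>i<k. 1)" by (rule sum.mono_neutral_cong_right) (use k in auto)
  finally show ?thesis by simp
qed

text \<open>Resolvents live in the coordinates of the range, whereas (RQC) and (ACI) are stated in
  the ambient space. Conjugation with \<open>C\<close> moves a contraction to the ambient space and
  keeps its trace and its quadratic form in the samples.\<close>

lemma
  fixes C B :: "real mat"
  assumes C: "C \<in> carrier_mat q p" "C * transpose_mat C = 1\<^sub>m q" and B: "psd_contraction q B"
  shows psd_contraction_conj: "psd_contraction p (transpose_mat C * B * C)"
    and mat_trace_conj: "mat_trace (transpose_mat C * B * C) = mat_trace B"
    and conj_quadratic: "\<And>v. v \<in> carrier_vec p \<Longrightarrow> v \<bullet> ((transpose_mat C * B * C) *\<^sub>v v) = (C *\<^sub>v v) \<bullet> (B *\<^sub>v (C *\<^sub>v v))"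
proof -
  let ?T = "transpose_mat C"
  have T: "?T \<in> carrier_mat p q" using C by simp
  have Bc: "B \<in> carrier_mat q q" "transpose_mat B = B" using B by (auto simp: psd_contraction_def psd_mat_def)
  show quad: "v \<bullet> ((?T * B * C) *\<^sub>v v) = (C *\<^sub>v v) \<bullet> (B *\<^sub>v (C *\<^sub>v v))" if v: "v \<in> carrier_vec p" for v
  proof -
    have "(?T * B * C) *\<^sub>v v = ?T *\<^sub>v (B *\<^sub>v (C *\<^sub>v v))"
      using T Bc(1) C(1) v by (simp add: assoc_mult_mat_vec[of _ p q _ q] assoc_mult_mat_vec[of _ p q _ p] mult_carrier_mat[of _ p q _ q])
    moreover have "v \<bullet> (?T *\<^sub>v (B *\<^sub>v (C *\<^sub>v v))) = (?T *\<^sub>v (B *\<^sub>v (C *\<^sub>v v))) \<bullet> v"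
      by (rule comm_scalar_prod[of _ p]) (use T Bc C v in auto)
    moreover have "\<dots> = (B *\<^sub>v (C *\<^sub>v v)) \<bullet> (C *\<^sub>v v)"
      by (rule transpose_vec_mult_scalar[OF C(1) v]) (use Bc C v in auto)
    moreover have "\<dots> = (C *\<^sub>v v) \<bullet> (B *\<^sub>v (C *\<^sub>v v))"
      by (rule comm_scalar_prod[of _ q]) (use Bc C v in auto)
    ultimately show ?thesis by simp
  qed
  show "mat_trace (?T * B * C) = mat_trace B"
  proof -
    have "mat_trace (?T * B * C) = mat_trace (C * (?T * B))"
      by (rule mat_trace_mult[of _ p q]) (use T Bc C in auto)
    also have "C * (?T * B) = (C * ?T) * B" by (rule assoc_mult_mat[symmetric, of _ q p _ q _ q]) (use T Bc C in auto)
    finally show ?thesis using C Bc by simp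
  qed
  have norm: "(C *\<^sub>v v) \<bullet> (C *\<^sub>v v) \<le> v \<bullet> v" if v: "v \<in> carrier_vec p" for v
  proof -
    \<comment> \<open>\<open>C\<close> does not increase norms because
      \<open>transpose_mat C * C\<close> is a projection.\<close>
    have "orth_projection p (?T * C)"
    proof -
      have "(?T * C) * (?T * C) = ?T * (C * ?T) * C"
        using T C(1) by (simp add: assoc_mult_mat[of _ p q _ p _ p] assoc_mult_mat[of _ p q _ q _ p] assoc_mult_mat[of _ q p _ q _ p] mult_carrier_mat[of _ p q _ p] mult_carrier_mat[of _ q p _ p] mult_carrier_mat[of _ q p _ q])
      then have "(?T * C) * (?T * C) = ?T * C" using C T by simp
      then show ?thesis using T C by (auto simp: orth_projection_def transpose_mult[of _ p q _ p])
    qed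
    from orth_projection_psd_contraction[OF this] have "v \<bullet> ((?T * C) *\<^sub>v v) \<le> v \<bullet> v"
      using v by (simp add: psd_contraction_def)
    moreover have "v \<bullet> ((?T * C) *\<^sub>v v) = (?T *\<^sub>v (C *\<^sub>v v)) \<bullet> v"
      using assoc_mult_mat_vec[OF T C(1) v] comm_scalar_prod[of v p "?T *\<^sub>v (C *\<^sub>v v)"] v T C by simp
    moreover have "\<dots> = (C *\<^sub>v v) \<bullet> (C *\<^sub>v v)"
      by (rule transpose_vec_mult_scalar[OF C(1) v]) (use C v in auto)
    ultimately show ?thesis by simp
  qed
  have "transpose_mat (?T * B * C) = ?T * B * C"
    using T C(1) Bc by (simp add: transpose_mult[of _ p q _ p] transpose_mult[of _ p q _ q] transpose_mult[of _ q q _ p] mult_carrier_mat[of _ q q _ p] assoc_mult_mat[of _ p q _ q _ p] mult_carrier_mat[of _ p q _ q])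
  moreover have "0 \<le> v \<bullet> ((?T * B * C) *\<^sub>v v) \<and> v \<bullet> ((?T * B * C) *\<^sub>v v) \<le> v \<bullet> v" if v: "v \<in> carrier_vec p" for v
  proof -
    have "C *\<^sub>v v \<in> carrier_vec q" using C v by auto
    then show ?thesis unfolding quad[OF v] using B norm[OF v] unfolding psd_contraction_def psd_mat_def by force
  qed
  moreover have "?T * B * C \<in> carrier_mat p p"
    by (intro mult_carrier_mat[of _ p q _ p] mult_carrier_mat[of _ p q _ q] T Bc C)
  ultimately show "psd_contraction p (?T * B * C)"
    unfolding psd_contraction_def psd_mat_def by blast
qed

lemma orth_diag_quadratic:
  fixes U :: "real mat"
  assumes U: "U \<in> carrier_mat n n" and v: "v \<in> carrier_vec n"
  shows "v \<bullet> ((U * mat_diag n f * transpose_mat U) *\<^sub>v v) = (\<Sum>i<n. f i * (col U i \<bullet> v)\<^sup>2)"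
proof -
  define w where "w = transpose_mat U *\<^sub>v v"
  have w: "w \<in> carrier_vec n" using U v by (auto simp: w_def)
  have wi: "w $ i = col U i \<bullet> v" if "i < n" for i using that U by (simp add: w_def)
  have D: "mat_diag n f *\<^sub>v w \<in> carrier_vec n" by (rule mult_mat_vec_carrier[OF mat_diag_dim w])
  have "(U * mat_diag n f * transpose_mat U) *\<^sub>v v = U *\<^sub>v (mat_diag n f *\<^sub>v w)"
    using U v by (simp add: assoc_mult_mat_vec[of _ n n _ n] w_def mult_carrier_mat[of _ n n _ n])
  then have "v \<bullet> ((U * mat_diag n f * transpose_mat U) *\<^sub>v v) = (transpose_mat U *\<^sub>v v) \<bullet> (mat_diag n f *\<^sub>v w)"
    using transpose_vec_mult_scalar[OF U D v] by simp
  also have "\<dots> = (\<Sum>i<n. w $ i * (mat_diag n f *\<^sub>v w) $ i)"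
    unfolding w_def[symmetric] using w D by (simp only: scalar_prod_def[of w] carrier_vecD atLeast0LessThan)
  also have "\<dots> = (\<Sum>i<n. f i * (w $ i)\<^sup>2)"
  proof (rule sum.cong)
    fix i assume "i \<in> {..<n}"
    then have i: "i < n" by simp
    have "(mat_diag n f *\<^sub>v w) $ i = (\<Sum>j<n. (if i = j then f j else 0) * w $ j)"
      using i w by (simp add: mat_diag_def scalar_prod_def atLeast0LessThan)
    also have "\<dots> = (\<Sum>j<n. if i = j then f j * w $ j else 0)" by (intro sum.cong) auto
    finally have "(mat_diag n f *\<^sub>v w) $ i = f i * w $ i" using i by simp
    then show "w $ i * (mat_diag n f *\<^sub>v w) $ i = f i * (w $ i)\<^sup>2" by (simp add: power2_eq_square)
  qed simp
  also have "\<dots> = (\<Sum>i<n. f i * (col U i \<bullet> v)\<^sup>2)" by (intro sum.cong) (auto simp: wi)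
  finally show ?thesis .
qed

lemma orth_diag_norm:
  fixes U :: "real mat"
  assumes U: "U \<in> carrier_mat n n" "U * transpose_mat U = 1\<^sub>m n" and v: "v \<in> carrier_vec n"
  shows "(\<Sum>i<n. (col U i \<bullet> v)\<^sup>2) = v \<bullet> v"
  using orth_diag_quadratic[OF U(1) v, of "\<lambda>_. 1"] U v by (simp add: right_mult_one_mat[of _ n n])

text \<open>The sum counts the positive integers up to \<open>x * m\<close>, hence equals the
  integer part of \<open>x * m\<close>.\<close>

lemma layer_sum_approx:
  fixes x :: real and m :: nat
  assumes m: "0 < m" and x: "0 \<le> x" "x \<le> 1"
  shows "\<bar>x - (\<Sum>k=1..m. if real k \<le> x * m then 1 else 0) / m\<bar> \<le> 1 / m"
proof -
  define r where "r = nat \<lfloor>x * m\<rfloor>"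
  have "real r = of_int \<lfloor>x * m\<rfloor>" using x by (simp add: r_def)
  then have r: "real r \<le> x * m" "x * m < r + 1"
    using real_of_int_floor_add_one_gt[of "x * m"] of_int_floor_le[of "x * m"] by linarith+
  have "x * m \<le> m" using x by (simp add: mult_left_le_one_le)
  then have rm: "r \<le> m" using r by linarith
  have iff: "real k \<le> x * m \<longleftrightarrow> k \<le> r" for k using r by linarith
  have "(\<Sum>k=1..m. if real k \<le> x * m then 1 else 0 :: real) = (\<Sum>k\<in>{1..r}. 1)"
    unfolding iff by (rule sum.mono_neutral_cong_right) (use rm in auto)
  then have "x - (\<Sum>k=1..m. if real k \<le> x * m then 1 else 0) / m = (x * m - r) / m" using m by (simp add: field_simps)
  moreover have "0 \<le> (x * m - r) / m" "(x * m - r) / m \<le> 1 / m"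
    using r m by (auto intro!: divide_nonneg_pos divide_right_mono)
  ultimately show ?thesis by linarith
qed

text \<open>The layer-cake formula \<open>A = \<integral>\<^sub>0\<^sup>1 1(A \<ge> s) ds\<close>, discretized: it reduces statements about
  quadratic forms of contractions to statements about projections.\<close>

lemma psd_contraction_layers:
  assumes A: "psd_contraction n A" and m: "0 < m"
  obtains P :: "nat \<Rightarrow> real mat" where "\<And>k. orth_projection n (P k)"
    "\<And>v. v \<in> carrier_vec n \<Longrightarrow> \<bar>v \<bullet> (A *\<^sub>v v) - (\<Sum>k=1..m. v \<bullet> (P k *\<^sub>v v)) / m\<bar> \<le> (v \<bullet> v) / m"
    "\<bar>mat_trace A - (\<Sum>k=1..m. mat_trace (P k)) / m\<bar> \<le> n / m"
proof -
  obtain U d where U: "U \<in> carrier_mat n n" "transpose_mat U * U = 1\<^sub>m n" "U * transpose_mat U = 1\<^sub>m n"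
    "A = U * mat_diag n d * transpose_mat U" and d: "\<And>i. i < n \<Longrightarrow> 0 \<le> d i" "\<And>i. i < n \<Longrightarrow> d i \<le> 1"
    using psd_contraction_spectral[OF A] by blast
  \<comment> \<open>\<open>P k\<close> becomes the spectral projection onto the eigenvalues that are
    at least \<open>k / m\<close>.\<close>
  define f where "f k i = (if real k \<le> d i * m then 1 else 0 :: real)" for k i
  define P where "P k = U * mat_diag n (f k) * transpose_mat U" for k
  show ?thesis
  proof (rule that[of P])
    show "orth_projection n (P k)" for k unfolding P_def
      by (rule orth_projection_orth_diag[OF U(1,2)]) (simp add: f_def)
    have L: "\<bar>d i - (\<Sum>k=1..m. f k i) / m\<bar> \<le> 1 / m" if "i < n" for i
      unfolding f_def by (rule layer_sum_approx[OF m d(1)[OF that] d(2)[OF that]])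
    fix v :: "real Matrix.vec" assume v: "v \<in> carrier_vec n"
    have "v \<bullet> (A *\<^sub>v v) - (\<Sum>k=1..m. v \<bullet> (P k *\<^sub>v v)) / m
      = (\<Sum>i<n. d i * (col U i \<bullet> v)\<^sup>2) - (\<Sum>k=1..m. \<Sum>i<n. f k i * (col U i \<bullet> v)\<^sup>2) / m"
      unfolding U(4) P_def orth_diag_quadratic[OF U(1) v] ..
    also have "\<dots> = (\<Sum>i<n. (d i - (\<Sum>k=1..m. f k i) / m) * (col U i \<bullet> v)\<^sup>2)"
    proof (subst sum.swap)
      have "(d i - (\<Sum>k=1..m. f k i) / m) * (col U i \<bullet> v)\<^sup>2
          = d i * (col U i \<bullet> v)\<^sup>2 - (\<Sum>k=1..m. f k i * (col U i \<bullet> v)\<^sup>2) / m" for i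
        by (simp add: left_diff_distrib sum_distrib_right)
      then show "(\<Sum>i<n. d i * (col U i \<bullet> v)\<^sup>2) - (\<Sum>i<n. \<Sum>k=1..m. f k i * (col U i \<bullet> v)\<^sup>2) / m
          = (\<Sum>i<n. (d i - (\<Sum>k=1..m. f k i) / m) * (col U i \<bullet> v)\<^sup>2)"
        by (simp only: sum_subtractf sum_divide_distrib)
    qed
    finally have "\<bar>v \<bullet> (A *\<^sub>v v) - (\<Sum>k=1..m. v \<bullet> (P k *\<^sub>v v)) / m\<bar> \<le> (\<Sum>i<n. \<bar>(d i - (\<Sum>k=1..m. f k i) / m) * (col U i \<bullet> v)\<^sup>2\<bar>)"
      by simp
    also have "\<dots> \<le> (\<Sum>i<n. 1 / m * (col U i \<bullet> v)\<^sup>2)"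
      unfolding abs_mult using L by (intro sum_mono mult_mono) auto
    also have "\<dots> = (v \<bullet> v) / m" 
      unfolding sum_distrib_left[symmetric] orth_diag_norm[OF U(1,3) v] by simp
    finally show "\<bar>v \<bullet> (A *\<^sub>v v) - (\<Sum>k=1..m. v \<bullet> (P k *\<^sub>v v)) / m\<bar> \<le> (v \<bullet> v) / m" .
  next
    have L: "\<bar>d i - (\<Sum>k=1..m. f k i) / m\<bar> \<le> 1 / m" if "i < n" for i
      unfolding f_def by (rule layer_sum_approx[OF m d(1)[OF that] d(2)[OF that]])
    have "mat_trace A - (\<Sum>k=1..m. mat_trace (P k)) / m = (\<Sum>i<n. d i - (\<Sum>k=1..m. f k i) / m)"
      unfolding U(4) P_def mat_trace_orth_diag[OF U(1,2)]
      by (subst sum.swap) (simp add: sum_subtractf sum_divide_distrib)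
    also have "\<bar>\<dots>\<bar> \<le> (\<Sum>i<n. 1 / m)" using L by (intro order_trans[OF sum_abs] sum_mono) auto
    finally show "\<bar>mat_trace A - (\<Sum>k=1..m. mat_trace (P k)) / m\<bar> \<le> n / m" by simp
  qed
qed

section \<open>Resolvent transforms and the Levy distance\<close>

lemma prob_on_nonneg_AE: "prob_on_nonneg \<mu> \<Longrightarrow> AE l in \<mu>. 0 \<le> l"
  unfolding prob_on_nonneg_def real_distribution_def real_distribution_axioms_def
  by (intro AE_I[where N="{..<0}"]) auto

lemma prob_on_nonneg_real_distribution: "prob_on_nonneg \<mu> \<Longrightarrow> real_distribution \<mu>"
  by (simp add: prob_on_nonneg_def)

lemma prob_on_nonneg_integrable:
  fixes g :: "real \<Rightarrow> 'b::{banach, second_countable_topology}"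
  assumes \<mu>: "prob_on_nonneg \<mu>" and g: "g \<in> borel_measurable borel" "\<And>l. 0 \<le> l \<Longrightarrow> norm (g l) \<le> B"
  shows "integrable \<mu> g"
proof -
  interpret real_distribution \<mu> using \<mu> by (simp add: prob_on_nonneg_def)
  show ?thesis using prob_on_nonneg_AE[OF \<mu>] g
    by (intro integrable_const_bound[of _ B]) auto
qed

lemma prob_on_nonneg_integral_diff:
  fixes g h :: "real \<Rightarrow> real"
  assumes \<mu>: "prob_on_nonneg \<mu>" and g: "integrable \<mu> g" and h: "integrable \<mu> h"
    and e: "\<And>l. 0 \<le> l \<Longrightarrow> \<bar>g l - h l\<bar> \<le> e"
  shows "\<bar>(LINT l|\<mu>. g l) - (LINT l|\<mu>. h l)\<bar> \<le> e"
proof -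
  interpret real_distribution \<mu> using \<mu> by (simp add: prob_on_nonneg_def)
  have "\<bar>(LINT l|\<mu>. g l) - (LINT l|\<mu>. h l)\<bar> = \<bar>LINT l|\<mu>. g l - h l\<bar>" using g h by simp
  also have "\<dots> \<le> (LINT l|\<mu>. \<bar>g l - h l\<bar>)" by (rule integral_abs_bound)
  also have "\<dots> \<le> (LINT l|\<mu>. e)"
    using g h e prob_on_nonneg_AE[OF \<mu>] by (intro integral_mono_AE) auto
  finally show ?thesis using prob_space by simp
qed

text \<open>The resolvent functions \<open>1/(l+t)\<close> generate, by linear combinations and uniform limits,
  all functions that are continuous on \<open>[0, \<infinity>]\<close>: with \<open>u = 1/(l+1)\<close> one has
  \<open>1/(l+1-h) = u/(1-h u)\<close>, whose expansion in \<open>h\<close> produces the powers of \<open>u\<close>.\<close>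

locale resolvent_class =
  fixes T :: "(real \<Rightarrow> real) set"
  assumes const: "(\<lambda>l. c) \<in> T"
    and add: "f \<in> T \<Longrightarrow> g \<in> T \<Longrightarrow> (\<lambda>l. f l + g l) \<in> T"
    and scale: "f \<in> T \<Longrightarrow> (\<lambda>l. c * f l) \<in> T"
    and uniform: "g \<in> borel_measurable borel \<Longrightarrow> (\<And>e. 0 < e \<Longrightarrow> \<exists>h\<in>T. \<forall>l\<ge>0. \<bar>h l - g l\<bar> \<le> e) \<Longrightarrow> g \<in> T"
    and resolvent_in: "0 < t \<Longrightarrow> (\<lambda>l. 1 / (l + t)) \<in> T"
begin

lemma sum_in: "finite I \<Longrightarrow> (\<And>i. i \<in> I \<Longrightarrow> f i \<in> T) \<Longrightarrow> (\<lambda>l. \<Sum>i\<in>I. f i l) \<in> T"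
  by (induction I rule: finite_induct) (auto intro: const add)

lemma geometric_tail:
  fixes h u :: real
  assumes "h * u \<noteq> 1"
  shows "u / (1 - h * u) - (\<Sum>j<k. h ^ j * u ^ Suc j) = h ^ k * u ^ Suc k / (1 - h * u)"
proof (induction k)
  case (Suc k)
  have "u / (1 - h * u) - (\<Sum>j<Suc k. h ^ j * u ^ Suc j) = h ^ k * u ^ Suc k / (1 - h * u) - h ^ k * u ^ Suc k"
    using Suc by simp
  also have "\<dots> = (h ^ k * u ^ Suc k - h ^ k * u ^ Suc k * (1 - h * u)) / (1 - h * u)"
    using assms by (simp add: diff_divide_distrib)
  also have "\<dots> = h ^ Suc k * u ^ Suc (Suc k) / (1 - h * u)" by (simp add: algebra_simps)
  finally show ?case .
qed simp

lemma power_in: "(\<lambda>l. (1 / (l + 1)) ^ k) \<in> T"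
proof (induction k rule: less_induct)
  case (less k)
  show ?case
  proof (cases k)
    case 0
    then show ?thesis using const by simp
  next
    case (Suc m)
    show ?thesis
    proof (rule uniform)
      fix e :: real assume e: "0 < e"
      define h where "h = min (1/2) (e/2)"
      have h: "0 < h" "h \<le> 1/2" "2 * h \<le> e" using e by (auto simp: h_def)
      \<comment> \<open>Removing the first \<open>m\<close> terms of the geometric series and
        dividing by \<open>h ^ m\<close> leaves \<open>u ^ Suc m / (1 - h * u)\<close>, which is
        within \<open>2 * h\<close> of the wanted power; the removed terms are in \<open>T\<close>
        by induction.\<close>
      define g where "g l = (1 / h ^ m) * (1 / (l + (1 - h)) + (-1) * (\<Sum>j<m. h ^ j * (1 / (l + 1)) ^ Suc j))" for l
      have pw: "(\<lambda>l. (1 / (l + 1)) ^ Suc j) \<in> T" if "j \<in> {..<m}" for j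
        by (rule less) (use that Suc in auto)
      have "g \<in> T" unfolding g_def 
        by (intro scale add sum_in resolvent_in pw) (use h in auto)
      moreover have "\<bar>g l - (1 / (l + 1)) ^ k\<bar> \<le> e" if l: "0 \<le> l" for l
      proof -
        define u where "u = 1 / (l + 1)"
        have u: "0 \<le> u" "u \<le> 1" using l by (auto simp: u_def)
        have hu: "h * u \<le> h" using u h by (simp add: mult_left_le)
        have "h * u \<le> 1/2" using hu h(2) by linarith
        moreover have "0 \<le> h * u" using h(1) u(1) by simp
        ultimately have hu2: "h * u \<le> 1/2" "0 \<le> h * u" .
        have "1 / (l + (1 - h)) = u / (1 - h * u)"
          using l h by (simp add: u_def divide_simps)
        then have "g l = (1 / h ^ m) * (h ^ m * u ^ Suc m / (1 - h * u))"
          using geometric_tail[of h u m] hu2 unfolding g_def u_def[symmetric] by (simp add: algebra_simps)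
        then have "g l = u ^ k / (1 - h * u)" using h Suc by simp
        then have "g l - u ^ k = u ^ k * (h * u) / (1 - h * u)"
          using hu2 by (simp add: field_simps)
        moreover have "u ^ k * (h * u) \<le> 1 * h" using hu hu2(2) u h(1) by (intro mult_mono power_le_one) auto
        then have "u ^ k * (h * u) / (1 - h * u) \<le> 1 * h / (1/2)"
          using hu2 h by (intro frac_le) linarith+
        moreover have "0 \<le> u ^ k * (h * u) / (1 - h * u)"
          by (intro divide_nonneg_nonneg mult_nonneg_nonneg[OF _ hu2(2)]) (use hu2 u in simp_all)
        ultimately have "0 \<le> g l - u ^ k" "g l - u ^ k \<le> 2 * h" by auto
        then show ?thesis using h(3) unfolding u_def[symmetric] by linarith
      qed
      ultimately show "\<exists>h\<in>T. \<forall>l\<ge>0. \<bar>h l - (1 / (l + 1)) ^ k\<bar> \<le> e" by blast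
    qed simp
  qed
qed

lemma poly_in: "(\<lambda>l. poly p (1 / (l + 1))) \<in> T"
  unfolding poly_altdef by (intro sum_in scale power_in) simp

text \<open>The substitution \<open>u = 1 / (l + 1)\<close> compactifies the half line to the unit
  interval, with \<open>L\<close> as the value at \<open>u = 0\<close>. Bernstein polynomials in
  \<open>u\<close> then approximate uniformly.\<close>

lemma continuous_in:
  fixes g :: "real \<Rightarrow> real"
  assumes g: "g \<in> borel_measurable borel" "continuous_on {0..} g" "(g \<longlongrightarrow> L) at_top"
  shows "g \<in> T"
proof (rule uniform[OF g(1)])
  fix e :: real assume e: "0 < e"
  define G where "G u = (if u = 0 then L else g (1 / u - 1))" for u
  have "continuous_on {0..1} G"
    unfolding continuous_on_def
  proof
    fix u :: real assume u: "u \<in> {0..1}"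
    show "(G \<longlongrightarrow> G u) (at u within {0..1})"
    proof (cases "u = 0")
      case True
      have "filterlim (\<lambda>u::real. 1 / u - 1) at_top (at_right 0)"
        using filterlim_tendsto_add_at_top[OF tendsto_const[of "-1"] filterlim_inverse_at_top_right]
        by (simp add: field_simps inverse_eq_divide)
      then have "((\<lambda>u. g (1 / u - 1)) \<longlongrightarrow> L) (at_right 0)" by (rule filterlim_compose[OF g(3)])
      then have "(G \<longlongrightarrow> L) (at_right 0)"
      proof (rule Lim_transform_eventually)
        show "eventually (\<lambda>u. g (1 / u - 1) = G u) (at_right 0)"
          using eventually_at_right_less[of 0] by (rule eventually_mono) (auto simp: G_def)
      qed
      moreover have "at (0::real) within {0..1} = at_right 0" by (rule at_within_Icc_at_right) simp
      ultimately show ?thesis using True by (simp add: G_def)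
    next
      case False
      then have u0: "0 < u" using u by auto
      have "continuous_on {0<..1} (\<lambda>u. g (1 / u - 1))"
        by (rule continuous_on_compose2[OF g(2)]) (auto intro!: continuous_intros)
      then have "continuous_on {0<..1} G"
        by (rule continuous_on_eq) (auto simp: G_def)
      then have "(G \<longlongrightarrow> G u) (at u within {0<..1})" using u u0 by (auto simp: continuous_on_def)
      moreover have "at u within {0<..1} = at u within {0..1}"
        by (rule at_within_nhd[of u "{0<..}"]) (use u0 in auto)
      ultimately show ?thesis by simp
    qed
  qed
  then obtain n where n: "\<And>x. x \<in> {0..1} \<Longrightarrow> \<bar>G x - (\<Sum>k\<le>n. G (k / n) * Bernstein n k x)\<bar> < e"
    using Bernstein_Weierstrass[OF _ e] by (meson order_refl)
  define p where "p = (\<Sum>k\<le>n. Polynomial.smult (G (real k / real n) * real (n choose k)) ([:0, 1:] ^ k * [:1, -1:] ^ (n - k)))"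
  have p: "poly p x = (\<Sum>k\<le>n. G (k / n) * Bernstein n k x)" for x
    by (simp add: p_def poly_sum poly_power Bernstein_def algebra_simps)
  have "\<bar>poly p (1 / (l + 1)) - g l\<bar> \<le> e" if l: "0 \<le> l" for l
  proof -
    have "G (1 / (l + 1)) = g l" using l by (simp add: G_def)
    moreover have "1 / (l + 1) \<in> {0..1}" using l by auto
    ultimately show ?thesis using n[of "1 / (l + 1)"] p[of "1 / (l + 1)"] by simp
  qed
  then show "\<exists>h\<in>T. \<forall>l\<ge>0. \<bar>h l - g l\<bar> \<le> e" using poly_in[of p] by (intro bexI[of _ "\<lambda>l. poly p (1 / (l + 1))"]) auto
qed

text \<open>The ramp is 1 up to \<open>a\<close> and 0 from \<open>b\<close> on, so its integral
  lies between the values of the distribution function at \<open>a\<close> and at \<open>b\<close>.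
  All passages from integrals to distribution functions use these ramps.\<close>

lemma cts_step_in:
  assumes "a < b"
  shows "cts_step a b \<in> T"
proof (rule continuous_in[where L=0])
  have "continuous_on UNIV (cts_step a b)"
    using cts_step_uniformly_continuous[OF assms] by (rule uniformly_continuous_imp_continuous)
  then show "continuous_on {0..} (cts_step a b)" "cts_step a b \<in> borel_measurable borel"
    by (auto intro: continuous_on_subset borel_measurable_continuous_onI)
  have "eventually (\<lambda>x. 0 = cts_step a b x) at_top"
    unfolding eventually_at_top_linorder using assms by (intro exI[of _ b]) (auto simp: cts_step_def)
  then show "(cts_step a b \<longlongrightarrow> 0) at_top" by (rule Lim_transform_eventually[OF tendsto_const])
qed

end

text \<open>The functions with equal integrals form a \<open>resolvent_class\<close>, which
  therefore contains the ramps; right-continuity then identifies the distribution functions.\<close>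

lemma resolvent_transform_unique:
  assumes \<mu>: "prob_on_nonneg \<mu>" "prob_on_nonneg \<nu>"
    and eq: "\<And>t. 0 < t \<Longrightarrow> (LINT l|\<mu>. 1 / (l + t)) = (LINT l|\<nu>. 1 / (l + t))"
  shows "\<mu> = \<nu>"
proof -
  define T where "T = {g. integrable \<mu> g \<and> integrable \<nu> g \<and> (LINT l|\<mu>. g l) = (LINT l|\<nu>. (g l :: real))}"
  interpret M: real_distribution \<mu> using \<mu> by (simp add: prob_on_nonneg_def)
  interpret N: real_distribution \<nu> using \<mu> by (simp add: prob_on_nonneg_def)
  interpret T: resolvent_class T
  proof
    show "(\<lambda>l. c) \<in> T" for c using M.prob_space N.prob_space by (simp add: T_def)
    show "f \<in> T \<Longrightarrow> g \<in> T \<Longrightarrow> (\<lambda>l. f l + g l) \<in> T" for f g by (simp add: T_def)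
    show "f \<in> T \<Longrightarrow> (\<lambda>l. c * f l) \<in> T" for f c by (simp add: T_def)
    show "0 < t \<Longrightarrow> (\<lambda>l. 1 / (l + t)) \<in> T" for t
      unfolding T_def using eq by (auto intro!: prob_on_nonneg_integrable[OF \<mu>(1), of _ "1/t"] prob_on_nonneg_integrable[OF \<mu>(2), of _ "1/t"] frac_le)
    fix g :: "real \<Rightarrow> real" assume g: "g \<in> borel_measurable borel" and ap: "\<And>e. 0 < e \<Longrightarrow> \<exists>h\<in>T. \<forall>l\<ge>0. \<bar>h l - g l\<bar> \<le> e"
    have int: "integrable \<rho> g" if \<rho>: "prob_on_nonneg \<rho>" and h: "integrable \<rho> h" "\<forall>l\<ge>0. \<bar>h l - g l\<bar> \<le> 1" for \<rho> h
    proof -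
      interpret R: real_distribution \<rho> using \<rho> by (simp add: prob_on_nonneg_def)
      have "integrable \<rho> (\<lambda>l. h l - g l)"
        using prob_on_nonneg_AE[OF \<rho>] h g by (intro R.integrable_const_bound[of _ 1]) auto
      then have "integrable \<rho> (\<lambda>l. h l - (h l - g l))" by (rule Bochner_Integration.integrable_diff[OF h(1)])
      moreover have "(\<lambda>l. h l - (h l - g l)) = g" by auto
      ultimately show ?thesis by (simp only:)
    qed
    obtain h where h: "h \<in> T" "\<forall>l\<ge>0. \<bar>h l - g l\<bar> \<le> 1" using ap[of 1] by auto
    have i: "integrable \<mu> g" "integrable \<nu> g" using int[OF \<mu>(1)] int[OF \<mu>(2)] h by (auto simp: T_def)
    have "\<bar>(LINT l|\<mu>. g l) - (LINT l|\<nu>. g l)\<bar> \<le> 0 + e" if e: "0 < e" for e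
    proof -
      obtain h where h: "h \<in> T" "\<forall>l\<ge>0. \<bar>h l - g l\<bar> \<le> e / 2" using ap[of "e/2"] e by auto
      have "\<bar>(LINT l|\<mu>. h l) - (LINT l|\<mu>. g l)\<bar> \<le> e / 2" "\<bar>(LINT l|\<nu>. h l) - (LINT l|\<nu>. g l)\<bar> \<le> e / 2"
        using h i by (intro prob_on_nonneg_integral_diff[OF \<mu>(1)] prob_on_nonneg_integral_diff[OF \<mu>(2)]; simp add: T_def)+
      moreover have "(LINT l|\<mu>. h l) = (LINT l|\<nu>. h l)" using h by (simp add: T_def)
      ultimately show ?thesis by linarith
    qed
    then have "\<bar>(LINT l|\<mu>. g l) - (LINT l|\<nu>. g l)\<bar> \<le> 0" by (rule field_le_epsilon)
    then show "g \<in> T" using i by (simp add: T_def)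
  qed
  have "cdf \<mu> x = cdf \<nu> x" for x
  proof -
    have l: "cdf \<mu> x \<le> cdf \<nu> y" "cdf \<nu> x \<le> cdf \<mu> y" if "x < y" for x y
      using T.cts_step_in[OF that] M.cdf_cts_step[OF that] N.cdf_cts_step[OF that] by (auto simp: T_def)
    have "cdf \<mu> x \<le> cdf \<nu> x"
    proof (rule tendsto_lowerbound[OF N.cdf_is_right_cont[unfolded continuous_within]])
      show "eventually (\<lambda>y. cdf \<mu> x \<le> cdf \<nu> y) (at_right x)" 
        unfolding eventually_at_right_field using l by (intro exI[of _ "x+1"]) auto
    qed simp
    moreover have "cdf \<nu> x \<le> cdf \<mu> x"
    proof (rule tendsto_lowerbound[OF M.cdf_is_right_cont[unfolded continuous_within]])
      show "eventually (\<lambda>y. cdf \<nu> x \<le> cdf \<mu> y) (at_right x)" 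
        unfolding eventually_at_right_field using l by (intro exI[of _ "x+1"]) auto
    qed simp
    ultimately show ?thesis by simp
  qed
  then show ?thesis by (intro cdf_unique) (auto intro: M.real_distribution_axioms N.real_distribution_axioms)
qed

section \<open>The Levy distance on laws of the half line\<close>

definition levy_close :: "real measure \<Rightarrow> real measure \<Rightarrow> real \<Rightarrow> bool" where
  "levy_close \<mu> \<nu> \<epsilon> \<longleftrightarrow> 0 < \<epsilon> \<and>
     (\<forall>t. cdf \<mu> (t - \<epsilon>) - \<epsilon> \<le> cdf \<nu> t \<and> cdf \<nu> t \<le> cdf \<mu> (t + \<epsilon>) + \<epsilon>)"

lemma levy_dist_eq: "levy_dist \<mu> \<nu> = Inf {\<epsilon>. levy_close \<mu> \<nu> \<epsilon>}"
  by (simp add: levy_dist_def levy_close_def)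

lemma levy_close_bdd: "bdd_below {\<epsilon>. levy_close \<mu> \<nu> \<epsilon>}"
  by (rule bdd_belowI[of _ 0]) (auto simp: levy_close_def)

lemma levy_dist_le: "levy_close \<mu> \<nu> \<epsilon> \<Longrightarrow> levy_dist \<mu> \<nu> \<le> \<epsilon>"
  unfolding levy_dist_eq by (intro cInf_lower levy_close_bdd) simp

lemma
  assumes "real_distribution \<mu>" "real_distribution \<nu>"
  shows levy_close_one: "levy_close \<mu> \<nu> 1"
    and levy_close_mono: "levy_close \<mu> \<nu> \<epsilon> \<Longrightarrow> \<epsilon> \<le> \<epsilon>' \<Longrightarrow> levy_close \<mu> \<nu> \<epsilon>'"
    and levy_dist_nonneg: "0 \<le> levy_dist \<mu> \<nu>"
    and levy_dist_less_iff: "levy_dist \<mu> \<nu> < \<delta> \<longleftrightarrow> (\<exists>\<epsilon><\<delta>. levy_close \<mu> \<nu> \<epsilon>)"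
proof -
  interpret M: real_distribution \<mu> by fact
  interpret N: real_distribution \<nu> by fact
  show one: "levy_close \<mu> \<nu> 1"
    unfolding levy_close_def using M.cdf_bounded_prob N.cdf_bounded_prob M.cdf_nonneg N.cdf_nonneg
    by (smt (verit))
  show "levy_close \<mu> \<nu> \<epsilon>'" if "levy_close \<mu> \<nu> \<epsilon>" "\<epsilon> \<le> \<epsilon>'"
    unfolding levy_close_def
  proof (intro conjI allI)
    show "0 < \<epsilon>'" using that by (auto simp: levy_close_def)
    fix t
    have "cdf \<mu> (t - \<epsilon>') \<le> cdf \<mu> (t - \<epsilon>)" "cdf \<mu> (t + \<epsilon>) \<le> cdf \<mu> (t + \<epsilon>')"
      using that by (auto intro!: M.cdf_nondecreasing)
    moreover have "cdf \<mu> (t - \<epsilon>) - \<epsilon> \<le> cdf \<nu> t" "cdf \<nu> t \<le> cdf \<mu> (t + \<epsilon>) + \<epsilon>"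
      using that by (auto simp: levy_close_def)
    ultimately show "cdf \<mu> (t - \<epsilon>') - \<epsilon>' \<le> cdf \<nu> t" "cdf \<nu> t \<le> cdf \<mu> (t + \<epsilon>') + \<epsilon>'"
      using that by linarith+
  qed
  show "0 \<le> levy_dist \<mu> \<nu>" unfolding levy_dist_eq
  proof (rule cInf_greatest)
    show "{\<epsilon>. levy_close \<mu> \<nu> \<epsilon>} \<noteq> {}" using one by blast
  qed (auto simp: levy_close_def)
  show "levy_dist \<mu> \<nu> < \<delta> \<longleftrightarrow> (\<exists>\<epsilon><\<delta>. levy_close \<mu> \<nu> \<epsilon>)"
    unfolding levy_dist_eq using one by (subst cInf_less_iff[OF _ levy_close_bdd]) auto
qed

text \<open>A finite grid of ramps is enough: within the grid monotonicity interpolates, below 0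
  both laws have no mass, and beyond the grid the small tail of \<mu> controls both. Finiteness is
  what makes the test usable for convergence in probability.\<close>

lemma levy_close_finite_test:
  assumes \<mu>: "prob_on_nonneg \<mu>" and h: "0 < h"
  obtains G :: "(real \<times> real) set" where "finite G" "\<And>a b. (a, b) \<in> G \<Longrightarrow> a < b"
    "\<And>\<mu>'. prob_on_nonneg \<mu>' \<Longrightarrow>
       (\<And>a b. (a, b) \<in> G \<Longrightarrow> \<bar>(LINT l|\<mu>'. cts_step a b l) - (LINT l|\<mu>. cts_step a b l)\<bar> \<le> h) \<Longrightarrow>
       levy_close \<mu>' \<mu> (2 * h)"
proof -
  interpret M: real_distribution \<mu> using \<mu> by (simp add: prob_on_nonneg_def)
  have "((\<lambda>m. cdf \<mu> (real m * h)) \<longlongrightarrow> 1) sequentially"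
    by (rule filterlim_compose[OF M.cdf_lim_at_top_prob])
       (use h in \<open>auto intro: filterlim_at_top_mult_tendsto_pos[OF tendsto_const _ filterlim_real_sequentially]\<close>)
  then have "eventually (\<lambda>m. 1 - h < cdf \<mu> (real m * h)) sequentially"
    using h by (intro order_tendstoD) auto
  then obtain m where m: "1 - h < cdf \<mu> (real m * h)" by (auto simp: eventually_sequentially)
  \<comment> \<open>The grid starts at -1 because a point in the cell with index 0 is compared
    through the ramp one cell to its left.\<close>
  define G where "G = (\<lambda>j::int. (j * h, (j + 1) * h)) ` {-1..int m + 1}"
  show ?thesis
  proof (rule that[of G])
    show "finite G" by (simp add: G_def)
    show "a < b" if "(a, b) \<in> G" for a b using that h by (auto simp: G_def)
    fix \<mu>' assume \<mu>': "prob_on_nonneg \<mu>'"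
      and close: "\<And>a b. (a, b) \<in> G \<Longrightarrow> \<bar>(LINT l|\<mu>'. cts_step a b l) - (LINT l|\<mu>. cts_step a b l)\<bar> \<le> h"
    interpret N: real_distribution \<mu>' using \<mu>' by (simp add: prob_on_nonneg_def)
    have st: "real_of_int j * h < (real_of_int j + 1) * h" for j using h by simp
    have F1: "cdf \<mu>' (j * h) \<le> cdf \<mu> ((j + 1) * h) + h" and F2: "cdf \<mu> (j * h) \<le> cdf \<mu>' ((j + 1) * h) + h"
      if "j \<in> {-1..int m + 1}" for j :: int
    proof -
      have "(real_of_int j * h, (real_of_int j + 1) * h) \<in> G" using that by (auto simp: G_def)
      from close[OF this] show "cdf \<mu>' (j * h) \<le> cdf \<mu> ((j + 1) * h) + h" "cdf \<mu> (j * h) \<le> cdf \<mu>' ((j + 1) * h) + h"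
        using M.cdf_cts_step[OF st[of j]] N.cdf_cts_step[OF st[of j]] by auto
    qed
    show "levy_close \<mu>' \<mu> (2 * h)" unfolding levy_close_def
    proof (intro conjI allI)
      show "0 < 2 * h" using h by simp
      fix t
      consider "t < 0" | "0 \<le> t" "t < m * h" | "m * h \<le> t" by linarith
      then have "cdf \<mu>' (t - 2 * h) - 2 * h \<le> cdf \<mu> t \<and> cdf \<mu> t \<le> cdf \<mu>' (t + 2 * h) + 2 * h"
      proof cases
        case 1
        have z: "cdf \<rho> s = 0" if "prob_on_nonneg \<rho>" "s < 0" for \<rho> s
        proof -
          have "emeasure \<rho> {..s} \<le> emeasure \<rho> {..<0}"
            using that by (intro emeasure_mono) (auto simp: prob_on_nonneg_def real_distribution_def real_distribution_axioms_def)
          then show ?thesis using that by (simp add: prob_on_nonneg_def cdf_def measure_def)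
        qed
        show ?thesis using z[OF \<mu>, of t] z[OF \<mu>', of "t - 2 * h"] 1 h N.cdf_nonneg[of "t + 2 * h"] by simp
      next
        case 2
        define i where "i = \<lfloor>t / h\<rfloor>"
        have "of_int i \<le> t / h" "t / h < of_int i + 1" by (auto simp: i_def)
        then have i: "i * h \<le> t" "t < (i + 1) * h" using h by (simp_all add: field_simps)
        have i0: "0 \<le> i" using 2 h by (simp add: i_def)
        have "t / h < real m" using 2 h by (simp add: field_simps)
        then have im: "i < int m" unfolding i_def by (simp add: floor_less_iff)
        have "cdf \<mu>' (t - 2 * h) \<le> cdf \<mu>' ((i - 1) * h)"
          using i h by (intro N.cdf_nondecreasing) (simp add: algebra_simps)
        also have "\<dots> \<le> cdf \<mu> (i * h) + h" using F1[of "i - 1"] i0 im by simp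
        also have "cdf \<mu> (i * h) \<le> cdf \<mu> t" using i by (intro M.cdf_nondecreasing)
        finally have A: "cdf \<mu>' (t - 2 * h) \<le> cdf \<mu> t + h" by simp
        have "cdf \<mu> t \<le> cdf \<mu> ((i + 1) * h)" using i by (intro M.cdf_nondecreasing) auto
        also have "\<dots> \<le> cdf \<mu>' ((i + 2) * h) + h" using F2[of "i + 1"] i0 im by (simp add: add.commute)
        also have "cdf \<mu>' ((i + 2) * h) \<le> cdf \<mu>' (t + 2 * h)"
          using i h by (intro N.cdf_nondecreasing) (simp add: algebra_simps)
        finally have B: "cdf \<mu> t \<le> cdf \<mu>' (t + 2 * h) + h" by simp
        show ?thesis using A B h by simp
      next
        case 3
        have "cdf \<mu> (m * h) \<le> cdf \<mu> t" using 3 by (intro M.cdf_nondecreasing)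
        moreover have "cdf \<mu>' (t - 2 * h) \<le> 1" "cdf \<mu> t \<le> 1" by (auto intro: N.cdf_bounded_prob M.cdf_bounded_prob)
        moreover have "cdf \<mu> (m * h) \<le> cdf \<mu>' ((m + 1) * h) + h" using F2[of "int m"] by (simp add: add.commute)
        moreover have "cdf \<mu>' ((m + 1) * h) \<le> cdf \<mu>' (t + 2 * h)"
          using 3 h by (intro N.cdf_nondecreasing) (simp add: algebra_simps)
        ultimately show ?thesis using m by auto
      qed
      then show "cdf \<mu>' (t - 2 * h) - 2 * h \<le> cdf \<mu> t" "cdf \<mu> t \<le> cdf \<mu>' (t + 2 * h) + 2 * h" by auto
    qed
  qed
qed

lemma levy_dist_tendsto_imp_weak_conv:
  assumes \<mu>: "real_distribution \<mu>" "\<And>n. real_distribution (\<mu>n n)"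
    and lim: "(\<lambda>n. levy_dist (\<mu>n n) \<mu>) \<longlonglongrightarrow> 0"
  shows "weak_conv_m \<mu>n \<mu>"
  unfolding weak_conv_m_def weak_conv_def
proof (intro allI impI)
  interpret M: real_distribution \<mu> by fact
  fix x assume c: "isCont (cdf \<mu>) x"
  show "(\<lambda>n. cdf (\<mu>n n) x) \<longlonglongrightarrow> cdf \<mu> x"
  proof (rule LIMSEQ_I)
    fix r :: real assume r: "0 < r"
    then obtain s where s: "0 < s" "\<And>y. \<bar>y - x\<bar> < s \<Longrightarrow> \<bar>cdf \<mu> y - cdf \<mu> x\<bar> < r / 2"
      using c[unfolded continuous_at_eps_delta, rule_format, of "r / 2"] by (auto simp: dist_real_def)
    define d where "d = min s (r / 2)"
    have d: "0 < d" using s r by (simp add: d_def)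
    have "eventually (\<lambda>n. levy_dist (\<mu>n n) \<mu> < d) sequentially" using lim d by (rule order_tendstoD)
    then obtain n0 where n0: "\<And>n. n0 \<le> n \<Longrightarrow> levy_dist (\<mu>n n) \<mu> < d" by (auto simp: eventually_sequentially)
    have "norm (cdf (\<mu>n n) x - cdf \<mu> x) < r" if n: "n0 \<le> n" for n
    proof -
      obtain \<epsilon> where e: "\<epsilon> < d" "levy_close (\<mu>n n) \<mu> \<epsilon>" using n0[OF n] levy_dist_less_iff[OF \<mu>(2) \<mu>(1)] by blast
      then have e0: "0 < \<epsilon>" by (simp add: levy_close_def)
      have "cdf (\<mu>n n) (x + \<epsilon> - \<epsilon>) - \<epsilon> \<le> cdf \<mu> (x + \<epsilon>)" "cdf \<mu> (x - \<epsilon>) \<le> cdf (\<mu>n n) (x - \<epsilon> + \<epsilon>) + \<epsilon>"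
        using e(2) unfolding levy_close_def by blast+
      moreover have "\<bar>cdf \<mu> (x + \<epsilon>) - cdf \<mu> x\<bar> < r / 2" "\<bar>cdf \<mu> (x - \<epsilon>) - cdf \<mu> x\<bar> < r / 2"
        using e e0 s(2)[of "x + \<epsilon>"] s(2)[of "x - \<epsilon>"] by (simp_all add: d_def)
      moreover have "\<epsilon> < r / 2" using e by (simp add: d_def)
      ultimately have "cdf (\<mu>n n) x < cdf \<mu> x + r" "cdf \<mu> x < cdf (\<mu>n n) x + r" by (simp_all, linarith+)
      then show ?thesis by (simp add: abs_less_iff)
    qed
    then show "\<exists>n0. \<forall>n\<ge>n0. norm (cdf (\<mu>n n) x - cdf \<mu> x) < r" by blast
  qed
qed

lemma weak_conv_resolvent_transform:
  assumes \<mu>: "prob_on_nonneg \<mu>" "\<And>n. prob_on_nonneg (\<mu>n n)" and t: "0 < t" and w: "weak_conv_m \<mu>n \<mu>"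
  shows "(\<lambda>n. LINT l|\<mu>n n. 1 / (l + t)) \<longlonglongrightarrow> (LINT l|\<mu>. 1 / (l + t))"
proof -
  \<comment> \<open>The resolvent function has a pole at \<open>-t\<close>. With
    \<open>max l 0\<close> it is bounded and continuous on the whole line and unchanged on the half
    line that carries the laws.\<close>
  define g where "g l = 1 / (max l 0 + t)" for l :: real
  have rd: "real_distribution \<mu>" "\<And>n. real_distribution (\<mu>n n)" using \<mu> by (auto simp: prob_on_nonneg_def)
  have "(\<lambda>n. LINT l|\<mu>n n. g l) \<longlonglongrightarrow> (LINT l|\<mu>. g l)"
  proof (rule weak_conv_imp_integral_bdd_continuous_conv[OF rd(2) rd(1) w, where B="1/t"])
    have nz: "max l 0 + t \<noteq> 0" for l using t by (smt (verit) max_def)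
    show "isCont g x" for x unfolding g_def using nz by (intro continuous_intros) auto
    show "norm (g x) \<le> 1 / t" for x using t by (auto simp: g_def intro!: frac_le)
  qed
  moreover have "(LINT l|\<rho>. g l) = (LINT l|\<rho>. 1 / (l + t))" if "prob_on_nonneg \<rho>" for \<rho>
  proof (rule integral_cong_AE)
    have [measurable_cong]: "sets \<rho> = sets borel" using that by (simp add: prob_on_nonneg_def real_distribution_def real_distribution_axioms_def)
    show "g \<in> borel_measurable \<rho>" "(\<lambda>l. 1 / (l + t)) \<in> borel_measurable \<rho>" unfolding g_def by measurable
    show "AE l in \<rho>. g l = 1 / (l + t)" using prob_on_nonneg_AE[OF that] by eventually_elim (simp add: g_def)
  qed
  ultimately show ?thesis using \<mu> by simp
qed

text \<open>A violating sequence would converge in Levy distance, hence weakly, against convergence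
  of the transforms. The uniform \<delta> is needed because the laws to be compared with \<mu> are
  random.\<close>

lemma resolvent_transform_levy_continuous:
  assumes \<mu>: "prob_on_nonneg \<mu>" and t: "0 < t" and e: "0 < e"
  obtains \<delta> where "0 < \<delta>" "\<And>\<mu>'. prob_on_nonneg \<mu>' \<Longrightarrow> levy_dist \<mu>' \<mu> < \<delta> \<Longrightarrow>
    \<bar>(LINT l|\<mu>'. 1 / (l + t)) - (LINT l|\<mu>. 1 / (l + t))\<bar> \<le> e"
proof (rule ccontr)
  assume "\<not> thesis"
  with that have "\<forall>\<delta>>0. \<exists>\<mu>'. prob_on_nonneg \<mu>' \<and> levy_dist \<mu>' \<mu> < \<delta> \<and> \<not> \<bar>(LINT l|\<mu>'. 1 / (l + t)) - (LINT l|\<mu>. 1 / (l + t))\<bar> \<le> e"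
    by metis
  then have "\<forall>n. \<exists>\<mu>'. prob_on_nonneg \<mu>' \<and> levy_dist \<mu>' \<mu> < 1 / real (Suc n) \<and> \<not> \<bar>(LINT l|\<mu>'. 1 / (l + t)) - (LINT l|\<mu>. 1 / (l + t))\<bar> \<le> e"
    by simp
  then obtain \<mu>n where n: "\<And>n. prob_on_nonneg (\<mu>n n)" "\<And>n. levy_dist (\<mu>n n) \<mu> < 1 / real (Suc n)" 
    "\<And>n. \<not> \<bar>(LINT l|\<mu>n n. 1 / (l + t)) - (LINT l|\<mu>. 1 / (l + t))\<bar> \<le> e" by metis
  have rd: "real_distribution \<mu>" "\<And>n. real_distribution (\<mu>n n)" using \<mu> n by (auto simp: prob_on_nonneg_def)
  have "(\<lambda>n. levy_dist (\<mu>n n) \<mu>) \<longlonglongrightarrow> 0"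
    by (rule tendsto_sandwich[OF _ _ tendsto_const LIMSEQ_inverse_real_of_nat])
       (use n(2) levy_dist_nonneg[OF rd(2) rd(1)] in \<open>auto simp: inverse_eq_divide less_imp_le\<close>)
  then have w: "weak_conv_m \<mu>n \<mu>" by (rule levy_dist_tendsto_imp_weak_conv[OF rd])
  have "(\<lambda>n. LINT l|\<mu>n n. 1 / (l + t)) \<longlonglongrightarrow> (LINT l|\<mu>. 1 / (l + t))"
    by (rule weak_conv_resolvent_transform[OF \<mu> n(1) t w])
  from LIMSEQ_D[OF this e] n(3) show False by (metis less_imp_le order_refl real_norm_def)
qed

section \<open>Convergence in probability\<close>

text \<open>Only the dominating \<open>Z\<close> has to be measurable, and it may change with the
  slack \<open>e\<close>. This suits approximation arguments in which a coarser quantity is measured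
  at each precision.\<close>

lemma tends_to_0_in_probI_dominated:
  assumes M: "\<And>n. prob_space (M n)"
    and dom: "\<And>e. 0 < e \<Longrightarrow> \<exists>Z. (\<forall>n. Z n \<in> borel_measurable (M n)) \<and> tends_to_0_in_prob M Z \<and>
      eventually (\<lambda>n. \<forall>\<omega>\<in>space (M n). \<bar>Y n \<omega>\<bar> \<le> \<bar>Z n \<omega>\<bar> + e) sequentially"
  shows "tends_to_0_in_prob M Y"
  unfolding tends_to_0_in_prob_def
proof (intro allI impI)
  fix \<epsilon> :: real assume \<epsilon>: "0 < \<epsilon>"
  obtain Z where Z: "\<And>n. Z n \<in> borel_measurable (M n)" "tends_to_0_in_prob M Z"
    "eventually (\<lambda>n. \<forall>\<omega>\<in>space (M n). \<bar>Y n \<omega>\<bar> \<le> \<bar>Z n \<omega>\<bar> + \<epsilon> / 2) sequentially"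
    using dom[of "\<epsilon> / 2"] \<epsilon> by auto
  have lim: "(\<lambda>n. measure (M n) {\<omega> \<in> space (M n). \<epsilon> / 2 < \<bar>Z n \<omega>\<bar>}) \<longlonglongrightarrow> 0"
    using Z(2) \<epsilon> unfolding tends_to_0_in_prob_def by (meson half_gt_zero)
  show "(\<lambda>n. measure (M n) {\<omega> \<in> space (M n). \<epsilon> < \<bar>Y n \<omega>\<bar>}) \<longlonglongrightarrow> 0"
  proof (rule tendsto_sandwich[OF _ _ tendsto_const lim])
    show "eventually (\<lambda>n. measure (M n) {\<omega> \<in> space (M n). \<epsilon> < \<bar>Y n \<omega>\<bar>}
      \<le> measure (M n) {\<omega> \<in> space (M n). \<epsilon> / 2 < \<bar>Z n \<omega>\<bar>}) sequentially"
      using Z(3)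
    proof eventually_elim
      case (elim n)
      interpret prob_space "M n" by (rule M)
      note [measurable] = Z(1)[of n]
      have "{\<omega> \<in> space (M n). \<epsilon> / 2 < \<bar>Z n \<omega>\<bar>} \<in> sets (M n)" by measurable
      moreover have "{\<omega> \<in> space (M n). \<epsilon> < \<bar>Y n \<omega>\<bar>} \<subseteq> {\<omega> \<in> space (M n). \<epsilon> / 2 < \<bar>Z n \<omega>\<bar>}"
        using elim by fastforce
      ultimately show ?case by (intro finite_measure_mono)
    qed
  qed simp
qed

lemma tends_to_0_in_prob_mono:
  assumes M: "\<And>n. prob_space (M n)" and Z: "\<And>n. Z n \<in> borel_measurable (M n)" "tends_to_0_in_prob M Z"
    and le: "eventually (\<lambda>n. \<forall>\<omega>\<in>space (M n). \<bar>Y n \<omega>\<bar> \<le> \<bar>Z n \<omega>\<bar>) sequentially"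
  shows "tends_to_0_in_prob M Y"
proof (rule tends_to_0_in_probI_dominated[OF M])
  fix e :: real assume "0 < e"
  then have "eventually (\<lambda>n. \<forall>\<omega>\<in>space (M n). \<bar>Y n \<omega>\<bar> \<le> \<bar>Z n \<omega>\<bar> + e) sequentially"
    using le by (auto elim!: eventually_mono simp: add_increasing2)
  then show "\<exists>Z. (\<forall>n. Z n \<in> borel_measurable (M n)) \<and> tends_to_0_in_prob M Z \<and>
      eventually (\<lambda>n. \<forall>\<omega>\<in>space (M n). \<bar>Y n \<omega>\<bar> \<le> \<bar>Z n \<omega>\<bar> + e) sequentially"
    using Z by blast
qed

lemma tends_to_0_in_prob_add:
  assumes M: "\<And>n. prob_space (M n)"
    and Y: "\<And>n. Y n \<in> borel_measurable (M n)" "tends_to_0_in_prob M Y"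
    and Z: "\<And>n. Z n \<in> borel_measurable (M n)" "tends_to_0_in_prob M Z"
  shows "tends_to_0_in_prob M (\<lambda>n \<omega>. Y n \<omega> + Z n \<omega>)"
  unfolding tends_to_0_in_prob_def
proof (intro allI impI)
  fix \<epsilon> :: real assume \<epsilon>: "0 < \<epsilon>"
  let ?m = "\<lambda>Y n. measure (M n) {\<omega> \<in> space (M n). \<epsilon> / 2 < \<bar>Y n \<omega>\<bar>}"
  have "?m Y \<longlonglongrightarrow> 0" "?m Z \<longlonglongrightarrow> 0"
    using Y(2) Z(2) \<epsilon> unfolding tends_to_0_in_prob_def by (meson half_gt_zero)+
  then have lim: "(\<lambda>n. ?m Y n + ?m Z n) \<longlonglongrightarrow> 0" by (rule tendsto_add_zero)
  have le: "measure (M n) {\<omega> \<in> space (M n). \<epsilon> < \<bar>Y n \<omega> + Z n \<omega>\<bar>} \<le> ?m Y n + ?m Z n" for n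
  proof -
    interpret prob_space "M n" by (rule M)
    note [measurable] = Y(1)[of n] Z(1)[of n]
    have "measure (M n) {\<omega> \<in> space (M n). \<epsilon> < \<bar>Y n \<omega> + Z n \<omega>\<bar>}
      \<le> measure (M n) ({\<omega> \<in> space (M n). \<epsilon> / 2 < \<bar>Y n \<omega>\<bar>} \<union> {\<omega> \<in> space (M n). \<epsilon> / 2 < \<bar>Z n \<omega>\<bar>})"
      by (intro finite_measure_mono) auto
    also have "\<dots> \<le> ?m Y n + ?m Z n" by (intro measure_Un_le) auto
    finally show ?thesis .
  qed
  show "(\<lambda>n. measure (M n) {\<omega> \<in> space (M n). \<epsilon> < \<bar>Y n \<omega> + Z n \<omega>\<bar>}) \<longlonglongrightarrow> 0"
  proof (rule tendsto_sandwich[OF _ _ tendsto_const lim])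
    show "eventually (\<lambda>n. measure (M n) {\<omega> \<in> space (M n). \<epsilon> < \<bar>Y n \<omega> + Z n \<omega>\<bar>} \<le> ?m Y n + ?m Z n) sequentially"
      by (intro always_eventually allI le)
  qed simp
qed

lemma tends_to_0_in_prob_scale:
  assumes "tends_to_0_in_prob M Y"
  shows "tends_to_0_in_prob M (\<lambda>n \<omega>. c * Y n \<omega>)"
proof (cases "c = 0")
  case False
  show ?thesis unfolding tends_to_0_in_prob_def
  proof (intro allI impI)
    fix \<epsilon> :: real assume "0 < \<epsilon>"
    then have "0 < \<epsilon> / \<bar>c\<bar>" using False by simp
    moreover have "(\<epsilon> < \<bar>c * y\<bar>) = (\<epsilon> / \<bar>c\<bar> < \<bar>y\<bar>)" for y
      using False by (simp add: abs_mult field_simps)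
    ultimately show "(\<lambda>n. measure (M n) {\<omega> \<in> space (M n). \<epsilon> < \<bar>c * Y n \<omega>\<bar>}) \<longlonglongrightarrow> 0"
      using assms unfolding tends_to_0_in_prob_def by simp
  qed
qed (simp add: tends_to_0_in_prob_def)

lemma tends_to_0_in_prob_0 [simp]: "tends_to_0_in_prob M (\<lambda>n \<omega>. 0)"
  by (simp add: tends_to_0_in_prob_def)

lemma tends_to_0_in_prob_sum:
  assumes M: "\<And>n. prob_space (M n)" and "finite I"
    and Y: "\<And>i n. i \<in> I \<Longrightarrow> Y i n \<in> borel_measurable (M n)" "\<And>i. i \<in> I \<Longrightarrow> tends_to_0_in_prob M (Y i)"
  shows "tends_to_0_in_prob M (\<lambda>n \<omega>. \<Sum>i\<in>I. Y i n \<omega>)"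
  using assms(2) Y by (induction I rule: finite_induct) (auto intro!: tends_to_0_in_prob_add[OF M])

lemma tends_to_0_in_prob_L1:
  assumes M: "\<And>n. prob_space (M n)" and int: "\<And>n. integrable (M n) (Y n)"
    and lim: "(\<lambda>n. LINT \<omega>|M n. \<bar>Y n \<omega>\<bar>) \<longlonglongrightarrow> 0"
  shows "tends_to_0_in_prob M Y"
  unfolding tends_to_0_in_prob_def
proof (intro allI impI)
  fix \<epsilon> :: real assume \<epsilon>: "0 < \<epsilon>"
  have le: "measure (M n) {\<omega> \<in> space (M n). \<epsilon> < \<bar>Y n \<omega>\<bar>} \<le> (LINT \<omega>|M n. \<bar>Y n \<omega>\<bar>) / \<epsilon>" for n
  proof -
    interpret prob_space "M n" by (rule M)
    have [measurable]: "Y n \<in> borel_measurable (M n)" using int by auto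
    have "measure (M n) {\<omega> \<in> space (M n). \<epsilon> < \<bar>Y n \<omega>\<bar>} \<le> measure (M n) {\<omega> \<in> space (M n). \<epsilon> \<le> \<bar>Y n \<omega>\<bar>}"
      by (intro finite_measure_mono) auto
    also have "\<dots> \<le> (LINT \<omega>|M n. \<bar>Y n \<omega>\<bar>) / \<epsilon>"
      using int[of n] \<epsilon> by (intro integral_Markov_inequality_measure[where A="{}"]) auto
    finally show ?thesis .
  qed
  have lim': "(\<lambda>n. (LINT \<omega>|M n. \<bar>Y n \<omega>\<bar>) / \<epsilon>) \<longlonglongrightarrow> 0" using tendsto_divide_zero[OF lim] .
  show "(\<lambda>n. measure (M n) {\<omega> \<in> space (M n). \<epsilon> < \<bar>Y n \<omega>\<bar>}) \<longlonglongrightarrow> 0"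
    by (rule tendsto_sandwich[OF _ _ tendsto_const lim']) (auto simp: le)
qed

lemma tends_to_0_in_prob_cong_eventually:
  assumes "tends_to_0_in_prob M Y" "eventually (\<lambda>n. \<forall>\<omega>\<in>space (M n). Y n \<omega> = Z n \<omega>) sequentially"
  shows "tends_to_0_in_prob M Z"
  unfolding tends_to_0_in_prob_def
proof (intro allI impI)
  fix \<epsilon> :: real assume "0 < \<epsilon>"
  with assms(1) have "(\<lambda>n. measure (M n) {\<omega> \<in> space (M n). \<epsilon> < \<bar>Y n \<omega>\<bar>}) \<longlonglongrightarrow> 0" 
    by (simp add: tends_to_0_in_prob_def)
  then show "(\<lambda>n. measure (M n) {\<omega> \<in> space (M n). \<epsilon> < \<bar>Z n \<omega>\<bar>}) \<longlonglongrightarrow> 0"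
    by (rule Lim_transform_eventually)
       (use assms(2) in eventually_elim, metis (mono_tags, lifting) Collect_cong)
qed

text \<open>Measurability of a random law is encoded by its resolvent transforms alone, since these
  are rational functions of the samples. Integrals of continuous functions, distribution functions
  and the Levy distance inherit it through \<open>resolvent_class\<close>.\<close>

locale random_spectral_measure =
  fixes N :: "'a measure" and \<mu> :: "'a \<Rightarrow> real measure"
  assumes \<mu>: "\<And>\<omega>. \<omega> \<in> space N \<Longrightarrow> prob_on_nonneg (\<mu> \<omega>)"
    and resolvent_measurable: "\<And>t. 0 < t \<Longrightarrow> (\<lambda>\<omega>. LINT l|\<mu> \<omega>. 1 / (l + t)) \<in> borel_measurable N"
begin

definition T :: "(real \<Rightarrow> real) set" where
  "T = {g. g \<in> borel_measurable borel \<and> (\<exists>B. \<forall>l\<ge>0. \<bar>g l\<bar> \<le> B) \<and> (\<lambda>\<omega>. LINT l|\<mu> \<omega>. g l) \<in> borel_measurable N}"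

lemma T_integrable: "g \<in> T \<Longrightarrow> prob_on_nonneg \<rho> \<Longrightarrow> integrable \<rho> g"
  using prob_on_nonneg_integrable[where g=g and \<mu>=\<rho>, unfolded real_norm_def] unfolding T_def by blast

lemma uniform_limit_bounded:
  assumes h: "\<exists>B. \<forall>l\<ge>0. \<bar>h l\<bar> \<le> B" "\<forall>l\<ge>0. \<bar>h l - g l\<bar> \<le> (1::real)"
  shows "\<exists>B. \<forall>l\<ge>0. \<bar>g l\<bar> \<le> (B::real)"
proof -
  obtain B where B: "\<forall>l\<ge>0. \<bar>h l\<bar> \<le> B" using h by auto
  have "\<bar>g l\<bar> \<le> B + 1" if "0 \<le> l" for l
    using B[rule_format, OF that] h(2)[rule_format, OF that] by linarith
  then show ?thesis by blast
qed

sublocale T: resolvent_class T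
proof
  show "(\<lambda>l. c) \<in> T" for c
  proof -
    have "(\<lambda>\<omega>. LINT l|\<mu> \<omega>. c) \<in> borel_measurable N"
      by (rule measurable_cong[THEN iffD2, OF _ borel_measurable_const[of c]])
         (use \<mu> in \<open>auto simp: prob_on_nonneg_def real_distribution_def prob_space.prob_space\<close>)
    then show ?thesis by (auto simp: T_def)
  qed
  show "(\<lambda>l. f l + g l) \<in> T" if f: "f \<in> T" and g: "g \<in> T" for f g
  proof -
    have "(\<lambda>\<omega>. LINT l|\<mu> \<omega>. f l + g l) \<in> borel_measurable N"
    proof (rule measurable_cong[THEN iffD2])
      show "(LINT l|\<mu> \<omega>. f l + g l) = (LINT l|\<mu> \<omega>. f l) + (LINT l|\<mu> \<omega>. g l)" if w: "\<omega> \<in> space N" for \<omega>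
        using T_integrable[OF f \<mu>[OF w]] T_integrable[OF g \<mu>[OF w]] by simp
      show "(\<lambda>\<omega>. (LINT l|\<mu> \<omega>. f l) + (LINT l|\<mu> \<omega>. g l)) \<in> borel_measurable N"
        by (rule borel_measurable_add) (use f g in \<open>auto simp: T_def\<close>)
    qed
    moreover obtain A B where "\<forall>l\<ge>0. \<bar>f l\<bar> \<le> A" "\<forall>l\<ge>0. \<bar>g l\<bar> \<le> B" using f g by (auto simp: T_def)
    then have "\<forall>l\<ge>0. \<bar>f l + g l\<bar> \<le> A + B" by (auto intro: order_trans[OF abs_triangle_ineq] add_mono)
    ultimately show ?thesis using f g by (auto simp: T_def)
  qed
  show "(\<lambda>l. c * f l) \<in> T" if f: "f \<in> T" for f c
  proof -
    obtain A where "\<forall>l\<ge>0. \<bar>f l\<bar> \<le> A" using f by (auto simp: T_def)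
    then have "\<forall>l\<ge>0. \<bar>c * f l\<bar> \<le> \<bar>c\<bar> * A" by (auto simp: abs_mult intro: mult_left_mono)
    then show ?thesis using f by (auto simp: T_def)
  qed
  show "(\<lambda>l. 1 / (l + t)) \<in> T" if t: "0 < t" for t
  proof -
    have "\<bar>1 / (l + t)\<bar> \<le> 1 / t" if "0 \<le> l" for l using that t by (simp add: frac_le)
    moreover have "(\<lambda>l. 1 / (l + t)) \<in> borel_measurable borel" by measurable
    moreover note resolvent_measurable[OF t]
    ultimately show ?thesis unfolding T_def mem_Collect_eq
      by (intro conjI exI[of _ "1 / t"] allI impI)
  qed
  fix g :: "real \<Rightarrow> real" assume g: "g \<in> borel_measurable borel" and ap: "\<And>e. 0 < e \<Longrightarrow> \<exists>h\<in>T. \<forall>l\<ge>0. \<bar>h l - g l\<bar> \<le> e"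
  obtain h1 where "h1 \<in> T" "\<forall>l\<ge>0. \<bar>h1 l - g l\<bar> \<le> 1" using ap[of 1] by auto
  then have bd: "\<exists>B. \<forall>l\<ge>0. \<bar>g l\<bar> \<le> B" using uniform_limit_bounded[of h1 g] unfolding T_def by blast
  then have gi: "integrable \<rho> g" if "prob_on_nonneg \<rho>" for \<rho>
    using bd prob_on_nonneg_integrable[OF that g, unfolded real_norm_def] by blast
  have "\<forall>k. \<exists>h\<in>T. \<forall>l\<ge>0. \<bar>h l - g l\<bar> \<le> inverse (real (Suc k))" using ap by simp
  then obtain h where h: "\<And>k. h k \<in> T" "\<And>k l. 0 \<le> l \<Longrightarrow> \<bar>h k l - g l\<bar> \<le> inverse (real (Suc k))" by metis
  have "(\<lambda>\<omega>. LINT l|\<mu> \<omega>. g l) \<in> borel_measurable N"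
  proof (rule borel_measurable_LIMSEQ_real)
    show "(\<lambda>\<omega>. LINT l|\<mu> \<omega>. h k l) \<in> borel_measurable N" for k using h by (auto simp: T_def)
    fix \<omega> assume w: "\<omega> \<in> space N"
    have "norm ((LINT l|\<mu> \<omega>. h k l) - (LINT l|\<mu> \<omega>. g l)) \<le> inverse (real (Suc k))" for k
      using prob_on_nonneg_integral_diff[OF \<mu>[OF w] T_integrable[OF h(1) \<mu>[OF w]] gi[OF \<mu>[OF w]] h(2)] by simp
    then have "(\<lambda>k. (LINT l|\<mu> \<omega>. h k l) - (LINT l|\<mu> \<omega>. g l)) \<longlonglongrightarrow> 0"
      by (intro Lim_null_comparison[OF _ LIMSEQ_inverse_real_of_nat] always_eventually allI)
    then show "(\<lambda>k. LINT l|\<mu> \<omega>. h k l) \<longlonglongrightarrow> (LINT l|\<mu> \<omega>. g l)" by (simp add: LIM_zero_iff)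
  qed
  then show "g \<in> T" using g bd by (auto simp: T_def)
qed

lemma integral_measurable:
  fixes g :: "real \<Rightarrow> real"
  assumes "g \<in> borel_measurable borel" "continuous_on {0..} g" "(g \<longlongrightarrow> L) at_top"
  shows "(\<lambda>\<omega>. LINT l|\<mu> \<omega>. g l) \<in> borel_measurable N"
  using T.continuous_in[OF assms] by (simp add: T_def)

lemma cdf_measurable: "(\<lambda>\<omega>. cdf (\<mu> \<omega>) s) \<in> borel_measurable N"
proof (rule borel_measurable_LIMSEQ_real)
  have pos: "s < s + inverse (real (Suc k))" for k by simp
  show "(\<lambda>\<omega>. LINT l|\<mu> \<omega>. cts_step s (s + inverse (real (Suc k))) l) \<in> borel_measurable N" for k
    using T.cts_step_in[OF pos] by (simp add: T_def)
  fix \<omega> assume w: "\<omega> \<in> space N"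
  interpret real_distribution "\<mu> \<omega>" using \<mu>[OF w] by (simp add: prob_on_nonneg_def)
  have "filterlim (\<lambda>k. s + inverse (real (Suc k))) (at_right s) sequentially"
    unfolding filterlim_at using LIMSEQ_inverse_real_of_nat_add[of s] by (auto simp: always_eventually)
  then have lim: "(\<lambda>k. cdf (\<mu> \<omega>) (s + inverse (real (Suc k)))) \<longlonglongrightarrow> cdf (\<mu> \<omega>) s"
    by (rule filterlim_compose[OF cdf_is_right_cont[unfolded continuous_within]])
  show "(\<lambda>k. LINT l|\<mu> \<omega>. cts_step s (s + inverse (real (Suc k))) l) \<longlonglongrightarrow> cdf (\<mu> \<omega>) s"
    by (rule tendsto_sandwich[OF _ _ tendsto_const lim]) (use cdf_cts_step[OF pos] in auto)
qed

text \<open>Right-continuity reduces the condition to rational points, so that the event for the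
  random law is a countable intersection.\<close>

lemma levy_close_rat:
  assumes "real_distribution \<rho>" "real_distribution \<rho>'" "0 < r"
  shows "levy_close \<rho>' \<rho> r \<longleftrightarrow> (\<forall>q::rat. cdf \<rho>' (of_rat q - r) - r \<le> cdf \<rho> (of_rat q) \<and> cdf \<rho> (of_rat q) \<le> cdf \<rho>' (of_rat q + r) + r)"
    (is "_ \<longleftrightarrow> ?R")
proof
  assume ?R
  interpret A: real_distribution \<rho> by fact
  interpret B: real_distribution \<rho>' by fact
  show "levy_close \<rho>' \<rho> r" unfolding levy_close_def
  proof (intro conjI allI)
    fix t :: real
    have "\<exists>q::rat. t < of_rat q \<and> of_rat q < t + inverse (real (Suc k))" for k
      by (rule of_rat_dense) simp
    then obtain q :: "nat \<Rightarrow> rat" where q: "\<And>k. t < of_rat (q k)" "\<And>k. of_rat (q k) < t + inverse (real (Suc k))" by metis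
    have q0: "(\<lambda>k. of_rat (q k)) \<longlonglongrightarrow> t"
      by (rule tendsto_sandwich[OF _ _ tendsto_const LIMSEQ_inverse_real_of_nat_add]) (use q(1)[THEN less_imp_le] q(2)[THEN less_imp_le] in auto)
    have qn: "of_rat (q k) \<noteq> t" for k using q(1)[of k] by simp
    have lim: "(\<lambda>k. cdf \<rho>'' (of_rat (q k) + a)) \<longlonglongrightarrow> cdf \<rho>'' (t + a)" if "real_distribution \<rho>''" for \<rho>'' a
    proof -
      interpret C: real_distribution \<rho>'' by fact
      have "filterlim (\<lambda>k. of_rat (q k) + a) (at_right (t + a)) sequentially"
        unfolding filterlim_at using tendsto_add[OF q0 tendsto_const[of a]] q qn by (auto simp: always_eventually)
      then show ?thesis by (rule filterlim_compose[OF C.cdf_is_right_cont[unfolded continuous_within]])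
    qed
    have l0: "(\<lambda>k. cdf \<rho> (of_rat (q k))) \<longlonglongrightarrow> cdf \<rho> t" using lim[OF assms(1), of 0] by simp
    have l1: "(\<lambda>k. cdf \<rho>' (of_rat (q k) - r) - r) \<longlonglongrightarrow> cdf \<rho>' (t - r) - r" 
      using tendsto_diff[OF lim[OF assms(2), of "-r"] tendsto_const[of r]] by simp
    have l2: "(\<lambda>k. cdf \<rho>' (of_rat (q k) + r) + r) \<longlonglongrightarrow> cdf \<rho>' (t + r) + r" 
      by (rule tendsto_add[OF lim[OF assms(2)] tendsto_const])
    show "cdf \<rho>' (t - r) - r \<le> cdf \<rho> t" by (rule LIMSEQ_le[OF l1 l0]) (use \<open>?R\<close> in auto)
    show "cdf \<rho> t \<le> cdf \<rho>' (t + r) + r" by (rule LIMSEQ_le[OF l0 l2]) (use \<open>?R\<close> in auto)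
  qed fact
qed (simp add: levy_close_def)

lemma levy_dist_measurable:
  assumes \<rho>: "real_distribution \<rho>"
  shows "(\<lambda>\<omega>. levy_dist (\<mu> \<omega>) \<rho>) \<in> borel_measurable N"
proof (rule borel_measurableI_less)
  fix \<delta> :: real
  note [measurable] = cdf_measurable
  have eq: "{\<omega> \<in> space N. levy_dist (\<mu> \<omega>) \<rho> < \<delta>} = {\<omega> \<in> space N. \<exists>e::rat. 0 < real_of_rat e \<and> of_rat e < \<delta> \<and>
    (\<forall>q::rat. cdf (\<mu> \<omega>) (of_rat q - of_rat e) - of_rat e \<le> cdf \<rho> (of_rat q) \<and> cdf \<rho> (of_rat q) \<le> cdf (\<mu> \<omega>) (of_rat q + of_rat e) + of_rat e)}"
  proof -
    have "levy_dist (\<mu> \<omega>) \<rho> < \<delta> \<longleftrightarrow> (\<exists>e::rat. 0 < real_of_rat e \<and> of_rat e < \<delta> \<and> 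
      (\<forall>q::rat. cdf (\<mu> \<omega>) (of_rat q - of_rat e) - of_rat e \<le> cdf \<rho> (of_rat q) \<and> cdf \<rho> (of_rat q) \<le> cdf (\<mu> \<omega>) (of_rat q + of_rat e) + of_rat e))" 
      if w: "\<omega> \<in> space N" for \<omega>
    proof -
      have rd: "real_distribution (\<mu> \<omega>)" using \<mu>[OF w] by (simp add: prob_on_nonneg_def)
      have "levy_dist (\<mu> \<omega>) \<rho> < \<delta> \<longleftrightarrow> (\<exists>e::rat. 0 < real_of_rat e \<and> of_rat e < \<delta> \<and> levy_close (\<mu> \<omega>) \<rho> (of_rat e))"
        unfolding levy_dist_less_iff[OF rd \<rho>]
      proof (safe, goal_cases)
        case (1 \<epsilon>)
        obtain e :: rat where "\<epsilon> < of_rat e" "of_rat e < \<delta>" using of_rat_dense[OF 1(1)] by auto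
        then show ?case using levy_close_mono[OF rd \<rho> 1(2), of "of_rat e"] 1 by (intro exI[of _ e]) (auto simp: levy_close_def)
      qed auto
      then show ?thesis using levy_close_rat[OF \<rho> rd] by auto
    qed
    then show ?thesis by blast
  qed
  show "{\<omega> \<in> space N. levy_dist (\<mu> \<omega>) \<rho> < \<delta>} \<in> sets N" unfolding eq by measurable
qed

end

text \<open>The test functions whose integrals converge in probability form a
  \<open>resolvent_class\<close>. It contains the ramps, and finitely many of these control the Levy
  distance.\<close>

lemma levy_dist_tends_to_0_in_prob:
  fixes \<mu> :: "nat \<Rightarrow> 'a \<Rightarrow> real measure"
  assumes M: "\<And>n. prob_space (M n)" and rsm: "\<And>n. random_spectral_measure (M n) (\<mu> n)"
    and \<rho>: "prob_on_nonneg \<rho>"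
    and lim: "\<And>t. 0 < t \<Longrightarrow> tends_to_0_in_prob M (\<lambda>n \<omega>. (LINT l|\<mu> n \<omega>. 1 / (l + t)) - (LINT l|\<rho>. 1 / (l + t)))"
  shows "tends_to_0_in_prob M (\<lambda>n \<omega>. levy_dist (\<mu> n \<omega>) \<rho>)"
proof -
  interpret S: random_spectral_measure "M n" "\<mu> n" for n by (rule rsm)
  interpret R: real_distribution \<rho> using \<rho> by (simp add: prob_on_nonneg_def)
  define T where "T = {g. (\<forall>n. g \<in> S.T n) \<and> tends_to_0_in_prob M (\<lambda>n \<omega>. (LINT l|\<mu> n \<omega>. g l) - (LINT l|\<rho>. g l))}"
  have gT: "g \<in> S.T n" "integrable \<rho> g" "\<omega> \<in> space (M n) \<Longrightarrow> integrable (\<mu> n \<omega>) g" 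
    "(\<lambda>\<omega>. (LINT l|\<mu> n \<omega>. g l) - (LINT l|\<rho>. g l)) \<in> borel_measurable (M n)" if "g \<in> T" for g n \<omega>
  proof -
    show t: "g \<in> S.T n" using that by (simp add: T_def)
    show "integrable \<rho> g" "\<omega> \<in> space (M n) \<Longrightarrow> integrable (\<mu> n \<omega>) g" using S.T_integrable[OF t] \<rho> S.\<mu> by auto
    show "(\<lambda>\<omega>. (LINT l|\<mu> n \<omega>. g l) - (LINT l|\<rho>. g l)) \<in> borel_measurable (M n)"
    proof -
      have "(\<lambda>\<omega>. LINT l|\<mu> n \<omega>. g l) \<in> borel_measurable (M n)" using t by (simp add: S.T_def)
      then show ?thesis by (rule borel_measurable_diff) simp
    qed
  qed
  interpret T: resolvent_class T
  proof
    show "(\<lambda>l. c) \<in> T" for c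
    proof -
      have "tends_to_0_in_prob M (\<lambda>n \<omega>. (LINT l|\<mu> n \<omega>. c) - (LINT l|\<rho>. c))"
        by (rule tends_to_0_in_prob_cong_eventually[OF tends_to_0_in_prob_0])
           (use S.\<mu> R.prob_space in \<open>auto simp: prob_on_nonneg_def real_distribution_def prob_space.prob_space\<close>)
      then show ?thesis using S.T.const by (auto simp: T_def)
    qed
    show "(\<lambda>l. f l + g l) \<in> T" if f: "f \<in> T" and g: "g \<in> T" for f g
    proof -
      have "tends_to_0_in_prob M (\<lambda>n \<omega>. (LINT l|\<mu> n \<omega>. f l + g l) - (LINT l|\<rho>. f l + g l))"
        by (rule tends_to_0_in_prob_cong_eventually[OF tends_to_0_in_prob_add[OF M gT(4)[OF f] _ gT(4)[OF g]]])
           (use f g gT(2,3)[OF f] gT(2,3)[OF g] in \<open>auto simp: T_def\<close>)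
      then show ?thesis using S.T.add f g by (auto simp: T_def)
    qed
    show "(\<lambda>l. c * f l) \<in> T" if f: "f \<in> T" for f c
    proof -
      have "tends_to_0_in_prob M (\<lambda>n \<omega>. (LINT l|\<mu> n \<omega>. c * f l) - (LINT l|\<rho>. c * f l))"
        by (rule tends_to_0_in_prob_cong_eventually[OF tends_to_0_in_prob_scale[of M _ c]])
           (use f in \<open>auto simp: T_def right_diff_distrib\<close>)
      then show ?thesis using S.T.scale f by (auto simp: T_def)
    qed
    show "(\<lambda>l. 1 / (l + t)) \<in> T" if t: "0 < t" for t
      using lim[OF t] S.T.resolvent_in[OF t] by (auto simp: T_def)
    fix g :: "real \<Rightarrow> real" assume g: "g \<in> borel_measurable borel" and ap: "\<And>e. 0 < e \<Longrightarrow> \<exists>h\<in>T. \<forall>l\<ge>0. \<bar>h l - g l\<bar> \<le> e"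
    have gS: "g \<in> S.T n" for n
    proof (rule S.T.uniform[OF g])
      fix e :: real assume "0 < e"
      then obtain h where "h \<in> T" "\<forall>l\<ge>0. \<bar>h l - g l\<bar> \<le> e" using ap by blast
      then show "\<exists>h\<in>S.T n. \<forall>l\<ge>0. \<bar>h l - g l\<bar> \<le> e" using gT(1) by blast
    qed
    have "tends_to_0_in_prob M (\<lambda>n \<omega>. (LINT l|\<mu> n \<omega>. g l) - (LINT l|\<rho>. g l))"
    proof (rule tends_to_0_in_probI_dominated[OF M])
      fix e :: real assume e: "0 < e"
      obtain h where h: "h \<in> T" "\<And>l. 0 \<le> l \<Longrightarrow> \<bar>h l - g l\<bar> \<le> e / 2" using ap[of "e/2"] e by auto
      have "\<bar>(LINT l|\<mu> n \<omega>. g l) - (LINT l|\<rho>. g l)\<bar> \<le> \<bar>(LINT l|\<mu> n \<omega>. h l) - (LINT l|\<rho>. h l)\<bar> + e" if w: "\<omega> \<in> space (M n)" for n \<omega>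
      proof -
        have "\<bar>(LINT l|\<mu> n \<omega>. h l) - (LINT l|\<mu> n \<omega>. g l)\<bar> \<le> e / 2"
          by (rule prob_on_nonneg_integral_diff[OF S.\<mu>[OF w] gT(3)[OF h(1) w] S.T_integrable[OF gS S.\<mu>[OF w]] h(2)])
        moreover have "\<bar>(LINT l|\<rho>. h l) - (LINT l|\<rho>. g l)\<bar> \<le> e / 2"
          by (rule prob_on_nonneg_integral_diff[OF \<rho> gT(2)[OF h(1)] S.T_integrable[OF gS \<rho>] h(2)])
        ultimately show ?thesis by linarith
      qed
      then show "\<exists>Z. (\<forall>n. Z n \<in> borel_measurable (M n)) \<and> tends_to_0_in_prob M Z \<and>
        eventually (\<lambda>n. \<forall>\<omega>\<in>space (M n). \<bar>(LINT l|\<mu> n \<omega>. g l) - (LINT l|\<rho>. g l)\<bar> \<le> \<bar>Z n \<omega>\<bar> + e) sequentially"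
        using gT(4)[OF h(1)] h(1) by (intro exI[of _ "\<lambda>n \<omega>. (LINT l|\<mu> n \<omega>. h l) - (LINT l|\<rho>. h l)"]) (auto simp: T_def)
    qed
    then show "g \<in> T" using gS by (simp add: T_def)
  qed
  show ?thesis
  proof (rule tends_to_0_in_probI_dominated[OF M])
    fix e :: real assume e: "0 < e"
    define h where "h = min 1 e / 2"
    have h: "0 < h" "2 * h \<le> e" using e by (auto simp: h_def)
    obtain G where G: "finite G" "\<And>a b. (a, b) \<in> G \<Longrightarrow> a < b"
      "\<And>\<mu>'. prob_on_nonneg \<mu>' \<Longrightarrow>
       (\<And>a b. (a, b) \<in> G \<Longrightarrow> \<bar>(LINT l|\<mu>'. cts_step a b l) - (LINT l|\<rho>. cts_step a b l)\<bar> \<le> h) \<Longrightarrow>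
       levy_close \<mu>' \<rho> (2 * h)"
      using levy_close_finite_test[OF \<rho> h(1)] by metis
    let ?D = "\<lambda>p n \<omega>. (LINT l|\<mu> n \<omega>. cts_step (fst p) (snd p) l) - (LINT l|\<rho>. cts_step (fst p) (snd p) l)"
    \<comment> \<open>Where some ramp integral is off by more than \<open>h\<close>,
      \<open>Z\<close> is at least 1 and dominates the trivial bound 1 on the distance. Elsewhere
      the distance is at most \<open>2 * h\<close>.\<close>
    define Z where "Z n \<omega> = (\<Sum>p\<in>G. (1 / h) * \<bar>?D p n \<omega>\<bar>)" for n \<omega>
    have cT: "cts_step (fst p) (snd p) \<in> T" if "p \<in> G" for p using G(2)[of "fst p" "snd p"] that T.cts_step_in by simp
    have Dm: "(\<lambda>\<omega>. (1 / h) * \<bar>?D p n \<omega>\<bar>) \<in> borel_measurable (M n)" if "p \<in> G" for p n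
      using gT(4)[OF cT[OF that]] by measurable
    have "tends_to_0_in_prob M Z" unfolding Z_def
    proof (rule tends_to_0_in_prob_sum[OF M G(1) Dm])
      fix p assume "p \<in> G"
      then have "tends_to_0_in_prob M (?D p)" using cT by (simp add: T_def)
      then have "tends_to_0_in_prob M (\<lambda>n \<omega>. \<bar>?D p n \<omega>\<bar>)" by (simp add: tends_to_0_in_prob_def)
      then show "tends_to_0_in_prob M (\<lambda>n \<omega>. (1 / h) * \<bar>?D p n \<omega>\<bar>)" by (rule tends_to_0_in_prob_scale)
    qed
    moreover have "Z n \<in> borel_measurable (M n)" for n unfolding Z_def by (rule borel_measurable_sum) (rule Dm)
    moreover have "\<bar>levy_dist (\<mu> n \<omega>) \<rho>\<bar> \<le> \<bar>Z n \<omega>\<bar> + e" if w: "\<omega> \<in> space (M n)" for n \<omega>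
    proof -
      have rd: "real_distribution (\<mu> n \<omega>)" using S.\<mu>[OF w] by (simp add: prob_on_nonneg_def)
      have Z0: "0 \<le> Z n \<omega>" using h by (simp add: Z_def sum_nonneg)
      have l0: "0 \<le> levy_dist (\<mu> n \<omega>) \<rho>" by (rule levy_dist_nonneg[OF rd R.real_distribution_axioms])
      show ?thesis
      proof (cases "\<forall>p\<in>G. \<bar>?D p n \<omega>\<bar> \<le> h")
        case True
        then have "levy_close (\<mu> n \<omega>) \<rho> (2 * h)" by (intro G(3) S.\<mu>[OF w]) auto
        then show ?thesis using levy_dist_le[of "\<mu> n \<omega>" \<rho> "2 * h"] h l0 Z0 by simp
      next
        case False
        then obtain p where p: "p \<in> G" "h < \<bar>?D p n \<omega>\<bar>" by auto
        have "1 \<le> (1 / h) * \<bar>?D p n \<omega>\<bar>" using p h by (simp add: field_simps)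
        also have "\<dots> \<le> Z n \<omega>" unfolding Z_def using h by (intro member_le_sum[OF p(1)] G) auto
        finally show ?thesis using levy_dist_le[OF levy_close_one[OF rd R.real_distribution_axioms]] l0 e by simp
      qed
    qed
    ultimately show "\<exists>Z. (\<forall>n. Z n \<in> borel_measurable (M n)) \<and> tends_to_0_in_prob M Z \<and>
      eventually (\<lambda>n. \<forall>\<omega>\<in>space (M n). \<bar>levy_dist (\<mu> n \<omega>) \<rho>\<bar> \<le> \<bar>Z n \<omega>\<bar> + e) sequentially"
      by (intro exI[of _ Z]) auto
  qed
qed

section \<open>The limit law\<close>

text \<open>This is the Stieltjes transform at \<open>-\<zeta>\<close>. With this sign the domain is
  the plane cut along the nonpositive reals, and the real arguments in use are positive.\<close>

definition resolvent_transform :: "real measure \<Rightarrow> complex \<Rightarrow> complex" where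
  "resolvent_transform \<mu> \<zeta> = (LINT l|\<mu>. 1 / (complex_of_real l + \<zeta>))"

lemma slit_plane_dist:
  assumes "\<zeta> \<notin> \<real>\<^sub>\<le>\<^sub>0"
  obtains \<delta> where "0 < \<delta>" "\<And>l. 0 \<le> l \<Longrightarrow> \<delta> \<le> cmod (complex_of_real l + \<zeta>)"
proof -
  obtain \<delta> where d: "0 < \<delta>" "\<And>x. x \<in> \<real>\<^sub>\<le>\<^sub>0 \<Longrightarrow> \<delta> \<le> dist \<zeta> x"
    using separate_point_closed[OF closed_nonpos_Reals_complex assms] by blast
  have "\<delta> \<le> cmod (complex_of_real l + \<zeta>)" if "0 \<le> l" for l
    using d(2)[of "- complex_of_real l"] that by (simp add: dist_norm add.commute complex_nonpos_Reals_iff)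
  then show ?thesis using d that by blast
qed

lemma resolvent_transform_integrable:
  assumes \<mu>: "prob_on_nonneg \<mu>" and \<zeta>: "\<zeta> \<notin> \<real>\<^sub>\<le>\<^sub>0"
  shows "integrable \<mu> (\<lambda>l. 1 / (complex_of_real l + \<zeta>))"
proof -
  obtain \<delta> where d: "0 < \<delta>" "\<And>l. 0 \<le> l \<Longrightarrow> \<delta> \<le> cmod (complex_of_real l + \<zeta>)" using slit_plane_dist[OF \<zeta>] by blast
  show ?thesis by (rule prob_on_nonneg_integrable[OF \<mu>, of _ "1/\<delta>"]) (use d in \<open>auto simp: norm_divide intro!: frac_le\<close>)
qed

lemma prob_on_nonneg_norm_integral_le:
  fixes g :: "real \<Rightarrow> complex"
  assumes \<mu>: "prob_on_nonneg \<mu>" and g: "g \<in> borel_measurable borel" "\<And>l. 0 \<le> l \<Longrightarrow> cmod (g l) \<le> B"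
  shows "cmod (LINT l|\<mu>. g l) \<le> B"
proof -
  interpret real_distribution \<mu> using \<mu> by (simp add: prob_on_nonneg_def)
  have i: "integrable \<mu> g" by (rule prob_on_nonneg_integrable[OF \<mu> g])
  have "cmod (LINT l|\<mu>. g l) \<le> (LINT l|\<mu>. cmod (g l))" by (rule integral_norm_bound)
  also have "\<dots> \<le> (LINT l|\<mu>. B)"
    using i prob_on_nonneg_AE[OF \<mu>] g(2) by (intro integral_mono_AE) auto
  finally show ?thesis using prob_space by simp
qed

text \<open>With \<open>a = l + w\<close> and \<open>b = l + \<zeta>\<close>, the difference
  quotient of the integrand misses its derivative by \<open>(a - b) / (a * b\<^sup>2)\<close>. Both
  denominators are bounded below uniformly in \<open>l\<close>, so the derivative passes under the
  integral.\<close>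

lemma resolvent_transform_holomorphic:
  assumes \<mu>: "prob_on_nonneg \<mu>"
  shows "resolvent_transform \<mu> holomorphic_on (- \<real>\<^sub>\<le>\<^sub>0)"
proof -
  have "\<exists>D. (resolvent_transform \<mu> has_field_derivative D) (at \<zeta>)" if z: "\<zeta> \<notin> \<real>\<^sub>\<le>\<^sub>0" for \<zeta>
  proof -
    obtain \<delta> where d: "0 < \<delta>" "\<And>l. 0 \<le> l \<Longrightarrow> \<delta> \<le> cmod (complex_of_real l + \<zeta>)" using slit_plane_dist[OF z] by blast
    define D where "D = (LINT l|\<mu>. - 1 / (complex_of_real l + \<zeta>)\<^sup>2)"
    have est: "cmod ((resolvent_transform \<mu> w - resolvent_transform \<mu> \<zeta>) / (w - \<zeta>) - D) \<le> cmod (w - \<zeta>) * (2 / \<delta> ^ 3)"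
      if w: "w \<noteq> \<zeta>" "cmod (w - \<zeta>) < \<delta> / 2" for w
    proof -
      have dw: "\<delta> / 2 \<le> cmod (complex_of_real l + w)" if "0 \<le> l" for l
      proof -
        have "cmod (complex_of_real l + \<zeta>) \<le> cmod (complex_of_real l + w) + cmod (w - \<zeta>)"
          using norm_triangle_ineq[of "complex_of_real l + w" "\<zeta> - w"] by (simp add: norm_minus_commute)
        then show ?thesis using d(2)[OF that] w by linarith
      qed
      have wz: "w \<notin> \<real>\<^sub>\<le>\<^sub>0"
      proof
        assume "w \<in> \<real>\<^sub>\<le>\<^sub>0"
        then obtain r where "w = complex_of_real r" "r \<le> 0" by (auto simp: nonpos_Reals_def)
        then show False using dw[of "-r"] d by simp
      qed
      have i1: "integrable \<mu> (\<lambda>l. 1 / (complex_of_real l + w))" "integrable \<mu> (\<lambda>l. 1 / (complex_of_real l + \<zeta>))"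
        by (intro resolvent_transform_integrable[OF \<mu>] wz z)+
      have i2: "integrable \<mu> (\<lambda>l. - 1 / (complex_of_real l + \<zeta>)\<^sup>2)"
        by (rule prob_on_nonneg_integrable[OF \<mu>, of _ "1/\<delta>\<^sup>2"])
           (use d in \<open>auto simp: norm_divide norm_power intro!: frac_le power_mono\<close>)
      have "(resolvent_transform \<mu> w - resolvent_transform \<mu> \<zeta>) / (w - \<zeta>) - D
        = (LINT l|\<mu>. (1 / (complex_of_real l + w) - 1 / (complex_of_real l + \<zeta>)) / (w - \<zeta>) - (- 1 / (complex_of_real l + \<zeta>)\<^sup>2))"
        unfolding resolvent_transform_def D_def using i1 i2 by simp
      also have "cmod \<dots> \<le> cmod (w - \<zeta>) * (2 / \<delta> ^ 3)"
      proof (rule prob_on_nonneg_norm_integral_le[OF \<mu>])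
        fix l :: real assume l: "0 \<le> l"
        define a where "a = complex_of_real l + w"
        define b where "b = complex_of_real l + \<zeta>"
        have ab: "\<delta> / 2 \<le> cmod a" "\<delta> \<le> cmod b" "a - b = w - \<zeta>" using dw[OF l] d(2)[OF l] by (auto simp: a_def b_def)
        then have nz: "a \<noteq> 0" "b \<noteq> 0" "a - b \<noteq> 0" using d(1) w by auto
        have "(1 / a - 1 / b) / (a - b) = - 1 / (a * b)" using nz by (simp add: divide_simps)
        then have "(1 / a - 1 / b) / (a - b) - (- 1 / b\<^sup>2) = 1 / b\<^sup>2 - 1 / (a * b)" by simp
        also have "\<dots> = (a - b) / (a * b\<^sup>2)" using nz by (simp add: divide_simps power2_eq_square algebra_simps)
        finally have "cmod ((1 / a - 1 / b) / (w - \<zeta>) - (- 1 / b\<^sup>2)) = cmod (w - \<zeta>) * (1 / (cmod a * (cmod b)\<^sup>2))"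
          using ab(3) by (simp add: norm_divide norm_mult norm_power)
        also have "\<dots> \<le> cmod (w - \<zeta>) * (1 / (\<delta> / 2 * \<delta>\<^sup>2))"
          using ab d by (intro mult_left_mono frac_le mult_mono power_mono) auto
        also have "1 / (\<delta> / 2 * \<delta>\<^sup>2) = 2 / \<delta> ^ 3" by (simp add: power2_eq_square power3_eq_cube)
        finally show "cmod ((1 / (complex_of_real l + w) - 1 / (complex_of_real l + \<zeta>)) / (w - \<zeta>) - (- 1 / (complex_of_real l + \<zeta>)\<^sup>2))
          \<le> cmod (w - \<zeta>) * (2 / \<delta> ^ 3)" by (simp add: a_def b_def)
      qed simp
      finally show ?thesis .
    qed
    have "((\<lambda>w. (resolvent_transform \<mu> w - resolvent_transform \<mu> \<zeta>) / (w - \<zeta>) - D) \<longlongrightarrow> 0) (at \<zeta>)"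
    proof (rule Lim_null_comparison)
      show "eventually (\<lambda>w. cmod ((resolvent_transform \<mu> w - resolvent_transform \<mu> \<zeta>) / (w - \<zeta>) - D) \<le> cmod (w - \<zeta>) * (2 / \<delta> ^ 3)) (at \<zeta>)"
        unfolding eventually_at using est d by (intro exI[of _ "\<delta>/2"]) (auto simp: dist_norm)
      have "((\<lambda>w. cmod (w - \<zeta>) * (2 / \<delta> ^ 3)) \<longlongrightarrow> cmod (\<zeta> - \<zeta>) * (2 / \<delta> ^ 3)) (at \<zeta>)"
        by (intro tendsto_intros)
      then show "((\<lambda>w. cmod (w - \<zeta>) * (2 / \<delta> ^ 3)) \<longlongrightarrow> 0) (at \<zeta>)" by simp
    qed
    then have "(resolvent_transform \<mu> has_field_derivative D) (at \<zeta>)"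
      unfolding has_field_derivative_iff by (simp add: LIM_zero_iff)
    then show ?thesis by blast
  qed
  then show ?thesis
    by (subst holomorphic_on_open) auto
qed

lemma Im_resolvent_transform:
  assumes \<mu>: "prob_on_nonneg \<mu>" and \<zeta>: "Im \<zeta> \<noteq> 0"
  shows "Im (resolvent_transform \<mu> \<zeta>) * Im \<zeta> < 0"
proof -
  interpret real_distribution \<mu> using \<mu> by (simp add: prob_on_nonneg_def)
  have nz: "\<zeta> \<notin> \<real>\<^sub>\<le>\<^sub>0" using \<zeta> by (auto simp: complex_nonpos_Reals_iff)
  note i = resolvent_transform_integrable[OF \<mu> nz]
  have p: "Im (1 / (complex_of_real l + \<zeta>)) * Im \<zeta> < 0" for l
  proof -
    define D where "D = (l + Re \<zeta>)\<^sup>2 + (Im \<zeta>)\<^sup>2"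
    have "0 < D" using \<zeta> by (simp add: D_def sum_power2_gt_zero_iff)
    have "Im (1 / (complex_of_real l + \<zeta>)) = Im (inverse (complex_of_real l + \<zeta>))" by (simp only: inverse_eq_divide)
    also have "\<dots> = - Im \<zeta> / D" by (simp add: D_def)
    finally have "Im (1 / (complex_of_real l + \<zeta>)) * Im \<zeta> = - ((Im \<zeta>)\<^sup>2 / D)" by (simp add: power2_eq_square)
    moreover have "0 < (Im \<zeta>)\<^sup>2 / D" using \<zeta> \<open>0 < D\<close> by (intro divide_pos_pos) auto
    ultimately show ?thesis by linarith
  qed
  have "Im (resolvent_transform \<mu> \<zeta>) = (LINT l|\<mu>. Im (1 / (complex_of_real l + \<zeta>)))"
    unfolding resolvent_transform_def by (rule integral_bounded_linear[OF bounded_linear_Im i, symmetric])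
  then have "Im (resolvent_transform \<mu> \<zeta>) * Im \<zeta> = (LINT l|\<mu>. Im (1 / (complex_of_real l + \<zeta>)) * Im \<zeta>)"
    by (simp only: integral_mult_left_zero)
  also have "\<dots> < 0"
  proof (rule expectation_less)
    have "integrable \<mu> (\<lambda>l. Im (1 / (complex_of_real l + \<zeta>)))"
      by (rule integrable_bounded_linear[OF bounded_linear_Im i])
    then show "integrable \<mu> (\<lambda>l. Im (1 / (complex_of_real l + \<zeta>)) * Im \<zeta>)"
      by (rule integrable_mult_left)
    show "AE l in \<mu>. Im (1 / (complex_of_real l + \<zeta>)) * Im \<zeta> < 0" by (rule AE_I2) (rule p)
  qed
  finally show ?thesis .
qed

lemma resolvent_function_integrable:
  assumes \<mu>: "prob_on_nonneg \<mu>" and t: "0 < t"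
  shows "integrable \<mu> (\<lambda>l. 1 / (l + t))"
  by (rule prob_on_nonneg_integrable[OF \<mu>, of _ "1/t"]) (use t in \<open>auto intro!: frac_le\<close>)

lemma resolvent_transform_of_real:
  assumes \<mu>: "prob_on_nonneg \<mu>" and t: "0 < t"
  shows "resolvent_transform \<mu> (complex_of_real t) = complex_of_real (LINT l|\<mu>. 1 / (l + t))"
proof -
  have "complex_of_real (LINT l|\<mu>. 1 / (l + t)) = (LINT l|\<mu>. complex_of_real (1 / (l + t)))"
    by (rule integral_of_real[symmetric]) (rule resolvent_function_integrable[OF \<mu> t])
  then show ?thesis by (simp add: resolvent_transform_def)
qed

lemma resolvent_transform_pos:
  assumes \<mu>: "prob_on_nonneg \<mu>" and t: "0 < t"
  shows "0 < (LINT l|\<mu>. 1 / (l + t))" "(LINT l|\<mu>. 1 / (l + t)) \<le> 1 / t"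
proof -
  interpret real_distribution \<mu> using \<mu> by (simp add: prob_on_nonneg_def)
  note i = resolvent_function_integrable[OF \<mu> t]
  show "0 < (LINT l|\<mu>. 1 / (l + t))"
    by (rule expectation_greater[OF i], rule eventually_mono[OF prob_on_nonneg_AE[OF \<mu>]]) (use t in auto)
  have "(LINT l|\<mu>. 1 / (l + t)) \<le> (LINT l|\<mu>. 1 / t)"
    by (rule integral_mono_AE[OF i], simp, rule eventually_mono[OF prob_on_nonneg_AE[OF \<mu>]]) (use t in \<open>auto intro!: frac_le\<close>)
  then show "(LINT l|\<mu>. 1 / (l + t)) \<le> 1 / t" using prob_space by simp
qed

text \<open>The value has nonzero imaginary part off the real axis and is positive on the positive
  axis. Consequently the transform of \<nu> may be evaluated at the inverse of a positive multiple
  of this value.\<close>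

lemma resolvent_transform_slit:
  assumes \<mu>: "prob_on_nonneg \<mu>" and \<zeta>: "\<zeta> \<notin> \<real>\<^sub>\<le>\<^sub>0"
  shows "resolvent_transform \<mu> \<zeta> \<notin> \<real>\<^sub>\<le>\<^sub>0"
proof (cases "Im \<zeta> = 0")
  case True
  then have "\<zeta> = complex_of_real (Re \<zeta>)" "0 < Re \<zeta>" using \<zeta> by (auto simp: complex_nonpos_Reals_iff complex_eq_iff)
  then show ?thesis using resolvent_transform_of_real[OF \<mu>, of "Re \<zeta>"] resolvent_transform_pos(1)[OF \<mu>, of "Re \<zeta>"]
    by (simp add: complex_nonpos_Reals_iff)
next
  case False
  then show ?thesis using Im_resolvent_transform[OF \<mu> False] by (auto simp: complex_nonpos_Reals_iff)
qed

text \<open>\<open>E f(r s)\<close> for the concave function \<open>f(u) = u/(1+u)\<close>; at \<open>z = -t\<close> the equation of the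
  limit law reads \<open>1 - t m = mp_G \<nu> (d m) / d\<close> with \<open>m = s(-t)\<close>.\<close>

definition mp_G :: "real measure \<Rightarrow> real \<Rightarrow> real" where
  "mp_G \<nu> s = (LINT r|\<nu>. r * s / (1 + r * s))"

text \<open>A modulus of continuity for \<open>mp_G \<nu>\<close> that tends to 0 at 0 without any
  moment of \<nu>. It also bounds the tails of \<nu>, so the same quantity serves both
  purposes.\<close>

definition mp_modulus :: "real measure \<Rightarrow> real \<Rightarrow> real" where
  "mp_modulus \<nu> \<delta> = (LINT r|\<nu>. min 1 (r * \<delta>))"

definition mp_real_eq :: "real \<Rightarrow> real measure \<Rightarrow> real \<Rightarrow> real \<Rightarrow> bool" where
  "mp_real_eq d \<nu> t m \<longleftrightarrow> 1 - t * m = mp_G \<nu> (d * m) / d"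

section \<open>The saturation \<open>u / (1 + u)\<close>, its averages and the real equation\<close>

lemma sat_bounds:
  fixes u :: real
  assumes "0 \<le> u" shows "0 \<le> u / (1 + u)" "u / (1 + u) \<le> 1"
  using assms by auto

lemma sat_mono:
  fixes u v :: real
  assumes "0 \<le> u" "u \<le> v" shows "u / (1 + u) \<le> v / (1 + v)"
  using assms by (simp add: divide_simps algebra_simps)

lemma sat_diff:
  fixes u v :: real
  assumes "0 \<le> u" "0 \<le> v" shows "\<bar>u / (1 + u) - v / (1 + v)\<bar> \<le> min 1 \<bar>u - v\<bar>"
proof -
  have "u / (1 + u) - v / (1 + v) = (u - v) / ((1 + u) * (1 + v))" using assms by (simp add: divide_simps algebra_simps)
  then have "\<bar>u / (1 + u) - v / (1 + v)\<bar> = \<bar>u - v\<bar> / ((1 + u) * (1 + v))" using assms by (simp add: abs_mult)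
  also have "1 \<le> (1 + u) * (1 + v)" using mult_mono[of 1 "1 + u" 1 "1 + v"] assms by simp
  then have "\<bar>u - v\<bar> / ((1 + u) * (1 + v)) \<le> \<bar>u - v\<bar> / 1" by (intro frac_le) auto
  finally have "\<bar>u / (1 + u) - v / (1 + v)\<bar> \<le> \<bar>u - v\<bar>" by simp
  moreover have "\<bar>u / (1 + u) - v / (1 + v)\<bar> \<le> 1" using sat_bounds[OF assms(1)] sat_bounds[OF assms(2)] by linarith
  ultimately show ?thesis by simp
qed

lemma mp_G_integrable:
  assumes \<nu>: "prob_on_nonneg \<nu>" and s: "0 \<le> s"
  shows "integrable \<nu> (\<lambda>r. r * s / (1 + r * s))"
proof (rule prob_on_nonneg_integrable[OF \<nu>])
  show "norm (r * s / (1 + r * s)) \<le> 1" if "0 \<le> r" for r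
    unfolding real_norm_def using sat_bounds[of "r * s"] mult_nonneg_nonneg[OF that s] by linarith
qed simp

lemma mp_modulus_integrable:
  assumes \<nu>: "prob_on_nonneg \<nu>" and s: "0 \<le> \<delta>"
  shows "integrable \<nu> (\<lambda>r. min 1 (r * \<delta>))"
  by (rule prob_on_nonneg_integrable[OF \<nu>, of _ 1]) (use s in auto)

lemma mp_G_bounds:
  assumes \<nu>: "prob_on_nonneg \<nu>" and s: "0 \<le> s"
  shows "0 \<le> mp_G \<nu> s" "mp_G \<nu> s \<le> 1"
proof -
  interpret real_distribution \<nu> using \<nu> by (simp add: prob_on_nonneg_def)
  show "0 \<le> mp_G \<nu> s" unfolding mp_G_def
    by (rule integral_nonneg_AE, rule eventually_mono[OF prob_on_nonneg_AE[OF \<nu>]]) (use s in auto)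
  have "mp_G \<nu> s \<le> (LINT r|\<nu>. 1)" unfolding mp_G_def
    by (rule integral_mono_AE[OF mp_G_integrable[OF \<nu> s]], simp, rule eventually_mono[OF prob_on_nonneg_AE[OF \<nu>]])
       (use s in \<open>auto intro!: sat_bounds(2)\<close>)
  then show "mp_G \<nu> s \<le> 1" using prob_space by simp
qed

lemma mp_G_mono:
  assumes \<nu>: "prob_on_nonneg \<nu>" and s: "0 \<le> s" "s \<le> s'"
  shows "mp_G \<nu> s \<le> mp_G \<nu> s'"
  unfolding mp_G_def
  by (rule integral_mono_AE) (use mp_G_integrable[OF \<nu>] s prob_on_nonneg_AE[OF \<nu>] in \<open>auto elim!: eventually_mono intro!: sat_mono mult_left_mono\<close>)

lemma mp_modulus_mono:
  assumes \<nu>: "prob_on_nonneg \<nu>" and s: "0 \<le> s" "s \<le> s'"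
  shows "mp_modulus \<nu> s \<le> mp_modulus \<nu> s'"
  unfolding mp_modulus_def
proof (rule integral_mono_AE)
  show "AE r in \<nu>. min 1 (r * s) \<le> min 1 (r * s')"
    by (rule eventually_mono[OF prob_on_nonneg_AE[OF \<nu>]]) (use s in \<open>auto intro!: min.mono[OF order_refl] mult_left_mono simp del: min.bounded_iff\<close>)
qed (use s mp_modulus_integrable[OF \<nu>] in auto)

lemma mp_G_diff:
  assumes \<nu>: "prob_on_nonneg \<nu>" and s: "0 \<le> s" "0 \<le> s'"
  shows "\<bar>mp_G \<nu> s - mp_G \<nu> s'\<bar> \<le> mp_modulus \<nu> \<bar>s - s'\<bar>"
proof -
  note i = mp_G_integrable[OF \<nu> s(1)] mp_G_integrable[OF \<nu> s(2)]
  have "\<bar>mp_G \<nu> s - mp_G \<nu> s'\<bar> = \<bar>LINT r|\<nu>. r * s / (1 + r * s) - r * s' / (1 + r * s')\<bar>"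
    unfolding mp_G_def using i by simp
  also have "\<dots> \<le> (LINT r|\<nu>. \<bar>r * s / (1 + r * s) - r * s' / (1 + r * s')\<bar>)" by (rule integral_abs_bound)
  also have "\<dots> \<le> mp_modulus \<nu> \<bar>s - s'\<bar>" unfolding mp_modulus_def
  proof (rule integral_mono_AE)
    show "AE r in \<nu>. \<bar>r * s / (1 + r * s) - r * s' / (1 + r * s')\<bar> \<le> min 1 (r * \<bar>s - s'\<bar>)"
      using prob_on_nonneg_AE[OF \<nu>]
    proof eventually_elim
      case (elim r)
      have "\<bar>r * s - r * s'\<bar> = r * \<bar>s - s'\<bar>" using elim by (simp add: abs_mult flip: right_diff_distrib)
      then show ?case using sat_diff[of "r * s" "r * s'"] elim s by simp
    qed
  qed (use i mp_modulus_integrable[OF \<nu>, of "\<bar>s - s'\<bar>"] in auto)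
  finally show ?thesis .
qed

lemma mp_modulus_tendsto_0:
  assumes \<nu>: "prob_on_nonneg \<nu>" and lim: "\<delta> \<longlonglongrightarrow> 0" and pos: "\<And>n. 0 \<le> \<delta> n"
  shows "(\<lambda>n. mp_modulus \<nu> (\<delta> n)) \<longlonglongrightarrow> 0"
proof -
  interpret real_distribution \<nu> using \<nu> by (simp add: prob_on_nonneg_def)
  have "(\<lambda>n. LINT r|\<nu>. min 1 (r * \<delta> n)) \<longlonglongrightarrow> (LINT r|\<nu>. 0)"
  proof (rule integral_dominated_convergence[where w="\<lambda>_. 1"])
    show "AE r in \<nu>. (\<lambda>n. min 1 (r * \<delta> n)) \<longlonglongrightarrow> 0"
    proof (rule AE_I2)
      fix r
      have "(\<lambda>n. min 1 (r * \<delta> n)) \<longlonglongrightarrow> min 1 (r * 0)" by (intro tendsto_intros lim)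
      then show "(\<lambda>n. min 1 (r * \<delta> n)) \<longlonglongrightarrow> 0" by simp
    qed
    show "AE r in \<nu>. norm (min 1 (r * \<delta> n)) \<le> 1" for n
      by (rule eventually_mono[OF prob_on_nonneg_AE[OF \<nu>]]) (use pos in \<open>auto simp: min_def\<close>)
  qed auto
  then show ?thesis by (simp add: mp_modulus_def)
qed

text \<open>The function \<open>t * m + mp_G \<nu> (d * m) / d\<close> is strictly increasing in
  \<open>m\<close>, and the equation asks for its value 1.\<close>

lemma mp_real_eq_unique:
  assumes \<nu>: "prob_on_nonneg \<nu>" and d: "0 < d" and t: "0 < t" and m: "0 < m" "mp_real_eq d \<nu> t m" "0 < m'" "mp_real_eq d \<nu> t m'"
  shows "m = m'"
proof -
  have "False" if "a < b" "0 < a" "mp_real_eq d \<nu> t a" "mp_real_eq d \<nu> t b" for a b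
  proof -
    have "mp_G \<nu> (d * a) / d \<le> mp_G \<nu> (d * b) / d"
      using mp_G_mono[OF \<nu>, of "d * a" "d * b"] that d by (simp add: divide_right_mono)
    moreover have "t * a < t * b" using that t by simp
    ultimately show False using that by (simp add: mp_real_eq_def)
  qed
  then show ?thesis using m by (metis linorder_neqE_linordered_idom)
qed

text \<open>The increasing function behind uniqueness is continuous, vanishes at 0 and is at least 1
  at \<open>1 / t\<close>, so the intermediate value theorem applies.\<close>

lemma mp_real_eq_exists:
  assumes \<nu>: "prob_on_nonneg \<nu>" and d: "0 < d" and t: "0 < t"
  obtains m where "0 < m" "m \<le> 1 / t" "mp_real_eq d \<nu> t m"
proof -
  define h where "h m = t * m + mp_G \<nu> (d * m) / d" for m
  have G0: "mp_G \<nu> 0 = 0" by (simp add: mp_G_def)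
  have "continuous_on {0..1/t} h"
    unfolding continuous_on_sequentially comp_def
  proof (intro allI ballI impI, elim conjE)
    fix x and a assume x: "\<forall>n. x n \<in> {0..1/t}" and a: "a \<in> {0..1/t}" and lim: "x \<longlonglongrightarrow> a"
    have "(\<lambda>n. \<bar>d * x n - d * a\<bar>) \<longlonglongrightarrow> \<bar>d * a - d * a\<bar>" by (intro tendsto_intros lim)
    then have "(\<lambda>n. mp_modulus \<nu> \<bar>d * x n - d * a\<bar>) \<longlonglongrightarrow> 0" by (intro mp_modulus_tendsto_0[OF \<nu>]) auto
    moreover have "norm (mp_G \<nu> (d * x n) - mp_G \<nu> (d * a)) \<le> mp_modulus \<nu> \<bar>d * x n - d * a\<bar>" for n
      using mp_G_diff[OF \<nu>, of "d * x n" "d * a"] x a d by simp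
    then have "eventually (\<lambda>n. norm (mp_G \<nu> (d * x n) - mp_G \<nu> (d * a)) \<le> mp_modulus \<nu> \<bar>d * x n - d * a\<bar>) sequentially"
      by (intro always_eventually allI)
    ultimately have "(\<lambda>n. mp_G \<nu> (d * x n) - mp_G \<nu> (d * a)) \<longlonglongrightarrow> 0"
      by (rule Lim_null_comparison[rotated])
    then have "(\<lambda>n. mp_G \<nu> (d * x n)) \<longlonglongrightarrow> mp_G \<nu> (d * a)" by (simp add: LIM_zero_iff)
    then show "(\<lambda>n. h (x n)) \<longlonglongrightarrow> h a" unfolding h_def using d by (intro tendsto_intros lim) auto
  qed
  moreover have "h 0 \<le> 1" by (simp add: h_def G0)
  moreover have "1 \<le> h (1/t)" using mp_G_bounds(1)[OF \<nu>, of "d * (1/t)"] d t by (simp add: h_def)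
  moreover have "0 \<le> 1 / t" using t by simp
  ultimately obtain m where m: "0 \<le> m" "m \<le> 1 / t" "h m = 1" using IVT'[of h 0 1 "1/t"] by auto
  have "m \<noteq> 0" using m by (auto simp: h_def G0)
  then show ?thesis using that[of m] m by (simp add: h_def mp_real_eq_def)
qed

text \<open>The equation of the limit law at \<open>z = -\<zeta>\<close>, multiplied by the
  transform. The integral over \<nu> is rewritten through
  \<open>1 / (1 + r w) = (1 / w) / (r + 1 / w)\<close> as a transform of \<nu>, which makes the
  whole expression a composition of holomorphic functions.\<close>

definition mp_char :: "real \<Rightarrow> real measure \<Rightarrow> real measure \<Rightarrow> complex \<Rightarrow> complex" where
  "mp_char d \<nu> \<mu> \<zeta> = (let w = of_real d * resolvent_transform \<mu> \<zeta> in
     1 - \<zeta> * resolvent_transform \<mu> \<zeta> - (1 - resolvent_transform \<nu> (1 / w) / w) / of_real d)"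

lemma slit_plane_inverse: "w \<notin> \<real>\<^sub>\<le>\<^sub>0 \<Longrightarrow> 1 / w \<notin> \<real>\<^sub>\<le>\<^sub>0" for w :: complex
  using nonpos_Reals_inverse_iff[of w] by (simp add: inverse_eq_divide)

lemma slit_plane_scale: "w \<notin> \<real>\<^sub>\<le>\<^sub>0 \<Longrightarrow> 0 < d \<Longrightarrow> of_real d * w \<notin> \<real>\<^sub>\<le>\<^sub>0" for w :: complex
  by (auto simp: complex_nonpos_Reals_iff mult_le_0_iff)

lemma mp_char_holomorphic:
  assumes "prob_on_nonneg \<mu>" "prob_on_nonneg \<nu>" and d: "0 < d"
  shows "mp_char d \<nu> \<mu> holomorphic_on (- \<real>\<^sub>\<le>\<^sub>0)"
proof -
  let ?w = "\<lambda>\<zeta>. of_real d * resolvent_transform \<mu> \<zeta>"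
  note h = resolvent_transform_holomorphic[OF assms(1)]
  have w: "?w \<zeta> \<notin> \<real>\<^sub>\<le>\<^sub>0" if "\<zeta> \<in> - \<real>\<^sub>\<le>\<^sub>0" for \<zeta>
    using slit_plane_scale[OF resolvent_transform_slit[OF assms(1)] d] that by simp
  have w0: "?w \<zeta> \<noteq> 0" if "\<zeta> \<in> - \<real>\<^sub>\<le>\<^sub>0" for \<zeta> using w[OF that] by auto
  have hw: "?w holomorphic_on (- \<real>\<^sub>\<le>\<^sub>0)" by (intro holomorphic_intros h)
  have "(resolvent_transform \<nu> \<circ> (\<lambda>\<zeta>. 1 / ?w \<zeta>)) holomorphic_on (- \<real>\<^sub>\<le>\<^sub>0)"
  proof (rule holomorphic_on_compose_gen[OF _ resolvent_transform_holomorphic[OF assms(2)]])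
    show "(\<lambda>\<zeta>. 1 / ?w \<zeta>) holomorphic_on (- \<real>\<^sub>\<le>\<^sub>0)" using w0 by (intro holomorphic_on_divide hw) auto
    show "(\<lambda>\<zeta>. 1 / ?w \<zeta>) ` (- \<real>\<^sub>\<le>\<^sub>0) \<subseteq> - \<real>\<^sub>\<le>\<^sub>0" using slit_plane_inverse[OF w] by blast
  qed
  then show ?thesis unfolding mp_char_def Let_def comp_def
    by (intro holomorphic_on_diff holomorphic_on_divide holomorphic_on_mult holomorphic_on_const holomorphic_on_ident h hw)
       (use w0 d in auto)
qed

text \<open>Two readings of the same function: the first form is compared with the definition of
  \<open>mp_law\<close>, the second with the real equation for \<open>mp_G\<close>.\<close>

lemma mp_char_integral:
  assumes \<mu>: "prob_on_nonneg \<mu>" and \<nu>: "prob_on_nonneg \<nu>" and d: "0 < d" and \<zeta>: "\<zeta> \<notin> \<real>\<^sub>\<le>\<^sub>0"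
  defines "s \<equiv> resolvent_transform \<mu> \<zeta>"
  shows "mp_char d \<nu> \<mu> \<zeta> = 1 - \<zeta> * s - s * (LINT r:{0..}|\<nu>. complex_of_real r / (1 + complex_of_real d * complex_of_real r * s))"
    and "mp_char d \<nu> \<mu> \<zeta> = 1 - \<zeta> * s - (1 - (LINT r|\<nu>. 1 / (1 + complex_of_real d * complex_of_real r * s))) / d"
proof -
  interpret N: real_distribution \<nu> using \<nu> by (simp add: prob_on_nonneg_def)
  define w where "w = of_real d * s"
  have w: "w \<notin> \<real>\<^sub>\<le>\<^sub>0" unfolding w_def s_def by (intro slit_plane_scale resolvent_transform_slit \<mu> \<zeta> d)
  then have w0: "w \<noteq> 0" by auto
  note w' = slit_plane_inverse[OF w]
  obtain \<delta> where dl: "0 < \<delta>" "\<And>l. 0 \<le> l \<Longrightarrow> \<delta> \<le> cmod (complex_of_real l + 1 / w)" using slit_plane_dist[OF w'] by blast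
  have eq: "1 / (complex_of_real r + 1 / w) / w = 1 / (1 + of_real r * w)" for r
  proof -
    have "complex_of_real r + 1 / w = (1 + of_real r * w) / w" using w0 by (simp add: add_divide_distrib)
    then show ?thesis using w0 by simp
  qed
  have nz: "1 + of_real r * w \<noteq> 0" if "0 \<le> r" for r
  proof
    assume "1 + of_real r * w = 0"
    then have "(complex_of_real r + 1 / w) * w = 0" using w0 by (simp add: field_simps)
    then show False using dl(2)[OF that] dl(1) w0 by simp
  qed
  have i: "integrable \<nu> (\<lambda>r. 1 / (1 + complex_of_real r * w))"
  proof -
    have "integrable \<nu> (\<lambda>r. 1 / (complex_of_real r + 1 / w) / w)"
      by (rule integrable_divide) (rule resolvent_transform_integrable[OF \<nu> w'])
    then show ?thesis by (simp only: eq)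
  qed
  have J: "resolvent_transform \<nu> (1 / w) / w = (LINT r|\<nu>. 1 / (1 + complex_of_real r * w))"
  proof -
    have "resolvent_transform \<nu> (1 / w) / w = (LINT r|\<nu>. 1 / (complex_of_real r + 1 / w) / w)"
      unfolding resolvent_transform_def by (rule integral_divide_zero[symmetric])
    then show ?thesis by (simp only: eq)
  qed
  have cm: "1 + complex_of_real d * complex_of_real r * s = 1 + complex_of_real r * w" for r by (simp add: w_def)
  show 2: "mp_char d \<nu> \<mu> \<zeta> = 1 - \<zeta> * s - (1 - (LINT r|\<nu>. 1 / (1 + complex_of_real d * complex_of_real r * s))) / d"
    unfolding mp_char_def Let_def s_def[symmetric] w_def[symmetric] J cm ..
  have "(1 - (LINT r|\<nu>. 1 / (1 + complex_of_real r * w))) / d = (LINT r|\<nu>. (1 - 1 / (1 + complex_of_real r * w)) / d)"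
    using i N.prob_space by simp
  also have "\<dots> = (LINT r|\<nu>. s * (indicator {0..} r *\<^sub>R (complex_of_real r / (1 + complex_of_real r * w))))"
  proof (rule integral_cong_AE)
    show "AE r in \<nu>. (1 - 1 / (1 + complex_of_real r * w)) / d = s * (indicator {0..} r *\<^sub>R (complex_of_real r / (1 + complex_of_real r * w)))"
      using prob_on_nonneg_AE[OF \<nu>]
    proof eventually_elim
      case (elim r)
      have "1 - 1 / (1 + complex_of_real r * w) = complex_of_real r * w / (1 + complex_of_real r * w)"
        using nz[OF elim] by (simp add: field_simps)
      then show ?case using elim d by (simp add: w_def)
    qed
  qed measurable
  also have "\<dots> = s * (LINT r:{0..}|\<nu>. complex_of_real r / (1 + complex_of_real r * w))"
    unfolding set_lebesgue_integral_def by (rule integral_mult_right_zero)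
  finally show "mp_char d \<nu> \<mu> \<zeta> = 1 - \<zeta> * s - s * (LINT r:{0..}|\<nu>. complex_of_real r / (1 + complex_of_real d * complex_of_real r * s))"
    unfolding 2 cm by simp
qed

lemma mp_char_of_real:
  assumes \<mu>: "prob_on_nonneg \<mu>" and \<nu>: "prob_on_nonneg \<nu>" and d: "0 < d" and t: "0 < t"
  shows "mp_char d \<nu> \<mu> (of_real t) = 0 \<longleftrightarrow> mp_real_eq d \<nu> t (LINT l|\<mu>. 1 / (l + t))"
proof -
  interpret N: real_distribution \<nu> using \<nu> by (simp add: prob_on_nonneg_def)
  define m where "m = (LINT l|\<mu>. 1 / (l + t))"
  have m: "0 < m" using resolvent_transform_pos[OF \<mu> t] by (simp add: m_def)
  have rt: "resolvent_transform \<mu> (of_real t) = of_real m" using resolvent_transform_of_real[OF \<mu> t] by (simp add: m_def)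
  have "(LINT r|\<nu>. 1 / (1 + complex_of_real d * complex_of_real r * complex_of_real m)) = complex_of_real (LINT r|\<nu>. 1 / (1 + d * r * m))"
  proof -
    have "complex_of_real (LINT r|\<nu>. 1 / (1 + d * r * m)) = (LINT r|\<nu>. complex_of_real (1 / (1 + d * r * m)))"
    proof (rule integral_of_real[symmetric], rule prob_on_nonneg_integrable[OF \<nu>])
      show "norm (1 / (1 + d * r * m)) \<le> 1" if "0 \<le> r" for r
        using mult_nonneg_nonneg[OF mult_nonneg_nonneg[OF less_imp_le[OF d] that] less_imp_le[OF m]] by simp
    qed simp
    then show ?thesis by simp
  qed
  moreover have "(LINT r|\<nu>. 1 / (1 + d * r * m)) = 1 - mp_G \<nu> (d * m)"
  proof -
    have dm: "0 \<le> d * m" using d m by simp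
    have "(LINT r|\<nu>. 1 / (1 + d * r * m)) = (LINT r|\<nu>. 1 - r * (d * m) / (1 + r * (d * m)))"
    proof (rule integral_cong_AE)
      show "AE r in \<nu>. 1 / (1 + d * r * m) = 1 - r * (d * m) / (1 + r * (d * m))"
        using prob_on_nonneg_AE[OF \<nu>]
      proof eventually_elim
        case (elim r)
        have "0 < 1 + r * (d * m)" using elim dm by (simp add: add_pos_nonneg)
        moreover have "1 + d * r * m = 1 + r * (d * m)" by simp
        ultimately show ?case by (simp add: field_simps)
      qed
    qed measurable
    also have "\<dots> = 1 - mp_G \<nu> (d * m)" using mp_G_integrable[OF \<nu> dm] N.prob_space by (simp add: mp_G_def)
    finally show ?thesis .
  qed
  ultimately have "mp_char d \<nu> \<mu> (of_real t) = of_real (1 - t * m - mp_G \<nu> (d * m) / d)"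
    using mp_char_integral(2)[OF \<mu> \<nu> d, of "of_real t"] t by (simp add: rt complex_nonpos_Reals_iff)
  then show ?thesis by (simp add: mp_real_eq_def m_def[symmetric] del: of_real_diff of_real_mult of_real_divide)
qed

lemma stieltjes_eq: "stieltjes \<mu> z = resolvent_transform \<mu> (- z)"
  by (simp add: stieltjes_def resolvent_transform_def inverse_eq_divide)

lemma mp_equation_iff:
  assumes \<mu>: "prob_on_nonneg \<mu>" and \<nu>: "prob_on_nonneg \<nu>" and d: "0 < d" and z: "0 < Im z"
  shows "1 / stieltjes \<mu> z + z = (LINT r:{0..}|\<nu>. complex_of_real r / (1 + complex_of_real d * complex_of_real r * stieltjes \<mu> z))
    \<longleftrightarrow> mp_char d \<nu> \<mu> (- z) = 0"
proof -
  have nz: "- z \<notin> \<real>\<^sub>\<le>\<^sub>0" using z by (auto simp: complex_nonpos_Reals_iff)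
  define s where "s = stieltjes \<mu> z"
  have "s \<notin> \<real>\<^sub>\<le>\<^sub>0" unfolding s_def stieltjes_eq by (rule resolvent_transform_slit[OF \<mu> nz])
  then have s0: "s \<noteq> 0" by auto
  have "mp_char d \<nu> \<mu> (- z) = 1 + z * s - s * (LINT r:{0..}|\<nu>. complex_of_real r / (1 + complex_of_real d * complex_of_real r * s))"
    using mp_char_integral(1)[OF \<mu> \<nu> d nz] by (simp add: s_def stieltjes_eq)
  then show ?thesis unfolding s_def[symmetric] using s0 by (auto simp: field_simps)
qed

text \<open>The parameter \<open>-t\<close> lies on the boundary of the half plane in which the
  equation is assumed. Since \<open>mp_char\<close> is continuous across that boundary, the equation
  extends to it.\<close>

lemma mp_char_zero_imp_real:
  assumes \<mu>: "prob_on_nonneg \<mu>" and \<nu>: "prob_on_nonneg \<nu>" and d: "0 < d" and t: "0 < t"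
    and eq: "\<And>z. 0 < Im z \<Longrightarrow> mp_char d \<nu> \<mu> (- z) = 0"
  shows "mp_real_eq d \<nu> t (LINT l|\<mu>. 1 / (l + t))"
proof -
  define \<zeta> where "\<zeta> k = complex_of_real t - \<i> * of_real (inverse (real (Suc k)))" for k
  have lim: "\<zeta> \<longlonglongrightarrow> complex_of_real t - \<i> * of_real 0" unfolding \<zeta>_def
    by (intro tendsto_intros LIMSEQ_inverse_real_of_nat)
  have "continuous_on (- \<real>\<^sub>\<le>\<^sub>0) (mp_char d \<nu> \<mu>)"
    by (intro holomorphic_on_imp_continuous_on mp_char_holomorphic \<mu> \<nu> d)
  then have "isCont (mp_char d \<nu> \<mu>) (of_real t)"
    using t by (simp add: continuous_on_eq_continuous_at open_Compl complex_nonpos_Reals_iff)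
  then have "(\<lambda>k. mp_char d \<nu> \<mu> (\<zeta> k)) \<longlonglongrightarrow> mp_char d \<nu> \<mu> (of_real t)"
    using lim by (intro isCont_tendsto_compose[of _ "mp_char d \<nu> \<mu>"]) auto
  moreover have "mp_char d \<nu> \<mu> (\<zeta> k) = 0" for k using eq[of "- \<zeta> k"] by (simp add: \<zeta>_def)
  ultimately have "mp_char d \<nu> \<mu> (of_real t) = 0" by (simp add: LIMSEQ_const_iff)
  then show ?thesis using mp_char_of_real[OF \<mu> \<nu> d t] by simp
qed

text \<open>By the identity theorem a sequence of parameters accumulating at 1 suffices. Countably
  many equations are what a construction by weak limits can supply.\<close>

lemma mp_law_eqI:
  assumes \<mu>: "prob_on_nonneg \<mu>" and \<nu>: "prob_on_nonneg \<nu>" and d: "0 < d"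
    and eq: "\<And>k. mp_real_eq d \<nu> (1 + inverse (real (Suc k))) (LINT l|\<mu>. 1 / (l + (1 + inverse (real (Suc k)))))"
  shows "mp_law d \<nu> = \<mu>" and "\<And>t. 0 < t \<Longrightarrow> mp_real_eq d \<nu> t (LINT l|\<mu>. 1 / (l + t))"
proof -
  let ?U = "range (\<lambda>k. complex_of_real (1 + inverse (real (Suc k))))"
  have zero: "mp_char d \<nu> \<mu> \<zeta> = 0" if \<zeta>: "\<zeta> \<in> - \<real>\<^sub>\<le>\<^sub>0" for \<zeta>
  proof (rule analytic_continuation[OF mp_char_holomorphic[OF \<mu> \<nu> d], of ?U 1])
    show "connected (- \<real>\<^sub>\<le>\<^sub>0 :: complex set)"
    proof -
      have "(\<real>\<^sub>\<le>\<^sub>0 :: complex set) = complex_of_real ` {..0}" by (auto simp: nonpos_Reals_def)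
      then show ?thesis using starlike_imp_connected[OF starlike_slotted_complex_plane_left[of 0]] by simp
    qed
    have "(\<lambda>k. complex_of_real (1 + inverse (real (Suc k)))) \<longlonglongrightarrow> complex_of_real (1 + 0)"
      by (intro tendsto_intros LIMSEQ_inverse_real_of_nat)
    then show "1 islimpt ?U" unfolding islimpt_sequential
      by (intro exI[of _ "\<lambda>k. complex_of_real (1 + inverse (real (Suc k)))"]) (auto simp: complex_eq_iff)
    show "?U \<subseteq> - \<real>\<^sub>\<le>\<^sub>0"
    proof (intro subsetI, elim rangeE)
      fix z k assume z: "z = complex_of_real (1 + inverse (real (Suc k)))"
      have "\<not> 1 + inverse (real (Suc k)) \<le> 0" by (simp add: add_pos_pos not_le)
      then show "z \<in> - \<real>\<^sub>\<le>\<^sub>0" unfolding z by (simp only: Compl_iff complex_nonpos_Reals_iff Re_complex_of_real) blast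
    qed
    show "mp_char d \<nu> \<mu> z = 0" if z: "z \<in> ?U" for z
    proof -
      obtain k where k: "z = complex_of_real (1 + inverse (real (Suc k)))" using z by blast
      have "0 < 1 + inverse (real (Suc k))" by (simp add: add_pos_pos)
      from mp_char_of_real[OF \<mu> \<nu> d this] show ?thesis unfolding k using eq[of k] by blast
    qed
  qed (use \<zeta> in \<open>auto simp: complex_nonpos_Reals_iff open_Compl add_pos_pos not_le\<close>)
  show re: "mp_real_eq d \<nu> t (LINT l|\<mu>. 1 / (l + t))" if "0 < t" for t
    using zero[of "of_real t"] mp_char_of_real[OF \<mu> \<nu> d that] that by (simp add: complex_nonpos_Reals_iff)
  show "mp_law d \<nu> = \<mu>" unfolding mp_law_def
  proof (rule the_equality)
    have "1 / stieltjes \<mu> z + z = (LINT r:{0..}|\<nu>. complex_of_real r / (1 + complex_of_real d * complex_of_real r * stieltjes \<mu> z))" if "0 < Im z" for z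
      using mp_equation_iff[OF \<mu> \<nu> d that] zero[of "- z"] that by (auto simp: complex_nonpos_Reals_iff)
    then show "prob_on_nonneg \<mu> \<and> (\<forall>z. 0 < Im z \<longrightarrow> 1 / stieltjes \<mu> z + z = 
        (LINT r:{0..}|\<nu>. complex_of_real r / (1 + complex_of_real d * complex_of_real r * stieltjes \<mu> z)))" using \<mu> by simp
  next
    fix \<mu>' assume a: "prob_on_nonneg \<mu>' \<and> (\<forall>z. 0 < Im z \<longrightarrow> 1 / stieltjes \<mu>' z + z = 
        (LINT r:{0..}|\<nu>. complex_of_real r / (1 + complex_of_real d * complex_of_real r * stieltjes \<mu>' z)))"
    then have \<mu>': "prob_on_nonneg \<mu>'" and z: "\<And>z. 0 < Im z \<Longrightarrow> mp_char d \<nu> \<mu>' (- z) = 0"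
      using mp_equation_iff[OF _ \<nu> d] by auto
    \<comment> \<open>Any other solution satisfies the real equation on the negative axis as well,
      and that equation has a single positive solution for each \<open>t\<close>.\<close>
    show "\<mu>' = \<mu>"
    proof (rule resolvent_transform_unique[OF \<mu>' \<mu>])
      fix t :: real assume t: "0 < t"
      show "(LINT l|\<mu>'. 1 / (l + t)) = (LINT l|\<mu>. 1 / (l + t))"
        by (rule mp_real_eq_unique[OF \<nu> d t]) (use resolvent_transform_pos[OF \<mu>' t] resolvent_transform_pos[OF \<mu> t] 
            mp_char_zero_imp_real[OF \<mu>' \<nu> d t z] re[OF t] in auto)
    qed
  qed
qed

section \<open>Concentration of the resolvent trace\<close>

definition mat_measurable :: "nat \<Rightarrow> 'a measure \<Rightarrow> ('a \<Rightarrow> real mat) \<Rightarrow> bool" where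
  "mat_measurable n M B \<longleftrightarrow> (\<forall>\<omega>. B \<omega> \<in> carrier_mat n n) \<and>
     (\<forall>i<n. \<forall>j<n. (\<lambda>\<omega>. B \<omega> $$ (i, j)) \<in> borel_measurable M)"

lemma det_measurable:
  assumes "mat_measurable n M B"
  shows "(\<lambda>\<omega>. Determinant.det (B \<omega>)) \<in> borel_measurable M"
proof -
  have [measurable]: "(\<lambda>\<omega>. B \<omega> $$ (i, j)) \<in> borel_measurable M" if "i < n" "j < n" for i j
    using assms that by (simp add: mat_measurable_def)
  have "(\<lambda>\<omega>. Determinant.det (B \<omega>)) = (\<lambda>\<omega>. \<Sum>\<pi>\<in>{\<pi>. \<pi> permutes {0..<n}}. signof \<pi> * (\<Prod>i = 0..<n. B \<omega> $$ (i, \<pi> i)))"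
    using assms by (intro ext det_def') (simp add: mat_measurable_def)
  also have "\<dots> \<in> borel_measurable M"
  proof (intro borel_measurable_sum borel_measurable_times borel_measurable_const borel_measurable_prod)
    fix \<pi> i assume "\<pi> \<in> {\<pi>. \<pi> permutes {0..<n}}" "i \<in> {0..<n}"
    then have "\<pi> i \<in> {0..<n}" "i < n" by (auto simp: permutes_in_image)
    then show "(\<lambda>\<omega>. B \<omega> $$ (i, \<pi> i)) \<in> borel_measurable M" by simp
  qed
  finally show ?thesis .
qed

lemma mat_measurable_adj:
  assumes B: "mat_measurable n M B"
  shows "mat_measurable n M (\<lambda>\<omega>. adj_mat (B \<omega>))"
  unfolding mat_measurable_def
proof (intro conjI allI impI)
  have Bc: "B \<omega> \<in> carrier_mat n n" for \<omega> using B by (simp add: mat_measurable_def)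
  show "adj_mat (B \<omega>) \<in> carrier_mat n n" for \<omega> using adj_mat(1)[OF Bc] .
  fix i j assume ij: "i < n" "j < n"
  have "mat_measurable (n - 1) M (\<lambda>\<omega>. mat_delete (B \<omega>) j i)"
    unfolding mat_measurable_def
  proof (intro conjI allI impI)
    show "mat_delete (B \<omega>) j i \<in> carrier_mat (n - 1) (n - 1)" for \<omega>
    proof -
      have "dim_row (B \<omega>) = n" "dim_col (B \<omega>) = n" using Bc[of \<omega>] by auto
      then show ?thesis by (simp add: mat_delete_def)
    qed
    fix k l assume kl: "k < n - 1" "l < n - 1"
    have "(\<lambda>\<omega>. mat_delete (B \<omega>) j i $$ (k, l)) = (\<lambda>\<omega>. B \<omega> $$ (if k < j then k else Suc k, if l < i then l else Suc l))"
    proof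
      fix \<omega>
      have "dim_row (B \<omega>) = n" "dim_col (B \<omega>) = n" using Bc[of \<omega>] by auto
      then show "mat_delete (B \<omega>) j i $$ (k, l) = B \<omega> $$ (if k < j then k else Suc k, if l < i then l else Suc l)"
        using kl by (simp add: mat_delete_def)
    qed
    also have "\<dots> \<in> borel_measurable M" using kl B unfolding mat_measurable_def by auto
    finally show "(\<lambda>\<omega>. mat_delete (B \<omega>) j i $$ (k, l)) \<in> borel_measurable M" .
  qed
  note [measurable] = det_measurable[OF this]
  have "(\<lambda>\<omega>. adj_mat (B \<omega>) $$ (i, j)) = (\<lambda>\<omega>. (-1) ^ (j + i) * Determinant.det (mat_delete (B \<omega>) j i))"
  proof
    fix \<omega>
    have "dim_row (B \<omega>) = n" "dim_col (B \<omega>) = n" using Bc[of \<omega>] by auto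
    then show "adj_mat (B \<omega>) $$ (i, j) = (-1) ^ (j + i) * Determinant.det (mat_delete (B \<omega>) j i)"
      using ij by (simp add: adj_mat_def cofactor_def)
  qed
  then show "(\<lambda>\<omega>. adj_mat (B \<omega>) $$ (i, j)) \<in> borel_measurable M" by simp
qed

lemma mat_measurable_resolvent:
  assumes B: "mat_measurable n M B"
  shows "mat_measurable n M (\<lambda>\<omega>. resolvent t (B \<omega>))"
proof -
  have Bc: "B \<omega> \<in> carrier_mat n n" for \<omega> using B by (simp add: mat_measurable_def)
  let ?S = "\<lambda>\<omega>. B \<omega> + t \<cdot>\<^sub>m 1\<^sub>m n"
  have S: "mat_measurable n M ?S"
    unfolding mat_measurable_def
  proof (intro conjI allI impI)
    show "?S \<omega> \<in> carrier_mat n n" for \<omega> using Bc by simp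
    fix i j assume ij: "i < n" "j < n"
    have "(\<lambda>\<omega>. ?S \<omega> $$ (i, j)) = (\<lambda>\<omega>. B \<omega> $$ (i, j) + t * 1\<^sub>m n $$ (i, j))" using ij Bc by auto
    also have "\<dots> \<in> borel_measurable M"
      using B ij by (intro borel_measurable_add borel_measurable_const) (simp add: mat_measurable_def)
    finally show "(\<lambda>\<omega>. ?S \<omega> $$ (i, j)) \<in> borel_measurable M" .
  qed
  have dim: "dim_row (B \<omega>) = n" for \<omega> using Bc by auto
  note [measurable] = det_measurable[OF S]
  have adj: "mat_measurable n M (\<lambda>\<omega>. adj_mat (?S \<omega>))" by (rule mat_measurable_adj[OF S])
  then have ac: "adj_mat (?S \<omega>) \<in> carrier_mat n n" for \<omega> by (simp add: mat_measurable_def)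
  show ?thesis unfolding mat_measurable_def resolvent_def Let_def dim
  proof (intro conjI allI impI)
    show "inverse (Determinant.det (?S \<omega>)) \<cdot>\<^sub>m adj_mat (?S \<omega>) \<in> carrier_mat n n" for \<omega> using ac by simp
    fix i j assume ij: "i < n" "j < n"
    have [measurable]: "(\<lambda>\<omega>. adj_mat (?S \<omega>) $$ (i, j)) \<in> borel_measurable M" using adj ij by (simp add: mat_measurable_def)
    have "(\<lambda>\<omega>. (inverse (Determinant.det (?S \<omega>)) \<cdot>\<^sub>m adj_mat (?S \<omega>)) $$ (i, j)) = (\<lambda>\<omega>. inverse (Determinant.det (?S \<omega>)) * adj_mat (?S \<omega>) $$ (i, j))"
    proof
      fix \<omega>
      show "(inverse (Determinant.det (?S \<omega>)) \<cdot>\<^sub>m adj_mat (?S \<omega>)) $$ (i, j) = inverse (Determinant.det (?S \<omega>)) * adj_mat (?S \<omega>) $$ (i, j)"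
        by (rule index_smult_mat) (use ij ac[of \<omega>] in auto)
    qed
    then show "(\<lambda>\<omega>. (inverse (Determinant.det (?S \<omega>)) \<cdot>\<^sub>m adj_mat (?S \<omega>)) $$ (i, j)) \<in> borel_measurable M" by simp
  qed
qed

lemma mat_trace_measurable:
  assumes B: "mat_measurable n M B"
  shows "(\<lambda>\<omega>. mat_trace (B \<omega>)) \<in> borel_measurable M"
proof -
  have dim: "dim_row (B \<omega>) = n" for \<omega> using B by (auto simp: mat_measurable_def)
  show ?thesis unfolding mat_trace_def dim using B by (intro borel_measurable_sum) (auto simp: mat_measurable_def)
qed

lemma quadratic_form_measurable:
  fixes y :: "'a \<Rightarrow> real Matrix.vec"
  assumes B: "mat_measurable n M B" and y: "\<And>\<omega>. y \<omega> \<in> carrier_vec n" "\<And>i. i < n \<Longrightarrow> (\<lambda>\<omega>. y \<omega> $ i) \<in> borel_measurable M"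
  shows "(\<lambda>\<omega>. y \<omega> \<bullet> (B \<omega> *\<^sub>v y \<omega>)) \<in> borel_measurable M"
proof -
  have "(\<lambda>\<omega>. y \<omega> \<bullet> (B \<omega> *\<^sub>v y \<omega>)) = (\<lambda>\<omega>. \<Sum>i<n. y \<omega> $ i * (\<Sum>j<n. B \<omega> $$ (i, j) * y \<omega> $ j))"
  proof
    fix \<omega>
    have "B \<omega> \<in> carrier_mat n n" using B by (simp add: mat_measurable_def)
    then show "y \<omega> \<bullet> (B \<omega> *\<^sub>v y \<omega>) = (\<Sum>i<n. y \<omega> $ i * (\<Sum>j<n. B \<omega> $$ (i, j) * y \<omega> $ j))"
      using y(1)[of \<omega>] by (simp add: scalar_prod_def atLeast0LessThan)
  qed
  also have "\<dots> \<in> borel_measurable M" using B y(2) by (auto simp: mat_measurable_def intro!: borel_measurable_sum borel_measurable_times)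
  finally show ?thesis .
qed

lemma mat_measurable_gram:
  fixes Y :: "'a \<Rightarrow> nat \<Rightarrow> real Matrix.vec"
  assumes "\<And>j k. j \<in> J \<Longrightarrow> k < n \<Longrightarrow> (\<lambda>\<omega>. Y \<omega> j $ k) \<in> borel_measurable M"
  shows "mat_measurable n M (\<lambda>\<omega>. gram_mat n N J (Y \<omega>))"
  unfolding mat_measurable_def
proof (intro conjI allI impI)
  fix k l assume kl: "k < n" "l < n"
  have "(\<lambda>\<omega>. gram_mat n N J (Y \<omega>) $$ (k, l)) = (\<lambda>\<omega>. (1 / real N) * (\<Sum>j\<in>J. Y \<omega> j $ k * Y \<omega> j $ l))"
    using kl by (simp add: gram_mat_def)
  also have "\<dots> \<in> borel_measurable M"
    using assms kl by (intro borel_measurable_times borel_measurable_const borel_measurable_sum) auto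
  finally show "(\<lambda>\<omega>. gram_mat n N J (Y \<omega>) $$ (k, l)) \<in> borel_measurable M" .
qed simp

section \<open>The resolvent trace on the product space of the samples\<close>

lemma (in prob_space) integral_bounded_above:
  fixes g :: "'a \<Rightarrow> real"
  assumes "integrable M g" "\<And>x. x \<in> space M \<Longrightarrow> g x \<le> c"
  shows "expectation g \<le> c"
proof -
  have "expectation g \<le> expectation (\<lambda>_. c)" by (rule integral_mono) (use assms in auto)
  then show ?thesis using prob_space by simp
qed

text \<open>The samples are the coordinates of a product space, to which the joint law of the data
  is transported later. The law \<open>L\<close> is arbitrary, so the same estimates serve the given
  vectors and the auxiliary sign vectors.\<close>

locale sample_cov_model =
  fixes p q N :: nat and C :: "real mat" and L :: "(nat \<Rightarrow> real) measure" and t :: real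
  assumes L: "prob_space L" and sets_L: "sets L = sets (vec_borel p)"
    and C: "C \<in> carrier_mat q p" and q: "0 < q" and N: "0 < N" and t: "0 < t"
begin

sublocale L: prob_space L by (rule L)

abbreviation PN :: "(nat \<Rightarrow> nat \<Rightarrow> real) measure" where "PN \<equiv> Pi\<^sub>M {..<N} (\<lambda>_. L)"

sublocale PN: prob_space PN by (rule prob_space_PiM) (rule L)

definition Y :: "(nat \<Rightarrow> nat \<Rightarrow> real) \<Rightarrow> nat \<Rightarrow> real Matrix.vec" where
  "Y X j = C *\<^sub>v Matrix.vec p (X j)"
definition m :: "(nat \<Rightarrow> nat \<Rightarrow> real) \<Rightarrow> real" where
  "m X = mat_trace (resolvent t (gram_mat q N {..<N} (Y X))) / q"
definition A :: "nat \<Rightarrow> (nat \<Rightarrow> nat \<Rightarrow> real) \<Rightarrow> real mat" where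
  "A j X = loo_resolvent q N t (Y X) j"
definition a :: "nat \<Rightarrow> (nat \<Rightarrow> nat \<Rightarrow> real) \<Rightarrow> real" where
  "a j X = (Y X j \<bullet> (A j X *\<^sub>v Y X j)) / N"
definition \<phi> :: "real mat \<Rightarrow> real" where
  "\<phi> B = (LINT x|L. (let u = ((C *\<^sub>v Matrix.vec p x) \<bullet> (B *\<^sub>v (C *\<^sub>v Matrix.vec p x))) / N in u / (1 + u)))"

lemma Y_carrier: "Y X j \<in> carrier_vec q" using C by (auto simp: Y_def)

lemma coord_measurable: "i < p \<Longrightarrow> (\<lambda>x. x i) \<in> borel_measurable L"
  by (subst measurable_cong_sets[OF sets_L refl]) simp

lemma C_coord: "k < q \<Longrightarrow> (C *\<^sub>v Matrix.vec p x) $ k = (\<Sum>i<p. C $$ (k, i) * x i)"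
  using C by (simp add: scalar_prod_def atLeast0LessThan)

lemma CL_measurable: "k < q \<Longrightarrow> (\<lambda>x. (C *\<^sub>v Matrix.vec p x) $ k) \<in> borel_measurable L"
  unfolding C_coord using coord_measurable by (intro borel_measurable_sum borel_measurable_times) auto

lemma Y_measurable:
  assumes "j \<in> I" "k < q"
  shows "(\<lambda>X. Y X j $ k) \<in> borel_measurable (Pi\<^sub>M I (\<lambda>_. L))"
  unfolding Y_def
  using measurable_compose[OF measurable_component_singleton[OF assms(1), of "\<lambda>_. L"] CL_measurable[OF assms(2)]] .

lemma m_measurable: "m \<in> borel_measurable PN"
  unfolding m_def
  by (intro borel_measurable_divide borel_measurable_const mat_trace_measurable[of q] mat_measurable_resolvent mat_measurable_gram Y_measurable) auto

lemma A_measurable: "mat_measurable q PN (A j)"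
  unfolding A_def loo_resolvent_def
  by (intro mat_measurable_resolvent mat_measurable_gram Y_measurable) auto

lemma trA_measurable: "(\<lambda>X. mat_trace (A j X)) \<in> borel_measurable PN"
  by (rule mat_trace_measurable[OF A_measurable])

lemma a_measurable: "j < N \<Longrightarrow> a j \<in> borel_measurable PN"
  unfolding a_def
  by (intro borel_measurable_divide borel_measurable_const quadratic_form_measurable[OF A_measurable] Y_carrier Y_measurable) auto

lemma psd_loo: "psd_mat q (gram_mat q N ({..<N} - {j}) (Y X))"
  by (rule psd_gram_mat) (rule Y_carrier)

lemma psd_full: "psd_mat q (gram_mat q N {..<N} (Y X))"
  by (rule psd_gram_mat) (rule Y_carrier)

text \<open>The random leave-one-out resolvents stay in a class described without reference to the
  samples. Hypotheses on \<open>\<phi>\<close> are made for all matrices of this class.\<close>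

lemma A_class: "A j X \<in> carrier_mat q q" "psd_contraction q (t \<cdot>\<^sub>m A j X)"
  using resolvent_carrier[OF psd_loo t] psd_contraction_smult_resolvent[OF psd_loo t]
  by (simp_all add: A_def loo_resolvent_def)

lemma trace_class_bounds:
  assumes "B \<in> carrier_mat q q" "psd_contraction q (t \<cdot>\<^sub>m B)"
  shows "0 \<le> mat_trace B" "mat_trace B \<le> q / t"
proof -
  have "0 \<le> mat_trace (t \<cdot>\<^sub>m B)" "mat_trace (t \<cdot>\<^sub>m B) \<le> q"
    using psd_mat_trace_nonneg psd_contraction_trace_le assms(2) by (auto simp: psd_contraction_def)
  then show "0 \<le> mat_trace B" "mat_trace B \<le> q / t"
    using t mat_trace_smult[OF assms(1)] by (auto simp: zero_le_mult_iff field_simps)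
qed

lemma form_nonneg:
  assumes "B \<in> carrier_mat q q" "psd_contraction q (t \<cdot>\<^sub>m B)" "v \<in> carrier_vec q"
  shows "0 \<le> v \<bullet> (B *\<^sub>v v)"
proof -
  have "0 \<le> v \<bullet> ((t \<cdot>\<^sub>m B) *\<^sub>v v)" using assms by (simp add: psd_contraction_def psd_mat_def)
  also have "(t \<cdot>\<^sub>m B) *\<^sub>v v = t \<cdot>\<^sub>v (B *\<^sub>v v)" by (rule smult_mat_mult_vec) (use assms in auto)
  also have "v \<bullet> (t \<cdot>\<^sub>v (B *\<^sub>v v)) = t * (v \<bullet> (B *\<^sub>v v))" using assms by simp
  finally show ?thesis using t by (simp add: zero_le_mult_iff)
qed

lemma
  assumes B: "B \<in> carrier_mat q q" "psd_contraction q (t \<cdot>\<^sub>m B)"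
  defines "u \<equiv> \<lambda>x. ((C *\<^sub>v Matrix.vec p x) \<bullet> (B *\<^sub>v (C *\<^sub>v Matrix.vec p x))) / N"
  shows \<phi>_integrable: "integrable L (\<lambda>x. u x / (1 + u x))"
    and \<phi>_bounds: "0 \<le> \<phi> B" "\<phi> B \<le> 1"
proof -
  have c: "C *\<^sub>v Matrix.vec p x \<in> carrier_vec q" for x using C by auto
  have u0: "0 \<le> u x" for x using form_nonneg[OF B c] by (simp add: u_def)
  have um: "u \<in> borel_measurable L" unfolding u_def
    by (intro borel_measurable_divide borel_measurable_const quadratic_form_measurable[of q] CL_measurable c)
       (use B in \<open>auto simp: mat_measurable_def\<close>)
  show i: "integrable L (\<lambda>x. u x / (1 + u x))"
  proof (rule L.integrable_const_bound[of _ 1], rule AE_I2)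
    show "norm (u x / (1 + u x)) \<le> 1" for x
      unfolding real_norm_def using sat_bounds[OF u0[of x]] by linarith
  qed (use um in measurable)
  have \<phi>: "\<phi> B = (LINT x|L. u x / (1 + u x))" by (simp add: \<phi>_def u_def Let_def)
  show "0 \<le> \<phi> B" unfolding \<phi> by (rule integral_nonneg_AE) (use u0 in auto)
  show "\<phi> B \<le> 1" unfolding \<phi> by (rule L.integral_bounded_above[OF i]) (rule sat_bounds(2)[OF u0])
qed

lemma m_bounds: "0 \<le> m X" "m X \<le> 1 / t"
proof -
  have "resolvent t (gram_mat q N {..<N} (Y X)) \<in> carrier_mat q q" by (rule resolvent_carrier[OF psd_full t])
  from trace_class_bounds[OF this psd_contraction_smult_resolvent[OF psd_full t]]
  show "0 \<le> m X" "m X \<le> 1 / t" using q t by (auto simp: m_def field_simps)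
qed

lemma a_nonneg: "j < N \<Longrightarrow> 0 \<le> a j X"
  unfolding a_def A_def by (rule loo_form_nonneg[OF Y_carrier t])

lemma m_identity: "q * (1 - t * m X) = (\<Sum>j<N. a j X / (1 + a j X))"
  using resolvent_trace_identity[where N=N and Y="Y X", OF Y_carrier t] q
  by (simp add: m_def a_def A_def Let_def right_diff_distrib)

lemma trA_m: "j < N \<Longrightarrow> \<bar>mat_trace (A j X) - q * m X\<bar> \<le> 1 / t"
  using loo_trace_diff[where N=N and Y="Y X", OF Y_carrier t] q by (simp add: m_def A_def)

lemma A_fun_upd: "A j (X(j := y)) = A j X"
proof -
  have "gram_mat q N ({..<N} - {j}) (Y (X(j := y))) = gram_mat q N ({..<N} - {j}) (Y X)"
    unfolding gram_mat_def by (intro cong_mat) (auto intro!: sum.cong simp: Y_def)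
  then show ?thesis by (simp add: A_def loo_resolvent_def)
qed

text \<open>Conditionally on the other samples, the matrix \<open>A j\<close> is deterministic.\<close>

lemma loo_integral_le:
  fixes h k :: "real \<Rightarrow> real"
  assumes j: "j < N" and hm: "h \<in> borel_measurable borel" "k \<in> borel_measurable borel"
    and hb: "\<And>s. 0 \<le> s \<Longrightarrow> s \<le> q / t \<Longrightarrow> \<bar>h s\<bar> \<le> b" "\<And>s. 0 \<le> s \<Longrightarrow> s \<le> q / t \<Longrightarrow> \<bar>k s\<bar> \<le> b"
    and le: "\<And>B. B \<in> carrier_mat q q \<Longrightarrow> psd_contraction q (t \<cdot>\<^sub>m B) \<Longrightarrow> h (mat_trace B) * \<phi> B + k (mat_trace B) \<le> c"
  shows "integrable PN (\<lambda>X. h (mat_trace (A j X)) * (a j X / (1 + a j X)) + k (mat_trace (A j X)))"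
    and "(LINT X|PN. h (mat_trace (A j X)) * (a j X / (1 + a j X)) + k (mat_trace (A j X))) \<le> c"
proof -
  let ?I = "{..<N} - {j}"
  let ?f = "\<lambda>X. h (mat_trace (A j X)) * (a j X / (1 + a j X)) + k (mat_trace (A j X))"
  have ins: "insert j ?I = {..<N}" using j by auto
  note [measurable] = hm trA_measurable a_measurable[OF j]
  have sat: "\<bar>u / (1 + u)\<bar> \<le> 1" if "0 \<le> u" for u :: real using that by simp
  have b0: "0 \<le> b" using hb(1)[of 0] t by (auto intro: order_trans[OF abs_ge_zero])
  have fb: "\<bar>?f X\<bar> \<le> b + b" for X
  proof -
    note tr = trace_class_bounds[OF A_class[of j X]]
    have "\<bar>h (mat_trace (A j X)) * (a j X / (1 + a j X))\<bar> \<le> b * 1"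
      unfolding abs_mult using hb(1)[OF tr] sat[OF a_nonneg[OF j]] b0 by (intro mult_mono) auto
    then show ?thesis using hb(2)[OF tr] by linarith
  qed
  show int: "integrable PN ?f"
    by (rule PN.integrable_const_bound[of _ "b + b"]) (use fb in auto)
  interpret PI: product_sigma_finite "\<lambda>_::nat. L" by unfold_locales
  interpret QI: prob_space "Pi\<^sub>M ?I (\<lambda>_. L)" by (rule prob_space_PiM) (rule L)
  have int': "integrable (Pi\<^sub>M (insert j ?I) (\<lambda>_. L)) ?f" using int by (simp only: ins)
  have "(LINT X|PN. ?f X) = (LINT X|Pi\<^sub>M (insert j ?I) (\<lambda>_. L). ?f X)" by (simp only: ins)
  also have "\<dots> = (LINT X|Pi\<^sub>M ?I (\<lambda>_. L). (LINT y|L. ?f (X(j := y))))"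
    by (rule PI.product_integral_insert[OF _ _ int']) auto
  finally have split: "(LINT X|PN. ?f X) = (LINT X|Pi\<^sub>M ?I (\<lambda>_. L). (LINT y|L. ?f (X(j := y))))" .
  have inner: "(LINT y|L. ?f (X(j := y))) = h (mat_trace (A j X)) * \<phi> (A j X) + k (mat_trace (A j X))" for X
  proof -
    let ?u = "\<lambda>y. ((C *\<^sub>v Matrix.vec p y) \<bullet> (A j X *\<^sub>v (C *\<^sub>v Matrix.vec p y))) / N"
    have a: "a j (X(j := y)) = ?u y" for y by (simp add: a_def A_fun_upd) (simp add: Y_def)
    define F where "F y = ?u y / (1 + ?u y)" for y
    have i: "integrable L F" unfolding F_def by (rule \<phi>_integrable[OF A_class[of j X]])
    have "(LINT y|L. ?f (X(j := y))) = (LINT y|L. h (mat_trace (A j X)) * F y + k (mat_trace (A j X)))"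
      by (simp only: a A_fun_upd F_def)
    also have "\<dots> = h (mat_trace (A j X)) * (LINT y|L. F y) + k (mat_trace (A j X))"
      using i L.prob_space by simp
    finally show ?thesis by (simp add: \<phi>_def Let_def F_def)
  qed
  have "(LINT X|Pi\<^sub>M ?I (\<lambda>_. L). (LINT y|L. ?f (X(j := y)))) \<le> c"
    unfolding inner
  proof (rule QI.integral_bounded_above)
    have fm: "?f \<in> borel_measurable (Pi\<^sub>M (insert j ?I) (\<lambda>_. L))" using int' by (rule borel_measurable_integrable)
    have "(\<lambda>(X, y). ?f (X(j := y))) \<in> borel_measurable (Pi\<^sub>M ?I (\<lambda>_. L) \<Otimes>\<^sub>M L)"
      using measurable_compose[OF measurable_add_dim[of j ?I "\<lambda>_. L"] fm] by (simp add: case_prod_unfold)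
    then have "(\<lambda>X. LINT y|L. ?f (X(j := y))) \<in> borel_measurable (Pi\<^sub>M ?I (\<lambda>_. L))"
      by (rule L.borel_measurable_lebesgue_integral)
    moreover have "\<bar>h (mat_trace (A j X)) * \<phi> (A j X) + k (mat_trace (A j X))\<bar> \<le> b + b" for X
    proof -
      note tr = trace_class_bounds[OF A_class[of j X]]
      have "\<bar>h (mat_trace (A j X)) * \<phi> (A j X)\<bar> \<le> b * 1"
        unfolding abs_mult using hb(1)[OF tr] \<phi>_bounds[OF A_class[of j X]] b0 by (intro mult_mono) auto
      then show ?thesis using hb(2)[OF tr] by linarith
    qed
    ultimately show "integrable (Pi\<^sub>M ?I (\<lambda>_. L)) (\<lambda>X. h (mat_trace (A j X)) * \<phi> (A j X) + k (mat_trace (A j X)))"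
      by (intro QI.integrable_const_bound[of _ "b + b"]) (auto simp only: inner real_norm_def intro!: AE_I2)
    show "h (mat_trace (A j X)) * \<phi> (A j X) + k (mat_trace (A j X)) \<le> c" for X by (rule le[OF A_class])
  qed
  then show "(LINT X|PN. ?f X) \<le> c" using split by simp
qed

text \<open>Both sides of \<open>1 - t m = (N/q) * average of f (a j)\<close> are tested against \<open>m - m\<^sub>*\<close>:
  since \<open>m + const * G\<close> is monotone, this already yields the concentration of \<open>m\<close>.\<close>

theorem resolvent_trace_L2_bound:
  assumes \<nu>: "prob_on_nonneg \<nu>" and d: "0 < d" and ms: "0 < ms" "ms \<le> 1 / t" "mp_real_eq d \<nu> t ms"
    and \<eta>: "\<And>B. B \<in> carrier_mat q q \<Longrightarrow> psd_contraction q (t \<cdot>\<^sub>m B) \<Longrightarrow> \<bar>\<phi> B - mp_G \<nu> (mat_trace B / N)\<bar> \<le> \<eta>"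
  shows "t * (LINT X|PN. (m X - ms)\<^sup>2) \<le> (N / q) * \<eta> / t + (1 / d + N / q) / (t * q)
    + (\<bar>N / q - 1 / d\<bar> + mp_modulus \<nu> (1 / (t * N) + \<bar>q / N - d\<bar> / t) / d) / t"
proof -
  define \<kappa> where "\<kappa> = real N / real q"
  define G where "G = mp_G \<nu>"
  define \<omega> where "\<omega> = mp_modulus \<nu> (1 / (t * N) + \<bar>q / N - d\<bar> / t)"
  define s where "s j X = a j X / (1 + a j X)" for j X
  \<comment> \<open>The combination \<open>h * s + k\<close> is \<kappa> times
    \<open>(m - ms) * (G - s)\<close>, with \<open>m\<close> and \<open>G\<close> taken at the
    leave-one-out trace. A weight that involved the sample \<open>j\<close> itself could not be
    frozen.\<close>
  define h where "h x = - \<kappa> * (x / q - ms)" for x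
  \<comment> \<open>With \<open>max 0\<close> the function of \<open>x\<close> is monotone on the
    whole line and therefore Borel.\<close>
  define k where "k x = \<kappa> * (x / q - ms) * G (max 0 x / N)" for x
  \<comment> \<open>\<open>E1\<close> pays for replacing \<open>m X\<close> by the leave-one-out
    trace in the weight, and \<open>E2\<close> for replacing the value of \<open>G\<close> at
    \<open>d * m X\<close> by the one at that trace, with the prefactor \<open>1 / d\<close>
    replaced by \<kappa>.\<close>
  define E1 where "E1 = (1 / d + \<kappa>) / (t * q)"
  define E2 where "E2 = (\<bar>\<kappa> - 1 / d\<bar> + \<omega> / d) / t"
  have \<kappa>0: "0 < \<kappa>" using q N by (simp add: \<kappa>_def)
  have qr: "0 < real q" "0 < real N" using q N by auto
  have Gb: "0 \<le> G x" "G x \<le> 1" if "0 \<le> x" for x using mp_G_bounds[OF \<nu> that] by (auto simp: G_def)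
  have Gmono: "mono (\<lambda>x. G (max 0 x / N))"
    unfolding G_def by (intro monoI mp_G_mono[OF \<nu>]) (auto intro!: divide_right_mono)
  have Gm: "(\<lambda>x. G (max 0 x / N)) \<in> borel_measurable borel" by (rule borel_measurable_mono[OF Gmono])
  have hm: "h \<in> borel_measurable borel" "k \<in> borel_measurable borel"
    unfolding h_def k_def using Gm by measurable
  have msb: "\<bar>x / q - ms\<bar> \<le> 1 / t" if "0 \<le> x" "x \<le> q / t" for x
  proof -
    have "x / q \<le> (q / t) / q" using that by (intro divide_right_mono) auto
    then have "0 \<le> x / q" "x / q \<le> 1 / t" using that qr by auto
    then show ?thesis using ms by linarith
  qed
  have hb: "\<bar>h x\<bar> \<le> \<kappa> / t" "\<bar>k x\<bar> \<le> \<kappa> / t" if "0 \<le> x" "x \<le> q / t" for x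
  proof -
    have 1: "\<bar>\<kappa> * (x / q - ms)\<bar> \<le> \<kappa> * (1 / t)"
      unfolding abs_mult using msb[OF that] \<kappa>0 by (intro mult_mono) auto
    then show "\<bar>h x\<bar> \<le> \<kappa> / t" by (simp add: h_def abs_mult)
    have "\<bar>k x\<bar> \<le> \<kappa> * (1 / t) * 1"
      unfolding k_def abs_mult[of _ "G _"] using 1 Gb[of "max 0 x / N"] t \<kappa>0 by (intro mult_mono) auto
    then show "\<bar>k x\<bar> \<le> \<kappa> / t" by simp
  qed
  have cls: "h (mat_trace B) * \<phi> B + k (mat_trace B) \<le> \<kappa> * \<eta> / t"
    if B: "B \<in> carrier_mat q q" "psd_contraction q (t \<cdot>\<^sub>m B)" for B
  proof -
    note tr = trace_class_bounds[OF B]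
    have "h (mat_trace B) * \<phi> B + k (mat_trace B) = - \<kappa> * (mat_trace B / q - ms) * (\<phi> B - G (mat_trace B / N))"
      using tr by (simp add: h_def k_def algebra_simps)
    also have "\<dots> \<le> \<bar>- \<kappa> * (mat_trace B / q - ms) * (\<phi> B - G (mat_trace B / N))\<bar>" by simp
    also have "\<dots> = \<kappa> * \<bar>mat_trace B / q - ms\<bar> * \<bar>\<phi> B - G (mat_trace B / N)\<bar>" using \<kappa>0 by (simp add: abs_mult)
    also have "\<dots> \<le> \<kappa> * (1 / t) * \<eta>"
      using msb[OF tr] \<eta>[OF B] \<kappa>0 t by (intro mult_mono) (auto simp: G_def)
    finally show ?thesis by simp
  qed
  have loo: "integrable PN (\<lambda>X. h (mat_trace (A j X)) * s j X + k (mat_trace (A j X)))"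
      "(LINT X|PN. h (mat_trace (A j X)) * s j X + k (mat_trace (A j X))) \<le> \<kappa> * \<eta> / t" if "j < N" for j
    unfolding s_def by (rule loo_integral_le[OF that hm hb cls], assumption+)+
  have point: "t * (m X - ms)\<^sup>2 \<le> (\<Sum>j<N. (h (mat_trace (A j X)) * s j X + k (mat_trace (A j X))) + E1 + E2) / N" for X
  proof -
    define g where "g = G (d * m X) / d"
    have gb: "0 \<le> g" "g \<le> 1 / d" using Gb[of "d * m X"] m_bounds[of X] d by (auto simp: g_def divide_right_mono)
    have eq1: "t * m X - 1 = - ((\<Sum>j<N. \<kappa> * s j X) / N)"
    proof -
      have "(\<Sum>j<N. \<kappa> * s j X) / N = (q * (1 - t * m X)) / q"
        unfolding sum_distrib_left[symmetric] m_identity s_def[symmetric] \<kappa>_def using qr by simp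
      then show ?thesis using qr by simp
    qed
    \<comment> \<open>The value of \<open>G\<close> at the limit may be exchanged for that at
      \<open>m X\<close> at no cost, because their difference has the sign of
      \<open>m X - ms\<close>. After this only quantities of the same sample are compared.\<close>
    have mono: "0 \<le> (m X - ms) * (g - G (d * ms) / d)"
    proof (cases "ms \<le> m X")
      case True
      then have "G (d * ms) \<le> G (d * m X)" unfolding G_def using d ms by (intro mp_G_mono[OF \<nu>]) auto
      then show ?thesis using True d by (intro mult_nonneg_nonneg) (auto simp: g_def divide_right_mono)
    next
      case False
      then have "G (d * m X) \<le> G (d * ms)" unfolding G_def using d m_bounds[of X] by (intro mp_G_mono[OF \<nu>]) auto
      then show ?thesis using False d by (intro mult_nonpos_nonpos) (auto simp: g_def divide_right_mono)
    qed
    have ms': "t * ms - 1 = - (G (d * ms) / d)" using ms by (simp add: mp_real_eq_def G_def)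
    have "t * (m X - ms)\<^sup>2 = (m X - ms) * ((t * m X - 1) - (t * ms - 1))" by (simp add: power2_eq_square algebra_simps)
    also have "\<dots> = (m X - ms) * (t * m X - 1 + G (d * ms) / d)" unfolding ms' by simp
    also have "\<dots> \<le> (m X - ms) * (t * m X - 1 + g)" using mono by (simp add: algebra_simps)
    also have "\<dots> = (\<Sum>j<N. (m X - ms) * (g - \<kappa> * s j X)) / N"
    proof -
      define T where "T = (\<Sum>j<N. \<kappa> * s j X)"
      have "(\<Sum>j<N. (m X - ms) * (g - \<kappa> * s j X)) = (m X - ms) * (N * g - T)"
        unfolding sum_distrib_left[symmetric] by (simp add: sum_subtractf T_def)
      then have "(\<Sum>j<N. (m X - ms) * (g - \<kappa> * s j X)) / N = (m X - ms) * ((N * g - T) / N)" by simp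
      also have "(N * g - T) / N = - (T / N) + g" using qr by (simp add: diff_divide_distrib)
      finally show ?thesis unfolding eq1 T_def ..
    qed
    also have "\<dots> \<le> (\<Sum>j<N. (h (mat_trace (A j X)) * s j X + k (mat_trace (A j X))) + E1 + E2) / N"
    proof (intro divide_right_mono sum_mono)
      fix j assume "j \<in> {..<N}"
      then have j: "j < N" by simp
      define r where "r = mat_trace (A j X)"
      define mj where "mj = r / q"
      define gj where "gj = \<kappa> * G (r / N)"
      have tr: "0 \<le> r" "r \<le> q / t" using trace_class_bounds[OF A_class[of j X]] by (auto simp: r_def)
      have sb: "0 \<le> s j X" "s j X \<le> 1" using sat_bounds[OF a_nonneg[OF j]] by (auto simp: s_def)
      have dm: "\<bar>r - q * m X\<bar> \<le> 1 / t" using trA_m[OF j] by (simp add: r_def)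
      have "mj - m X = (r - q * m X) / q" using qr by (simp add: mj_def diff_divide_distrib)
      then have "\<bar>m X - mj\<bar> = \<bar>r - q * m X\<bar> / q" by (simp only: abs_minus_commute[of "m X"] abs_divide abs_of_nat)
      also have "\<dots> \<le> (1 / t) / q" using dm by (intro divide_right_mono) auto
      finally have mm: "\<bar>m X - mj\<bar> \<le> 1 / (t * q)" by simp
      have ks: "0 \<le> \<kappa> * s j X" "\<kappa> * s j X \<le> \<kappa>" using sb \<kappa>0 by (auto simp: mult_left_le)
      have "\<bar>g - \<kappa> * s j X\<bar> \<le> 1 / d + \<kappa>" using gb ks by linarith
      then have "\<bar>(m X - mj) * (g - \<kappa> * s j X)\<bar> \<le> 1 / (t * q) * (1 / d + \<kappa>)"
        unfolding abs_mult using mm t by (intro mult_mono) auto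
      then have e1: "(m X - mj) * (g - \<kappa> * s j X) \<le> E1" by (simp add: E1_def)
      have arg: "\<bar>d * m X - r / N\<bar> \<le> 1 / (t * N) + \<bar>q / N - d\<bar> / t"
      proof -
        have eq: "d * m X - r / N = - (r - q * m X) / N - (q / N - d) * m X" using qr by (simp add: field_simps)
        have "\<bar>- (r - q * m X) / N\<bar> \<le> (1 / t) / N"
          unfolding abs_divide abs_minus_cancel abs_of_nat using dm by (intro divide_right_mono) simp_all
        then have b1: "\<bar>- (r - q * m X) / N\<bar> \<le> 1 / (t * N)" by simp
        have "\<bar>(q / N - d) * m X\<bar> \<le> \<bar>q / N - d\<bar> * (1 / t)"
          unfolding abs_mult using m_bounds[of X] by (intro mult_left_mono) auto
        then have b2: "\<bar>(q / N - d) * m X\<bar> \<le> \<bar>q / N - d\<bar> / t" by simp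
        show ?thesis unfolding eq by (rule order_trans[OF abs_triangle_ineq4 add_mono[OF b1 b2]])
      qed
      have "\<bar>G (d * m X) - G (r / N)\<bar> \<le> mp_modulus \<nu> \<bar>d * m X - r / N\<bar>"
        unfolding G_def using m_bounds[of X] d tr by (intro mp_G_diff[OF \<nu>]) auto
      also have "\<dots> \<le> \<omega>" unfolding \<omega>_def by (rule mp_modulus_mono[OF \<nu> _ arg]) simp
      finally have w: "\<bar>G (d * m X) - G (r / N)\<bar> \<le> \<omega>" .
      have "g - gj = (G (d * m X) - G (r / N)) / d - (\<kappa> - 1 / d) * G (r / N)"
        by (simp add: g_def gj_def algebra_simps diff_divide_distrib)
      moreover have "\<bar>(G (d * m X) - G (r / N)) / d\<bar> \<le> \<omega> / d" using w d by (simp add: divide_right_mono)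
      moreover have "\<bar>(\<kappa> - 1 / d) * G (r / N)\<bar> \<le> \<bar>\<kappa> - 1 / d\<bar> * 1"
        unfolding abs_mult using Gb[of "r / N"] tr by (intro mult_left_mono) auto
      ultimately have "\<bar>g - gj\<bar> \<le> \<omega> / d + \<bar>\<kappa> - 1 / d\<bar> * 1"
        by (simp only:)
      then have "\<bar>g - gj\<bar> \<le> \<bar>\<kappa> - 1 / d\<bar> + \<omega> / d" by (simp only: mult_1_right add.commute)
      then have "\<bar>(mj - ms) * (g - gj)\<bar> \<le> (1 / t) * (\<bar>\<kappa> - 1 / d\<bar> + \<omega> / d)"
        unfolding abs_mult using msb[OF tr] t by (intro mult_mono) (auto simp: mj_def)
      then have e2: "(mj - ms) * (g - gj) \<le> E2" by (simp add: E2_def)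
      have "(m X - ms) * (g - \<kappa> * s j X) = (mj - ms) * (gj - \<kappa> * s j X) + (m X - mj) * (g - \<kappa> * s j X) + (mj - ms) * (g - gj)"
        by (simp add: algebra_simps)
      moreover have "(mj - ms) * (gj - \<kappa> * s j X) = h r * s j X + k r" using tr by (simp add: h_def k_def gj_def mj_def algebra_simps)
      ultimately show "(m X - ms) * (g - \<kappa> * s j X) \<le> (h (mat_trace (A j X)) * s j X + k (mat_trace (A j X))) + E1 + E2"
        using e1 e2 by (simp add: r_def)
    qed simp
    finally show ?thesis .
  qed
  have int2: "integrable PN (\<lambda>X. (m X - ms)\<^sup>2)"
  proof (rule PN.integrable_const_bound[of _ "(1 / t)\<^sup>2"])
    have "\<bar>m X - ms\<bar> \<le> 1 / t" for X using m_bounds[of X] ms by linarith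
    then show "AE X in PN. norm ((m X - ms)\<^sup>2) \<le> (1 / t)\<^sup>2" by (auto simp: abs_le_square_iff[symmetric] t less_imp_le)
    show "(\<lambda>X. (m X - ms)\<^sup>2) \<in> borel_measurable PN" using m_measurable by measurable
  qed
  define F where "F j X = h (mat_trace (A j X)) * s j X + k (mat_trace (A j X))" for j X
  have Fi: "integrable PN (F j)" "(LINT X|PN. F j X) \<le> \<kappa> * \<eta> / t" if "j < N" for j
    using loo[OF that] unfolding F_def[abs_def] by auto
  have "t * (LINT X|PN. (m X - ms)\<^sup>2) = (LINT X|PN. t * (m X - ms)\<^sup>2)" by simp
  also have "\<dots> \<le> (LINT X|PN. (\<Sum>j<N. F j X + E1 + E2) / N)"
  proof (rule integral_mono)
    show "integrable PN (\<lambda>X. t * (m X - ms)\<^sup>2)" using int2 by simp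
    show "integrable PN (\<lambda>X. (\<Sum>j<N. F j X + E1 + E2) / N)"
      by (intro integrable_divide Bochner_Integration.integrable_sum Bochner_Integration.integrable_add Fi(1)) auto
    show "t * (m X - ms)\<^sup>2 \<le> (\<Sum>j<N. F j X + E1 + E2) / N" for X using point[of X] by (simp only: F_def)
  qed
  also have "\<dots> = (\<Sum>j<N. (LINT X|PN. F j X) + E1 + E2) / N"
  proof -
    have "integrable PN (\<lambda>X. \<Sum>j<N. F j X)" by (intro Bochner_Integration.integrable_sum Fi(1)) auto
    moreover have "(LINT X|PN. (\<Sum>j<N. F j X)) = (\<Sum>j<N. (LINT X|PN. F j X))"
      by (intro Bochner_Integration.integral_sum Fi(1)) auto
    ultimately show ?thesis using PN.prob_space by (simp add: sum.distrib)
  qed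
  also have "\<dots> \<le> (\<Sum>j<N. \<kappa> * \<eta> / t + E1 + E2) / N"
    using Fi(2) by (intro divide_right_mono sum_mono add_right_mono) auto
  also have "\<dots> = \<kappa> * \<eta> / t + E1 + E2" using qr by simp
  finally show ?thesis by (simp add: \<kappa>_def E1_def E2_def \<omega>_def)
qed

text \<open>If the Jensen gap \<open>g (tr B / N) - \<phi> B\<close> were at least \<open>\<gamma>\<close> for all matrices with
  \<open>tr B / N\<close> close to \<open>v\<close>, then the mean of \<open>m\<close> would be too large.\<close>

theorem resolvent_trace_mean_bound:
  assumes g: "mono_on {0..} g" "\<And>s. 0 \<le> s \<Longrightarrow> 0 \<le> g s" "\<And>s. 0 \<le> s \<Longrightarrow> g s \<le> 1"
    and v: "0 \<le> v" and \<delta>: "0 < \<delta>" "1 / (t * N) \<le> \<delta> / 2" and \<gamma>: "0 \<le> \<gamma>" and e: "0 \<le> e"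
    and up: "\<And>B. B \<in> carrier_mat q q \<Longrightarrow> psd_contraction q (t \<cdot>\<^sub>m B) \<Longrightarrow> \<phi> B \<le> g (mat_trace B / N) + e"
    and gap: "\<And>B. B \<in> carrier_mat q q \<Longrightarrow> psd_contraction q (t \<cdot>\<^sub>m B) \<Longrightarrow>
      \<bar>mat_trace B / N - v\<bar> \<le> \<delta> \<Longrightarrow> \<phi> B \<le> g (mat_trace B / N) - \<gamma>"
  shows "(q / N) * (1 - t * (LINT X|PN. m X)) \<le> g (v + \<delta>)
    + (1 + \<gamma>) * measure PN {X \<in> space PN. \<delta> / 2 < \<bar>(q / N) * m X - v\<bar>} + e - \<gamma>"
proof -
  have qr: "0 < real q" "0 < real N" using q N by auto
  \<comment> \<open>Away from \<open>v\<close> no gap is assumed, so \<gamma> is subtracted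
    artificially there. Then \<open>\<phi> B + k (mat_trace B)\<close> is at most
    \<open>e - \<gamma>\<close> on the whole class, and the excess is repaid by the probability of
    \<open>bad\<close>.\<close>
  define k where "k x = - g (max 0 x / N) - \<gamma> * indicator {x. \<delta> < \<bar>x / N - v\<bar>} x" for x
  \<comment> \<open>The threshold is \<open>\<delta> / 2\<close> because the leave-one-out trace
    over \<open>N\<close> differs from \<open>(q / N) * m X\<close> by at most
    \<open>1 / (t * N)\<close>, which is assumed to be below the other half.\<close>
  define bad where "bad = {X \<in> space PN. \<delta> / 2 < \<bar>(q / N) * m X - v\<bar>}"
  have badm: "bad \<in> sets PN" unfolding bad_def using m_measurable by measurable
  have Gmono: "mono (\<lambda>x. g (max 0 x / N))"
    by (intro monoI mono_onD[OF g(1)]) (auto intro!: divide_right_mono)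
  have Gm: "(\<lambda>x. g (max 0 x / N)) \<in> borel_measurable borel" by (rule borel_measurable_mono[OF Gmono])
  have km: "k \<in> borel_measurable borel" unfolding k_def using Gm by measurable
  have kb: "\<bar>k x\<bar> \<le> 1 + \<gamma>" if "0 \<le> x" "x \<le> q / t" for x
    using g(2,3)[of "x / N"] that \<gamma> by (auto simp: k_def indicator_def)
  have cls: "1 * \<phi> B + k (mat_trace B) \<le> e - \<gamma>" if B: "B \<in> carrier_mat q q" "psd_contraction q (t \<cdot>\<^sub>m B)" for B
    using up[OF B] gap[OF B] trace_class_bounds(1)[OF B] e by (auto simp: k_def indicator_def not_less)
  have loo: "integrable PN (\<lambda>X. 1 * (a j X / (1 + a j X)) + k (mat_trace (A j X)))"
      "(LINT X|PN. 1 * (a j X / (1 + a j X)) + k (mat_trace (A j X))) \<le> e - \<gamma>" if "j < N" for j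
    by (rule loo_integral_le[where h="\<lambda>_. 1" and k=k and b="1 + \<gamma>" and c="e - \<gamma>", OF that _ km _ kb cls]; use \<gamma> in simp)+
  have k_lower: "- k (mat_trace (A j X)) \<le> g (v + \<delta>) + (1 + \<gamma>) * indicator bad X" if j: "j < N" and X: "X \<in> space PN" for j X
  proof -
    define r where "r = mat_trace (A j X)"
    have r0: "0 \<le> r" using trace_class_bounds[OF A_class[of j X]] by (simp add: r_def)
    have "r / N - (q / N) * m X = (r - q * m X) / N" by (simp add: diff_divide_distrib)
    then have "\<bar>r / N - (q / N) * m X\<bar> = \<bar>r - q * m X\<bar> / N" by (simp only: abs_divide abs_of_nat)
    also have "\<dots> \<le> (1 / t) / N" using trA_m[OF j, of X] by (intro divide_right_mono) (auto simp: r_def)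
    finally have d: "\<bar>r / N - (q / N) * m X\<bar> \<le> \<delta> / 2" using \<delta> by simp
    show ?thesis
    proof (cases "X \<in> bad")
      case True
      have "g (r / N) \<le> 1" using g(3)[of "r / N"] r0 by simp
      moreover have "0 \<le> g (v + \<delta>)" using g(2)[of "v + \<delta>"] v \<delta> by simp
      ultimately show ?thesis using True r0 \<gamma> unfolding r_def[symmetric] by (auto simp: k_def indicator_def)
    next
      case False
      define z where "z = (q / N) * m X"
      have "\<bar>z - v\<bar> \<le> \<delta> / 2" using False X by (simp add: bad_def z_def not_less)
      then have close: "\<bar>r / N - v\<bar> \<le> \<delta>" using d unfolding z_def[symmetric] by linarith
      have "g (r / N) \<le> g (v + \<delta>)" by (rule mono_onD[OF g(1)]) (use close r0 v \<delta> in auto)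
      then show ?thesis using False close r0 unfolding r_def[symmetric] by (simp add: k_def indicator_def)
    qed
  qed
  have indi: "integrable PN (\<lambda>X. (1 + \<gamma>) * indicator bad X)"
    by (intro integrable_mult_right integrable_real_indicator badm) (simp add: PN.emeasure_eq_measure)
  have mint: "integrable PN m"
    by (rule PN.integrable_const_bound[of _ "1/t"]) (use m_bounds m_measurable in auto)
  have sint: "integrable PN (\<lambda>X. a j X / (1 + a j X))" if j: "j < N" for j
  proof (rule PN.integrable_const_bound[of _ 1], rule AE_I2)
    show "norm (a j X / (1 + a j X)) \<le> 1" for X
      unfolding real_norm_def using sat_bounds[OF a_nonneg[OF j, of X]] by linarith
  qed (use a_measurable[OF j] in measurable)
  have each: "(LINT X|PN. a j X / (1 + a j X)) \<le> g (v + \<delta>) + (1 + \<gamma>) * measure PN bad + e - \<gamma>" if j: "j < N" for j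
  proof -
    have "(LINT X|PN. a j X / (1 + a j X)) \<le> (LINT X|PN. (1 * (a j X / (1 + a j X)) + k (mat_trace (A j X))) + (g (v + \<delta>) + (1 + \<gamma>) * indicator bad X))"
    proof (rule integral_mono[OF sint[OF j]])
      show "integrable PN (\<lambda>X. (1 * (a j X / (1 + a j X)) + k (mat_trace (A j X))) + (g (v + \<delta>) + (1 + \<gamma>) * indicator bad X))"
        by (intro Bochner_Integration.integrable_add[OF loo(1)[OF j]] Bochner_Integration.integrable_add[OF _ indi]) simp
      show "a j X / (1 + a j X) \<le> (1 * (a j X / (1 + a j X)) + k (mat_trace (A j X))) + (g (v + \<delta>) + (1 + \<gamma>) * indicator bad X)" if "X \<in> space PN" for X
        using k_lower[OF j that] by simp
    qed
    also have "\<dots> = (LINT X|PN. 1 * (a j X / (1 + a j X)) + k (mat_trace (A j X))) + (LINT X|PN. g (v + \<delta>) + (1 + \<gamma>) * indicator bad X)"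
      by (intro Bochner_Integration.integral_add[OF loo(1)[OF j]] Bochner_Integration.integrable_add[OF _ indi]) simp
    also have "(LINT X|PN. g (v + \<delta>) + (1 + \<gamma>) * indicator bad X) = g (v + \<delta>) + (1 + \<gamma>) * measure PN bad"
      using badm PN.prob_space by (subst Bochner_Integration.integral_add[OF _ indi]) (auto simp: sets.Int_space_eq2)
    finally show ?thesis using loo(2)[OF j] by simp
  qed
  have "(q / N) * (1 - t * (LINT X|PN. m X)) = (LINT X|PN. (q * (1 - t * m X)) / N)"
    using mint PN.prob_space by (simp add: right_diff_distrib diff_divide_distrib)
  also have "\<dots> = (LINT X|PN. (\<Sum>j<N. a j X / (1 + a j X)) / N)" by (simp only: m_identity)
  also have "\<dots> = (\<Sum>j<N. (LINT X|PN. a j X / (1 + a j X))) / N"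
    using sint by (simp add: Bochner_Integration.integral_sum)
  also have "\<dots> \<le> (\<Sum>j<N. g (v + \<delta>) + (1 + \<gamma>) * measure PN bad + e - \<gamma>) / N"
    using each by (intro divide_right_mono sum_mono) auto
  also have "\<dots> = g (v + \<delta>) + (1 + \<gamma>) * measure PN bad + e - \<gamma>" using qr by simp
  finally show ?thesis by (simp add: bad_def)
qed

end

section \<open>Existence of the limit law\<close>

text \<open>A sign vector is encoded by the set of its positive coordinates. Enlarging the dimension
  by 1 then splits the subsets by membership of the new index, which drives the inductions
  below.\<close>

definition sign_fun :: "nat set \<Rightarrow> nat \<Rightarrow> real" where
  "sign_fun S i = (if i \<in> S then 1 else - 1)"

definition sign_avg :: "nat \<Rightarrow> (nat set \<Rightarrow> real) \<Rightarrow> real" where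
  "sign_avg p g = (\<Sum>S\<in>Pow {..<p}. g S) / 2 ^ p"

lemma sign_fun_square [simp]: "sign_fun S i * sign_fun S i = 1"
  by (simp add: sign_fun_def)

lemma sign_fun_insert: "i < p \<Longrightarrow> sign_fun (insert p S) i = sign_fun S i"
  by (simp add: sign_fun_def)

lemma sign_avg_expectation: "measure_pmf.expectation (pmf_of_set (Pow {..<p})) g = sign_avg p g"
  by (subst integral_pmf_of_set) (auto simp: sign_avg_def card_Pow)

lemma sign_avg_Suc: "sign_avg (Suc p) g = (sign_avg p (\<lambda>S. g (insert p S)) + sign_avg p g) / 2"
proof -
  have "Pow {..<Suc p} = Pow {..<p} \<union> insert p ` Pow {..<p}" by (simp add: lessThan_Suc Pow_insert)
  moreover have "Pow {..<p} \<inter> insert p ` Pow {..<p} = {}" by auto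
  moreover have "inj_on (insert p) (Pow {..<p})" 
    by (rule inj_onI) (metis PowD insert_ident lessThan_iff less_irrefl subsetD)
  ultimately have "(\<Sum>S\<in>Pow {..<Suc p}. g S) = (\<Sum>S\<in>Pow {..<p}. g S) + (\<Sum>S\<in>Pow {..<p}. g (insert p S))"
    by (simp add: sum.union_disjoint sum.reindex)
  then show ?thesis by (simp add: sign_avg_def add_divide_distrib)
qed

lemma sign_avg_cong: "(\<And>S. S \<subseteq> {..<p} \<Longrightarrow> f S = g S) \<Longrightarrow> sign_avg p f = sign_avg p g"
  by (auto simp: sign_avg_def intro!: sum.cong)

lemma sign_avg_mono: "(\<And>S. f S \<le> g S) \<Longrightarrow> sign_avg p f \<le> sign_avg p g"
  by (auto simp: sign_avg_def intro!: divide_right_mono sum_mono)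

lemma sign_avg_add: "sign_avg p (\<lambda>S. f S + g S) = sign_avg p f + sign_avg p g"
  by (simp add: sign_avg_def sum.distrib add_divide_distrib)

lemma sign_avg_scale: "sign_avg p (\<lambda>S. c * f S) = c * sign_avg p f"
  by (simp add: sign_avg_def sum_distrib_left)

lemma sign_avg_const: "sign_avg p (\<lambda>S. c) = c"
  by (simp add: sign_avg_def card_Pow)

lemma sign_avg_linear_form: "sign_avg p (\<lambda>S. (\<Sum>i<p. a i * sign_fun S i)\<^sup>2) = (\<Sum>i<p. (a i)\<^sup>2)"
proof (induction p)
  case (Suc p)
  let ?L = "\<lambda>S. \<Sum>i<p. a i * sign_fun S i"
  have 1: "sign_avg p (\<lambda>S. (\<Sum>i<Suc p. a i * sign_fun (insert p S) i)\<^sup>2) = sign_avg p (\<lambda>S. (?L S + a p)\<^sup>2)"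
    by (rule sign_avg_cong) (simp add: sign_fun_insert, simp add: sign_fun_def)
  have 2: "sign_avg p (\<lambda>S. (\<Sum>i<Suc p. a i * sign_fun S i)\<^sup>2) = sign_avg p (\<lambda>S. (?L S - a p)\<^sup>2)"
  proof (rule sign_avg_cong)
    fix S assume "S \<subseteq> {..<p}"
    then have "sign_fun S p = -1" by (auto simp: sign_fun_def)
    then show "(\<Sum>i<Suc p. a i * sign_fun S i)\<^sup>2 = (?L S - a p)\<^sup>2" by simp
  qed
  have "sign_avg p (\<lambda>S. (?L S + a p)\<^sup>2) + sign_avg p (\<lambda>S. (?L S - a p)\<^sup>2) = sign_avg p (\<lambda>S. 2 * (?L S)\<^sup>2 + 2 * (a p)\<^sup>2)"
    unfolding sign_avg_add[symmetric] by (simp add: power2_eq_square algebra_simps)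
  also have "\<dots> = 2 * (\<Sum>i<p. (a i)\<^sup>2) + 2 * (a p)\<^sup>2"
    by (simp add: sign_avg_add sign_avg_scale sign_avg_const Suc)
  finally show ?case unfolding sign_avg_Suc 1 2 by simp
qed (simp add: sign_avg_def)

text \<open>In the induction the last sign multiplies twice a linear form in the other signs. The
  cross term cancels in the average, and four times the squared coefficients remain; they are
  matched by the two symmetric copies of each new entry on the right.\<close>

lemma sign_avg_quadratic_form:
  assumes sym: "\<And>i j. b i j = b j i"
  shows "sign_avg p (\<lambda>S. ((\<Sum>i<p. \<Sum>j<p. b i j * (sign_fun S i * sign_fun S j)) - (\<Sum>i<p. b i i))\<^sup>2)
    \<le> 2 * (\<Sum>i<p. \<Sum>j<p. (b i j)\<^sup>2)"
proof (induction p)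
  case (Suc p)
  let ?Q = "\<lambda>p S. (\<Sum>i<p. \<Sum>j<p. b i j * (sign_fun S i * sign_fun S j)) - (\<Sum>i<p. b i i)"
  let ?L = "\<lambda>S. \<Sum>i<p. b i p * sign_fun S i"
  have sym': "b p j = b j p" if "j < p" for j by (rule sym)
  have split: "?Q (Suc p) S = ?Q p S + 2 * sign_fun S p * ?L S" for S
    by (simp add: sum.distrib sum_distrib_left sym' algebra_simps)
  have 1: "sign_avg p (\<lambda>S. (?Q (Suc p) (insert p S))\<^sup>2) = sign_avg p (\<lambda>S. (?Q p S + 2 * ?L S)\<^sup>2)"
    unfolding split by (rule sign_avg_cong) (simp add: sign_fun_insert, simp add: sign_fun_def)
  have 2: "sign_avg p (\<lambda>S. (?Q (Suc p) S)\<^sup>2) = sign_avg p (\<lambda>S. (?Q p S - 2 * ?L S)\<^sup>2)"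
    unfolding split
  proof (rule sign_avg_cong)
    fix S assume "S \<subseteq> {..<p}"
    then have "sign_fun S p = -1" by (auto simp: sign_fun_def)
    then show "(?Q p S + 2 * sign_fun S p * ?L S)\<^sup>2 = (?Q p S - 2 * ?L S)\<^sup>2" by simp
  qed
  have alg: "(a + 2 * l)\<^sup>2 + (a - 2 * l)\<^sup>2 = 2 * a\<^sup>2 + 8 * l\<^sup>2" for a l :: real
    by (simp add: power2_eq_square algebra_simps)
  have "sign_avg p (\<lambda>S. (?Q p S + 2 * ?L S)\<^sup>2) + sign_avg p (\<lambda>S. (?Q p S - 2 * ?L S)\<^sup>2) 
      = sign_avg p (\<lambda>S. 2 * (?Q p S)\<^sup>2 + 8 * (?L S)\<^sup>2)"
    unfolding sign_avg_add[symmetric] by (rule sign_avg_cong) (rule alg)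
  also have "\<dots> = 2 * sign_avg p (\<lambda>S. (?Q p S)\<^sup>2) + 8 * (\<Sum>i<p. (b i p)\<^sup>2)"
    by (simp only: sign_avg_add sign_avg_scale sign_avg_linear_form)
  finally have "sign_avg (Suc p) (\<lambda>S. (?Q (Suc p) S)\<^sup>2) = sign_avg p (\<lambda>S. (?Q p S)\<^sup>2) + 4 * (\<Sum>i<p. (b i p)\<^sup>2)"
    unfolding sign_avg_Suc 1 2 by simp
  also have "\<dots> \<le> 2 * (\<Sum>i<p. \<Sum>j<p. (b i j)\<^sup>2) + 4 * (\<Sum>i<p. (b i p)\<^sup>2)" using Suc by simp
  also have "\<dots> \<le> 2 * (\<Sum>i<Suc p. \<Sum>j<Suc p. (b i j)\<^sup>2)"
    by (simp add: sum.distrib sym' algebra_simps)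
  finally show ?case .
qed (simp add: sign_avg_def)

lemma sign_avg_abs_le: 
  assumes "0 \<le> K" "sign_avg p (\<lambda>S. (f S)\<^sup>2) \<le> K\<^sup>2"
  shows "sign_avg p (\<lambda>S. \<bar>f S\<bar>) \<le> K"
proof -
  define A where "A = sign_avg p (\<lambda>S. \<bar>f S\<bar>)"
  have "0 \<le> sign_avg p (\<lambda>S. (\<bar>f S\<bar> - A)\<^sup>2)" using sign_avg_mono[of "\<lambda>_. 0" "\<lambda>S. (\<bar>f S\<bar> - A)\<^sup>2" p] by (simp add: sign_avg_const)
  also have "\<dots> = sign_avg p (\<lambda>S. (f S)\<^sup>2 + ((- 2 * A) * \<bar>f S\<bar> + A\<^sup>2))"
    by (intro sign_avg_cong) (simp add: power2_diff algebra_simps)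
  also have "\<dots> = sign_avg p (\<lambda>S. (f S)\<^sup>2) - A\<^sup>2"
    unfolding sign_avg_add sign_avg_scale sign_avg_const A_def[symmetric] by (simp add: power2_eq_square)
  finally have "A\<^sup>2 \<le> K\<^sup>2" using assms by linarith
  then show ?thesis using power2_le_imp_le[OF _ assms(1)] unfolding A_def by blast
qed

text \<open>The law of \<open>\<surd>r * (random signs)\<close> with \<open>r\<close> distributed as \<open>\<nu>\<close>; it serves to construct
  the limit law for an arbitrary \<open>\<nu>\<close>.\<close>

definition sign_law :: "real measure \<Rightarrow> nat \<Rightarrow> (nat \<Rightarrow> real) measure" where
  "sign_law \<nu> p = distr (\<nu> \<Otimes>\<^sub>M measure_pmf (pmf_of_set (Pow {..<p}))) (vec_borel p)
     (\<lambda>z. \<lambda>i\<in>{..<p}. sqrt (fst z) * sign_fun (snd z) i)"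

lemma
  assumes \<nu>: "prob_on_nonneg \<nu>"
  shows sign_law_prob: "prob_space (sign_law \<nu> p)"
    and sign_law_sets: "sets (sign_law \<nu> p) = sets (vec_borel p)"
    and sign_law_integral: "\<And>g :: (nat \<Rightarrow> real) \<Rightarrow> real. g \<in> borel_measurable (vec_borel p) \<Longrightarrow> (\<And>x. \<bar>g x\<bar> \<le> 1) \<Longrightarrow>
      (LINT x|sign_law \<nu> p. g x) = (LINT r|\<nu>. sign_avg p (\<lambda>S. g (\<lambda>i\<in>{..<p}. sqrt r * sign_fun S i)))"
    and sign_law_integrable: "\<And>g :: (nat \<Rightarrow> real) \<Rightarrow> real. g \<in> borel_measurable (vec_borel p) \<Longrightarrow> (\<And>x. \<bar>g x\<bar> \<le> 1) \<Longrightarrow>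
      integrable \<nu> (\<lambda>r. sign_avg p (\<lambda>S. g (\<lambda>i\<in>{..<p}. sqrt r * sign_fun S i)))"
proof -
  let ?S = "measure_pmf (pmf_of_set (Pow {..<p}))"
  let ?f = "\<lambda>z. \<lambda>i\<in>{..<p}. sqrt (fst z) * sign_fun (snd z) i"
  interpret N: real_distribution \<nu> using \<nu> by (simp add: prob_on_nonneg_def)
  interpret S: prob_space ?S by (rule prob_space_measure_pmf)
  interpret P: pair_prob_space \<nu> ?S by unfold_locales
  have [measurable]: "(\<lambda>z. sqrt (fst z)) \<in> borel_measurable (\<nu> \<Otimes>\<^sub>M ?S)" by measurable
  have sg: "(\<lambda>z. sign_fun (snd z) i) \<in> borel_measurable (\<nu> \<Otimes>\<^sub>M ?S)" for i
    by (rule measurable_compose[OF measurable_snd]) simp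
  have f: "?f \<in> (\<nu> \<Otimes>\<^sub>M ?S) \<rightarrow>\<^sub>M vec_borel p"
    by (rule measurable_restrict) (intro borel_measurable_times sg, measurable)
  show "prob_space (sign_law \<nu> p)" unfolding sign_law_def by (rule P.prob_space_distr[OF f])
  show "sets (sign_law \<nu> p) = sets (vec_borel p)" by (simp add: sign_law_def)
  fix g :: "(nat \<Rightarrow> real) \<Rightarrow> real" assume g: "g \<in> borel_measurable (vec_borel p)" "\<And>x. \<bar>g x\<bar> \<le> 1"
  have int: "integrable (\<nu> \<Otimes>\<^sub>M ?S) (\<lambda>z. g (?f z))"
    by (rule P.integrable_const_bound[of _ 1]) (use g measurable_compose[OF f g(1)] in auto)
  have inner: "(LINT S|?S. g (?f (r, S))) = sign_avg p (\<lambda>S. g (\<lambda>i\<in>{..<p}. sqrt r * sign_fun S i))" for r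
    using sign_avg_expectation[of p "\<lambda>S. g (\<lambda>i\<in>{..<p}. sqrt r * sign_fun S i)"] by simp
  have "(LINT x|sign_law \<nu> p. g x) = (LINT z|(\<nu> \<Otimes>\<^sub>M ?S). g (?f z))"
    unfolding sign_law_def by (rule integral_distr[OF f g(1)])
  also have "\<dots> = (LINT r|\<nu>. (LINT S|?S. g (?f (r, S))))" by (rule P.integral_fst'[symmetric, OF int])
  finally show "(LINT x|sign_law \<nu> p. g x) = (LINT r|\<nu>. sign_avg p (\<lambda>S. g (\<lambda>i\<in>{..<p}. sqrt r * sign_fun S i)))"
    unfolding inner .
  show "integrable \<nu> (\<lambda>r. sign_avg p (\<lambda>S. g (\<lambda>i\<in>{..<p}. sqrt r * sign_fun S i)))"
    using P.integrable_fst'[OF int] unfolding inner .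
qed

lemma sign_law_model:
  assumes "prob_on_nonneg \<nu>" "0 < p" "0 < N" "0 < t"
  shows "sample_cov_model p p N (1\<^sub>m p) (sign_law \<nu> p) t"
  using assms sign_law_prob[OF assms(1), of p] sign_law_sets[OF assms(1), of p] by (simp add: sample_cov_model_def)

text \<open>By symmetry the sum is the trace of \<open>A * A\<close>, that is the sum of the squared
  eigenvalues.\<close>

lemma psd_contraction_frobenius:
  assumes A: "psd_contraction n A"
  shows "(\<Sum>i<n. \<Sum>j<n. (A $$ (i, j))\<^sup>2) \<le> n"
proof -
  obtain U d where U: "U \<in> carrier_mat n n" "transpose_mat U * U = 1\<^sub>m n" "U * transpose_mat U = 1\<^sub>m n"
    "A = U * mat_diag n d * transpose_mat U" and d: "\<And>i. i < n \<Longrightarrow> 0 \<le> d i" "\<And>i. i < n \<Longrightarrow> d i \<le> 1"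
    using psd_contraction_spectral[OF A] by blast
  have Ac: "A \<in> carrier_mat n n" "transpose_mat A = A" using A by (auto simp: psd_contraction_def psd_mat_def)
  have sym: "A $$ (j, i) = A $$ (i, j)" if "i < n" "j < n" for i j
    using that Ac by (metis carrier_matD index_transpose_mat(1))
  have "(\<Sum>i<n. \<Sum>j<n. (A $$ (i, j))\<^sup>2) = mat_trace (A * A)"
    using Ac by (simp add: mat_trace_def scalar_prod_def atLeast0LessThan sym power2_eq_square)
  also have "A * A = U * mat_diag n (\<lambda>i. d i * d i) * transpose_mat U"
    unfolding U(4) by (rule orth_diag_product[OF U(1,2)])
  also have "mat_trace \<dots> = (\<Sum>i<n. d i * d i)" by (rule mat_trace_orth_diag[OF U(1,2)])
  also have "\<dots> \<le> (\<Sum>i<n. 1)" using d by (intro sum_mono) (auto intro: mult_le_one)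
  finally show ?thesis by simp
qed

text \<open>Given the radius \<open>r\<close>, the form is \<open>r / N\<close> times a quadratic
  form in the signs with mean \<open>tr B\<close> and variance at most
  \<open>2 * p / t\<^sup>2\<close>. Its mean deviation is thus of order \<open>sqrt p\<close>, small
  against \<open>N\<close>, and averaging over \<open>r\<close> produces the modulus of
  \<nu>.\<close>

lemma sign_law_form:
  assumes \<nu>: "prob_on_nonneg \<nu>" and pN: "0 < p" "0 < N" and t: "0 < t"
    and B: "B \<in> carrier_mat p p" "psd_contraction p (t \<cdot>\<^sub>m B)"
  shows "\<bar>sample_cov_model.\<phi> p N (1\<^sub>m p) (sign_law \<nu> p) B - mp_G \<nu> (mat_trace B / N)\<bar> \<le> mp_modulus \<nu> (sqrt (2 * p) / (t * N))"
proof -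
  interpret sample_cov_model p p N "1\<^sub>m p" "sign_law \<nu> p" t by (rule sign_law_model[OF \<nu> pN t])
  interpret V: real_distribution \<nu> using \<nu> by (simp add: prob_on_nonneg_def)
  define T where "T = mat_trace B"
  have T0: "0 \<le> T" using trace_class_bounds(1)[OF B] by (simp add: T_def)
  have tB: "transpose_mat (t \<cdot>\<^sub>m B) = t \<cdot>\<^sub>m B" using B by (auto simp: psd_contraction_def psd_mat_def)
  have sym: "B $$ (j, i) = B $$ (i, j)" if "i < p" "j < p" for i j
    using arg_cong[OF tB, of "\<lambda>M. M $$ (i, j)"] B(1) that t by simp
  \<comment> \<open>Extension by 0 makes the array symmetric for all indices, as the variance bound
    requires.\<close>
  define b where "b i j = (if i < p \<and> j < p then B $$ (i, j) else 0)" for i j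
  have bsym: "b i j = b j i" for i j using sym by (simp add: b_def)
  define q where "q S = (\<Sum>i<p. \<Sum>j<p. b i j * (sign_fun S i * sign_fun S j))" for S
  have Tb: "T = (\<Sum>i<p. b i i)" using B(1) by (simp add: T_def mat_trace_def b_def)
  have form: "Matrix.vec p x \<bullet> (B *\<^sub>v Matrix.vec p x) = (\<Sum>i<p. \<Sum>j<p. b i j * (x i * x j))" for x
    using B(1) by (simp add: scalar_prod_def atLeast0LessThan b_def sum_distrib_left algebra_simps)
  have form_sign: "Matrix.vec p (\<lambda>i\<in>{..<p}. sqrt r * sign_fun S i) \<bullet> (B *\<^sub>v Matrix.vec p (\<lambda>i\<in>{..<p}. sqrt r * sign_fun S i)) = r * q S"
    if "0 \<le> r" for r S
  proof -
    have "b i j * ((sqrt r * sign_fun S i) * (sqrt r * sign_fun S j)) = (sqrt r * sqrt r) * (b i j * (sign_fun S i * sign_fun S j))" for i j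
      by (simp only: mult_ac)
    then have e: "b i j * ((sqrt r * sign_fun S i) * (sqrt r * sign_fun S j)) = r * (b i j * (sign_fun S i * sign_fun S j))" for i j
      using that by simp
    show ?thesis unfolding form q_def sum_distrib_left
      by (intro sum.cong refl) (simp only: restrict_apply' e)
  qed
  have q0: "0 \<le> q S" for S
    using form_nonneg[OF B, of "Matrix.vec p (\<lambda>i\<in>{..<p}. sqrt 1 * sign_fun S i)"] form_sign[of 1 S] by simp
  have "sign_avg p (\<lambda>S. (q S - T)\<^sup>2) \<le> 2 * (\<Sum>i<p. \<Sum>j<p. (b i j)\<^sup>2)"
    unfolding q_def Tb by (rule sign_avg_quadratic_form) (rule bsym)
  also have "(\<Sum>i<p. \<Sum>j<p. (b i j)\<^sup>2) = (\<Sum>i<p. \<Sum>j<p. ((t \<cdot>\<^sub>m B) $$ (i, j))\<^sup>2) / t\<^sup>2"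
    unfolding sum_divide_distrib using B(1) t by (intro sum.cong) (auto simp: b_def power_mult_distrib)
  also have "\<dots> \<le> p / t\<^sup>2" by (intro divide_right_mono psd_contraction_frobenius B) simp
  finally have "sign_avg p (\<lambda>S. (q S - T)\<^sup>2) \<le> (sqrt (2 * p) / t)\<^sup>2" by (simp add: power_divide)
  then have avg: "sign_avg p (\<lambda>S. \<bar>q S - T\<bar>) \<le> sqrt (2 * p) / t" using t by (intro sign_avg_abs_le) auto
  define u where "u x = (Matrix.vec p x \<bullet> (B *\<^sub>v Matrix.vec p x)) / N" for x
  define g where "g x = u x / (1 + u x)" for x
  have u0: "0 \<le> u x" for x using form_nonneg[OF B, of "Matrix.vec p x"] by (simp add: u_def)
  have gb: "\<bar>g x\<bar> \<le> 1" for x using sat_bounds[OF u0[of x]] unfolding g_def by linarith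
  have gm: "g \<in> borel_measurable (vec_borel p)"
    unfolding g_def u_def form by measurable
  have \<phi>: "\<phi> B = (LINT x|sign_law \<nu> p. g x)" by (simp add: \<phi>_def g_def u_def Let_def)
  have "\<bar>\<phi> B - mp_G \<nu> (T / N)\<bar> = \<bar>LINT r|\<nu>. sign_avg p (\<lambda>S. g (\<lambda>i\<in>{..<p}. sqrt r * sign_fun S i)) - r * (T / N) / (1 + r * (T / N))\<bar>"
    unfolding \<phi> sign_law_integral[OF \<nu> gm gb] mp_G_def using sign_law_integrable[OF \<nu> gm gb] mp_G_integrable[OF \<nu>, of "T / N"] T0 by simp
  also have "\<dots> \<le> (LINT r|\<nu>. \<bar>sign_avg p (\<lambda>S. g (\<lambda>i\<in>{..<p}. sqrt r * sign_fun S i)) - r * (T / N) / (1 + r * (T / N))\<bar>)"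
    by (rule integral_abs_bound)
  also have "\<dots> \<le> mp_modulus \<nu> (sqrt (2 * p) / (t * N))"
    unfolding mp_modulus_def
  proof (rule integral_mono_AE)
    show "AE r in \<nu>. \<bar>sign_avg p (\<lambda>S. g (\<lambda>i\<in>{..<p}. sqrt r * sign_fun S i)) - r * (T / N) / (1 + r * (T / N))\<bar> \<le> min 1 (r * (sqrt (2 * p) / (t * N)))"
      using prob_on_nonneg_AE[OF \<nu>]
    proof eventually_elim
      case (elim r)
      define h where "h S = g (\<lambda>i\<in>{..<p}. sqrt r * sign_fun S i) - r * (T / N) / (1 + r * (T / N))" for S
      have eq: "sign_avg p (\<lambda>S. g (\<lambda>i\<in>{..<p}. sqrt r * sign_fun S i)) - r * (T / N) / (1 + r * (T / N)) = sign_avg p h"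
        using sign_avg_add[of p "\<lambda>S. g (\<lambda>i\<in>{..<p}. sqrt r * sign_fun S i)" "\<lambda>S. - (r * (T / N) / (1 + r * (T / N)))"]
        by (simp add: h_def[abs_def] sign_avg_const)
      have hb: "\<bar>h S\<bar> \<le> min 1 ((r / N) * \<bar>q S - T\<bar>)" for S
      proof -
        have "h S = r * q S / N / (1 + r * q S / N) - r * (T / N) / (1 + r * (T / N))"
          unfolding h_def g_def u_def form_sign[OF elim] ..
        moreover have "\<bar>r * q S / N - r * (T / N)\<bar> = (r / N) * \<bar>q S - T\<bar>"
          using elim by (simp add: abs_mult flip: right_diff_distrib diff_divide_distrib)
        ultimately show ?thesis using sat_diff[of "r * q S / N" "r * (T / N)"] elim q0[of S] T0 by simp
      qed
      have "\<bar>sign_avg p h\<bar> \<le> sign_avg p (\<lambda>S. \<bar>h S\<bar>)"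
        unfolding sign_avg_def by (simp add: divide_right_mono)
      moreover have "sign_avg p (\<lambda>S. \<bar>h S\<bar>) \<le> sign_avg p (\<lambda>S. 1)" using hb by (intro sign_avg_mono) auto
      moreover have "sign_avg p (\<lambda>S. \<bar>h S\<bar>) \<le> sign_avg p (\<lambda>S. (r / N) * \<bar>q S - T\<bar>)" using hb by (intro sign_avg_mono) auto
      moreover have "\<dots> \<le> (r / N) * (sqrt (2 * p) / t)"
        unfolding sign_avg_scale using avg elim by (intro mult_left_mono) auto
      ultimately show ?case unfolding eq by (simp add: sign_avg_const mult.commute)
    qed
  qed (use sign_law_integrable[OF \<nu> gm gb] mp_G_integrable[OF \<nu>, of "T / N"] T0 t mp_modulus_integrable[OF \<nu>, of "sqrt (2 * p) / (t * N)"] in auto)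
  finally show ?thesis by (simp add: T_def)
qed

lemma L2_bound_tendsto_0:
  assumes \<nu>: "prob_on_nonneg \<nu>" and d: "0 < d" and t: "0 < t"
    and \<eta>: "\<eta> \<longlonglongrightarrow> 0" and q: "filterlim q at_top sequentially" and qN: "(\<lambda>n. real (q n) / real (N n)) \<longlonglongrightarrow> d"
  shows "(\<lambda>n. (N n / q n) * \<eta> n / t + (1 / d + N n / q n) / (t * q n)
    + (\<bar>N n / q n - 1 / d\<bar> + mp_modulus \<nu> (1 / (t * N n) + \<bar>q n / N n - d\<bar> / t) / d) / t) \<longlonglongrightarrow> 0"
proof -
  have k: "(\<lambda>n. real (N n) / real (q n)) \<longlonglongrightarrow> 1 / d"
    using tendsto_divide[OF tendsto_const[of 1] qN] d by simp
  have qi: "(\<lambda>n. 1 / real (q n)) \<longlonglongrightarrow> 0"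
    by (rule tendsto_divide_0[OF tendsto_const]) (use q in \<open>auto intro!: filterlim_at_top_imp_at_infinity filterlim_compose[OF filterlim_real_sequentially]\<close>)
  have ev: "eventually (\<lambda>n. 0 < q n) sequentially" by (rule eventually_compose_filterlim[OF eventually_gt_at_top q])
  have Ni: "(\<lambda>n. 1 / real (N n)) \<longlonglongrightarrow> 0"
  proof (rule Lim_transform_eventually)
    show "(\<lambda>n. (real (q n) / real (N n)) * (1 / real (q n))) \<longlonglongrightarrow> 0" using tendsto_mult[OF qN qi] by simp
    show "eventually (\<lambda>n. (real (q n) / real (N n)) * (1 / real (q n)) = 1 / real (N n)) sequentially"
      using ev by eventually_elim simp
  qed
  have "(\<lambda>n. (1 / real (N n)) / t + \<bar>real (q n) / real (N n) - d\<bar> / t) \<longlonglongrightarrow> 0 / t + \<bar>d - d\<bar> / t"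
    by (intro tendsto_intros Ni qN) (use t in auto)
  then have arg: "(\<lambda>n. 1 / (t * real (N n)) + \<bar>real (q n) / real (N n) - d\<bar> / t) \<longlonglongrightarrow> 0"
    by (simp add: mult.commute)
  have md: "(\<lambda>n. mp_modulus \<nu> (1 / (t * real (N n)) + \<bar>real (q n) / real (N n) - d\<bar> / t)) \<longlonglongrightarrow> 0"
    by (rule mp_modulus_tendsto_0[OF \<nu> arg]) (use t in auto)
  have "(\<lambda>n. (N n / q n) * \<eta> n / t + ((1 / d + N n / q n) / t) * (1 / real (q n))
    + (\<bar>N n / q n - 1 / d\<bar> + mp_modulus \<nu> (1 / (t * N n) + \<bar>q n / N n - d\<bar> / t) / d) / t) \<longlonglongrightarrow>
     (1 / d) * 0 / t + ((1 / d + 1 / d) / t) * 0 + (\<bar>1 / d - 1 / d\<bar> + 0 / d) / t"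
    by (intro tendsto_intros k qi md \<eta>) (use t d in auto)
  then show ?thesis by simp
qed

context sample_cov_model begin

lemma random_spectral_measure_ESD: "random_spectral_measure PN (\<lambda>X. ESD (gram_mat q N {..<N} (Y X)))"
proof
  show "prob_on_nonneg (ESD (gram_mat q N {..<N} (Y X)))" for X by (rule prob_on_nonneg_ESD[OF psd_full q])
  fix s :: real assume s: "0 < s"
  have "(\<lambda>X. mat_trace (resolvent s (gram_mat q N {..<N} (Y X))) / q) \<in> borel_measurable PN"
    by (intro borel_measurable_divide borel_measurable_const mat_trace_measurable[of q] mat_measurable_resolvent mat_measurable_gram Y_measurable) auto
  then show "(\<lambda>X. LINT l|ESD (gram_mat q N {..<N} (Y X)). 1 / (l + s)) \<in> borel_measurable PN"
    by (simp only: mat_trace_resolvent_ESD[OF psd_full s q])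
qed

lemma m_ESD: "m X = (LINT l|ESD (gram_mat q N {..<N} (Y X)). 1 / (l + t))"
  unfolding m_def mat_trace_resolvent_ESD[OF psd_full t q] ..

end

section \<open>Transfer of convergence in probability and its proof by second moments\<close>

lemma (in prob_space) integrable_event:
  assumes "A \<in> events"
  shows "integrable M (indicat_real A)"
  by (rule integrable_const_bound[of _ 1], rule AE_I2, simp add: indicator_def, rule borel_measurable_indicator, rule assms)

lemma tends_to_0_in_prob_distr:
  assumes T: "\<And>n. T n \<in> M n \<rightarrow>\<^sub>M K n" and Y: "\<And>n. Y n \<in> borel_measurable (K n)"
  shows "tends_to_0_in_prob (\<lambda>n. distr (M n) (K n) (T n)) Y \<longleftrightarrow> tends_to_0_in_prob M (\<lambda>n \<omega>. Y n (T n \<omega>))"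
proof -
  have "measure (distr (M n) (K n) (T n)) {\<omega> \<in> space (distr (M n) (K n) (T n)). e < \<bar>Y n \<omega>\<bar>} = measure (M n) {\<omega> \<in> space (M n). e < \<bar>Y n (T n \<omega>)\<bar>}" for n e
  proof -
    have [measurable]: "Y n \<in> borel_measurable (K n)" by (rule Y)
    have "{\<omega> \<in> space (K n). e < \<bar>Y n \<omega>\<bar>} \<in> sets (K n)" by measurable
    then show ?thesis
      by (subst measure_distr[OF T]) (use measurable_space[OF T] in \<open>auto intro!: arg_cong[of _ _ "measure (M n)"]\<close>)
  qed
  then show ?thesis by (simp add: tends_to_0_in_prob_def)
qed

lemma tends_to_0_in_prob_L2:
  fixes Y :: "nat \<Rightarrow> 'a \<Rightarrow> real"
  assumes M: "\<And>n. prob_space (M n)" and int: "\<And>n. integrable (M n) (\<lambda>\<omega>. (Y n \<omega>)\<^sup>2)"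
    and lim: "(\<lambda>n. LINT \<omega>|M n. (Y n \<omega>)\<^sup>2) \<longlonglongrightarrow> 0"
  shows "tends_to_0_in_prob M Y"
  unfolding tends_to_0_in_prob_def
proof (intro allI impI)
  fix e :: real assume e: "0 < e"
  have "tends_to_0_in_prob M (\<lambda>n \<omega>. (Y n \<omega>)\<^sup>2)"
    by (rule tends_to_0_in_prob_L1[OF M int]) (use lim in simp)
  then have "(\<lambda>n. measure (M n) {\<omega> \<in> space (M n). e\<^sup>2 < \<bar>(Y n \<omega>)\<^sup>2\<bar>}) \<longlonglongrightarrow> 0"
    using e by (simp add: tends_to_0_in_prob_def)
  moreover have "e\<^sup>2 < \<bar>y\<^sup>2\<bar> \<longleftrightarrow> e < \<bar>y\<bar>" for y :: real
    using e abs_le_square_iff[of y e] by (simp add: not_le[symmetric])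
  ultimately show "(\<lambda>n. measure (M n) {\<omega> \<in> space (M n). e < \<bar>Y n \<omega>\<bar>}) \<longlonglongrightarrow> 0" by simp
qed

section \<open>Dependence of \<open>mp_G\<close> and \<open>mp_modulus\<close> on the radial
  law\<close>

lemma weak_conv_nonneg_integral:
  fixes h :: "real \<Rightarrow> real"
  assumes \<mu>: "prob_on_nonneg \<mu>" "\<And>n. prob_on_nonneg (\<mu>n n)" and w: "weak_conv_m \<mu>n \<mu>"
    and h: "continuous_on {0..} h" "\<And>x. 0 \<le> x \<Longrightarrow> \<bar>h x\<bar> \<le> B" "h \<in> borel_measurable borel"
  shows "(\<lambda>n. LINT l|\<mu>n n. h l) \<longlonglongrightarrow> (LINT l|\<mu>. h l)"
proof -
  define g where "g l = h (max l 0)" for l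
  have rd: "real_distribution \<mu>" "\<And>n. real_distribution (\<mu>n n)" using \<mu> by (auto simp: prob_on_nonneg_def)
  have gc: "continuous_on UNIV g"
    unfolding g_def by (rule continuous_on_compose2[OF h(1)]) (auto intro!: continuous_intros)
  have "(\<lambda>n. LINT l|\<mu>n n. g l) \<longlonglongrightarrow> (LINT l|\<mu>. g l)"
    by (rule weak_conv_imp_integral_bdd_continuous_conv[OF rd(2) rd(1) w, where B=B])
      (use gc h(2) in \<open>auto simp: g_def continuous_on_eq_continuous_at\<close>)
  moreover have "(LINT l|\<rho>. g l) = (LINT l|\<rho>. h l)" if "prob_on_nonneg \<rho>" for \<rho>
  proof (rule integral_cong_AE)
    have s: "sets \<rho> = sets borel" using that by (simp add: prob_on_nonneg_def real_distribution_def real_distribution_axioms_def)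
    have "g \<in> borel_measurable borel" unfolding g_def by (rule measurable_compose[OF _ h(3)]) measurable
    then show "g \<in> borel_measurable \<rho>" "h \<in> borel_measurable \<rho>" using h(3) by (auto simp: measurable_cong_sets[OF s refl])
    show "AE l in \<rho>. g l = h l" using prob_on_nonneg_AE[OF that] by eventually_elim (simp add: g_def)
  qed
  ultimately show ?thesis using \<mu> by simp
qed

lemma mp_G_weak_conv:
  assumes \<nu>: "prob_on_nonneg \<nu>" "\<And>n. prob_on_nonneg (\<nu>n n)" and w: "weak_conv_m \<nu>n \<nu>" and s: "0 \<le> s"
  shows "(\<lambda>n. mp_G (\<nu>n n) s) \<longlonglongrightarrow> mp_G \<nu> s"
  unfolding mp_G_def
proof (rule weak_conv_nonneg_integral[OF \<nu> w, where B=1])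
  have nz: "1 + r * s \<noteq> 0" if "0 \<le> r" for r using s that by (smt (verit) mult_nonneg_nonneg)
  show "continuous_on {0..} (\<lambda>r. r * s / (1 + r * s))" using nz by (intro continuous_intros) auto
  show "\<bar>x * s / (1 + x * s)\<bar> \<le> 1" if "0 \<le> x" for x using sat_bounds[of "x * s"] s that by simp
qed measurable

lemma mp_modulus_weak_conv:
  assumes \<nu>: "prob_on_nonneg \<nu>" "\<And>n. prob_on_nonneg (\<nu>n n)" and w: "weak_conv_m \<nu>n \<nu>" and s: "0 \<le> s"
  shows "(\<lambda>n. mp_modulus (\<nu>n n) s) \<longlonglongrightarrow> mp_modulus \<nu> s"
  unfolding mp_modulus_def
  by (rule weak_conv_nonneg_integral[OF \<nu> w, where B=1]) (use s in \<open>auto intro!: continuous_intros\<close>)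

text \<open>Monotone functions that converge pointwise to a continuous function converge uniformly
  on compact intervals. The modulus of \<nu> selects the mesh, after which finitely many points are
  tested.\<close>

lemma mp_G_weak_conv_uniform:
  assumes \<nu>: "prob_on_nonneg \<nu>" "\<And>n. prob_on_nonneg (\<nu>n n)" and w: "weak_conv_m \<nu>n \<nu>"
    and S: "0 < S" and e: "0 < e"
  shows "eventually (\<lambda>n. \<forall>s\<in>{0..S}. \<bar>mp_G (\<nu>n n) s - mp_G \<nu> s\<bar> \<le> e) sequentially"
proof -
  have "(\<lambda>k. mp_modulus \<nu> (S / real (Suc k))) \<longlonglongrightarrow> 0"
    by (rule mp_modulus_tendsto_0[OF \<nu>(1) LIMSEQ_Suc[OF lim_const_over_n]]) (use S in auto)
  then have "eventually (\<lambda>k. mp_modulus \<nu> (S / real (Suc k)) < e / 2) sequentially"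
    by (rule order_tendstoD) (use e in simp)
  then obtain k where k: "mp_modulus \<nu> (S / real (Suc k)) < e / 2" by (auto dest: eventually_happens)
  define h where "h = S / real (Suc k)"
  have h: "0 < h" "S = real (Suc k) * h" using S by (auto simp: h_def)
  have step: "\<bar>mp_G \<nu> (real i * h) - mp_G \<nu> s\<bar> \<le> e / 2" if "\<bar>real i * h - s\<bar> \<le> h" "0 \<le> s" for i s
    using mp_G_diff[OF \<nu>(1), of "real i * h" s] mp_modulus_mono[OF \<nu>(1) _ that(1)] k that h by (simp add: h_def[symmetric])
  have "eventually (\<lambda>n. \<forall>i\<in>{..Suc (Suc k)}. \<bar>mp_G (\<nu>n n) (real i * h) - mp_G \<nu> (real i * h)\<bar> < e / 2) sequentially"
  proof (intro eventually_ball_finite ballI)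
    fix i
    have "(\<lambda>n. mp_G (\<nu>n n) (real i * h)) \<longlonglongrightarrow> mp_G \<nu> (real i * h)" by (rule mp_G_weak_conv[OF \<nu> w]) (use h in auto)
    from tendstoD[OF this, of "e / 2"] e
    show "eventually (\<lambda>n. \<bar>mp_G (\<nu>n n) (real i * h) - mp_G \<nu> (real i * h)\<bar> < e / 2) sequentially"
      by (simp add: dist_real_def)
  qed simp
  then show ?thesis
  proof eventually_elim
    case (elim n)
    have gi: "\<bar>mp_G (\<nu>n n) (real i * h) - mp_G \<nu> (real i * h)\<bar> < e / 2" if "i \<le> Suc (Suc k)" for i
      using elim that by blast
    show ?case
    proof
      fix s assume s: "s \<in> {0..S}"
      define i where "i = nat \<lfloor>s / h\<rfloor>"
      have i0: "real i = real_of_int \<lfloor>s / h\<rfloor>" using s h by (simp add: i_def)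
      then have "real i \<le> s / h" "s / h \<le> real i + 1" by linarith+
      then have i: "real i * h \<le> s" "s \<le> real (Suc i) * h" using h(1) by (simp_all add: field_simps)
      have "real i * h \<le> real (Suc k) * h" using i(1) s h(2) by simp
      then have "real i \<le> real (Suc k)" using h(1) by simp
      then have ik: "i \<le> Suc (Suc k)" "Suc i \<le> Suc (Suc k)" by linarith+
      have "mp_G (\<nu>n n) s \<le> mp_G (\<nu>n n) (real (Suc i) * h)" using mp_G_mono[OF \<nu>(2)] i(2) s by simp
      also have "\<dots> \<le> mp_G \<nu> (real (Suc i) * h) + e / 2" using gi[OF ik(2)] by linarith
      also have "\<dots> \<le> mp_G \<nu> s + e"
      proof -
        have "\<bar>real (Suc i) * h - s\<bar> \<le> h" using i by (simp add: algebra_simps abs_le_iff)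
        from step[OF this] s have "\<bar>mp_G \<nu> (real (Suc i) * h) - mp_G \<nu> s\<bar> \<le> e / 2" by simp
        then show ?thesis by linarith
      qed
      finally have 1: "mp_G (\<nu>n n) s \<le> mp_G \<nu> s + e" .
      have "\<bar>real i * h - s\<bar> \<le> h" using i by (simp add: algebra_simps abs_le_iff)
      from step[OF this] s have "\<bar>mp_G \<nu> (real i * h) - mp_G \<nu> s\<bar> \<le> e / 2" by simp
      then have "mp_G \<nu> s \<le> mp_G \<nu> (real i * h) + e / 2" by linarith
      also have "\<dots> \<le> mp_G (\<nu>n n) (real i * h) + e" using gi[OF ik(1)] by linarith
      also have "\<dots> \<le> mp_G (\<nu>n n) s + e" using mp_G_mono[OF \<nu>(2), of "real i * h" s] i(1) h by simp
      finally show "\<bar>mp_G (\<nu>n n) s - mp_G \<nu> s\<bar> \<le> e" using 1 by simp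
    qed
  qed
qed

section \<open>Uniform consequences of (RQC)\<close>

lemma quadratic_measurable:
  assumes "A \<in> carrier_mat p p"
  shows "(\<lambda>x. Matrix.vec p x \<bullet> (A *\<^sub>v Matrix.vec p x)) \<in> borel_measurable (vec_borel p)"
  by (rule quadratic_form_measurable[of p]) (use assms in \<open>auto simp: mat_measurable_def\<close>)

lemma norm_measurable: "(\<lambda>x. Matrix.vec p x \<bullet> Matrix.vec p x) \<in> borel_measurable (vec_borel p)"
  using quadratic_measurable[of "1\<^sub>m p" p] by simp

lemma R_val_measurable: "R_val p \<in> borel_measurable (vec_borel p)"
  unfolding R_val_def[abs_def] using norm_measurable by simp

lemma Q_val_measurable: "A \<in> carrier_mat p p \<Longrightarrow> Q_val p A \<in> borel_measurable (vec_borel p)"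
  unfolding Q_val_def[abs_def] using quadratic_measurable R_val_measurable by simp

lemma R_val_nonneg: "0 \<le> R_val p x"
  by (simp add: R_val_def scalar_prod_real_nonneg)

lemma prob_on_nonneg_distr:
  assumes "prob_space M" "Y \<in> borel_measurable M" "\<And>\<omega>. \<omega> \<in> space M \<Longrightarrow> 0 \<le> Y \<omega>"
  shows "prob_on_nonneg (distr M borel Y)"
proof -
  have "emeasure (distr M borel Y) {..<0} = emeasure M (Y -` {..<0} \<inter> space M)" by (rule emeasure_distr) (use assms in auto)
  also have "Y -` {..<0} \<inter> space M = {}" using assms(3) by (auto simp: not_less[symmetric])
  finally show ?thesis using prob_space.real_distribution_distr[OF assms(1,2)] by (simp add: prob_on_nonneg_def)
qed

text \<open>A sequence of projections violating the conclusion would contradict (RQC).\<close>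

lemma RQC_uniform:
  assumes RQC: "RQC M p x" and e: "0 < e"
  shows "eventually (\<lambda>n. \<forall>P. orth_projection (p n) P \<longrightarrow>
    measure (M n) {\<omega> \<in> space (M n). e < \<bar>Q_val (p n) P (x n \<omega>)\<bar>} \<le> e) sequentially"
proof -
  define bad where "bad n P \<longleftrightarrow> orth_projection (p n) P \<and> e < measure (M n) {\<omega> \<in> space (M n). e < \<bar>Q_val (p n) P (x n \<omega>)\<bar>}" for n P
  \<comment> \<open>The identity fills the indices without a bad projection, so that the sequence is
    admissible in (RQC) at every \<open>n\<close>.\<close>
  define P where "P n = (if \<exists>P. bad n P then SOME P. bad n P else 1\<^sub>m (p n))" for n
  have P: "(\<exists>P. bad n P) \<Longrightarrow> bad n (P n)" for n by (auto simp: P_def intro: someI)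
  have "orth_projection (p n) (P n)" for n
    using P[of n] orth_projection_one[of "p n"] by (cases "\<exists>P. bad n P") (auto simp: bad_def P_def)
  then have "tends_to_0_in_prob M (\<lambda>n \<omega>. Q_val (p n) (P n) (x n \<omega>))" using RQC by (simp add: RQC_def)
  then have "(\<lambda>n. measure (M n) {\<omega> \<in> space (M n). e < \<bar>Q_val (p n) (P n) (x n \<omega>)\<bar>}) \<longlonglongrightarrow> 0"
    using e by (simp add: tends_to_0_in_prob_def)
  then have "eventually (\<lambda>n. measure (M n) {\<omega> \<in> space (M n). e < \<bar>Q_val (p n) (P n) (x n \<omega>)\<bar>} < e) sequentially"
    by (rule order_tendstoD) (rule e)
  then show ?thesis
  proof eventually_elim
    case (elim n)
    then have "\<not> bad n (P n)" by (simp add: bad_def)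
    then have "\<not> bad n P'" for P' using P[of n] by blast
    then show ?case by (auto simp: bad_def not_less)
  qed
qed

text \<open>Discretizing into \<open>m\<close> layers costs \<open>R_val / m\<close> for the
  quadratic form and again for the trace term, hence the factor 2.\<close>

lemma Q_val_contraction_layers:
  assumes A: "psd_contraction p A" and m: "0 < m" and p: "0 < p"
  obtains P :: "nat \<Rightarrow> real mat" where "\<And>k. orth_projection p (P k)"
    "\<And>x. \<bar>Q_val p A x\<bar> \<le> 2 * R_val p x / m + (\<Sum>k=1..m. \<bar>Q_val p (P k) x\<bar>) / m"
proof -
  obtain P where P: "\<And>k. orth_projection p (P k)"
    "\<And>v. v \<in> carrier_vec p \<Longrightarrow> \<bar>v \<bullet> (A *\<^sub>v v) - (\<Sum>k=1..m. v \<bullet> (P k *\<^sub>v v)) / m\<bar> \<le> (v \<bullet> v) / m"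
    "\<bar>mat_trace A - (\<Sum>k=1..m. mat_trace (P k)) / m\<bar> \<le> p / m"
    using psd_contraction_layers[OF A m] by blast
  have "\<bar>Q_val p A x\<bar> \<le> 2 * R_val p x / m + (\<Sum>k=1..m. \<bar>Q_val p (P k) x\<bar>) / m" for x
  proof -
    define v where "v = Matrix.vec p x"
    define R where "R = R_val p x"
    define S where "S = (\<Sum>k=1..m. v \<bullet> (P k *\<^sub>v v)) / m"
    define T where "T = (\<Sum>k=1..m. mat_trace (P k)) / m"
    have R0: "0 \<le> R" by (simp add: R_def R_val_nonneg)
    have sumQ: "(\<Sum>k=1..m. Q_val p (P k) x) / m = S / p - R * (T / p)"
      by (simp add: Q_val_def v_def[symmetric] R_def[symmetric] S_def T_def sum_subtractf sum_divide_distrib sum_distrib_left diff_divide_distrib mult.commute)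
    have "\<bar>v \<bullet> (A *\<^sub>v v) - S\<bar> / p \<le> (v \<bullet> v) / m / p"
      using P(2)[of v] unfolding S_def by (intro divide_right_mono) (auto simp: v_def)
    then have 1: "\<bar>(v \<bullet> (A *\<^sub>v v) - S) / p\<bar> \<le> R / m" by (simp add: R_def R_val_def v_def mult.commute)
    have "R / p * \<bar>mat_trace A - T\<bar> \<le> R / p * (p / m)"
      using P(3) R0 unfolding T_def by (intro mult_left_mono) auto
    then have "\<bar>R / p * (mat_trace A - T)\<bar> \<le> R / m" using R0 p by (simp add: abs_mult)
    then have 2: "\<bar>R * ((mat_trace A - T) / p)\<bar> \<le> R / m" by simp
    have "Q_val p A x = (v \<bullet> (A *\<^sub>v v) - S) / p - R * ((mat_trace A - T) / p) + (\<Sum>k=1..m. Q_val p (P k) x) / m"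
      unfolding sumQ by (simp add: Q_val_def v_def[symmetric] R_def[symmetric] diff_divide_distrib right_diff_distrib)
    moreover have "\<bar>(\<Sum>k=1..m. Q_val p (P k) x) / m\<bar> \<le> (\<Sum>k=1..m. \<bar>Q_val p (P k) x\<bar>) / m"
      by (simp add: divide_right_mono)
    ultimately show ?thesis using 1 2 unfolding R_def[symmetric] by linarith
  qed
  then show ?thesis using that P(1) by blast
qed

text \<open>The number of layers is fixed first, from the limit law of the radii alone. Only then is
  (RQC) applied to that many projections; these depend on \<open>A\<close>, which is harmless
  because \<open>rqc\<close> holds for all projections at once.\<close>

lemma contraction_form_uniform:
  fixes L :: "nat \<Rightarrow> (nat \<Rightarrow> real) measure"
  assumes p: "\<And>n. 0 < p n" and L: "\<And>n. prob_space (L n)" and sL: "\<And>n. sets (L n) = sets (vec_borel (p n))"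
    and \<nu>: "prob_on_nonneg \<nu>" and w: "weak_conv_m (\<lambda>n. distr (L n) borel (R_val (p n))) \<nu>"
    and rqc: "\<And>e. 0 < e \<Longrightarrow> eventually (\<lambda>n. \<forall>P. orth_projection (p n) P \<longrightarrow>
        measure (L n) {y \<in> space (L n). e < \<bar>Q_val (p n) P y\<bar>} \<le> e) sequentially"
    and K: "0 < K" and e: "0 < e"
  shows "eventually (\<lambda>n. \<forall>A. psd_contraction (p n) A \<longrightarrow> (LINT y|L n. min 1 (K * \<bar>Q_val (p n) A y\<bar>)) \<le> e) sequentially"
proof -
  have mb: "f \<in> borel_measurable (vec_borel (p n)) \<Longrightarrow> f \<in> borel_measurable (L n)" for f :: "_ \<Rightarrow> real" and n
    by (simp add: measurable_cong_sets[OF sL refl])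
  have Rm: "R_val (p n) \<in> borel_measurable (L n)" for n by (rule mb[OF R_val_measurable])
  have Rn: "prob_on_nonneg (distr (L n) borel (R_val (p n)))" for n
    by (rule prob_on_nonneg_distr[OF L Rm]) (rule R_val_nonneg)
  have "(\<lambda>k. mp_modulus \<nu> ((2 * K) / real (Suc k))) \<longlonglongrightarrow> 0"
    by (rule mp_modulus_tendsto_0[OF \<nu> LIMSEQ_Suc[OF lim_const_over_n]]) (use K in auto)
  then have "eventually (\<lambda>k. mp_modulus \<nu> ((2 * K) / real (Suc k)) < e / 2) sequentially"
    by (rule order_tendstoD) (use e in simp)
  then obtain k where k: "mp_modulus \<nu> (2 * K / real (Suc k)) < e / 2" by (auto dest: eventually_happens)
  define m where "m = Suc k"
  define u where "u = K + real m"
  \<comment> \<open>Solves \<open>K * d + m * d = e / 2\<close>: the first term bounds the forms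
    when all \<open>m\<close> layers deviate by at most \<open>d\<close>, the second the total
    probability of the \<open>m\<close> exceptional events.\<close>
  define d where "d = e / (2 * u)"
  have u: "0 < u" using K by (simp add: u_def m_def)
  then have "u * d = e / 2" "0 < d" using e by (simp_all add: d_def)
  then have d: "0 < d" "K * d + m * d = e / 2" by (simp_all add: u_def distrib_right)
  have m: "0 < m" by (simp add: m_def)
  have "eventually (\<lambda>n. mp_modulus (distr (L n) borel (R_val (p n))) (2 * K / m) < e / 2) sequentially"
    by (rule order_tendstoD(2)[OF mp_modulus_weak_conv[OF \<nu> Rn w]]) (use k K in \<open>auto simp: m_def\<close>)
  then show ?thesis using rqc[OF d(1)]
  proof eventually_elim
    case (elim n)
    interpret L: prob_space "L n" by (rule L)
    show ?case
    proof (intro allI impI)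
      fix A assume A: "psd_contraction (p n) A"
      obtain P where P: "\<And>k. orth_projection (p n) (P k)"
        "\<And>x. \<bar>Q_val (p n) A x\<bar> \<le> 2 * R_val (p n) x / m + (\<Sum>k=1..m. \<bar>Q_val (p n) (P k) x\<bar>) / m"
        using Q_val_contraction_layers[OF A m p] by blast
      define E where "E k = {y \<in> space (L n). d < \<bar>Q_val (p n) (P k) y\<bar>}" for k
      have Qm: "Q_val (p n) (P k) \<in> borel_measurable (L n)" for k
        using P(1)[of k] by (intro mb Q_val_measurable) (simp add: orth_projection_def)
      have QA: "Q_val (p n) A \<in> borel_measurable (L n)"
        using A by (intro mb Q_val_measurable) (simp add: psd_contraction_def psd_mat_def)
      have Es: "E k \<in> sets (L n)" for k unfolding E_def using Qm by measurable
      define f1 where "f1 y = min 1 (R_val (p n) y * (2 * K / m))" for y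
      define f2 where "f2 y = (\<Sum>k=1..m. indicat_real (E k) y)" for y
      have i1: "integrable (L n) f1" unfolding f1_def
        by (rule L.integrable_const_bound[of _ 1]) (use Rm R_val_nonneg K in auto)
      have i2: "integrable (L n) f2" unfolding f2_def using Es by (intro Bochner_Integration.integrable_sum L.integrable_event)
      have pt: "min 1 (K * \<bar>Q_val (p n) A y\<bar>) \<le> f1 y + (K * d + f2 y)" if y: "y \<in> space (L n)" for y
      proof (cases "\<exists>k\<in>{1..m}. y \<in> E k")
        case True
        then obtain j where j: "j \<in> {1..m}" "y \<in> E j" by blast
        have "indicat_real (E j) y \<le> f2 y" unfolding f2_def by (rule member_le_sum[OF j(1)]) auto
        moreover have "0 \<le> f1 y" using R_val_nonneg K by (simp add: f1_def)
        moreover have "0 \<le> K * d" using K d by simp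
        ultimately show ?thesis using j(2) by simp
      next
        case False
        then have "(\<Sum>k=1..m. \<bar>Q_val (p n) (P k) y\<bar>) \<le> (\<Sum>k=1..m. d)"
          using y by (intro sum_mono) (auto simp: E_def not_less)
        then have "(\<Sum>k=1..m. \<bar>Q_val (p n) (P k) y\<bar>) / m \<le> d" using m by (simp add: field_simps)
        then have "\<bar>Q_val (p n) A y\<bar> \<le> 2 * R_val (p n) y / m + d" using P(2)[of y] by linarith
        then have "K * \<bar>Q_val (p n) A y\<bar> \<le> K * (2 * R_val (p n) y / m + d)" using K by (intro mult_left_mono) auto
        then have "K * \<bar>Q_val (p n) A y\<bar> \<le> R_val (p n) y * (2 * K / m) + K * d" by (simp add: algebra_simps)
        moreover have "0 \<le> f2 y" unfolding f2_def by (intro sum_nonneg) auto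
        moreover have "0 \<le> K * d" using K d by simp
        ultimately show ?thesis by (simp add: f1_def)
      qed
      have "(LINT y|L n. min 1 (K * \<bar>Q_val (p n) A y\<bar>)) \<le> (LINT y|L n. f1 y + (K * d + f2 y))"
        by (rule integral_mono)
          (use pt i1 i2 QA K in \<open>auto intro!: L.integrable_const_bound[of _ 1] Bochner_Integration.integrable_add\<close>)
      also have "\<dots> = (LINT y|L n. f1 y) + (K * d + (LINT y|L n. f2 y))" using i1 i2 by (simp add: L.prob_space)
      also have "(LINT y|L n. f1 y) = mp_modulus (distr (L n) borel (R_val (p n))) (2 * K / m)"
        unfolding mp_modulus_def f1_def by (subst integral_distr[OF Rm]) auto
      also have "(LINT y|L n. f2 y) = (\<Sum>k=1..m. measure (L n) (E k))"
        unfolding f2_def using Es by (subst Bochner_Integration.integral_sum) (auto intro: L.integrable_event)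
      also have "\<dots> \<le> (\<Sum>k=1..m. d)" unfolding E_def using elim(2) P(1) by (intro sum_mono) auto
      finally show "(LINT y|L n. min 1 (K * \<bar>Q_val (p n) A y\<bar>)) \<le> e" using elim(1) d by simp
    qed
  qed
qed

context sample_cov_model begin

text \<open>The normalized form of \<open>B\<close> minus \<open>R_val\<close> times
  \<open>tr B / N\<close> is exactly \<open>p / (t * N)\<close> times the \<open>Q_val\<close> of
  the conjugated contraction; \<open>sat_diff\<close> turns this identity into the bound.\<close>

lemma form_concentration:
  assumes CC: "C * transpose_mat C = 1\<^sub>m q" and p: "0 < p"
    and B: "B \<in> carrier_mat q q" "psd_contraction q (t \<cdot>\<^sub>m B)"
  shows "\<bar>\<phi> B - mp_G (distr L borel (R_val p)) (mat_trace B / N)\<bar>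
    \<le> (LINT x|L. min 1 (p / (t * N) * \<bar>Q_val p (transpose_mat C * (t \<cdot>\<^sub>m B) * C) x\<bar>))"
proof -
  define A where "A = transpose_mat C * (t \<cdot>\<^sub>m B) * C"
  define s where "s = mat_trace B / N"
  define u where "u x = ((C *\<^sub>v Matrix.vec p x) \<bullet> (B *\<^sub>v (C *\<^sub>v Matrix.vec p x))) / N" for x
  have mb: "f \<in> borel_measurable (vec_borel p) \<Longrightarrow> f \<in> borel_measurable L" for f :: "_ \<Rightarrow> real"
    by (simp add: measurable_cong_sets[OF sets_L refl])
  have s0: "0 \<le> s" using trace_class_bounds[OF B] by (simp add: s_def)
  have Cx: "C *\<^sub>v Matrix.vec p x \<in> carrier_vec q" for x using C by auto
  have u0: "0 \<le> u x" for x using form_nonneg[OF B Cx] by (simp add: u_def)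
  have Rs: "0 \<le> R_val p x * s" for x using s0 R_val_nonneg by simp
  have diff: "u x - R_val p x * s = p / (t * N) * Q_val p A x" for x
  proof -
    have "Matrix.vec p x \<bullet> (A *\<^sub>v Matrix.vec p x) = t * (u x * N)"
      unfolding A_def using conj_quadratic[OF C CC B(2), of "Matrix.vec p x"] Cx[of x] B(1) N
      by (simp add: u_def smult_mat_mult_vec)
    moreover have "mat_trace A = t * mat_trace B"
      unfolding A_def mat_trace_conj[OF C CC B(2)] by (rule mat_trace_smult[OF B(1)])
    ultimately show ?thesis using p t N by (simp add: Q_val_def s_def field_simps)
  qed
  have Ac: "A \<in> carrier_mat p p" using psd_contraction_conj[OF C CC B(2)] by (simp add: A_def psd_contraction_def psd_mat_def)
  have Rm: "R_val p \<in> borel_measurable L" by (rule mb[OF R_val_measurable])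
  have i1: "integrable L (\<lambda>x. u x / (1 + u x))" using \<phi>_integrable[OF B] by (simp add: u_def)
  have i2: "integrable L (\<lambda>x. R_val p x * s / (1 + R_val p x * s))"
  proof (rule L.integrable_const_bound[of _ 1])
    have "\<bar>R_val p x * s / (1 + R_val p x * s)\<bar> \<le> 1" for x using sat_bounds[OF Rs[of x]] by linarith
    then show "AE x in L. norm (R_val p x * s / (1 + R_val p x * s)) \<le> 1" by simp
  qed (use Rm in measurable)
  have \<phi>: "\<phi> B = (LINT x|L. u x / (1 + u x))" by (simp add: \<phi>_def u_def Let_def)
  have G: "mp_G (distr L borel (R_val p)) s = (LINT x|L. R_val p x * s / (1 + R_val p x * s))"
    unfolding mp_G_def by (rule integral_distr[OF Rm]) measurable
  have "\<bar>\<phi> B - mp_G (distr L borel (R_val p)) s\<bar> = \<bar>LINT x|L. u x / (1 + u x) - R_val p x * s / (1 + R_val p x * s)\<bar>"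
    unfolding \<phi> G using i1 i2 by simp
  also have "\<dots> \<le> (LINT x|L. \<bar>u x / (1 + u x) - R_val p x * s / (1 + R_val p x * s)\<bar>)" by (rule integral_abs_bound)
  also have "\<dots> \<le> (LINT x|L. min 1 (p / (t * N) * \<bar>Q_val p A x\<bar>))"
  proof (rule integral_mono)
    show "integrable L (\<lambda>x. \<bar>u x / (1 + u x) - R_val p x * s / (1 + R_val p x * s)\<bar>)" using i1 i2 by simp
    show "integrable L (\<lambda>x. min 1 (p / (t * N) * \<bar>Q_val p A x\<bar>))"
      by (rule L.integrable_const_bound[of _ 1]) (use mb[OF Q_val_measurable[OF Ac]] t in auto)
    show "\<bar>u x / (1 + u x) - R_val p x * s / (1 + R_val p x * s)\<bar> \<le> min 1 (p / (t * N) * \<bar>Q_val p A x\<bar>)" for x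
      using sat_diff[OF u0[of x] Rs[of x]] t unfolding diff by (simp add: abs_mult)
  qed
  finally show ?thesis by (simp add: A_def s_def)
qed

lemma \<phi>_mp_G_diff:
  assumes \<nu>: "prob_on_nonneg \<nu>" and B: "B \<in> carrier_mat q q" "psd_contraction q (t \<cdot>\<^sub>m B)"
  shows "\<bar>\<phi> B - mp_G \<nu> (mat_trace B / N)\<bar> \<le> 1"
  using \<phi>_bounds[OF B] mp_G_bounds[OF \<nu>, of "mat_trace B / N"] trace_class_bounds(1)[OF B] by (simp add: abs_le_iff)

end

lemma uniform_error_sequence:
  fixes f :: "nat \<Rightarrow> 'b \<Rightarrow> real"
  assumes bd: "\<And>n B. B \<in> S n \<Longrightarrow> f n B \<le> b"
    and ev: "\<And>e. 0 < e \<Longrightarrow> eventually (\<lambda>n. \<forall>B\<in>S n. f n B \<le> e) sequentially"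
  obtains \<eta> where "\<eta> \<longlonglongrightarrow> 0" "\<And>n B. B \<in> S n \<Longrightarrow> f n B \<le> \<eta> n"
proof -
  \<comment> \<open>Inserting 0 keeps the supremum meaningful when \<open>S n\<close> is empty and
    makes it nonnegative.\<close>
  define \<eta> where "\<eta> n = Sup (insert 0 (f n ` S n))" for n
  have bdd: "bdd_above (insert 0 (f n ` S n))" for n
    by (rule bdd_aboveI[of _ "max 0 b"]) (use bd in \<open>auto simp: le_max_iff_disj\<close>)
  have up: "f n B \<le> \<eta> n" if "B \<in> S n" for n B unfolding \<eta>_def by (rule cSup_upper[OF _ bdd]) (use that in simp)
  have pos: "0 \<le> \<eta> n" for n unfolding \<eta>_def by (rule cSup_upper[OF _ bdd]) simp
  have "\<eta> \<longlonglongrightarrow> 0"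
  proof (rule tendstoI)
    fix e :: real assume e: "0 < e"
    have "eventually (\<lambda>n. \<forall>B\<in>S n. f n B \<le> e / 2) sequentially" using ev[of "e / 2"] e by simp
    then show "eventually (\<lambda>n. dist (\<eta> n) 0 < e) sequentially"
    proof eventually_elim
      case (elim n)
      have "\<eta> n \<le> e / 2" unfolding \<eta>_def using elim e by (intro cSup_least) auto
      then show ?case using pos[of n] e by (simp add: dist_real_def)
    qed
  qed
  then show ?thesis using that up by blast
qed

text \<open>If \<open>m\<close> is the transform of a law at \<open>t\<close>, then
  \<open>1 - t * m\<close> is the mean of \<open>l / (l + t)\<close>, a smooth tail. The bound tends
  to 0 for large \<open>t\<close>; it gives tightness in the construction of the limit law and the
  choice of \<open>t\<close> in the converse.\<close>

lemma mp_real_eq_tail: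
  assumes \<nu>: "prob_on_nonneg \<nu>" and d: "0 < d" and t: "0 < t" and m: "0 \<le> m" "m \<le> 1 / t" "mp_real_eq d \<nu> t m"
  shows "1 - t * m \<le> mp_modulus \<nu> (d / t) / d"
proof -
  have "mp_G \<nu> (d * m) \<le> mp_modulus \<nu> (d * m)"
    using mp_G_diff[OF \<nu>, of "d * m" 0] d m by (simp add: mp_G_def)
  also have "\<dots> \<le> mp_modulus \<nu> (d / t)"
  proof (rule mp_modulus_mono[OF \<nu>])
    show "d * m \<le> d / t" using mult_left_mono[OF m(2), of d] d by simp
  qed (use d m in auto)
  finally show ?thesis using m(3) d by (simp add: mp_real_eq_def divide_right_mono)
qed

text \<open>Probabilistic method: for sign vectors with random radii the mean squared errors of the
  resolvent traces tend to 0, so for large \<open>n\<close> some realization has an empirical law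
  with the prescribed transforms up to \<open>e\<close>.\<close>

lemma sign_law_sample_exists:
  assumes \<nu>: "prob_on_nonneg \<nu>" and d: "0 < d" and T: "finite T" "\<And>t. t \<in> T \<Longrightarrow> 0 < t"
    and ms: "\<And>t. 0 < t \<Longrightarrow> 0 < ms t" "\<And>t. 0 < t \<Longrightarrow> ms t \<le> 1 / t" "\<And>t. 0 < t \<Longrightarrow> mp_real_eq d \<nu> t (ms t)"
    and e: "0 < e"
  shows "\<exists>\<rho>. prob_on_nonneg \<rho> \<and> (\<forall>t\<in>T. \<bar>(LINT l|\<rho>. 1 / (l + t)) - ms t\<bar> \<le> e)"
proof -
  define p where "p n = Suc n" for n
  \<comment> \<open>Makes \<open>p / N\<close> tend to \<open>d\<close>; rounding up keeps the
    sample size positive.\<close>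
  define N where "N n = nat \<lceil>real (Suc n) / d\<rceil>" for n
  define P where "P n = PiM {..<N n} (\<lambda>_. sign_law \<nu> (p n))" for n
  define m where "m n t = sample_cov_model.m (p n) (p n) (N n) (1\<^sub>m (p n)) t" for n t
  define ES where "ES n X = ESD (gram_mat (p n) (N n) {..<N n} (sample_cov_model.Y (p n) (1\<^sub>m (p n)) X))" for n X
  have Nlow: "real (Suc n) / d \<le> real (N n)" for n unfolding N_def by linarith
  have Nup: "real (N n) \<le> real (Suc n) / d + 1" for n
    unfolding N_def using d by (smt (verit) divide_nonneg_pos of_int_ceiling_le_add_one of_nat_0_le_iff of_nat_nat zero_le_ceiling)
  have pN: "0 < p n" "0 < N n" for n using d by (auto simp: p_def N_def)
  have model: "sample_cov_model (p n) (p n) (N n) (1\<^sub>m (p n)) (sign_law \<nu> (p n)) t" if "0 < t" for n t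
    using sign_law_model[OF \<nu> pN that] .
  have mE: "m n t X = (LINT l|ES n X. 1 / (l + t))" if "0 < t" for n t X
    using sample_cov_model.m_ESD[OF model[OF that]] by (simp add: m_def ES_def)
  have mm: "m n t \<in> borel_measurable (P n)" if "0 < t" for n t
    using sample_cov_model.m_measurable[OF model[OF that]] by (simp add: m_def P_def)
  have mb: "0 \<le> m n t X" "m n t X \<le> 1 / t" if "0 < t" for n t X
    using sample_cov_model.m_bounds[OF model[OF that]] by (auto simp: m_def)
  have ESn: "prob_on_nonneg (ES n X)" for n X
    unfolding ES_def by (rule prob_on_nonneg_ESD[OF sample_cov_model.psd_full[OF model[of 1]] pN(1)]) simp
  have prP: "prob_space (P n)" for n
    unfolding P_def by (rule prob_space_PiM) (rule sign_law_prob[OF \<nu>])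
  have plim: "filterlim p at_top sequentially" unfolding p_def by (rule filterlim_Suc)
  have pr: "(\<lambda>n. 1 / real (Suc n)) \<longlonglongrightarrow> 0" by (rule LIMSEQ_Suc[OF lim_1_over_n])
  have Nr: "(\<lambda>n. real (N n) / real (p n)) \<longlonglongrightarrow> 1 / d"
  proof (rule tendsto_sandwich)
    show "(\<lambda>n. 1 / d) \<longlonglongrightarrow> 1 / d" by simp
    show "(\<lambda>n. 1 / d + 1 / real (Suc n)) \<longlonglongrightarrow> 1 / d" using tendsto_add[OF tendsto_const pr] by simp
    show "eventually (\<lambda>n. 1 / d \<le> real (N n) / real (p n)) sequentially"
    proof (intro always_eventually allI)
      show "1 / d \<le> real (N n) / real (p n)" for n using Nlow[of n] d by (simp add: p_def divide_simps mult.commute)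
    qed
    show "eventually (\<lambda>n. real (N n) / real (p n) \<le> 1 / d + 1 / real (Suc n)) sequentially"
    proof (intro always_eventually allI)
      fix n
      have "real (N n) / real (p n) \<le> (real (Suc n) / d + 1) / real (Suc n)" unfolding p_def by (rule divide_right_mono[OF Nup]) simp
      also have "\<dots> = 1 / d + 1 / real (Suc n)" by (simp only: add_divide_distrib) (simp del: of_nat_Suc)
      finally show "real (N n) / real (p n) \<le> 1 / d + 1 / real (Suc n)" .
    qed
  qed
  have qN: "(\<lambda>n. real (p n) / real (N n)) \<longlonglongrightarrow> d"
    using tendsto_divide[OF tendsto_const[of 1] Nr] d by simp
  have L2: "(\<lambda>n. LINT X|P n. (m n t X - ms t)\<^sup>2) \<longlonglongrightarrow> 0" if t: "0 < t" for t
  proof -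
    have e0: "(\<lambda>n. (sqrt 2 / t) * (real (p n) / real (N n)) * sqrt (1 / real (p n))) \<longlonglongrightarrow> (sqrt 2 / t) * d * sqrt 0"
      by (intro tendsto_intros qN pr[folded p_def])
    have eq: "(sqrt 2 / t) * (real (p n) / real (N n)) * sqrt (1 / real (p n)) = sqrt (2 * p n) / (t * N n)" for n
    proof -
      have "real (p n) * sqrt (1 / real (p n)) = sqrt (real (p n))" by (simp add: real_sqrt_divide real_div_sqrt)
      then have s: "sqrt (2 * real (p n)) = sqrt 2 * (real (p n) * sqrt (1 / real (p n)))" by (simp add: real_sqrt_mult)
      have alg: "(a / u) * (b / v) * w = (a * (b * w)) / (u * v)" for a b u v w :: real by simp
      show ?thesis unfolding of_nat_mult of_nat_numeral s by (rule alg)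
    qed
    have "(\<lambda>n. mp_modulus \<nu> (sqrt (2 * p n) / (t * N n))) \<longlonglongrightarrow> 0"
      by (rule mp_modulus_tendsto_0[OF \<nu>]) (use e0[unfolded eq] t in auto)
    note lim = L2_bound_tendsto_0[OF \<nu> d t this plim qN]
    have "(\<lambda>n. t * (LINT X|P n. (m n t X - ms t)\<^sup>2)) \<longlonglongrightarrow> 0"
    proof (rule tendsto_sandwich[OF _ _ tendsto_const lim])
      show "eventually (\<lambda>n. 0 \<le> t * (LINT X|P n. (m n t X - ms t)\<^sup>2)) sequentially" using t by simp
      show "eventually (\<lambda>n. t * (LINT X|P n. (m n t X - ms t)\<^sup>2) \<le> (N n / p n) * mp_modulus \<nu> (sqrt (2 * p n) / (t * N n)) / t + (1 / d + N n / p n) / (t * p n)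
    + (\<bar>N n / p n - 1 / d\<bar> + mp_modulus \<nu> (1 / (t * N n) + \<bar>p n / N n - d\<bar> / t) / d) / t) sequentially"
        unfolding P_def m_def
        by (intro always_eventually allI sample_cov_model.resolvent_trace_L2_bound[OF model[OF t] \<nu> d ms[OF t]])
          (rule sign_law_form[OF \<nu> pN t])
    qed
    from tendsto_mult[OF tendsto_const[of "1/t"] this] show ?thesis using t by simp
  qed
  have int: "integrable (P n) (\<lambda>X. (m n t X - ms t)\<^sup>2)" if "0 < t" for n t
  proof (rule finite_measure.integrable_const_bound[where B="(1 / t)\<^sup>2"])
    show "finite_measure (P n)" using prP by (simp add: prob_space_def)
    show "(\<lambda>X. (m n t X - ms t)\<^sup>2) \<in> borel_measurable (P n)" using mm[OF that] by simp
    have "\<bar>m n t X - ms t\<bar> \<le> \<bar>1 / t\<bar>" for X using mb[OF that, of n X] ms(1,2)[OF that] by linarith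
    then have "(m n t X - ms t)\<^sup>2 \<le> (1 / t)\<^sup>2" for X unfolding abs_le_square_iff .
    then show "AE X in P n. norm ((m n t X - ms t)\<^sup>2) \<le> (1 / t)\<^sup>2" by simp
  qed
  have "(\<lambda>n. \<Sum>t\<in>T. LINT X|P n. (m n t X - ms t)\<^sup>2) \<longlonglongrightarrow> (\<Sum>t\<in>T. 0)"
    by (intro tendsto_sum L2 T)
  then have "eventually (\<lambda>n. (\<Sum>t\<in>T. LINT X|P n. (m n t X - ms t)\<^sup>2) < e\<^sup>2) sequentially"
    by (rule order_tendstoD) (use e in simp)
  then obtain n where n: "(\<Sum>t\<in>T. LINT X|P n. (m n t X - ms t)\<^sup>2) < e\<^sup>2"
    by (auto dest: eventually_happens)
  \<comment> \<open>A single realization has to serve all parameters of \<open>T\<close>, therefore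
    the squared errors are added before a point below their mean bound is picked.\<close>
  define F where "F X = (\<Sum>t\<in>T. (m n t X - ms t)\<^sup>2)" for X
  have Fi: "integrable (P n) F" "(LINT X|P n. F X) < e\<^sup>2"
    using n int T unfolding F_def[abs_def] by (auto simp: Bochner_Integration.integral_sum intro: Bochner_Integration.integrable_sum)
  interpret Pn: prob_space "P n" by (rule prP)
  have "\<exists>X\<in>space (P n). F X < e\<^sup>2"
  proof (rule ccontr)
    assume "\<not> ?thesis"
    then have "AE X in P n. e\<^sup>2 \<le> F X" by (intro AE_I2) (auto simp: not_less)
    then have "e\<^sup>2 \<le> (LINT X|P n. F X)" by (rule Pn.integral_ge_const[OF Fi(1)])
    then show False using Fi(2) by simp
  qed
  then obtain X where X: "F X < e\<^sup>2" by blast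
  have "\<bar>(LINT l|ES n X. 1 / (l + t)) - ms t\<bar> \<le> e" if "t \<in> T" for t
  proof -
    have "(m n t X - ms t)\<^sup>2 \<le> F X" unfolding F_def using T(1) that by (intro member_le_sum) auto
    then have "\<bar>m n t X - ms t\<bar> \<le> \<bar>e\<bar>" using X by (simp add: abs_le_square_iff)
    then show ?thesis using mE[OF T(2)[OF that]] e by simp
  qed
  then show ?thesis using ESn by blast
qed

text \<open>The quantity in \<open>tail\<close> is the mean of \<open>l / (l + T)\<close>, which is
  at least 1/2 beyond \<open>T\<close>. The finitely many indices before the bound takes effect are
  covered by enlarging the interval.\<close>

lemma prob_on_nonneg_tight:
  assumes \<rho>: "\<And>n. prob_on_nonneg (\<rho> n)"
    and tail: "\<And>e. 0 < e \<Longrightarrow> \<exists>T>0. eventually (\<lambda>n. 1 - T * (LINT l|\<rho> n. 1 / (l + T)) \<le> e) sequentially"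
  shows "tight \<rho>"
  unfolding tight_def
proof (intro conjI allI impI)
  show rd: "real_distribution (\<rho> n)" for n using \<rho> by (simp add: prob_on_nonneg_def)
  fix e :: real assume e: "0 < e"
  obtain T where T: "0 < T" and ev: "eventually (\<lambda>n. 1 - T * (LINT l|\<rho> n. 1 / (l + T)) \<le> e / 4) sequentially"
    using tail[of "e / 4"] e by auto
  have cdfT: "1 - cdf (\<rho> n) T \<le> 2 * (1 - T * (LINT l|\<rho> n. 1 / (l + T)))" for n
  proof -
    interpret R: real_distribution "\<rho> n" by (rule rd)
    have "1 - cdf (\<rho> n) T = measure (\<rho> n) {T<..}"
      using R.prob_compl[of "{..T}"] by (simp add: cdf_def Compl_eq_Diff_UNIV[symmetric])
    also have "\<dots> = (LINT l|\<rho> n. indicator {T<..} l)" by simp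
    also have "\<dots> \<le> (LINT l|\<rho> n. 2 * (1 - T * (1 / (l + T))))"
    proof (rule integral_mono_AE)
      show "integrable (\<rho> n) (indicator {T<..} :: real \<Rightarrow> real)"
        by (rule R.integrable_event) simp
      show "integrable (\<rho> n) (\<lambda>l. 2 * (1 - T * (1 / (l + T))))"
        using resolvent_function_integrable[OF \<rho> T, of n] by (intro integrable_mult_right Bochner_Integration.integrable_diff) auto
      show "AE l in \<rho> n. indicator {T<..} l \<le> 2 * (1 - T * (1 / (l + T)))"
        using prob_on_nonneg_AE[OF \<rho>[of n]]
        by eventually_elim (use T in \<open>auto simp: indicator_def divide_simps\<close>)
    qed
    also have "\<dots> = 2 * (1 - T * (LINT l|\<rho> n. 1 / (l + T)))"
    proof -
      define F where "F l = 1 / (l + T)" for l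
      have "integrable (\<rho> n) F" using resolvent_function_integrable[OF \<rho> T, of n] by (simp add: F_def[abs_def])
      then have "(LINT l|\<rho> n. 2 * (1 - T * F l)) = 2 * (1 - T * (LINT l|\<rho> n. F l))" using R.prob_space by simp
      then show ?thesis by (simp only: F_def)
    qed
    finally show ?thesis .
  qed
  from ev obtain K where K0: "\<And>n. K \<le> n \<Longrightarrow> 1 - T * (LINT l|\<rho> n. 1 / (l + T)) \<le> e / 4"
    unfolding eventually_sequentially by blast
  have K: "1 - e < cdf (\<rho> n) T" if "K \<le> n" for n
  proof -
    have "1 - cdf (\<rho> n) T \<le> 2 * (1 - T * (LINT l|\<rho> n. 1 / (l + T)))" by (rule cdfT)
    also have "\<dots> \<le> 2 * (e / 4)" by (rule mult_left_mono[OF K0[OF that]]) simp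
    also have "\<dots> < e" using e by simp
    finally show ?thesis by (simp add: algebra_simps)
  qed
  have "eventually (\<lambda>b. \<forall>n\<in>{..<K}. 1 - e < cdf (\<rho> n) b) at_top"
  proof (rule eventually_ball_finite)
    show "\<forall>n\<in>{..<K}. eventually (\<lambda>b. 1 - e < cdf (\<rho> n) b) at_top"
      using e by (intro ballI order_tendstoD(1)[OF real_distribution.cdf_lim_at_top_prob[OF rd]]) simp
  qed simp
  then have "eventually (\<lambda>b. (\<forall>n\<in>{..<K}. 1 - e < cdf (\<rho> n) b) \<and> T \<le> b) at_top"
    using eventually_ge_at_top[of T] by eventually_elim simp
  then obtain b where b: "\<forall>n\<in>{..<K}. 1 - e < cdf (\<rho> n) b" "T \<le> b" by (auto dest: eventually_happens)
  have "1 - e < measure (\<rho> n) {-1<..b}" for n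
  proof -
    interpret R: real_distribution "\<rho> n" by (rule rd)
    have "cdf (\<rho> n) (-1) \<le> measure (\<rho> n) {..<0}" unfolding cdf_def by (rule R.finite_measure_mono) auto
    also have "\<dots> = 0" using \<rho>[of n] by (simp add: prob_on_nonneg_def measure_def)
    finally have "cdf (\<rho> n) b \<le> measure (\<rho> n) {-1<..b}" using R.cdf_diff_eq[of "-1" b] b(2) T by simp
    moreover have "1 - e < cdf (\<rho> n) b"
    proof (cases "n < K")
      case False
      then show ?thesis using K[of n] R.cdf_nondecreasing[OF b(2)] by linarith
    qed (use b in auto)
    ultimately show ?thesis by linarith
  qed
  then show "\<exists>a b. a < b \<and> (\<forall>n. 1 - e < measure (\<rho> n) {a<..b})"
    using b(2) T by (intro exI[of _ "-1"] exI[of _ b]) auto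
qed

text \<open>Test with a bounded continuous function that is positive exactly on the negative half
  line.\<close>

lemma weak_conv_prob_on_nonneg:
  assumes \<rho>: "\<And>n. prob_on_nonneg (\<rho> n)" and \<mu>: "real_distribution \<mu>" and w: "weak_conv_m \<rho> \<mu>"
  shows "prob_on_nonneg \<mu>"
proof -
  interpret R: real_distribution \<mu> by (rule \<mu>)
  define g where "g l = min 1 (max 0 (- l))" for l :: real
  have rd: "\<And>n. real_distribution (\<rho> n)" using \<rho> by (simp add: prob_on_nonneg_def)
  have gm: "g \<in> borel_measurable borel" unfolding g_def by measurable
  have "(\<lambda>n. LINT l|\<rho> n. g l) \<longlonglongrightarrow> (LINT l|\<mu>. g l)"
    by (rule weak_conv_imp_integral_bdd_continuous_conv[OF rd \<mu> w, where B=1])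
      (auto simp: g_def intro!: continuous_intros)
  moreover have "(LINT l|\<rho> n. g l) = 0" for n
  proof -
    have "AE l in \<rho> n. g l = 0" using prob_on_nonneg_AE[OF \<rho>[of n]] by eventually_elim (simp add: g_def)
    then show ?thesis by (rule integral_eq_zero_AE)
  qed
  ultimately have "(LINT l|\<mu>. g l) = 0" by (simp add: LIMSEQ_const_iff)
  moreover have "integrable \<mu> g" by (rule R.integrable_const_bound[of _ 1]) (use gm in \<open>auto simp: g_def\<close>)
  ultimately have "AE l in \<mu>. g l = 0" by (subst (asm) integral_nonneg_eq_0_iff_AE) (auto simp: g_def)
  then have "AE l in \<mu>. l \<notin> {..<0}" by eventually_elim (auto simp: g_def min_def max_def split: if_splits)
  then have "emeasure \<mu> {..<0} = 0" by (subst (asm) AE_iff_measurable[of "{..<0}"]) auto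
  then show ?thesis using \<mu> by (simp add: prob_on_nonneg_def)
qed

text \<open>Realizations with prescribed transforms on growing finite parameter sets are tight, and
  any weak limit solves the equation at all these parameters, so \<open>mp_law_eqI\<close> applies
  to it.\<close>

theorem
  assumes \<nu>: "prob_on_nonneg \<nu>" and d: "0 < d"
  shows prob_on_nonneg_mp_law: "prob_on_nonneg (mp_law d \<nu>)"
    and mp_law_real_eq: "\<And>t. 0 < t \<Longrightarrow> mp_real_eq d \<nu> t (LINT l|mp_law d \<nu>. 1 / (l + t))"
proof -
  define ms where "ms t = (SOME m. 0 < m \<and> m \<le> 1 / t \<and> mp_real_eq d \<nu> t m)" for t
  have msall: "0 < ms t \<and> ms t \<le> 1 / t \<and> mp_real_eq d \<nu> t (ms t)" if "0 < t" for t
    unfolding ms_def by (rule someI_ex) (use mp_real_eq_exists[OF \<nu> d that] in blast)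
  \<comment> \<open>The first family accumulates at 1 and feeds the identity theorem. The integers
    grow without bound and feed the tightness criterion.\<close>
  define Tk where "Tk k = (\<lambda>i. 1 + inverse (real (Suc i))) ` {..k} \<union> (\<lambda>i. real (Suc i)) ` {..k}" for k
  have Tpos: "0 < t" if "t \<in> Tk k" for t k using that by (auto simp: Tk_def add_pos_pos)
  have Tk1: "finite (Tk k)" for k by (auto simp: Tk_def)
  have "\<exists>\<rho>. prob_on_nonneg \<rho> \<and> (\<forall>t\<in>Tk k. \<bar>(LINT l|\<rho>. 1 / (l + t)) - ms t\<bar> \<le> 1 / real (Suc k))" for k
    by (rule sign_law_sample_exists[OF \<nu> d Tk1 Tpos]) (use msall in auto)
  then obtain \<rho> where \<rho>: "\<And>k. prob_on_nonneg (\<rho> k)"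
    and \<rho>T: "\<And>k t. t \<in> Tk k \<Longrightarrow> \<bar>(LINT l|\<rho> k. 1 / (l + t)) - ms t\<bar> \<le> 1 / real (Suc k)"
    by metis
  have lim: "(\<lambda>k. LINT l|\<rho> k. 1 / (l + t)) \<longlonglongrightarrow> ms t" if t: "t \<in> Tk i" for t i
  proof (rule LIM_zero_cancel, rule Lim_null_comparison)
    show "eventually (\<lambda>k. norm ((LINT l|\<rho> k. 1 / (l + t)) - ms t) \<le> 1 / real (Suc k)) sequentially"
      using eventually_ge_at_top[of i]
    proof eventually_elim
      case (elim k)
      then have "t \<in> Tk k" using t by (fastforce simp: Tk_def)
      then show ?case using \<rho>T by simp
    qed
    show "(\<lambda>k. 1 / real (Suc k)) \<longlonglongrightarrow> 0" by (rule LIMSEQ_Suc[OF lim_1_over_n])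
  qed
  have "tight \<rho>"
  proof (rule prob_on_nonneg_tight[OF \<rho>])
    fix e :: real assume e: "0 < e"
    have "(\<lambda>i. mp_modulus \<nu> (d / real (Suc i)) / d) \<longlonglongrightarrow> 0 / d"
    proof (intro tendsto_divide mp_modulus_tendsto_0[OF \<nu>] tendsto_const)
      show "(\<lambda>i. d / real (Suc i)) \<longlonglongrightarrow> 0" by (rule LIMSEQ_Suc[OF lim_const_over_n])
    qed (use d in auto)
    then have "eventually (\<lambda>i. mp_modulus \<nu> (d / real (Suc i)) / d < e / 2) sequentially"
      by (rule order_tendstoD) (use e in simp)
    then obtain i where i: "mp_modulus \<nu> (d / real (Suc i)) / d < e / 2" by (auto dest: eventually_happens)
    have "1 - real (Suc i) * ms (real (Suc i)) \<le> mp_modulus \<nu> (d / real (Suc i)) / d"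
      by (rule mp_real_eq_tail[OF \<nu> d]) (use msall[of "real (Suc i)"] in auto)
    then have "1 - real (Suc i) * ms (real (Suc i)) < e" using i e by linarith
    moreover have "(\<lambda>k. 1 - real (Suc i) * (LINT l|\<rho> k. 1 / (l + real (Suc i)))) \<longlonglongrightarrow> 1 - real (Suc i) * ms (real (Suc i))"
      by (intro tendsto_intros lim[of _ i]) (simp add: Tk_def)
    ultimately have "eventually (\<lambda>k. 1 - real (Suc i) * (LINT l|\<rho> k. 1 / (l + real (Suc i))) < e) sequentially"
      by (rule order_tendstoD(2)[rotated])
    then show "\<exists>T>0. eventually (\<lambda>n. 1 - T * (LINT l|\<rho> n. 1 / (l + T)) \<le> e) sequentially"
      by (intro exI[of _ "real (Suc i)"] conjI) (auto elim: eventually_mono)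
  qed
  then obtain r M where r: "strict_mono (r :: nat \<Rightarrow> nat)" "real_distribution M" "weak_conv_m (\<rho> \<circ> id \<circ> r) M"
    using tight_imp_convergent_subsubsequence[of \<rho> id] strict_mono_id by (auto simp: id_def)
  have w: "weak_conv_m (\<lambda>n. \<rho> (r n)) M" using r(3) by (simp add: comp_def)
  have M: "prob_on_nonneg M" by (rule weak_conv_prob_on_nonneg[OF \<rho> r(2) w])
  have val: "(LINT l|M. 1 / (l + t)) = ms t" if t: "t \<in> Tk i" for t i
  proof (rule LIMSEQ_unique)
    show "(\<lambda>n. LINT l|\<rho> (r n). 1 / (l + t)) \<longlonglongrightarrow> (LINT l|M. 1 / (l + t))"
      by (rule weak_conv_resolvent_transform[OF M \<rho> Tpos[OF t] w])
    show "(\<lambda>n. LINT l|\<rho> (r n). 1 / (l + t)) \<longlonglongrightarrow> ms t"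
      using LIMSEQ_subseq_LIMSEQ[OF lim[OF t] r(1)] by (simp add: comp_def)
  qed
  have key: "mp_real_eq d \<nu> (1 + inverse (real (Suc k))) (LINT l|M. 1 / (l + (1 + inverse (real (Suc k)))))" for k
  proof -
    have "1 + inverse (real (Suc k)) \<in> Tk k" by (auto simp: Tk_def)
    then show ?thesis using val msall[OF Tpos] by metis
  qed
  have eq: "mp_law d \<nu> = M" by (rule mp_law_eqI(1)[OF M \<nu> d key])
  show "prob_on_nonneg (mp_law d \<nu>)" using M eq by simp
  show "mp_real_eq d \<nu> t (LINT l|mp_law d \<nu>. 1 / (l + t))" if "0 < t" for t
    unfolding eq by (rule mp_law_eqI(2)[OF M \<nu> d key that])
qed

section \<open>Radial quadratic concentration implies the spectral limits\<close>

locale sample_sequence =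
  fixes M :: "nat \<Rightarrow> 'a measure" and p N :: "nat \<Rightarrow> nat" and c :: real
    and x :: "nat \<Rightarrow> 'a \<Rightarrow> nat \<Rightarrow> real" and X :: "nat \<Rightarrow> nat \<Rightarrow> 'a \<Rightarrow> nat \<Rightarrow> real"
  assumes p: "0 < p n" and N: "0 < N n"
    and p_lim: "filterlim p at_top sequentially"
    and c: "0 < c" and pN_lim: "(\<lambda>n. real (p n) / real (N n)) \<longlonglongrightarrow> c"
    and M: "prob_space (M n)"
    and x: "x n \<in> M n \<rightarrow>\<^sub>M vec_borel (p n)"
    and indep: "prob_space.indep_vars (M n) (\<lambda>_. vec_borel (p n)) (X n) {..<N n}"
    and ident: "j < N n \<Longrightarrow> distr (M n) (vec_borel (p n)) (X n j) = distr (M n) (vec_borel (p n)) (x n)"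
begin

definition L :: "nat \<Rightarrow> (nat \<Rightarrow> real) measure" where
  "L n = distr (M n) (vec_borel (p n)) (x n)"

definition S :: "nat \<Rightarrow> (nat \<Rightarrow> nat \<Rightarrow> real) measure" where
  "S n = Pi\<^sub>M {..<N n} (\<lambda>_. L n)"

text \<open>The samples are restricted to their index set so that the values lie in the product
  space. The law of \<open>T n\<close> is the product measure \<open>S n\<close>, which carries all
  estimates for sample covariance matrices.\<close>

definition T :: "nat \<Rightarrow> 'a \<Rightarrow> nat \<Rightarrow> nat \<Rightarrow> real" where
  "T n \<omega> = (\<lambda>j\<in>{..<N n}. X n j \<omega>)"

lemma L: "prob_space (L n)" "sets (L n) = sets (vec_borel (p n))"
  unfolding L_def by (auto intro: prob_space.prob_space_distr[OF M x])

lemma S: "prob_space (S n)"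
  unfolding S_def by (rule prob_space_PiM) (rule L)

lemma sets_S: "sets (S n) = sets (Pi\<^sub>M {..<N n} (\<lambda>_. vec_borel (p n)))"
  unfolding S_def by (rule sets_PiM_cong) (auto simp: L)

lemma X: "j < N n \<Longrightarrow> X n j \<in> M n \<rightarrow>\<^sub>M vec_borel (p n)"
  using indep[of n] unfolding prob_space.indep_vars_def2[OF M] by simp

lemma T: "T n \<in> M n \<rightarrow>\<^sub>M S n"
  unfolding measurable_cong_sets[OF refl sets_S] T_def[abs_def] by (rule measurable_restrict) (use X in auto)

lemma distr_T: "distr (M n) (S n) (T n) = S n"
proof -
  have "distr (M n) (S n) (T n) = distr (M n) (Pi\<^sub>M {..<N n} (\<lambda>_. vec_borel (p n))) (\<lambda>\<omega>. \<lambda>j\<in>{..<N n}. X n j \<omega>)"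
    by (rule distr_cong) (auto simp: sets_S T_def)
  also have "\<dots> = Pi\<^sub>M {..<N n} (\<lambda>j. distr (M n) (vec_borel (p n)) (X n j))"
    using prob_space.indep_vars_iff_distr_eq_PiM'[OF M[of n], of "{..<N n}" "X n" "\<lambda>_. vec_borel (p n)"] indep[of n] N[of n] X by auto
  also have "\<dots> = S n" unfolding S_def L_def by (rule PiM_cong) (auto simp: ident)
  finally show ?thesis .
qed

lemma tends_to_0_in_prob_samples:
  assumes "\<And>n. Y n \<in> borel_measurable (S n)"
  shows "tends_to_0_in_prob S Y \<longleftrightarrow> tends_to_0_in_prob M (\<lambda>n \<omega>. Y n (T n \<omega>))"
  using tends_to_0_in_prob_distr[OF T assms] by (simp add: distr_T)

lemma sample_cov_T: "sample_cov (p n) (N n) C (T n \<omega>) = sample_cov (p n) (N n) C (\<lambda>j. X n j \<omega>)"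
  by (simp add: sample_cov_def T_def)

context
  fixes n :: nat and P C :: "real mat" and t :: real
  assumes rows: "orthonormal_rows_of_range (p n) P C" and q: "0 < mat_rank P" and t: "0 < t"
begin

lemma rows_dims: "C \<in> carrier_mat (mat_rank P) (p n)" "C * transpose_mat C = 1\<^sub>m (mat_rank P)" "dim_row C = mat_rank P"
  using rows by (auto simp: orthonormal_rows_of_range_def)

lemma model: "sample_cov_model (p n) (mat_rank P) (N n) C (L n) t"
  using L N rows_dims q t by (simp add: sample_cov_model_def)

lemma sample_cov_gram: "sample_cov (p n) (N n) C Y = gram_mat (mat_rank P) (N n) {..<N n} (sample_cov_model.Y (p n) C Y)"
  unfolding sample_cov_eq_gram_mat rows_dims(3) sample_cov_model.Y_def[OF model, abs_def] ..

lemma model_m: "sample_cov_model.m (p n) (mat_rank P) (N n) C t Y = (LINT l|ESD (sample_cov (p n) (N n) C Y). 1 / (l + t))"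
  unfolding sample_cov_gram by (rule sample_cov_model.m_ESD[OF model])

lemma random_spectral_measure_samples: "random_spectral_measure (S n) (\<lambda>Y. ESD (sample_cov (p n) (N n) C Y))"
  unfolding sample_cov_gram S_def by (rule sample_cov_model.random_spectral_measure_ESD[OF model])

end

text \<open>The empirical law of a matrix of size 0 is unspecified, so \<mu> is substituted at rank
  0. When the relative ranks have a positive limit, this happens for finitely many \<open>n\<close>
  only.\<close>

definition spectral_law where
  "spectral_law P C \<mu> n Y = (if 0 < mat_rank (P n) then ESD (sample_cov (p n) (N n) (C n) Y) else \<mu>)"

lemma random_spectral_measure_spectral_law:
  assumes rows: "\<And>n. orthonormal_rows_of_range (p n) (P n) (C n)" and \<mu>: "prob_on_nonneg \<mu>"
  shows "random_spectral_measure (S n) (spectral_law P C \<mu> n)"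
proof (cases "0 < mat_rank (P n)")
  case True
  then show ?thesis using random_spectral_measure_samples[OF rows True, of 1] by (simp add: spectral_law_def[abs_def])
next
  case False
  then show ?thesis by (intro random_spectral_measure.intro) (auto simp: spectral_law_def \<mu>)
qed

lemma orth_projection_rank_le:
  assumes "orth_projection (p n) P"
  shows "mat_rank P \<le> p n" 
  using orth_projection_trace[OF assms] psd_contraction_trace_le[OF orth_projection_psd_contraction[OF assms]] by simp

lemma
  assumes lim: "(\<lambda>n. real (q n) / real (p n)) \<longlonglongrightarrow> \<alpha>" and \<alpha>: "0 < \<alpha>"
  shows rank_lim: "filterlim q at_top sequentially"
    and rank_sample_ratio: "(\<lambda>n. real (q n) / real (N n)) \<longlonglongrightarrow> c * \<alpha>"
proof -
  have "(\<lambda>n. (real (p n) / real (N n)) * (real (q n) / real (p n))) \<longlonglongrightarrow> c * \<alpha>" by (intro tendsto_mult pN_lim lim)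
  moreover have "(real (p n) / real (N n)) * (real (q n) / real (p n)) = real (q n) / real (N n)" for n using p[of n] by simp
  ultimately show "(\<lambda>n. real (q n) / real (N n)) \<longlonglongrightarrow> c * \<alpha>" by simp
  have "filterlim (\<lambda>n. (real (q n) / real (p n)) * real (p n)) at_top sequentially"
    by (rule filterlim_tendsto_pos_mult_at_top[OF lim \<alpha>]) (rule filterlim_compose[OF filterlim_real_sequentially p_lim])
  moreover have "(real (q n) / real (p n)) * real (p n) = real (q n)" for n using p[of n] by simp
  ultimately have "filterlim (\<lambda>n. real (q n)) at_top sequentially" by simp
  then show "filterlim q at_top sequentially" 
    by (simp add: filterlim_sequentially_iff_filterlim_real)
qed

text \<open>For each matrix \<open>B\<close> two approximations are combined: the form against
  \<open>R_val\<close> times the normalized trace, uniform by (RQC), and the law of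
  \<open>R_val\<close> against \<nu>, uniform on the bounded range of \<open>tr B / N\<close>.
  Together they are the hypothesis of \<open>resolvent_trace_L2_bound\<close>.\<close>

theorem RMP_of_RQC:
  assumes \<nu>: "prob_on_nonneg \<nu>" and w: "weak_conv_m (\<lambda>n. distr (M n) borel (\<lambda>\<omega>. R_val (p n) (x n \<omega>))) \<nu>"
    and rqc: "RQC M p x"
  shows "RMP_Pi M p N X c \<nu>"
  unfolding RMP_Pi_def
proof (intro allI impI, elim conjE)
  fix \<alpha> :: real and P C :: "nat \<Rightarrow> real mat"
  assume \<alpha>: "0 < \<alpha>" "\<alpha> \<le> 1" and PC: "\<forall>n. orth_projection (p n) (P n) \<and> orthonormal_rows_of_range (p n) (P n) (C n)"
    and lim: "(\<lambda>n. real (mat_rank (P n)) / real (p n)) \<longlonglongrightarrow> \<alpha>"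
  define q where "q n = mat_rank (P n)" for n
  define d where "d = c * \<alpha>"
  define \<rho> where "\<rho> = mp_law d \<nu>"
  have d: "0 < d" using c \<alpha> by (simp add: d_def)
  have qinf: "filterlim q at_top sequentially" and qN: "(\<lambda>n. real (q n) / real (N n)) \<longlonglongrightarrow> d"
    using rank_lim[OF lim \<alpha>(1)] rank_sample_ratio[OF lim \<alpha>(1)] by (auto simp: q_def[abs_def] d_def)
  have qp: "q n \<le> p n" for n using orth_projection_rank_le PC by (simp add: q_def)
  have qpos: "eventually (\<lambda>n. 0 < q n) sequentially" by (rule eventually_compose_filterlim[OF eventually_gt_at_top qinf])
  have \<rho>: "prob_on_nonneg \<rho>" unfolding \<rho>_def by (rule prob_on_nonneg_mp_law[OF \<nu> d])
  have PC': "orthonormal_rows_of_range (p n) (P n) (C n)" "orth_projection (p n) (P n)" for n using PC by auto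
  note facts = PC'(1)
  have L_R: "distr (L n) borel (R_val (p n)) = distr (M n) borel (\<lambda>\<omega>. R_val (p n) (x n \<omega>))" for n
    unfolding L_def by (subst distr_distr[OF R_val_measurable x]) (simp add: comp_def)
  have wL: "weak_conv_m (\<lambda>n. distr (L n) borel (R_val (p n))) \<nu>" using w unfolding L_R .
  have rqcL: "eventually (\<lambda>n. \<forall>P. orth_projection (p n) P \<longrightarrow>
        measure (L n) {y \<in> space (L n). e < \<bar>Q_val (p n) P y\<bar>} \<le> e) sequentially" if e: "0 < e" for e
    using RQC_uniform[OF rqc e]
  proof eventually_elim
    case (elim n)
    show ?case
    proof (intro allI impI)
      fix P assume P: "orth_projection (p n) P"
      have [measurable]: "Q_val (p n) P \<in> borel_measurable (vec_borel (p n))"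
        using P by (intro Q_val_measurable) (simp add: orth_projection_def)
      have "{y \<in> space (vec_borel (p n)). e < \<bar>Q_val (p n) P y\<bar>} \<in> sets (vec_borel (p n))" by measurable
      then have "measure (L n) {y \<in> space (L n). e < \<bar>Q_val (p n) P y\<bar>} = measure (M n) {\<omega> \<in> space (M n). e < \<bar>Q_val (p n) P (x n \<omega>)\<bar>}"
        unfolding L_def by (simp, subst measure_distr[OF x])
          (use measurable_space[OF x[of n]] in \<open>auto intro!: arg_cong[of _ _ "measure (M n)"]\<close>)
      then show "measure (L n) {y \<in> space (L n). e < \<bar>Q_val (p n) P y\<bar>} \<le> e" using elim P by simp
    qed
  qed
  have Rn: "prob_on_nonneg (distr (L n) borel (R_val (p n)))" for n
    by (rule prob_on_nonneg_distr[OF L(1)]) (use R_val_nonneg R_val_measurable in \<open>auto simp: measurable_cong_sets[OF L(2) refl]\<close>)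
  define ES where "ES = spectral_law P C \<rho>"
  have ES_alt: "ES n Y = (if 0 < q n then ESD (sample_cov (p n) (N n) (C n) Y) else \<rho>)" for n Y
    by (simp add: ES_def spectral_law_def q_def)
  have rsm: "random_spectral_measure (S n) (ES n)" for n
    unfolding ES_def by (rule random_spectral_measure_spectral_law[OF facts \<rho>])
  have "tends_to_0_in_prob S (\<lambda>n Y. levy_dist (ES n Y) \<rho>)"
  proof (rule levy_dist_tends_to_0_in_prob[OF S rsm \<rho>])
    fix t :: real assume t: "0 < t"
    define ms where "ms = (LINT l|\<rho>. 1 / (l + t))"
    have ms: "0 < ms" "ms \<le> 1 / t" "mp_real_eq d \<nu> t ms"
      using resolvent_transform_pos[OF \<rho> t] mp_law_real_eq[OF \<nu> d t] by (auto simp: ms_def \<rho>_def)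
    define F where "F n Y = (LINT l|ES n Y. 1 / (l + t)) - ms" for n Y
    have model: "sample_cov_model (p n) (q n) (N n) (C n) (L n) t" if "0 < q n" for n
      using model[OF facts _ t] that by (simp add: q_def)
    define \<phi> where "\<phi> n = sample_cov_model.\<phi> (p n) (N n) (C n) (L n)" for n
    \<comment> \<open>The sample model needs positive rank; at rank 0 the class is empty and imposes
      nothing.\<close>
    define Bs where "Bs n = (if 0 < q n then {B \<in> carrier_mat (q n) (q n). psd_contraction (q n) (t \<cdot>\<^sub>m B)} else {})" for n
    define f where "f n B = \<bar>\<phi> n B - mp_G \<nu> (mat_trace B / N n)\<bar>" for n B
    \<comment> \<open>Eventually bounds \<open>p / (t * N)\<close>, the factor in front of
      \<open>Q_val\<close>, and with it the argument \<open>tr B / N\<close>.\<close>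
    define K where "K = (c + 1) / t"
    have K: "0 < K" using c t by (simp add: K_def)
    obtain \<eta> where \<eta>: "\<eta> \<longlonglongrightarrow> 0" "\<And>n B. B \<in> Bs n \<Longrightarrow> f n B \<le> \<eta> n"
    proof (rule uniform_error_sequence)
      show "f n B \<le> 1" if "B \<in> Bs n" for n B
        using that sample_cov_model.\<phi>_mp_G_diff[OF model \<nu>, of n B] by (auto simp: Bs_def f_def \<phi>_def split: if_splits)
      fix e :: real assume e: "0 < e"
      have e2: "0 < e / 2" using e by simp
      have "eventually (\<lambda>n. real (p n) / real (N n) < c + 1) sequentially"
        by (rule order_tendstoD(2)[OF pN_lim]) simp
      moreover have "eventually (\<lambda>n. \<forall>A. psd_contraction (p n) A \<longrightarrow> (LINT y|L n. min 1 (K * \<bar>Q_val (p n) A y\<bar>)) \<le> e / 2) sequentially"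
        by (rule contraction_form_uniform[OF p L \<nu> wL _ K e2]) (rule rqcL)
      ultimately show "eventually (\<lambda>n. \<forall>B\<in>Bs n. f n B \<le> e) sequentially"
        using mp_G_weak_conv_uniform[OF \<nu> Rn wL K e2]
      proof eventually_elim
        case (elim n)
        show ?case
        proof
          fix B assume "B \<in> Bs n"
          then have qn: "0 < q n" and B: "B \<in> carrier_mat (q n) (q n)" "psd_contraction (q n) (t \<cdot>\<^sub>m B)"
            by (auto simp: Bs_def split: if_splits)
          interpret SC: sample_cov_model "p n" "q n" "N n" "C n" "L n" t by (rule model[OF qn])
          have Cn: "C n \<in> carrier_mat (q n) (p n)" "C n * transpose_mat (C n) = 1\<^sub>m (q n)"
            using PC'(1)[of n] by (auto simp: orthonormal_rows_of_range_def q_def)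
          define A where "A = transpose_mat (C n) * (t \<cdot>\<^sub>m B) * C n"
          have A: "psd_contraction (p n) A" unfolding A_def by (rule psd_contraction_conj[OF Cn B(2)])
          define k where "k = p n / (t * N n)"
          have k: "0 \<le> k" "k \<le> K"
            using elim(1) t divide_right_mono[of "p n / N n" "c + 1" t] by (auto simp: k_def K_def mult.commute)
          have Qm: "Q_val (p n) A \<in> borel_measurable (L n)"
            using A unfolding measurable_cong_sets[OF L(2) refl] by (intro Q_val_measurable) (simp add: psd_contraction_def psd_mat_def)
          have "\<bar>\<phi> n B - mp_G (distr (L n) borel (R_val (p n))) (mat_trace B / N n)\<bar> \<le> (LINT y|L n. min 1 (k * \<bar>Q_val (p n) A y\<bar>))"
            using SC.form_concentration[OF Cn(2) p B] by (simp add: A_def k_def \<phi>_def)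
          also have "\<dots> \<le> (LINT y|L n. min 1 (K * \<bar>Q_val (p n) A y\<bar>))"
          proof (rule integral_mono)
            show "integrable (L n) (\<lambda>y. min 1 (k * \<bar>Q_val (p n) A y\<bar>))" "integrable (L n) (\<lambda>y. min 1 (K * \<bar>Q_val (p n) A y\<bar>))"
              using Qm k K by (auto intro!: SC.L.integrable_const_bound[of _ 1])
            show "min 1 (k * \<bar>Q_val (p n) A y\<bar>) \<le> min 1 (K * \<bar>Q_val (p n) A y\<bar>)" for y
              using mult_right_mono[OF k(2), of "\<bar>Q_val (p n) A y\<bar>"] by linarith
          qed
          also have "\<dots> \<le> e / 2" using elim(2) A by simp
          finally have 1: "\<bar>\<phi> n B - mp_G (distr (L n) borel (R_val (p n))) (mat_trace B / N n)\<bar> \<le> e / 2" .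
          have "mat_trace B / N n \<le> (p n / t) / N n"
            using SC.trace_class_bounds(2)[OF B] divide_right_mono[of "real (q n)" "real (p n)" t] qp[of n] t by (intro divide_right_mono) auto
          then have "mat_trace B / N n \<in> {0..K}" using k SC.trace_class_bounds(1)[OF B] by (simp add: k_def)
          then have "\<bar>mp_G (distr (L n) borel (R_val (p n))) (mat_trace B / N n) - mp_G \<nu> (mat_trace B / N n)\<bar> \<le> e / 2"
            using elim(3) by blast
          then show "f n B \<le> e" using 1 unfolding f_def by linarith
        qed
      qed
    qed (rule that, assumption, blast)
    define bound where "bound n = (N n / q n) * \<eta> n / t + (1 / d + N n / q n) / (t * q n)
      + (\<bar>N n / q n - 1 / d\<bar> + mp_modulus \<nu> (1 / (t * N n) + \<bar>q n / N n - d\<bar> / t) / d) / t" for n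
    have blim: "bound \<longlonglongrightarrow> 0" unfolding bound_def[abs_def] by (rule L2_bound_tendsto_0[OF \<nu> d t \<eta>(1) qinf qN])
    have bd: "t * (LINT Y|S n. (F n Y)\<^sup>2) \<le> bound n" if qn: "0 < q n" for n
    proof -
      have "F n Y = sample_cov_model.m (p n) (q n) (N n) (C n) t Y - ms" for Y
        using model_m[OF facts _ t, of n Y] qn by (simp add: F_def ES_alt q_def)
      then show ?thesis
        unfolding bound_def S_def 
        using sample_cov_model.resolvent_trace_L2_bound[OF model[OF qn] \<nu> d ms, of "\<eta> n"] \<eta>(2)[of _ n] qn by (simp add: Bs_def f_def \<phi>_def)
    qed
    have "tends_to_0_in_prob S F"
    proof (rule tends_to_0_in_prob_L2[OF S])
      fix n
      interpret Sn: prob_space "S n" by (rule S)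
      interpret R: random_spectral_measure "S n" "ES n" by (rule rsm)
      show "integrable (S n) (\<lambda>Y. (F n Y)\<^sup>2)"
      proof (rule Sn.integrable_const_bound[of _ "(1 / t)\<^sup>2"])
        have "\<bar>F n Y\<bar> \<le> \<bar>1 / t\<bar>" if "Y \<in> space (S n)" for Y
          using resolvent_transform_pos[OF R.\<mu>[OF that] t] ms(1,2) unfolding F_def by linarith
        then have "(F n Y)\<^sup>2 \<le> (1 / t)\<^sup>2" if "Y \<in> space (S n)" for Y using that unfolding abs_le_square_iff .
        then show "AE Y in S n. norm ((F n Y)\<^sup>2) \<le> (1 / t)\<^sup>2" by (intro AE_I2) simp
        show "(\<lambda>Y. (F n Y)\<^sup>2) \<in> borel_measurable (S n)" unfolding F_def using R.resolvent_measurable[OF t] by simp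
      qed
    next
      show "(\<lambda>n. LINT Y|S n. (F n Y)\<^sup>2) \<longlonglongrightarrow> 0"
      proof (rule tendsto_sandwich)
        show "eventually (\<lambda>n. 0 \<le> (LINT Y|S n. (F n Y)\<^sup>2)) sequentially" by simp
        show "eventually (\<lambda>n. (LINT Y|S n. (F n Y)\<^sup>2) \<le> bound n / t) sequentially"
          using qpos by eventually_elim (use bd t in \<open>simp add: pos_le_divide_eq mult.commute\<close>)
        show "(\<lambda>n. bound n / t) \<longlonglongrightarrow> 0" using tendsto_divide[OF blim tendsto_const[of t]] t by simp
      qed simp
    qed
    then show "tends_to_0_in_prob S (\<lambda>n Y. (LINT l|ES n Y. 1 / (l + t)) - (LINT l|\<rho>. 1 / (l + t)))"
      unfolding F_def[abs_def] ms_def .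
  qed
  then have "tends_to_0_in_prob M (\<lambda>n \<omega>. levy_dist (ES n (T n \<omega>)) \<rho>)"
    by (subst (asm) tends_to_0_in_prob_samples) 
      (rule random_spectral_measure.levy_dist_measurable[OF rsm prob_on_nonneg_real_distribution[OF \<rho>]])
  then show "tends_to_0_in_prob M (\<lambda>n \<omega>. levy_dist (ESD (sample_cov (p n) (N n) (C n) (\<lambda>j. X n j \<omega>))) (mp_law (c * \<alpha>) \<nu>))"
    by (rule tends_to_0_in_prob_cong_eventually)
      (use qpos in \<open>auto elim!: eventually_mono simp: ES_alt sample_cov_T \<rho>_def d_def\<close>)
qed

end

section \<open>Conditional isotropy and the Jensen gap\<close>

text \<open>The trace norm is \<open>n\<close> times the integral of the square root against the
  empirical law of \<open>transpose_mat (D \<omega>) * D \<omega>\<close>. Cut off by ramps, the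
  square root becomes a function vanishing at infinity, to which \<open>integral_measurable\<close>
  applies; at each point a high enough cut-off is exact.\<close>

lemma trace_norm_measurable:
  assumes n: "0 < n" and D: "mat_measurable n M D" and sym: "\<And>\<omega>. transpose_mat (D \<omega>) = D \<omega>"
  shows "(\<lambda>\<omega>. trace_norm (D \<omega>)) \<in> borel_measurable M"
proof -
  define S where "S \<omega> = transpose_mat (D \<omega>) * D \<omega>" for \<omega>
  have Dc: "D \<omega> \<in> carrier_mat n n" for \<omega> using D by (simp add: mat_measurable_def)
  have psd: "psd_mat n (S \<omega>)" for \<omega>
  proof -
    obtain U d where U: "U \<in> carrier_mat n n" "S \<omega> = U * mat_diag n (\<lambda>i. d i * d i) * transpose_mat U"
      using trace_norm_eq_ESD_sum[OF Dc[of \<omega>] sym] unfolding S_def by metis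
    have "0 \<le> v \<bullet> (S \<omega> *\<^sub>v v)" if "v \<in> carrier_vec n" for v
      unfolding U(2) orth_diag_quadratic[OF U(1) that] by (intro sum_nonneg) simp
    then show ?thesis using U Dc[of \<omega>] orth_diag_transpose[OF U(1)] by (auto simp: psd_mat_def)
  qed
  have Sm: "mat_measurable n M S"
    unfolding mat_measurable_def
  proof (intro conjI allI impI)
    show "S \<omega> \<in> carrier_mat n n" for \<omega> using psd by (simp add: psd_mat_def)
    fix i j assume ij: "i < n" "j < n"
    have "S \<omega> $$ (i, j) = (\<Sum>k<n. D \<omega> $$ (k, i) * D \<omega> $$ (k, j))" for \<omega>
      using Dc[of \<omega>] ij by (simp add: S_def scalar_prod_def atLeast0LessThan)
    moreover have "(\<lambda>\<omega>. \<Sum>k<n. D \<omega> $$ (k, i) * D \<omega> $$ (k, j)) \<in> borel_measurable M"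
      by (intro borel_measurable_sum borel_measurable_times) (use D ij in \<open>auto simp: mat_measurable_def\<close>)
    ultimately show "(\<lambda>\<omega>. S \<omega> $$ (i, j)) \<in> borel_measurable M" by simp
  qed
  interpret random_spectral_measure M "\<lambda>\<omega>. ESD (S \<omega>)"
  proof
    show "prob_on_nonneg (ESD (S \<omega>))" for \<omega> by (rule prob_on_nonneg_ESD[OF psd n])
    fix t :: real assume t: "0 < t"
    have "(\<lambda>\<omega>. mat_trace (resolvent t (S \<omega>)) / n) \<in> borel_measurable M"
      by (intro borel_measurable_divide borel_measurable_const mat_trace_measurable[of n] mat_measurable_resolvent Sm)
    then show "(\<lambda>\<omega>. LINT l|ESD (S \<omega>). 1 / (l + t)) \<in> borel_measurable M"
      by (simp only: mat_trace_resolvent_ESD[OF psd t n])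
  qed
  define g where "g K l = sqrt (max l 0) * cts_step (real K) (real K + 1) l" for K l
  have gc: "continuous_on UNIV (g K)" for K
    unfolding g_def by (intro continuous_intros uniformly_continuous_imp_continuous cts_step_uniformly_continuous) simp
  have gm: "g K \<in> borel_measurable borel" for K by (rule borel_measurable_continuous_onI[OF gc])
  have g0: "(g K \<longlongrightarrow> 0) at_top" for K
  proof (rule tendsto_eventually)
    show "eventually (\<lambda>l. g K l = 0) at_top"
      using eventually_ge_at_top[of "real K + 1"] by eventually_elim (simp add: g_def cts_step_def)
  qed
  show ?thesis
  proof (rule borel_measurable_LIMSEQ_real)
    show "(\<lambda>\<omega>. real n * (LINT l|ESD (S \<omega>). g K l)) \<in> borel_measurable M" for K
      by (intro borel_measurable_times borel_measurable_const integral_measurable[OF gm _ g0] continuous_on_subset[OF gc]) simp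
    fix \<omega> assume "\<omega> \<in> space M"
    obtain U d where U: "U \<in> carrier_mat n n" "transpose_mat U * U = 1\<^sub>m n" "U * transpose_mat U = 1\<^sub>m n"
      "S \<omega> = U * mat_diag n (\<lambda>i. d i * d i) * transpose_mat U" "trace_norm (D \<omega>) = (\<Sum>i<n. \<bar>d i\<bar>)"
      using trace_norm_eq_ESD_sum[OF Dc[of \<omega>] sym] unfolding S_def by blast
    show "(\<lambda>K. real n * (LINT l|ESD (S \<omega>). g K l)) \<longlonglongrightarrow> trace_norm (D \<omega>)"
    proof (rule tendsto_eventually)
      have "eventually (\<lambda>K. \<forall>i\<in>{..<n}. d i * d i \<le> real K) sequentially"
      proof (intro eventually_ball_finite ballI)
        show "eventually (\<lambda>K. d i * d i \<le> real K) sequentially" for i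
          using filterlim_real_sequentially by (rule filterlim_at_top[THEN iffD1, rule_format])
      qed simp
      then show "eventually (\<lambda>K. real n * (LINT l|ESD (S \<omega>). g K l) = trace_norm (D \<omega>)) sequentially"
      proof eventually_elim
        case (elim K)
        have "(LINT l|ESD (S \<omega>). g K l) = (\<Sum>i<n. g K (d i * d i)) / n"
          unfolding U(4) by (rule integral_ESD_orth_diag[OF U(1,2,3) n gm])
        also have "(\<Sum>i<n. g K (d i * d i)) = (\<Sum>i<n. \<bar>d i\<bar>)"
          using elim by (intro sum.cong) (auto simp: g_def cts_step_def)
        finally show ?case using U(5) n by simp
      qed
    qed
  qed
qed

section \<open>Quadratic forms under conditional isotropy\<close>

locale conditional_isotropy = prob_space M for M :: "'a measure" +
  fixes H :: "'a measure" and p :: nat and x :: "'a \<Rightarrow> nat \<Rightarrow> real" and \<rho> :: "'a \<Rightarrow> real"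
  assumes subalg: "subalgebra M H" and p: "0 < p"
    and x: "x \<in> M \<rightarrow>\<^sub>M vec_borel p"
    and fin: "AE \<omega> in M. nn_cond_exp M H (\<lambda>\<omega>'. ennreal (Matrix.vec p (x \<omega>') \<bullet> Matrix.vec p (x \<omega>'))) \<omega> < \<infinity>"
    and \<rho>: "\<rho> \<in> borel_measurable H" and \<rho>0: "\<omega> \<in> space M \<Longrightarrow> 0 \<le> \<rho> \<omega>"
begin

sublocale finite_measure_subalgebra M H by unfold_locales (rule subalg)

abbreviation v :: "'a \<Rightarrow> real Matrix.vec" where "v \<omega> \<equiv> Matrix.vec p (x \<omega>)"

abbreviation D :: "'a \<Rightarrow> real mat" where "D \<omega> \<equiv> cond_second_moment M H p x \<omega> - \<rho> \<omega> \<cdot>\<^sub>m 1\<^sub>m p"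

abbreviation nce :: "'a \<Rightarrow> ennreal" where "nce \<equiv> nn_cond_exp M H (\<lambda>\<omega>. ennreal (v \<omega> \<bullet> v \<omega>))"

definition good :: "'a set \<Rightarrow> real \<Rightarrow> bool" where
  "good G e \<longleftrightarrow> G \<in> sets H \<and> prob (space M - G) \<le> e \<and>
     (\<exists>k. 0 \<le> k \<and> (\<forall>\<omega>\<in>G. nce \<omega> \<le> ennreal k \<and> \<rho> \<omega> \<le> k)) \<and> (\<forall>\<omega>\<in>G. trace_norm (D \<omega>) / p \<le> e)"

lemma from_H: "f \<in> borel_measurable H \<Longrightarrow> f \<in> borel_measurable M"
  by (rule measurable_from_subalg[OF subalg])

lemma sets_H: "A \<in> sets H \<Longrightarrow> A \<in> sets M" "space H = space M"
  using subalg by (auto simp: subalgebra_def)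

lemma coord: "i < p \<Longrightarrow> (\<lambda>\<omega>. x \<omega> i) \<in> borel_measurable M"
  by (rule measurable_compose[OF x]) (auto intro: measurable_component_singleton)

lemma form_measurable: "A \<in> carrier_mat p p \<Longrightarrow> (\<lambda>\<omega>. v \<omega> \<bullet> (A *\<^sub>v v \<omega>)) \<in> borel_measurable M"
  by (rule measurable_compose[OF x quadratic_measurable])

lemma norm_form_measurable: "(\<lambda>\<omega>. v \<omega> \<bullet> v \<omega>) \<in> borel_measurable M"
  by (rule measurable_compose[OF x norm_measurable])

lemma D_index: "i < p \<Longrightarrow> j < p \<Longrightarrow>
    D \<omega> $$ (i, j) = real_cond_exp M H (\<lambda>\<omega>'. x \<omega>' i * x \<omega>' j) \<omega> - (if i = j then \<rho> \<omega> else 0)"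
  by (simp add: cond_second_moment_def)

lemma D_carrier: "D \<omega> \<in> carrier_mat p p" by (rule minus_carrier_mat) simp

lemma D_sym: "transpose_mat (D \<omega>) = D \<omega>"
proof (rule eq_matI)
  fix i j assume "i < dim_row (D \<omega>)" "j < dim_col (D \<omega>)"
  then have "i < p" "j < p" by auto
  then show "transpose_mat (D \<omega>) $$ (i, j) = D \<omega> $$ (i, j)"
    using D_carrier[of \<omega>] by (subst index_transpose_mat) (auto simp: D_index mult.commute simp del: index_minus_mat)
qed (use D_carrier[of \<omega>] in \<open>auto simp: cond_second_moment_def\<close>)

lemma trace_norm_D: "(\<lambda>\<omega>. trace_norm (D \<omega>)) \<in> borel_measurable H"
proof (rule trace_norm_measurable[OF p _ D_sym])
  show "mat_measurable p H D"
    unfolding mat_measurable_def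
  proof (intro conjI allI impI D_carrier)
    fix i j assume ij: "i < p" "j < p"
    show "(\<lambda>\<omega>. D \<omega> $$ (i, j)) \<in> borel_measurable H"
      unfolding D_index[OF ij] by (intro borel_measurable_diff borel_measurable_cond_exp) (use \<rho> in auto)
  qed
qed

text \<open>The sets where the conditional moment or \<rho> exceeds a level decrease to a null set,
  so some level has small probability. Half of \<open>e\<close> is spent on this and half on the
  trace norm.\<close>

lemma good_exists:
  assumes e: "0 < e" and tn: "prob {\<omega> \<in> space M. e < \<bar>trace_norm (D \<omega>) / p\<bar>} \<le> e / 2"
  shows "\<exists>G. good G e"
proof -
  define B where "B k = {\<omega> \<in> space M. of_nat k < nce \<omega> \<or> real k < \<rho> \<omega>}" for k
  have [measurable]: "nce \<in> borel_measurable H" "\<rho> \<in> borel_measurable H" "(\<lambda>\<omega>. trace_norm (D \<omega>)) \<in> borel_measurable H"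
    using borel_measurable_nn_cond_exp \<rho> trace_norm_D by auto
  have BH: "B k \<in> sets H" for k unfolding B_def sets_H(2)[symmetric] by measurable
  have B: "B k \<in> sets M" for k using sets_H(1)[OF BH] .
  have "(\<lambda>k. prob (B k)) \<longlonglongrightarrow> prob (\<Inter>k. B k)"
  proof (rule finite_Lim_measure_decseq)
    show "decseq B"
    proof (rule decseq_SucI)
      fix k
      have "(of_nat k :: ennreal) < nce \<omega>" if "of_nat (Suc k) < nce \<omega>" for \<omega>
        using that by (rule le_less_trans[rotated]) (intro of_nat_mono, simp)
      then show "B (Suc k) \<subseteq> B k" by (auto simp: B_def)
    qed
  qed (use B in auto)
  moreover have "prob (\<Inter>k. B k) = 0"
  proof (subst prob_eq_0)
    show "(\<Inter>k. B k) \<in> sets M" using B by auto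
    show "AE \<omega> in M. \<omega> \<notin> (\<Inter>k. B k)"
      using fin
    proof eventually_elim
      case (elim \<omega>)
      define r where "r = enn2real (nce \<omega>)"
      have nr: "nce \<omega> = ennreal r" "0 \<le> r" using elim by (auto simp: r_def less_top)
      obtain k :: nat where k: "max r (\<rho> \<omega>) \<le> real k" using real_arch_simple by blast
      have "nce \<omega> \<le> ennreal (real k)" unfolding nr(1) using k by (intro ennreal_leI) simp
      then have "\<omega> \<notin> B k" using k by (auto simp: B_def ennreal_of_nat_eq_real_of_nat not_less)
      then show ?case by blast
    qed
  qed
  ultimately have "eventually (\<lambda>k. prob (B k) < e / 2) sequentially"
    using e by (intro order_tendstoD(2)[of _ 0]) auto
  then obtain k where k: "prob (B k) < e / 2" by (auto dest: eventually_happens)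
  define E where "E = {\<omega> \<in> space M. e < \<bar>trace_norm (D \<omega>) / p\<bar>}"
  have E: "E \<in> sets H" unfolding E_def sets_H(2)[symmetric] by measurable
  define G where "G = space M - (B k \<union> E)"
  have GH: "G \<in> sets H" unfolding G_def sets_H(2)[symmetric] using BH E by auto
  have "prob (space M - G) \<le> prob (B k \<union> E)"
    by (rule finite_measure_mono) (use B sets_H(1)[OF E] in \<open>auto simp: G_def\<close>)
  also have "\<dots> \<le> prob (B k) + prob E" by (rule measure_Un_le) (use B sets_H(1)[OF E] in auto)
  finally have "prob (space M - G) \<le> e" using k tn by (simp add: E_def)
  moreover have "nce \<omega> \<le> ennreal (real k) \<and> \<rho> \<omega> \<le> real k" if "\<omega> \<in> G" for \<omega>
    using that by (auto simp: G_def B_def ennreal_of_nat_eq_real_of_nat not_less)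
  moreover have "trace_norm (D \<omega>) / p \<le> e" if "\<omega> \<in> G" for \<omega>
    using that by (auto simp: G_def E_def not_less simp del: abs_divide dest: abs_le_D1)
  ultimately show ?thesis unfolding good_def using GH by (intro exI[of _ G]) (auto intro!: exI[of _ "real k"])
qed

text \<open>On \<open>G\<close> the products of coordinates may be replaced by their conditional
  expectations; the mean becomes that of the trace of \<open>D \<omega> * A\<close>, which trace
  duality bounds. The weight \<open>h\<close> is later a Taylor coefficient or the indicator of a
  bounded radius, both measurable for the conditioning field.\<close>

lemma
  assumes good: "good G e" and A: "psd_contraction p A"
    and h: "h \<in> borel_measurable H" "\<And>\<omega>. \<omega> \<in> space M \<Longrightarrow> 0 \<le> h \<omega>" "\<And>\<omega>. \<omega> \<in> space M \<Longrightarrow> h \<omega> \<le> 1"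
  defines "f \<equiv> \<lambda>\<omega>. indicator G \<omega> * h \<omega> * ((v \<omega> \<bullet> (A *\<^sub>v v \<omega>) - \<rho> \<omega> * mat_trace A) / p)"
  shows good_form_integrable: "integrable M f"
    and good_form_bound: "\<bar>LINT \<omega>|M. f \<omega>\<bar> \<le> e"
proof -
  obtain k where G: "G \<in> sets H" and k: "0 \<le> k" "\<And>\<omega>. \<omega> \<in> G \<Longrightarrow> nce \<omega> \<le> ennreal k" "\<And>\<omega>. \<omega> \<in> G \<Longrightarrow> \<rho> \<omega> \<le> k"
    and tn: "\<And>\<omega>. \<omega> \<in> G \<Longrightarrow> trace_norm (D \<omega>) / p \<le> e"
    using good by (auto simp: good_def)
  have Gsp: "G \<subseteq> space M" using sets.sets_into_space[OF G] by (simp add: sets_H(2))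
  have e0: "0 \<le> e" using good measure_nonneg[of M "space M - G"] unfolding good_def by linarith
  define w where "w \<omega> = indicat_real G \<omega> * h \<omega>" for \<omega>
  have wH: "w \<in> borel_measurable H" unfolding w_def using G h(1) by measurable
  have wM: "w \<in> borel_measurable M" by (rule from_H[OF wH])
  have w: "0 \<le> w \<omega>" "w \<omega> \<le> indicat_real G \<omega>" "w \<omega> \<le> 1" "\<omega> \<notin> G \<Longrightarrow> w \<omega> = 0" if "\<omega> \<in> space M" for \<omega>
    using h(2,3)[OF that] by (auto simp: w_def indicator_def)
  have Ac: "A \<in> carrier_mat p p" "transpose_mat A = A" using A by (auto simp: psd_contraction_def psd_mat_def)
  have Asym: "A $$ (j, i) = A $$ (i, j)" if "i < p" "j < p" for i j
    using that Ac by (metis carrier_matD index_transpose_mat(1))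
  define N2 where "N2 \<omega> = v \<omega> \<bullet> v \<omega>" for \<omega>
  have N2m: "N2 \<in> borel_measurable M" unfolding N2_def by (rule norm_form_measurable)
  have N20: "0 \<le> N2 \<omega>" for \<omega> by (simp add: N2_def scalar_prod_real_nonneg)
  have coord_le: "\<bar>x \<omega> i * x \<omega> j\<bar> \<le> N2 \<omega>" if "i < p" "j < p" for i j \<omega>
  proof -
    have N2: "N2 \<omega> = (\<Sum>i<p. (x \<omega> i)\<^sup>2)" by (simp add: N2_def scalar_prod_def atLeast0LessThan power2_eq_square)
    have "(x \<omega> i)\<^sup>2 \<le> N2 \<omega>" "(x \<omega> j)\<^sup>2 \<le> N2 \<omega>" unfolding N2 using that by (auto intro!: member_le_sum)
    moreover have "2 * (\<bar>x \<omega> i\<bar> * \<bar>x \<omega> j\<bar>) \<le> (x \<omega> i)\<^sup>2 + (x \<omega> j)\<^sup>2"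
      using sum_squares_bound[of "\<bar>x \<omega> i\<bar>" "\<bar>x \<omega> j\<bar>"] by (simp add: mult.assoc)
    ultimately show ?thesis by (simp add: abs_mult)
  qed
  \<comment> \<open>The squared norm alone may fail to be integrable. Moving the indicator of
    \<open>G\<close> through the conditional expectation bounds the weighted integral by
    \<open>k\<close>.\<close>
  have wN: "integrable M (\<lambda>\<omega>. w \<omega> * N2 \<omega>)"
  proof (rule integrableI_nonneg)
    show "(\<lambda>\<omega>. w \<omega> * N2 \<omega>) \<in> borel_measurable M" using wM N2m by simp
    show "AE \<omega> in M. 0 \<le> w \<omega> * N2 \<omega>" using w(1) N20 by (intro AE_I2) simp
    have "(\<integral>\<^sup>+\<omega>. ennreal (w \<omega> * N2 \<omega>) \<partial>M) \<le> (\<integral>\<^sup>+\<omega>. indicator G \<omega> * ennreal (N2 \<omega>) \<partial>M)"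
    proof (rule nn_integral_mono)
      fix \<omega> assume "\<omega> \<in> space M"
      then show "ennreal (w \<omega> * N2 \<omega>) \<le> indicator G \<omega> * ennreal (N2 \<omega>)"
        using w[of \<omega>] mult_right_mono[of "w \<omega>" 1 "N2 \<omega>"] N20[of \<omega>] by (cases "\<omega> \<in> G") (auto intro: ennreal_leI)
    qed
    also have "\<dots> = (\<integral>\<^sup>+\<omega>. indicator G \<omega> * nce \<omega> \<partial>M)"
      using G N2m unfolding N2_def by (intro nn_cond_exp_intg[symmetric]) auto
    also have "\<dots> \<le> (\<integral>\<^sup>+\<omega>. ennreal k \<partial>M)"
      using k by (intro nn_integral_mono) (auto simp: indicator_def)
    also have "\<dots> < \<infinity>" by (simp add: emeasure_space_1)
    finally show "(\<integral>\<^sup>+\<omega>. ennreal (w \<omega> * N2 \<omega>) \<partial>M) < \<infinity>" .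
  qed
  define r where "r i j = real_cond_exp M H (\<lambda>\<omega>. x \<omega> i * x \<omega> j)" for i j
  have int: "integrable M (\<lambda>\<omega>. w \<omega> * (x \<omega> i * x \<omega> j))" if ij: "i < p" "j < p" for i j
  proof (rule Bochner_Integration.integrable_bound[OF wN])
    show "(\<lambda>\<omega>. w \<omega> * (x \<omega> i * x \<omega> j)) \<in> borel_measurable M" using wM coord[OF ij(1)] coord[OF ij(2)] by simp
    show "AE \<omega> in M. norm (w \<omega> * (x \<omega> i * x \<omega> j)) \<le> norm (w \<omega> * N2 \<omega>)"
      using w(1) N20 coord_le[OF ij] by (intro AE_I2) (auto simp: abs_mult[of "w _"] intro!: mult_left_mono)
  qed
  have ce: "integrable M (\<lambda>\<omega>. w \<omega> * r i j \<omega>)" "(LINT \<omega>|M. w \<omega> * r i j \<omega>) = (LINT \<omega>|M. w \<omega> * (x \<omega> i * x \<omega> j))"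
    if ij: "i < p" "j < p" for i j
    unfolding r_def using real_cond_exp_intg[OF int[OF ij] wH] coord[OF ij(1)] coord[OF ij(2)] by auto
  have q: "v \<omega> \<bullet> (A *\<^sub>v v \<omega>) = (\<Sum>i<p. \<Sum>j<p. A $$ (i, j) * (x \<omega> i * x \<omega> j))" for \<omega>
    using Ac by (simp add: scalar_prod_def atLeast0LessThan sum_distrib_left algebra_simps)
  define Q where "Q \<omega> = w \<omega> * (v \<omega> \<bullet> (A *\<^sub>v v \<omega>))" for \<omega>
  define Q' where "Q' \<omega> = w \<omega> * (\<Sum>i<p. \<Sum>j<p. A $$ (i, j) * r i j \<omega>)" for \<omega>
  have Qs: "Q \<omega> = (\<Sum>i<p. \<Sum>j<p. A $$ (i, j) * (w \<omega> * (x \<omega> i * x \<omega> j)))"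
    "Q' \<omega> = (\<Sum>i<p. \<Sum>j<p. A $$ (i, j) * (w \<omega> * r i j \<omega>))" for \<omega>
    by (simp_all add: Q_def Q'_def q sum_distrib_left mult.left_commute)
  have Qi: "integrable M Q" "integrable M Q'" unfolding Qs using int ce(1) by (auto intro!: Bochner_Integration.integrable_sum)
  have QQ: "(LINT \<omega>|M. Q \<omega>) = (LINT \<omega>|M. Q' \<omega>)"
  proof -
    have dbl: "(LINT \<omega>|M. (\<Sum>i<p. \<Sum>j<p. A $$ (i, j) * k i j \<omega>)) = (\<Sum>i<p. \<Sum>j<p. A $$ (i, j) * (LINT \<omega>|M. k i j \<omega>))"
      if k: "\<And>i j. i < p \<Longrightarrow> j < p \<Longrightarrow> integrable M (k i j)" for k
    proof -
      have i1: "integrable M (\<lambda>\<omega>. A $$ (i, j) * k i j \<omega>)" if "i < p" "j < p" for i j using k[OF that] by simp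
      have "(LINT \<omega>|M. (\<Sum>i<p. \<Sum>j<p. A $$ (i, j) * k i j \<omega>)) = (\<Sum>i<p. LINT \<omega>|M. (\<Sum>j<p. A $$ (i, j) * k i j \<omega>))"
        by (rule Bochner_Integration.integral_sum) (use i1 in \<open>auto intro!: Bochner_Integration.integrable_sum\<close>)
      also have "\<dots> = (\<Sum>i<p. \<Sum>j<p. A $$ (i, j) * (LINT \<omega>|M. k i j \<omega>))"
      proof (rule sum.cong[OF refl])
        fix i assume i: "i \<in> {..<p}"
        have "(LINT \<omega>|M. (\<Sum>j<p. A $$ (i, j) * k i j \<omega>)) = (\<Sum>j<p. LINT \<omega>|M. A $$ (i, j) * k i j \<omega>)"
          by (rule Bochner_Integration.integral_sum) (use i1 i in auto)
        then show "(LINT \<omega>|M. (\<Sum>j<p. A $$ (i, j) * k i j \<omega>)) = (\<Sum>j<p. A $$ (i, j) * (LINT \<omega>|M. k i j \<omega>))" by simp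
      qed
      finally show ?thesis .
    qed
    show ?thesis
      unfolding Qs by (subst (1 2) dbl) (use int ce in \<open>auto intro!: sum.cong\<close>)
  qed
  define Z where "Z \<omega> = w \<omega> * \<rho> \<omega> * mat_trace A" for \<omega>
  have Zi: "integrable M Z"
    unfolding Z_def
  proof (rule integrable_mult_left, rule integrable_const_bound[where B=k])
    show "AE \<omega> in M. norm (w \<omega> * \<rho> \<omega>) \<le> k"
    proof (rule AE_I2)
      fix \<omega> assume o: "\<omega> \<in> space M"
      show "norm (w \<omega> * \<rho> \<omega>) \<le> k"
      proof (cases "\<omega> \<in> G")
        case True
        then have "w \<omega> * \<rho> \<omega> \<le> 1 * k" using w[OF o] \<rho>0[OF o] k by (intro mult_mono) auto
        then show ?thesis using w(1)[OF o] \<rho>0[OF o] by simp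
      qed (use w(4)[OF o] k in simp)
    qed
    show "(\<lambda>\<omega>. w \<omega> * \<rho> \<omega>) \<in> borel_measurable M" using wM from_H[OF \<rho>] by simp
  qed
  have f: "f \<omega> = (Q \<omega> - Z \<omega>) / p" for \<omega> by (simp add: f_def Q_def Z_def w_def algebra_simps diff_divide_distrib)
  show "integrable M f" unfolding f using Qi Zi by simp
  have pt: "\<bar>(Q' \<omega> - Z \<omega>) / p\<bar> \<le> e" if o: "\<omega> \<in> space M" for \<omega>
  proof (cases "\<omega> \<in> G")
    case True
    have "mat_trace (D \<omega> * A) = (\<Sum>i<p. \<Sum>j<p. (r i j \<omega> - (if i = j then \<rho> \<omega> else 0)) * A $$ (i, j))"
      using D_carrier[of \<omega>] Ac by (simp add: mat_trace_def scalar_prod_def atLeast0LessThan D_index r_def Asym del: index_minus_mat)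
    also have "\<dots> = (\<Sum>i<p. (\<Sum>j<p. A $$ (i, j) * r i j \<omega>) - \<rho> \<omega> * A $$ (i, i))"
    proof (rule sum.cong[OF refl])
      fix i assume "i \<in> {..<p}"
      then have "(\<Sum>j<p. (if i = j then \<rho> \<omega> * A $$ (i, j) else 0)) = \<rho> \<omega> * A $$ (i, i)" by simp
      moreover have "(r i j \<omega> - (if i = j then \<rho> \<omega> else 0)) * A $$ (i, j)
          = A $$ (i, j) * r i j \<omega> - (if i = j then \<rho> \<omega> * A $$ (i, j) else 0)" for j
        by (simp add: algebra_simps)
      ultimately show "(\<Sum>j<p. (r i j \<omega> - (if i = j then \<rho> \<omega> else 0)) * A $$ (i, j))
          = (\<Sum>j<p. A $$ (i, j) * r i j \<omega>) - \<rho> \<omega> * A $$ (i, i)"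
        by (simp only: sum_subtractf)
    qed
    also have "\<dots> = (\<Sum>i<p. \<Sum>j<p. A $$ (i, j) * r i j \<omega>) - \<rho> \<omega> * mat_trace A"
      using Ac by (simp add: mat_trace_def sum_distrib_left sum_subtractf)
    finally have tD: "mat_trace (D \<omega> * A) = (\<Sum>i<p. \<Sum>j<p. A $$ (i, j) * r i j \<omega>) - \<rho> \<omega> * mat_trace A" .
    have "Q' \<omega> - Z \<omega> = w \<omega> * mat_trace (D \<omega> * A)"
      by (simp only: tD Q'_def Z_def right_diff_distrib mult.assoc)
    then have "\<bar>Q' \<omega> - Z \<omega>\<bar> = w \<omega> * \<bar>mat_trace (D \<omega> * A)\<bar>" using w(1)[OF o] by (simp add: abs_mult)
    also have "\<dots> \<le> 1 * trace_norm (D \<omega>)"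
      using w[OF o] trace_norm_symmetric_duality[OF D_carrier D_sym A, of \<omega>] by (intro mult_mono) auto
    also have "\<dots> \<le> e * p" using tn[OF True] p by (simp add: pos_divide_le_eq)
    finally show ?thesis using p by (simp add: abs_divide pos_divide_le_eq)
  qed (use w(4)[OF o] e0 in \<open>simp add: Q'_def Z_def\<close>)
  have "(LINT \<omega>|M. f \<omega>) = (LINT \<omega>|M. (Q' \<omega> - Z \<omega>) / p)" unfolding f using Qi Zi QQ by simp
  also have "\<bar>\<dots>\<bar> \<le> (LINT \<omega>|M. \<bar>(Q' \<omega> - Z \<omega>) / p\<bar>)" by (rule integral_abs_bound)
  also have "\<dots> \<le> e" by (rule integral_bounded_above) (use Qi Zi pt in auto)
  finally show "\<bar>LINT \<omega>|M. f \<omega>\<bar> \<le> e" .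
qed

text \<open>The remainder in the second-order Taylor formula for the concave function
  \<open>u / (1 + u)\<close> at the conditional mean.\<close>

definition J :: "real \<Rightarrow> real mat \<Rightarrow> 'a \<Rightarrow> real" where
  "J s A \<omega> = (let y = s * (v \<omega> \<bullet> (A *\<^sub>v v \<omega>)); u = s * (\<rho> \<omega> * mat_trace A) in (y - u)\<^sup>2 / ((1 + u)\<^sup>2 * (1 + y)))"

lemma sat_taylor:
  fixes y u :: real
  assumes "0 \<le> y" "0 \<le> u"
  shows "(y - u)\<^sup>2 / ((1 + u)\<^sup>2 * (1 + y)) = (u / (1 + u) - y / (1 + y)) + 1 / (1 + u)\<^sup>2 * (y - u)"
proof -
  have "1 + y \<noteq> 0" "1 + u \<noteq> 0" using assms by auto
  then show ?thesis by (simp add: divide_simps power2_eq_square) (simp add: algebra_simps)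
qed

lemma form_pos:
  assumes "psd_contraction p A"
  shows "0 \<le> v \<omega> \<bullet> (A *\<^sub>v v \<omega>)" "0 \<le> mat_trace A" "A \<in> carrier_mat p p"
  using assms psd_mat_trace_nonneg by (auto simp: psd_contraction_def psd_mat_def)

lemma J_nonneg: 
  assumes "psd_contraction p A" "0 \<le> s"
  shows "0 \<le> J s A \<omega>"
  using form_pos(1)[OF assms(1), of \<omega>] assms(2)
  by (auto simp: J_def Let_def intro!: divide_nonneg_nonneg mult_nonneg_nonneg add_nonneg_nonneg)

lemma J_measurable: 
  assumes "psd_contraction p A"
  shows "J s A \<in> borel_measurable M"
  using form_measurable[OF form_pos(3)[OF assms]] from_H[OF \<rho>] unfolding J_def[abs_def] Let_def by measurable

lemma J_integrable:
  assumes "psd_contraction p A" "0 \<le> s"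
  shows "integrable M (\<lambda>\<omega>. min 1 (J s A \<omega>))"
proof (rule integrable_const_bound[of _ 1])
  show "AE \<omega> in M. norm (min 1 (J s A \<omega>)) \<le> 1" using J_nonneg[OF assms] by (intro AE_I2) (simp add: min_def)
qed (use J_measurable[OF assms(1)] in measurable)

text \<open>The linear Taylor term has the coefficient \<open>1 / (1 + u)\<^sup>2\<close>, which is
  measurable for the conditioning field and at most 1; on \<open>G\<close> its mean costs
  \<open>s * p * e\<close>. Outside \<open>G\<close> the truncated remainder and the difference of
  two saturations cost at most 2, hence \<open>2 * e\<close>.\<close>

lemma jensen_gap:
  fixes s e :: real
  assumes good: "good G e" and A: "psd_contraction p A" and s: "0 \<le> s"
  defines "y \<equiv> \<lambda>\<omega>. s * (v \<omega> \<bullet> (A *\<^sub>v v \<omega>))"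
  shows "expectation (\<lambda>\<omega>. min 1 (J s A \<omega>))
    \<le> mp_G (distr M borel \<rho>) (s * mat_trace A) - expectation (\<lambda>\<omega>. y \<omega> / (1 + y \<omega>)) + (2 + s * p) * e"
proof -
  define u where "u \<omega> = s * (\<rho> \<omega> * mat_trace A)" for \<omega>
  define h where "h \<omega> = 1 / (1 + u \<omega>)\<^sup>2" for \<omega>
  define f where "f \<omega> = indicator G \<omega> * h \<omega> * ((v \<omega> \<bullet> (A *\<^sub>v v \<omega>) - \<rho> \<omega> * mat_trace A) / p)" for \<omega>
  have G: "G \<in> sets M" "prob (space M - G) \<le> e" using good sets_H(1) by (auto simp: good_def)
  have y0: "0 \<le> y \<omega>" for \<omega> using form_pos(1)[OF A] s by (simp add: y_def)
  have u0: "0 \<le> u \<omega>" if "\<omega> \<in> space M" for \<omega> using form_pos(2)[OF A] s \<rho>0[OF that] by (simp add: u_def)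
  have uH: "u \<in> borel_measurable H" unfolding u_def using \<rho> by measurable
  have hH: "h \<in> borel_measurable H" unfolding h_def using uH by measurable
  have h01: "0 \<le> h \<omega>" "h \<omega> \<le> 1" if "\<omega> \<in> space M" for \<omega> 
    using u0[OF that] one_le_power[of "1 + u \<omega>" 2] by (auto simp: h_def divide_simps)
  note f = good_form_integrable[OF good A hH h01, folded f_def[abs_def]] good_form_bound[OF good A hH h01, folded f_def]
  have ym: "y \<in> borel_measurable M" unfolding y_def using form_measurable[OF form_pos(3)[OF A]] by simp
  have um: "u \<in> borel_measurable M" by (rule from_H[OF uH])
  have iy: "integrable M (\<lambda>\<omega>. y \<omega> / (1 + y \<omega>))"
  proof (rule integrable_const_bound[of _ 1])
    have "\<bar>y \<omega> / (1 + y \<omega>)\<bar> \<le> 1" for \<omega> using sat_bounds[OF y0[of \<omega>]] by linarith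
    then show "AE \<omega> in M. norm (y \<omega> / (1 + y \<omega>)) \<le> 1" by simp
  qed (use ym in measurable)
  have iu: "integrable M (\<lambda>\<omega>. u \<omega> / (1 + u \<omega>))"
  proof (rule integrable_const_bound[of _ 1])
    have "\<bar>u \<omega> / (1 + u \<omega>)\<bar> \<le> 1" if "\<omega> \<in> space M" for \<omega> using sat_bounds[OF u0[OF that]] by linarith
    then show "AE \<omega> in M. norm (u \<omega> / (1 + u \<omega>)) \<le> 1" by (intro AE_I2) simp
  qed (use um in measurable)
  have G2: "mp_G (distr M borel \<rho>) (s * mat_trace A) = expectation (\<lambda>\<omega>. u \<omega> / (1 + u \<omega>))"
    unfolding mp_G_def by (subst integral_distr[OF from_H[OF \<rho>]]) (auto simp: u_def mult.left_commute)
  define F where "F \<omega> = (u \<omega> / (1 + u \<omega>) - y \<omega> / (1 + y \<omega>)) + (2 * indicat_real (space M - G) \<omega> + (s * p) * f \<omega>)" for \<omega>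
  have Fi: "integrable M F"
    unfolding F_def using iy iu f(1) G by (intro Bochner_Integration.integrable_add Bochner_Integration.integrable_diff integrable_mult_right integrable_event) auto
  have "expectation (\<lambda>\<omega>. min 1 (J s A \<omega>)) \<le> expectation F"
  proof (rule integral_mono[OF J_integrable[OF A s] Fi])
    fix \<omega> assume o: "\<omega> \<in> space M"
    show "min 1 (J s A \<omega>) \<le> F \<omega>"
    proof (cases "\<omega> \<in> G")
      case True
      have "J s A \<omega> = (y \<omega> - u \<omega>)\<^sup>2 / ((1 + u \<omega>)\<^sup>2 * (1 + y \<omega>))" by (simp add: J_def y_def u_def Let_def)
      also have "\<dots> = (u \<omega> / (1 + u \<omega>) - y \<omega> / (1 + y \<omega>)) + h \<omega> * (y \<omega> - u \<omega>)"
        unfolding h_def by (rule sat_taylor[OF y0 u0[OF o]])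
        also have "h \<omega> * (y \<omega> - u \<omega>) = (s * p) * f \<omega>"
        proof -
          define w where "w = v \<omega> \<bullet> (A *\<^sub>v v \<omega>) - \<rho> \<omega> * mat_trace A"
          have "y \<omega> - u \<omega> = s * w" by (simp add: y_def u_def w_def right_diff_distrib)
          moreover have "f \<omega> = h \<omega> * (w / p)" using True by (simp add: f_def w_def)
          ultimately show ?thesis using p by simp
        qed
      finally show ?thesis using True by (simp add: F_def)
    next
      case False
      then show ?thesis using sat_bounds[OF y0[of \<omega>]] sat_bounds[OF u0[OF o]] o by (simp add: F_def f_def)
    qed
  qed
  also have "expectation F = (expectation (\<lambda>\<omega>. u \<omega> / (1 + u \<omega>)) - expectation (\<lambda>\<omega>. y \<omega> / (1 + y \<omega>)))
      + (2 * prob (space M - G) + (s * p) * expectation f)"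
  proof -
    define a where "a \<omega> = u \<omega> / (1 + u \<omega>)" for \<omega>
    define b where "b \<omega> = y \<omega> / (1 + y \<omega>)" for \<omega>
    define g where "g = indicat_real (space M - G)"
    have int: "integrable M a" "integrable M b" "integrable M g" 
      using iu iy G integrable_event[of "space M - G"] by (auto simp: a_def[abs_def] b_def[abs_def] g_def)
    have "expectation (\<lambda>\<omega>. (a \<omega> - b \<omega>) + (2 * g \<omega> + (s * p) * f \<omega>))
        = (expectation a - expectation b) + (2 * expectation g + (s * p) * expectation f)"
      using int f(1) by simp
    moreover have "expectation g = prob (space M - G)" unfolding g_def using G by simp
    ultimately show ?thesis by (simp only: F_def[abs_def] a_def[abs_def] b_def[abs_def] g_def)
  qed
  also have "\<dots> \<le> (expectation (\<lambda>\<omega>. u \<omega> / (1 + u \<omega>)) - expectation (\<lambda>\<omega>. y \<omega> / (1 + y \<omega>))) + (2 * e + (s * p) * e)"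
    using G(2) f(2) s by (intro add_left_mono add_mono mult_left_mono) auto
  finally show ?thesis unfolding G2 by (simp add: algebra_simps)
qed

text \<open>The deviation splits into the form of \<open>P - A\<close>, its radial mean and the
  deviation of the form of \<open>A\<close>, with \<open>\<epsilon> / 3\<close> allotted to each.
  Markov's inequality handles the first and \<open>\<kappa> * \<tau>\<close> the second; the third
  would make the Taylor remainder at least \<open>j\<close>.\<close>

lemma projection_form_bound:
  fixes s \<epsilon> \<kappa> \<tau> \<sigma>1 \<sigma>2 e :: real
  assumes good: "good G e" and A: "psd_contraction p A" and PA: "psd_contraction p (P - A)" and P: "P \<in> carrier_mat p p"
    and \<epsilon>: "0 < \<epsilon>" and \<kappa>: "0 \<le> \<kappa>" and \<tau>: "mat_trace (P - A) / p \<le> \<tau>" "\<kappa> * \<tau> \<le> \<epsilon> / 3"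
    and s: "0 < \<sigma>1" "\<sigma>1 \<le> s * p" "s * p \<le> \<sigma>2"
  defines "\<theta> \<equiv> \<sigma>1 * \<epsilon> / 3"
  defines "j \<equiv> min 1 (\<theta>\<^sup>2 / ((1 + \<sigma>2 * \<kappa>)\<^sup>2 * (1 + \<sigma>2 * \<kappa> + \<theta>)))"
  shows "prob {\<omega> \<in> space M. \<epsilon> < \<bar>v \<omega> \<bullet> (P *\<^sub>v v \<omega>) / p - \<rho> \<omega> * mat_trace P / p\<bar>}
    \<le> prob {\<omega> \<in> space M. \<kappa> < \<rho> \<omega>} + e + 3 * (e + \<kappa> * \<tau>) / \<epsilon> + expectation (\<lambda>\<omega>. min 1 (J s A \<omega>)) / j"
proof -
  have "0 < s * p" using s by linarith
  then have s0: "0 < s" using p by (simp add: zero_less_mult_iff)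
  have \<theta>: "0 < \<theta>" using s \<epsilon> by (simp add: \<theta>_def)
  have \<sigma>2: "0 \<le> \<sigma>2 * \<kappa>" using s \<kappa> by auto
  have j: "0 < j" using \<theta> \<sigma>2 by (auto simp: j_def intro!: divide_pos_pos mult_pos_pos add_pos_nonneg)
  have Ac: "A \<in> carrier_mat p p" by (rule form_pos(3)[OF A])
  define W where "W \<omega> = v \<omega> \<bullet> ((P - A) *\<^sub>v v \<omega>) / p" for \<omega>
  define T where "T = mat_trace (P - A) / p"
  have T: "0 \<le> T" "T \<le> \<tau>" using form_pos(2)[OF PA] \<tau> by (auto simp: T_def)
  have W0: "0 \<le> W \<omega>" for \<omega> using form_pos(1)[OF PA] by (simp add: W_def)
  have tr: "mat_trace P / p = mat_trace A / p + T" using mat_trace_minus[OF P Ac] by (simp add: T_def diff_divide_distrib)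
  have Pf: "v \<omega> \<bullet> (P *\<^sub>v v \<omega>) / p = v \<omega> \<bullet> (A *\<^sub>v v \<omega>) / p + W \<omega>" for \<omega>
  proof -
    have "v \<omega> \<bullet> ((P - A) *\<^sub>v v \<omega>) = v \<omega> \<bullet> (P *\<^sub>v v \<omega>) - v \<omega> \<bullet> (A *\<^sub>v v \<omega>)"
      using P Ac by (subst minus_mult_distrib_mat_vec[of _ p p]) (auto intro!: scalar_prod_minus_distrib[of _ p])
    then show ?thesis by (simp add: W_def diff_divide_distrib)
  qed
  \<comment> \<open>The cut-off at \<kappa> keeps the radial mean of \<open>P - A\<close> below
    \<open>\<kappa> * \<tau>\<close>, and it is an admissible weight because \<rho> is measurable
    for the conditioning field.\<close>
  define h where "h \<omega> = (if \<rho> \<omega> \<le> \<kappa> then 1 else 0 :: real)" for \<omega>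
  have hH: "h \<in> borel_measurable H" unfolding h_def using \<rho> by measurable
  have h01: "0 \<le> h \<omega>" "h \<omega> \<le> 1" for \<omega> by (auto simp: h_def)
  define f where "f \<omega> = indicator G \<omega> * h \<omega> * ((v \<omega> \<bullet> ((P - A) *\<^sub>v v \<omega>) - \<rho> \<omega> * mat_trace (P - A)) / p)" for \<omega>
  note f = good_form_integrable[OF good PA hH h01, folded f_def[abs_def]] good_form_bound[OF good PA hH h01, folded f_def]
  have G: "G \<in> sets M" "prob (space M - G) \<le> e" using good sets_H(1) by (auto simp: good_def)
  have \<rho>m: "\<rho> \<in> borel_measurable M" by (rule from_H[OF \<rho>])
  have Wm: "W \<in> borel_measurable M" unfolding W_def using form_measurable[OF form_pos(3)[OF PA]] by simp
  have Am: "(\<lambda>\<omega>. v \<omega> \<bullet> (A *\<^sub>v v \<omega>)) \<in> borel_measurable M" by (rule form_measurable[OF Ac])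
  have Jm: "J s A \<in> borel_measurable M" by (rule J_measurable[OF A])
  define Z where "Z \<omega> = f \<omega> + \<kappa> * \<tau>" for \<omega>
  have \<kappa>\<tau>: "0 \<le> \<kappa> * \<tau>" using \<kappa> T by simp
  define W' where "W' \<omega> = indicator G \<omega> * h \<omega> * W \<omega>" for \<omega>
  have W'm: "W' \<in> borel_measurable M" unfolding W'_def using G(1) from_H[OF hH] Wm by measurable
  have W'0: "0 \<le> W' \<omega>" for \<omega> using h01 W0 by (simp add: W'_def)
  have W'Z: "W' \<omega> \<le> Z \<omega>" if o: "\<omega> \<in> space M" for \<omega>
  proof (cases "\<omega> \<in> G \<and> \<rho> \<omega> \<le> \<kappa>")
    case True
    have "\<rho> \<omega> * T \<le> \<kappa> * \<tau>" using True T \<rho>0[OF o] \<kappa> by (intro mult_mono) auto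
    then show ?thesis using True by (simp add: W'_def Z_def f_def h_def W_def T_def diff_divide_distrib)
  next
    case False
    then show ?thesis using \<kappa>\<tau> by (auto simp: W'_def Z_def f_def h_def)
  qed
  have Zi: "integrable M Z" unfolding Z_def using f(1) by simp
  have W'i: "integrable M W'"
    by (rule Bochner_Integration.integrable_bound[OF Zi W'm]) (use W'0 W'Z in \<open>force intro!: AE_I2\<close>)
  have "expectation W' \<le> expectation Z" using W'i Zi W'Z by (rule integral_mono)
  also have "\<dots> \<le> e + \<kappa> * \<tau>" unfolding Z_def using f by (simp add: prob_space)
  finally have EW: "expectation W' \<le> e + \<kappa> * \<tau>" .
  define E1 where "E1 = {\<omega> \<in> space M. \<kappa> < \<rho> \<omega>}"
  define E2 where "E2 = space M - G"
  define E3 where "E3 = {\<omega> \<in> space M. \<epsilon> / 3 \<le> W' \<omega>}"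
  define E4 where "E4 = {\<omega> \<in> space M. j \<le> min 1 (J s A \<omega>)}"
  have E[measurable]: "E1 \<in> sets M" "E2 \<in> sets M" "E3 \<in> sets M" "E4 \<in> sets M"
    unfolding E1_def E2_def E3_def E4_def using \<rho>m G(1) W'm Jm by measurable
  have E3: "prob E3 \<le> 3 * (e + \<kappa> * \<tau>) / \<epsilon>"
  proof -
    have "prob E3 \<le> expectation W' / (\<epsilon> / 3)"
      unfolding E3_def by (rule integral_Markov_inequality_measure[where A="{}"]) (use W'i W'0 \<epsilon> in auto)
    also have "\<dots> \<le> (e + \<kappa> * \<tau>) / (\<epsilon> / 3)" using EW \<epsilon> by (intro divide_right_mono) auto
    finally show ?thesis by (simp add: mult.commute)
  qed
  have E4: "prob E4 \<le> expectation (\<lambda>\<omega>. min 1 (J s A \<omega>)) / j"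
    unfolding E4_def
    by (rule integral_Markov_inequality_measure[where A="{}"]) (use J_integrable[OF A] s0 J_nonneg[OF A] j in auto)
  have sub: "{\<omega> \<in> space M. \<epsilon> < \<bar>v \<omega> \<bullet> (P *\<^sub>v v \<omega>) / p - \<rho> \<omega> * mat_trace P / p\<bar>} \<subseteq> E1 \<union> E2 \<union> E3 \<union> E4"
  proof (intro subsetI, rule ccontr)
    fix \<omega> assume "\<omega> \<in> {\<omega> \<in> space M. \<epsilon> < \<bar>v \<omega> \<bullet> (P *\<^sub>v v \<omega>) / p - \<rho> \<omega> * mat_trace P / p\<bar>}"
    then have o: "\<omega> \<in> space M" and big: "\<epsilon> < \<bar>v \<omega> \<bullet> (P *\<^sub>v v \<omega>) / p - \<rho> \<omega> * (mat_trace P / p)\<bar>" by auto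
    assume "\<omega> \<notin> E1 \<union> E2 \<union> E3 \<union> E4"
    then have \<rho>\<kappa>: "\<rho> \<omega> \<le> \<kappa>" and oG: "\<omega> \<in> G" and w: "W' \<omega> < \<epsilon> / 3" and jj: "min 1 (J s A \<omega>) < j"
      using o by (auto simp: E1_def E2_def E3_def E4_def not_less not_le)
    have w: "W \<omega> < \<epsilon> / 3" using w \<rho>\<kappa> oG by (simp add: W'_def h_def)
    define a where "a = v \<omega> \<bullet> (A *\<^sub>v v \<omega>) / p - \<rho> \<omega> * (mat_trace A / p)"
    have "\<rho> \<omega> * T \<le> \<kappa> * \<tau>" "0 \<le> \<rho> \<omega> * T" using \<rho>\<kappa> T \<rho>0[OF o] \<kappa> by (auto intro: mult_mono)
    moreover have "v \<omega> \<bullet> (P *\<^sub>v v \<omega>) / p - \<rho> \<omega> * (mat_trace P / p) = a + W \<omega> - \<rho> \<omega> * T"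
      unfolding Pf tr a_def by (simp add: algebra_simps)
    ultimately have a: "\<epsilon> / 3 < \<bar>a\<bar>" using big w \<tau>(2) W0[of \<omega>] by linarith
    define y where "y = s * (v \<omega> \<bullet> (A *\<^sub>v v \<omega>))"
    define u where "u = s * (\<rho> \<omega> * mat_trace A)"
    define \<Delta> where "\<Delta> = \<bar>y - u\<bar>"
    have y0: "0 \<le> y" and u0: "0 \<le> u" using form_pos(1,2)[OF A] s0 \<rho>0[OF o] by (auto simp: y_def u_def)
    have "y - u = (s * p) * a"
    proof -
      have "v \<omega> \<bullet> (A *\<^sub>v v \<omega>) - \<rho> \<omega> * mat_trace A = p * a"
        using p by (simp add: a_def right_diff_distrib)
      then show ?thesis by (simp add: y_def u_def right_diff_distrib[symmetric])
    qed
    then have "\<Delta> = (s * p) * \<bar>a\<bar>" using s0 by (simp add: \<Delta>_def abs_mult)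
    moreover have "\<sigma>1 * (\<epsilon> / 3) \<le> (s * p) * \<bar>a\<bar>" using s a \<epsilon> s0 by (intro mult_mono) auto
    ultimately have \<Delta>: "\<theta> \<le> \<Delta>" by (simp add: \<theta>_def)
    have "s * (\<rho> \<omega> * mat_trace A) \<le> s * (\<kappa> * p)"
      using \<rho>\<kappa> psd_contraction_trace_le[OF A] form_pos(2)[OF A] s0 \<kappa> by (intro mult_left_mono mult_mono) auto
    also have "\<dots> = (s * p) * \<kappa>" by simp
    also have "\<dots> \<le> \<sigma>2 * \<kappa>" using s \<kappa> by (intro mult_right_mono) auto
    finally have u2: "u \<le> \<sigma>2 * \<kappa>" by (simp add: u_def)
    define b where "b = 1 + \<sigma>2 * \<kappa>"
    have b: "1 \<le> b" "1 + u \<le> b" using \<sigma>2 u2 by (auto simp: b_def)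
    \<comment> \<open>The function \<open>z\<^sup>2 / (b + z)\<close> increases in \<open>z\<close>.
      Together with \<open>1 + y \<le> b + \<Delta>\<close> this bounds the remainder below even
      when \<open>y\<close> is huge.\<close>
    have "\<theta>\<^sup>2 / (b + \<theta>) \<le> \<Delta>\<^sup>2 / (b + \<Delta>)"
    proof -
      have "\<theta>\<^sup>2 * \<Delta> \<le> \<Delta>\<^sup>2 * \<theta>" using mult_left_mono[OF \<Delta>, of "\<theta> * \<Delta>"] \<theta> \<Delta> by (simp add: power2_eq_square mult.commute mult.left_commute)
      moreover have "\<theta>\<^sup>2 * b \<le> \<Delta>\<^sup>2 * b" using \<theta> \<Delta> b by (intro mult_right_mono power_mono) auto
      ultimately have main: "\<theta>\<^sup>2 * (b + \<Delta>) \<le> \<Delta>\<^sup>2 * (b + \<theta>)" unfolding distrib_left by (rule add_mono[rotated])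
      have pos: "0 < b + \<theta>" "0 < b + \<Delta>" using \<theta> \<Delta> b by auto
      show ?thesis
        unfolding pos_divide_le_eq[OF pos(1)] times_divide_eq_left pos_le_divide_eq[OF pos(2)] by (rule main)
    qed
    also have "\<dots> \<le> \<Delta>\<^sup>2 / (1 + y)" 
      using b y0 by (intro divide_left_mono) (auto simp: \<Delta>_def intro!: mult_pos_pos)
    finally have 1: "\<theta>\<^sup>2 / (b + \<theta>) \<le> \<Delta>\<^sup>2 / (1 + y)" .
    have "\<theta>\<^sup>2 / (b\<^sup>2 * (b + \<theta>)) = (\<theta>\<^sup>2 / (b + \<theta>)) / b\<^sup>2" by (simp add: mult.commute)
    also have "\<dots> \<le> (\<Delta>\<^sup>2 / (1 + y)) / (1 + u)\<^sup>2"
    proof (rule frac_le)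
      show "0 \<le> \<Delta>\<^sup>2 / (1 + y)" using y0 by simp
      show "(1 + u)\<^sup>2 \<le> b\<^sup>2" using b u0 by (intro power_mono) auto
    qed (use 1 u0 in auto)
    also have "\<dots> = J s A \<omega>"
    proof -
      have J: "J s A \<omega> = (y - u)\<^sup>2 / ((1 + u)\<^sup>2 * (1 + y))" by (simp add: J_def Let_def y_def u_def)
      show ?thesis unfolding J \<Delta>_def by (simp add: mult.commute)
    qed
    finally have "j \<le> min 1 (J s A \<omega>)" unfolding j_def b_def by (simp add: add.assoc min_def)
    then show False using jj leD by blast
  qed
  have "prob {\<omega> \<in> space M. \<epsilon> < \<bar>v \<omega> \<bullet> (P *\<^sub>v v \<omega>) / p - \<rho> \<omega> * mat_trace P / p\<bar>} \<le> prob (E1 \<union> E2 \<union> E3 \<union> E4)"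
    by (rule finite_measure_mono[OF sub]) simp
  also have "\<dots> \<le> prob E1 + prob E2 + prob E3 + prob E4"
    by (intro order_trans[OF measure_Un_le] add_right_mono) auto
  also have "\<dots> \<le> prob E1 + e + 3 * (e + \<kappa> * \<tau>) / \<epsilon> + expectation (\<lambda>\<omega>. min 1 (J s A \<omega>)) / j"
    using E3 E4 G(2) by (simp add: E2_def)
  finally show ?thesis by (simp add: E1_def)
qed

end

section \<open>Spectral limits imply radial quadratic concentration\<close>

lemma tends_to_0_in_probD:
  "tends_to_0_in_prob M Y \<Longrightarrow> 0 < e \<Longrightarrow> (\<lambda>n. measure (M n) {\<omega> \<in> space (M n). e < \<bar>Y n \<omega>\<bar>}) \<longlonglongrightarrow> 0"
  by (simp add: tends_to_0_in_prob_def)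

lemma tends_to_0_in_prob_bounded_L1:
  fixes Y :: "nat \<Rightarrow> 'a \<Rightarrow> real"
  assumes M: "\<And>n. prob_space (M n)" and Y: "\<And>n. Y n \<in> borel_measurable (M n)" "tends_to_0_in_prob M Y"
    and b: "\<And>n \<omega>. \<omega> \<in> space (M n) \<Longrightarrow> \<bar>Y n \<omega>\<bar> \<le> b"
  shows "(\<lambda>n. LINT \<omega>|M n. \<bar>Y n \<omega>\<bar>) \<longlonglongrightarrow> 0"
proof (rule tendstoI)
  fix e :: real assume e: "0 < e"
  have "(\<lambda>n. \<bar>b\<bar> * measure (M n) {\<omega> \<in> space (M n). e / 2 < \<bar>Y n \<omega>\<bar>}) \<longlonglongrightarrow> \<bar>b\<bar> * 0"
    by (intro tendsto_mult tendsto_const tends_to_0_in_probD[OF Y(2)]) (use e in simp)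
  then have "eventually (\<lambda>n. \<bar>b\<bar> * measure (M n) {\<omega> \<in> space (M n). e / 2 < \<bar>Y n \<omega>\<bar>} < e / 2) sequentially"
    by (rule order_tendstoD) (use e in simp)
  then show "eventually (\<lambda>n. dist (LINT \<omega>|M n. \<bar>Y n \<omega>\<bar>) 0 < e) sequentially"
  proof eventually_elim
    case (elim n)
    interpret prob_space "M n" by (rule M)
    define E where "E = {\<omega> \<in> space (M n). e / 2 < \<bar>Y n \<omega>\<bar>}"
    have E: "E \<in> events" unfolding E_def using Y(1)[of n] by measurable
    have "(LINT \<omega>|M n. \<bar>Y n \<omega>\<bar>) \<le> (LINT \<omega>|M n. e / 2 + \<bar>b\<bar> * indicator E \<omega>)"
    proof (rule integral_mono)
      show "integrable (M n) (\<lambda>\<omega>. \<bar>Y n \<omega>\<bar>)"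
        by (rule integrable_const_bound[of _ b]) (use b Y(1)[of n] in auto)
      show "integrable (M n) (\<lambda>\<omega>. e / 2 + \<bar>b\<bar> * indicator E \<omega>)"
        using integrable_event[OF E] by simp
      show "\<bar>Y n \<omega>\<bar> \<le> e / 2 + \<bar>b\<bar> * indicator E \<omega>" if "\<omega> \<in> space (M n)" for \<omega>
        using b[OF that] that e by (cases "\<omega> \<in> E") (auto simp: E_def)
    qed
    also have "\<dots> = e / 2 + \<bar>b\<bar> * prob E"
      using integrable_event[OF E] E by (simp add: prob_space)
    finally show ?case using elim by (simp add: dist_real_def E_def)
  qed
qed

text \<open>Slutsky's lemma, tested on the ramps because they are Lipschitz.\<close>

lemma weak_conv_tends_to_0_in_prob:
  fixes Y Z :: "nat \<Rightarrow> 'a \<Rightarrow> real"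
  assumes M: "\<And>n. prob_space (M n)" and Y: "\<And>n. Y n \<in> borel_measurable (M n)" and Z: "\<And>n. Z n \<in> borel_measurable (M n)"
    and lim: "tends_to_0_in_prob M (\<lambda>n \<omega>. Y n \<omega> - Z n \<omega>)"
    and w: "weak_conv_m (\<lambda>n. distr (M n) borel (Z n)) \<nu>" and \<nu>: "real_distribution \<nu>"
  shows "weak_conv_m (\<lambda>n. distr (M n) borel (Y n)) \<nu>"
proof (rule integral_cts_step_conv_imp_weak_conv)
  have rd: "real_distribution (distr (M n) borel (Y n))" "real_distribution (distr (M n) borel (Z n))" for n
    using prob_space.real_distribution_distr[OF M] Y Z by auto
  show "\<And>n. real_distribution (distr (M n) borel (Y n))" "real_distribution \<nu>" using rd \<nu> by auto
  fix a b :: real assume ab: "a < b"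
  let ?c = "cts_step a b"
  have cm: "?c \<in> borel_measurable borel"
    by (rule borel_measurable_continuous_onI[OF uniformly_continuous_imp_continuous[OF cts_step_uniformly_continuous[OF ab]]])
  have c01: "0 \<le> ?c u" "?c u \<le> 1" for u using ab by (auto simp: cts_step_def)
  have lip: "\<bar>?c u - ?c u'\<bar> \<le> \<bar>(1 / (b - a)) * (u - u')\<bar>" for u u'
    using ab by (auto simp: cts_step_def abs_mult divide_simps abs_if)
  have Zlim: "(\<lambda>n. LINT \<omega>|M n. ?c (Z n \<omega>)) \<longlonglongrightarrow> (LINT l|\<nu>. ?c l)"
  proof -
    have "(\<lambda>n. LINT l|distr (M n) borel (Z n). ?c l) \<longlonglongrightarrow> (LINT l|\<nu>. ?c l)"
    proof (rule weak_conv_imp_integral_bdd_continuous_conv[OF rd(2) \<nu> w, where B=1])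
      show "isCont ?c u" for u
        using uniformly_continuous_imp_continuous[OF cts_step_uniformly_continuous[OF ab]] by (simp add: continuous_on_eq_continuous_at)
      show "norm (?c u) \<le> 1" for u using c01[of u] by simp
    qed
    then show ?thesis using integral_distr[OF Z cm] by simp
  qed
  have "tends_to_0_in_prob M (\<lambda>n \<omega>. ?c (Y n \<omega>) - ?c (Z n \<omega>))"
    by (rule tends_to_0_in_prob_mono[OF M _ tends_to_0_in_prob_scale[OF lim, of "1 / (b - a)"]])
      (use Y Z lip in \<open>auto intro!: borel_measurable_times borel_measurable_diff\<close>)
  then have "(\<lambda>n. LINT \<omega>|M n. \<bar>?c (Y n \<omega>) - ?c (Z n \<omega>)\<bar>) \<longlonglongrightarrow> 0"
  proof (rule tends_to_0_in_prob_bounded_L1[OF M, rotated])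
    show "(\<lambda>\<omega>. ?c (Y n \<omega>) - ?c (Z n \<omega>)) \<in> borel_measurable (M n)" for n
      by (intro borel_measurable_diff measurable_compose[OF _ cm] Y Z)
    show "\<bar>?c (Y n \<omega>) - ?c (Z n \<omega>)\<bar> \<le> 1" for n \<omega> using c01[of "Y n \<omega>"] c01[of "Z n \<omega>"] by linarith
  qed
  then have "(\<lambda>n. (LINT \<omega>|M n. ?c (Y n \<omega>)) - (LINT \<omega>|M n. ?c (Z n \<omega>))) \<longlonglongrightarrow> 0"
  proof (rule Lim_null_comparison[rotated])
    have int: "integrable (M n) (\<lambda>\<omega>. ?c (V \<omega>))" if "V \<in> borel_measurable (M n)" for n V
    proof -
      interpret prob_space "M n" by (rule M)
      show ?thesis by (rule integrable_const_bound[of _ 1]) (use c01 measurable_compose[OF that cm] in auto)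
    qed
    show "eventually (\<lambda>n. norm ((LINT \<omega>|M n. ?c (Y n \<omega>)) - (LINT \<omega>|M n. ?c (Z n \<omega>))) \<le> (LINT \<omega>|M n. \<bar>?c (Y n \<omega>) - ?c (Z n \<omega>)\<bar>)) sequentially"
    proof (intro always_eventually allI)
      fix n
      show "norm ((LINT \<omega>|M n. ?c (Y n \<omega>)) - (LINT \<omega>|M n. ?c (Z n \<omega>))) \<le> (LINT \<omega>|M n. \<bar>?c (Y n \<omega>) - ?c (Z n \<omega>)\<bar>)"
        unfolding Bochner_Integration.integral_diff[OF int[OF Y] int[OF Z], symmetric] real_norm_def by (rule integral_abs_bound)
    qed
  qed
  from tendsto_add[OF this Zlim] have "(\<lambda>n. LINT \<omega>|M n. ?c (Y n \<omega>)) \<longlonglongrightarrow> (LINT l|\<nu>. ?c l)" by simp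
  then show "(\<lambda>n. LINT l|distr (M n) borel (Y n). ?c l) \<longlonglongrightarrow> (LINT l|\<nu>. ?c l)"
    using integral_distr[OF Y cm] by simp
qed

lemma psd_contraction_complement:
  assumes A: "psd_contraction n A"
  shows "psd_contraction n (1\<^sub>m n - A)"
proof -
  have Ac: "A \<in> carrier_mat n n" "transpose_mat A = A" using A by (auto simp: psd_contraction_def psd_mat_def)
  have "transpose_mat (1\<^sub>m n - A) = 1\<^sub>m n - A"
  proof (rule eq_matI)
    fix i j assume ij: "i < dim_row (1\<^sub>m n - A)" "j < dim_col (1\<^sub>m n - A)"
    then have "A $$ (j, i) = A $$ (i, j)" using Ac by (metis carrier_matD index_minus_mat(2,3) index_transpose_mat(1))
    then show "transpose_mat (1\<^sub>m n - A) $$ (i, j) = (1\<^sub>m n - A) $$ (i, j)" using ij Ac(1) by auto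
  qed (use Ac in auto)
  moreover have "w \<bullet> ((1\<^sub>m n - A) *\<^sub>v w) = w \<bullet> w - w \<bullet> (A *\<^sub>v w)" if "w \<in> carrier_vec n" for w
    using that Ac by (subst minus_mult_distrib_mat_vec[of _ n n]) (auto intro!: scalar_prod_minus_distrib[of _ n])
  ultimately show ?thesis using A Ac by (auto simp: psd_contraction_def psd_mat_def)
qed

text \<open>Markov's inequality for the truncated variable \<open>min 1 (\<rho> / \<kappa>)\<close>.
  Its mean is continuous under weak convergence, so the bound passes to large \<open>n\<close> from
  \<nu>.\<close>

lemma prob_gt_le_mp_modulus:
  assumes M: "prob_space M" and \<rho>: "\<rho> \<in> borel_measurable M" "\<And>\<omega>. \<omega> \<in> space M \<Longrightarrow> 0 \<le> \<rho> \<omega>" and \<kappa>: "0 < \<kappa>"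
  shows "measure M {\<omega> \<in> space M. \<kappa> < \<rho> \<omega>} \<le> mp_modulus (distr M borel \<rho>) (1 / \<kappa>)"
proof -
  interpret prob_space M by (rule M)
  have E: "{\<omega> \<in> space M. \<kappa> < \<rho> \<omega>} \<in> events" using \<rho>(1) by measurable
  have "prob {\<omega> \<in> space M. \<kappa> < \<rho> \<omega>} = expectation (indicator {\<omega> \<in> space M. \<kappa> < \<rho> \<omega>})" using E by simp
  also have "\<dots> \<le> expectation (\<lambda>\<omega>. min 1 (\<rho> \<omega> * (1 / \<kappa>)))"
  proof (rule integral_mono)
    show "integrable M (indicat_real {\<omega> \<in> space M. \<kappa> < \<rho> \<omega>})" using E by (simp add: integrable_indicator_iff less_top[symmetric])
    show "integrable M (\<lambda>\<omega>. min 1 (\<rho> \<omega> * (1 / \<kappa>)))"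
      by (rule integrable_const_bound[of _ 1], rule AE_I2) (use \<rho> \<kappa> in auto)
    show "indicat_real {\<omega> \<in> space M. \<kappa> < \<rho> \<omega>} \<omega> \<le> min 1 (\<rho> \<omega> * (1 / \<kappa>))" if "\<omega> \<in> space M" for \<omega>
      using \<rho>(2)[OF that] \<kappa> by (auto simp: indicator_def field_simps)
  qed
  also have "\<dots> = mp_modulus (distr M borel \<rho>) (1 / \<kappa>)"
    unfolding mp_modulus_def by (rule integral_distr[OF \<rho>(1), symmetric]) measurable
  finally show ?thesis .
qed

locale aci_sequence = sample_sequence +
  fixes H :: "nat \<Rightarrow> 'a measure" and \<rho> :: "nat \<Rightarrow> 'a \<Rightarrow> real" and \<nu> :: "real measure"
  assumes \<nu>: "prob_on_nonneg \<nu>" and aci: "ACI_through M p x H \<rho> \<nu>" and rmp: "RMP_Pi M p N X c \<nu>"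
begin

lemma isotropy: "conditional_isotropy (M n) (H n) (p n) (x n) (\<rho> n)"
  using aci M x p unfolding ACI_through_def radial_reduction_def conditional_isotropy_def conditional_isotropy_axioms_def by blast

lemma \<rho>_measurable: "\<rho> n \<in> borel_measurable (M n)"
  by (rule conditional_isotropy.from_H[OF isotropy conditional_isotropy.\<rho>[OF isotropy]])

lemma \<rho>_law: "prob_on_nonneg (distr (M n) borel (\<rho> n))"
  by (rule prob_on_nonneg_distr[OF M \<rho>_measurable conditional_isotropy.\<rho>0[OF isotropy]])

lemma \<rho>_lim: "weak_conv_m (\<lambda>n. distr (M n) borel (\<rho> n)) \<nu>"
  using aci by (simp add: ACI_through_def)

lemma good_eventually:
  assumes e: "0 < e"
  shows "eventually (\<lambda>n. \<exists>G. conditional_isotropy.good (M n) (H n) (p n) (x n) (\<rho> n) G e) sequentially"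
proof -
  have "(\<lambda>n. measure (M n) {\<omega> \<in> space (M n). e < \<bar>trace_norm (cond_second_moment (M n) (H n) (p n) (x n) \<omega> - \<rho> n \<omega> \<cdot>\<^sub>m 1\<^sub>m (p n)) / real (p n)\<bar>}) \<longlonglongrightarrow> 0"
    using aci e by (simp add: ACI_through_def radial_reduction_def tends_to_0_in_prob_def)
  then have "eventually (\<lambda>n. measure (M n) {\<omega> \<in> space (M n). e < \<bar>trace_norm (cond_second_moment (M n) (H n) (p n) (x n) \<omega> - \<rho> n \<omega> \<cdot>\<^sub>m 1\<^sub>m (p n)) / real (p n)\<bar>} < e / 2) sequentially"
    by (rule order_tendstoD) (use e in simp)
  then show ?thesis
    by eventually_elim (use conditional_isotropy.good_exists[OF isotropy e] in auto)
qed

lemma inverse_N: "(\<lambda>n. 1 / real (N n)) \<longlonglongrightarrow> 0"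
proof -
  have "(\<lambda>n. 1 / real (p n)) \<longlonglongrightarrow> 0"
    by (rule tendsto_divide_0[OF tendsto_const filterlim_at_top_imp_at_infinity[OF filterlim_compose[OF filterlim_real_sequentially p_lim]]])
  from tendsto_mult[OF pN_lim this] have "(\<lambda>n. (real (p n) / real (N n)) * (1 / real (p n))) \<longlonglongrightarrow> 0" by simp
  moreover have "(real (p n) / real (N n)) * (1 / real (p n)) = 1 / real (N n)" for n using p[of n] by simp
  ultimately show ?thesis by simp
qed

section \<open>A sequence of projections with positive limiting relative rank\<close>

context
  fixes P C :: "nat \<Rightarrow> real mat" and \<alpha> :: real
  assumes \<alpha>: "0 < \<alpha>" "\<alpha> \<le> 1" and P: "\<And>n. orth_projection (p n) (P n)"
    and C: "\<And>n. orthonormal_rows_of_range (p n) (P n) (C n)" 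
    and lim: "(\<lambda>n. real (mat_rank (P n)) / real (p n)) \<longlonglongrightarrow> \<alpha>"
begin

definition q where "q n = mat_rank (P n)"
definition d where "d = c * \<alpha>"
definition \<mu> where "\<mu> = mp_law d \<nu>"
definition ms where "ms t = (LINT l|\<mu>. 1 / (l + t))"
definition mr where "mr t n Y = (LINT l|spectral_law P C \<mu> n Y. 1 / (l + t))"

lemma d: "0 < d" using c \<alpha> by (simp add: d_def)

lemma \<mu>: "prob_on_nonneg \<mu>" unfolding \<mu>_def by (rule prob_on_nonneg_mp_law[OF \<nu> d])

lemma ms: assumes "0 < t" shows "0 < ms t" "ms t \<le> 1 / t" "mp_real_eq d \<nu> t (ms t)"
  using resolvent_transform_pos[OF \<mu> assms] mp_law_real_eq[OF \<nu> d assms] by (auto simp: ms_def \<mu>_def)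

lemma q_lim: "filterlim q at_top sequentially" "(\<lambda>n. real (q n) / real (N n)) \<longlonglongrightarrow> d"
  using rank_lim[OF lim \<alpha>(1)] rank_sample_ratio[OF lim \<alpha>(1)] by (auto simp: q_def[abs_def] d_def)

lemma q_pos: "eventually (\<lambda>n. 0 < q n) sequentially"
  by (rule eventually_compose_filterlim[OF eventually_gt_at_top q_lim(1)])

lemma spectral: "random_spectral_measure (S n) (spectral_law P C \<mu> n)"
  by (rule random_spectral_measure_spectral_law[OF C \<mu>])

lemma mr_measurable: "0 < t \<Longrightarrow> mr t n \<in> borel_measurable (S n)"
  unfolding mr_def[abs_def] by (rule random_spectral_measure.resolvent_measurable[OF spectral])

lemma mr_bounds: "0 < t \<Longrightarrow> Y \<in> space (S n) \<Longrightarrow> 0 < mr t n Y" "0 < t \<Longrightarrow> Y \<in> space (S n) \<Longrightarrow> mr t n Y \<le> 1 / t"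
  unfolding mr_def using resolvent_transform_pos[OF random_spectral_measure.\<mu>[OF spectral]] by auto

text \<open>Continuity of the resolvent transform at the fixed law \<mu> turns the convergence in
  Levy distance into convergence of the normalized resolvent traces.\<close>

lemma mr_lim:
  assumes t: "0 < t"
  shows "tends_to_0_in_prob S (\<lambda>n Y. mr t n Y - ms t)"
proof -
  let ?l = "\<lambda>n Y. levy_dist (spectral_law P C \<mu> n Y) \<mu>"
  have lm: "?l n \<in> borel_measurable (S n)" for n
    by (rule random_spectral_measure.levy_dist_measurable[OF spectral prob_on_nonneg_real_distribution[OF \<mu>]])
  have "tends_to_0_in_prob M (\<lambda>n \<omega>. levy_dist (ESD (sample_cov (p n) (N n) (C n) (\<lambda>j. X n j \<omega>))) (mp_law (c * \<alpha>) \<nu>))"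
    using rmp \<alpha> P C lim unfolding RMP_Pi_def by blast
  then have "tends_to_0_in_prob M (\<lambda>n \<omega>. ?l n (T n \<omega>))"
    by (rule tends_to_0_in_prob_cong_eventually)
      (use q_pos in \<open>auto elim!: eventually_mono simp: spectral_law_def sample_cov_T \<mu>_def d_def q_def\<close>)
  then have l: "tends_to_0_in_prob S ?l" using tends_to_0_in_prob_samples[OF lm] by simp
  show ?thesis
    unfolding tends_to_0_in_prob_def
  proof (intro allI impI)
    fix e :: real assume e: "0 < e"
    obtain \<delta> where \<delta>: "0 < \<delta>" "\<And>\<mu>'. prob_on_nonneg \<mu>' \<Longrightarrow> levy_dist \<mu>' \<mu> < \<delta> \<Longrightarrow>
      \<bar>(LINT l|\<mu>'. 1 / (l + t)) - (LINT l|\<mu>. 1 / (l + t))\<bar> \<le> e"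
      using resolvent_transform_levy_continuous[OF \<mu> t e] by blast
    show "(\<lambda>n. measure (S n) {Y \<in> space (S n). e < \<bar>mr t n Y - ms t\<bar>}) \<longlonglongrightarrow> 0"
    proof (rule tendsto_sandwich[OF _ _ tendsto_const])
      show "(\<lambda>n. measure (S n) {Y \<in> space (S n). \<delta> / 2 < \<bar>?l n Y\<bar>}) \<longlonglongrightarrow> 0"
        by (rule tends_to_0_in_probD[OF l]) (use \<delta>(1) in simp)
      show "eventually (\<lambda>n. measure (S n) {Y \<in> space (S n). e < \<bar>mr t n Y - ms t\<bar>} \<le> measure (S n) {Y \<in> space (S n). \<delta> / 2 < \<bar>?l n Y\<bar>}) sequentially"
      proof (intro always_eventually allI)
        fix n
        interpret prob_space "S n" by (rule S)
        show "prob {Y \<in> space (S n). e < \<bar>mr t n Y - ms t\<bar>} \<le> prob {Y \<in> space (S n). \<delta> / 2 < \<bar>?l n Y\<bar>}"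
        proof (rule finite_measure_mono)
          show "{Y \<in> space (S n). \<delta> / 2 < \<bar>?l n Y\<bar>} \<in> events" using lm[of n] by measurable
          show "{Y \<in> space (S n). e < \<bar>mr t n Y - ms t\<bar>} \<subseteq> {Y \<in> space (S n). \<delta> / 2 < \<bar>?l n Y\<bar>}"
          proof (intro subsetI, rule ccontr)
            fix Y assume Y: "Y \<in> {Y \<in> space (S n). e < \<bar>mr t n Y - ms t\<bar>}" "Y \<notin> {Y \<in> space (S n). \<delta> / 2 < \<bar>?l n Y\<bar>}"
            then have "?l n Y < \<delta>" using \<delta>(1) by auto
            then have "\<bar>mr t n Y - ms t\<bar> \<le> e"
              using \<delta>(2)[OF random_spectral_measure.\<mu>[OF spectral]] Y(1) by (simp add: mr_def ms_def)
            then show False using Y(1) by simp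
          qed
        qed
      qed
    qed auto
  qed
qed

lemma mean_lim:
  assumes t: "0 < t"
  shows "(\<lambda>n. LINT Y|S n. mr t n Y) \<longlonglongrightarrow> ms t"
proof -
  have b: "\<bar>mr t n Y - ms t\<bar> \<le> 1 / t" if "Y \<in> space (S n)" for n Y
    using mr_bounds[OF t that] ms(1,2)[OF t] by linarith
  have "(\<lambda>n. LINT Y|S n. \<bar>mr t n Y - ms t\<bar>) \<longlonglongrightarrow> 0"
    by (rule tends_to_0_in_prob_bounded_L1[OF S _ mr_lim[OF t] b]) (use mr_measurable[OF t] in auto)
  then have "(\<lambda>n. (LINT Y|S n. mr t n Y) - ms t) \<longlonglongrightarrow> 0"
  proof (rule Lim_null_comparison[rotated])
    show "eventually (\<lambda>n. norm ((LINT Y|S n. mr t n Y) - ms t) \<le> (LINT Y|S n. \<bar>mr t n Y - ms t\<bar>)) sequentially"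
    proof (intro always_eventually allI)
      fix n
      interpret prob_space "S n" by (rule S)
      have "integrable (S n) (mr t n)"
      proof (rule integrable_const_bound[of _ "1 / t"])
        show "AE Y in S n. norm (mr t n Y) \<le> 1 / t" using mr_bounds[OF t] by (intro AE_I2) (simp add: abs_of_pos)
      qed (rule mr_measurable[OF t])
      then have "(LINT Y|S n. mr t n Y) - ms t = (LINT Y|S n. mr t n Y - ms t)" by (simp add: prob_space)
      then show "norm ((LINT Y|S n. mr t n Y) - ms t) \<le> (LINT Y|S n. \<bar>mr t n Y - ms t\<bar>)"
        using integral_abs_bound[of "S n" "\<lambda>Y. mr t n Y - ms t"] by simp
    qed
  qed
  then show ?thesis by (rule LIM_zero_cancel)
qed

definition conj_form where "conj_form t n B = transpose_mat (C n) * (t \<cdot>\<^sub>m B) * C n"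

text \<open>With the scale \<open>1 / (t * N)\<close> the factor \<open>t\<close> in
  \<open>conj_form\<close> cancels, so the abstract gap becomes a statement about
  \<open>\<phi>\<close> of the sample model.\<close>

lemma jensen_gap_samples:
  fixes t :: real
  assumes t: "0 < t" and qn: "0 < q n" and B: "B \<in> carrier_mat (q n) (q n)" "psd_contraction (q n) (t \<cdot>\<^sub>m B)"
    and good: "conditional_isotropy.good (M n) (H n) (p n) (x n) (\<rho> n) G e"
  shows "(LINT \<omega>|M n. min 1 (conditional_isotropy.J (p n) (x n) (\<rho> n) (1 / (t * N n)) (conj_form t n B) \<omega>))
    \<le> mp_G (distr (M n) borel (\<rho> n)) (mat_trace B / N n)
      - sample_cov_model.\<phi> (p n) (N n) (C n) (L n) B + (2 + p n / (t * N n)) * e"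
proof -
  interpret SC: sample_cov_model "p n" "q n" "N n" "C n" "L n" t
    using model[OF C _ t, of n] qn by (simp add: q_def)
  interpret I: conditional_isotropy "M n" "H n" "p n" "x n" "\<rho> n" by (rule isotropy)
  define A where "A = conj_form t n B"
  define s where "s = 1 / (t * N n)"
  have Cn: "C n \<in> carrier_mat (q n) (p n)" "C n * transpose_mat (C n) = 1\<^sub>m (q n)"
    using C[of n] by (auto simp: orthonormal_rows_of_range_def q_def)
  have A: "psd_contraction (p n) A" unfolding A_def conj_form_def by (rule psd_contraction_conj[OF Cn B(2)])
  have s0: "0 \<le> s" using t by (simp add: s_def)
  have tr: "s * mat_trace A = mat_trace B / N n"
    using t unfolding A_def conj_form_def mat_trace_conj[OF Cn B(2)] by (simp add: s_def mat_trace_smult[OF B(1)])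
  have form: "((C n *\<^sub>v Matrix.vec (p n) z) \<bullet> (B *\<^sub>v (C n *\<^sub>v Matrix.vec (p n) z))) / N n = s * (Matrix.vec (p n) z \<bullet> (A *\<^sub>v Matrix.vec (p n) z))" for z
  proof -
    have Cz: "C n *\<^sub>v Matrix.vec (p n) z \<in> carrier_vec (q n)" using Cn by auto
    have "Matrix.vec (p n) z \<bullet> (A *\<^sub>v Matrix.vec (p n) z) = t * ((C n *\<^sub>v Matrix.vec (p n) z) \<bullet> (B *\<^sub>v (C n *\<^sub>v Matrix.vec (p n) z)))"
      unfolding A_def conj_form_def using conj_quadratic[OF Cn B(2), of "Matrix.vec (p n) z"] Cz B(1) by (simp add: smult_mat_mult_vec)
    then show ?thesis using t by (simp add: s_def)
  qed
  have Ac: "A \<in> carrier_mat (p n) (p n)" by (rule I.form_pos(3)[OF A])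
  have "SC.\<phi> B = (LINT \<omega>|M n. s * (I.v \<omega> \<bullet> (A *\<^sub>v I.v \<omega>)) / (1 + s * (I.v \<omega> \<bullet> (A *\<^sub>v I.v \<omega>))))"
    unfolding SC.\<phi>_def Let_def form unfolding L_def
    by (rule integral_distr[OF x]) (intro borel_measurable_divide borel_measurable_add borel_measurable_times borel_measurable_const quadratic_measurable[OF Ac])
  then show ?thesis
    using I.jensen_gap[OF good A s0] unfolding tr A_def[symmetric] s_def[symmetric] by (simp add: s_def)
qed

text \<open>If every admissible matrix with the right trace had a Jensen gap of at least \<open>\<gamma>\<close>, the mean
  of the resolvent trace would be bounded away from its limit.\<close>

lemma small_gap_matrix:
  fixes t \<gamma> \<delta> :: real
  assumes t: "0 < t" and \<gamma>: "0 < \<gamma>" and \<delta>: "0 < \<delta>"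
  shows "eventually (\<lambda>n. \<exists>B\<in>carrier_mat (q n) (q n). psd_contraction (q n) (t \<cdot>\<^sub>m B) \<and>
    \<bar>mat_trace B / N n - d * ms t\<bar> \<le> \<delta> \<and>
    (LINT \<omega>|M n. min 1 (conditional_isotropy.J (p n) (x n) (\<rho> n) (1 / (t * N n)) (conj_form t n B) \<omega>)) < \<gamma>) sequentially"
proof -
  define v where "v = d * ms t"
  have v: "0 \<le> v" using d ms(1)[OF t] by (simp add: v_def)
  have "(\<lambda>k. mp_modulus \<nu> (\<delta> / real (Suc k))) \<longlonglongrightarrow> 0"
    by (rule mp_modulus_tendsto_0[OF \<nu> LIMSEQ_Suc[OF lim_const_over_n]]) (use \<delta> in auto)
  then have "eventually (\<lambda>k. mp_modulus \<nu> (\<delta> / real (Suc k)) < \<gamma> / 16) sequentially"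
    by (rule order_tendstoD) (use \<gamma> in simp)
  then obtain k where k: "mp_modulus \<nu> (\<delta> / real (Suc k)) < \<gamma> / 16" by (auto dest: eventually_happens)
  \<comment> \<open>The window is shrunk until \<open>mp_G \<nu>\<close> changes by less than
    \<open>\<gamma> / 16\<close> across it.\<close>
  define \<delta>' where "\<delta>' = \<delta> / real (Suc k)"
  have \<delta>': "0 < \<delta>'" "\<delta>' \<le> \<delta>" using \<delta> by (auto simp: \<delta>'_def divide_le_eq)
  have Gv: "mp_G \<nu> (v + \<delta>') < mp_G \<nu> v + \<gamma> / 16"
  proof -
    have "\<bar>mp_G \<nu> (v + \<delta>') - mp_G \<nu> v\<bar> \<le> mp_modulus \<nu> \<delta>'" using mp_G_diff[OF \<nu>, of "v + \<delta>'" v] v \<delta>' by simp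
    moreover have "mp_modulus \<nu> \<delta>' < \<gamma> / 16" unfolding \<delta>'_def by (rule k)
    ultimately show ?thesis by linarith
  qed
  define K where "K = (c + 1) / t"
  have K: "0 < K" using c t by (simp add: K_def)
  define u where "u = 2 + K"
  \<comment> \<open>Keeps the error \<open>(2 + p / (t * N)) * e\<close> of the Jensen gap at most
    \<open>\<gamma> / 16\<close>.\<close>
  define e where "e = \<gamma> / 16 / u"
  have "0 < u" using K by (simp add: u_def)
  then have "0 < e" "u * e = \<gamma> / 16" using \<gamma> by (simp_all add: e_def)
  then have e: "0 < e" "(2 + K) * e = \<gamma> / 16" by (simp_all only: u_def)
  define pr where "pr n = measure (S n) {Y \<in> space (S n). \<delta>' / 2 < \<bar>(q n / N n) * mr t n Y - v\<bar>}" for n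
  have "(\<lambda>n. (real (q n) / real (N n)) * (1 - t * (LINT Y|S n. mr t n Y))) \<longlonglongrightarrow> d * (1 - t * ms t)"
    by (intro tendsto_intros q_lim mean_lim t)
  moreover have "d * (1 - t * ms t) = mp_G \<nu> v" using ms(3)[OF t] d by (simp add: mp_real_eq_def v_def)
  ultimately have E2: "eventually (\<lambda>n. mp_G \<nu> v - \<gamma> / 16 < (real (q n) / real (N n)) * (1 - t * (LINT Y|S n. mr t n Y))) sequentially"
    using \<gamma> by (intro order_tendstoD(1)) auto
  have E3: "eventually (\<lambda>n. mp_G (distr (M n) borel (\<rho> n)) (v + \<delta>') < mp_G \<nu> (v + \<delta>') + \<gamma> / 16) sequentially"
    by (rule order_tendstoD(2)[OF mp_G_weak_conv[OF \<nu> \<rho>_law \<rho>_lim]]) (use v \<delta>' \<gamma> in auto)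
  have "tends_to_0_in_prob S (\<lambda>n Y. (q n / N n) * mr t n Y - v)"
  proof (rule tends_to_0_in_probI_dominated[OF S])
    fix b :: real assume b: "0 < b"
    have "eventually (\<lambda>n. \<bar>real (q n) / real (N n) - d\<bar> < b * t) sequentially"
      using tendstoD[OF q_lim(2), of "b * t"] b t by (simp add: dist_real_def)
    then have "eventually (\<lambda>n. \<forall>Y\<in>space (S n). \<bar>(q n / N n) * mr t n Y - v\<bar> \<le> \<bar>d * (mr t n Y - ms t)\<bar> + b) sequentially"
    proof eventually_elim
      case (elim n)
      show ?case
      proof
        fix Y assume Y: "Y \<in> space (S n)"
        have "\<bar>real (q n) / real (N n) - d\<bar> * mr t n Y \<le> (b * t) * (1 / t)"
          using elim mr_bounds[OF t Y] t b by (intro mult_mono) auto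
        then have "\<bar>(real (q n) / real (N n) - d) * mr t n Y\<bar> \<le> b" using mr_bounds(1)[OF t Y] t by (simp add: abs_mult)
        moreover have "(q n / N n) * mr t n Y - v = (real (q n) / real (N n) - d) * mr t n Y + d * (mr t n Y - ms t)"
          by (simp add: v_def algebra_simps)
        moreover have "\<bar>y\<bar> \<le> \<bar>z\<bar> + b" if "\<bar>k\<bar> \<le> b" "y = k + z" for k y z :: real using that by linarith
        ultimately show "\<bar>(q n / N n) * mr t n Y - v\<bar> \<le> \<bar>d * (mr t n Y - ms t)\<bar> + b" by blast
      qed
    qed
    then show "\<exists>Z. (\<forall>n. Z n \<in> borel_measurable (S n)) \<and> tends_to_0_in_prob S Z \<and>
      eventually (\<lambda>n. \<forall>Y\<in>space (S n). \<bar>(q n / N n) * mr t n Y - v\<bar> \<le> \<bar>Z n Y\<bar> + b) sequentially"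
      using mr_measurable[OF t] tends_to_0_in_prob_scale[OF mr_lim[OF t], of d]
      by (intro exI[of _ "\<lambda>n Y. d * (mr t n Y - ms t)"]) auto
  qed
  then have "pr \<longlonglongrightarrow> 0" unfolding pr_def[abs_def] by (rule tends_to_0_in_probD) (use \<delta>' in simp)
  then have p0: "(\<lambda>n. (1 + \<gamma> / 2) * pr n) \<longlonglongrightarrow> (1 + \<gamma> / 2) * 0" by (intro tendsto_mult tendsto_const)
  have E4: "eventually (\<lambda>n. (1 + \<gamma> / 2) * pr n < \<gamma> / 16) sequentially"
    by (rule order_tendstoD(2)[OF p0]) (use \<gamma> in simp)
  have E6: "eventually (\<lambda>n. real (p n) / real (N n) < c + 1) sequentially"
    by (rule order_tendstoD(2)[OF pN_lim]) simp
  have E7: "eventually (\<lambda>n. 1 / real (N n) < t * \<delta>' / 2) sequentially"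
    by (rule order_tendstoD(2)[OF inverse_N]) (use t \<delta>' in simp)
  show ?thesis
    using q_pos E2 E3 E4 good_eventually[OF e(1)] E6 E7
  proof eventually_elim
    case (elim n)
    then obtain G where good: "conditional_isotropy.good (M n) (H n) (p n) (x n) (\<rho> n) G e" by blast
    interpret SC: sample_cov_model "p n" "q n" "N n" "C n" "L n" t
      using model[OF C _ t, of n] elim(1) by (simp add: q_def)
    let ?g = "mp_G (distr (M n) borel (\<rho> n))"
    let ?J = "\<lambda>B. LINT \<omega>|M n. min 1 (conditional_isotropy.J (p n) (x n) (\<rho> n) (1 / (t * N n)) (conj_form t n B) \<omega>)"
    have pk: "p n / (t * N n) \<le> K"
      using elim(6) t divide_right_mono[of "p n / N n" "c + 1" t] by (simp add: K_def mult.commute)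
    have key: "?J B \<le> ?g (mat_trace B / N n) - SC.\<phi> B + \<gamma> / 16" if B: "B \<in> carrier_mat (q n) (q n)" "psd_contraction (q n) (t \<cdot>\<^sub>m B)" for B
    proof -
      have "(2 + p n / (t * N n)) * e \<le> (2 + K) * e" using pk e by (intro mult_right_mono) auto
      then show ?thesis using jensen_gap_samples[OF t elim(1) B good] e(2) by linarith
    qed
    have J0: "0 \<le> ?J B" if B: "B \<in> carrier_mat (q n) (q n)" "psd_contraction (q n) (t \<cdot>\<^sub>m B)" for B
    proof (rule integral_nonneg_AE, rule AE_I2)
      have Cn: "C n \<in> carrier_mat (q n) (p n)" "C n * transpose_mat (C n) = 1\<^sub>m (q n)"
        using C[of n] by (auto simp: orthonormal_rows_of_range_def q_def)
      show "0 \<le> min 1 (conditional_isotropy.J (p n) (x n) (\<rho> n) (1 / (t * N n)) (conj_form t n B) \<omega>)" for \<omega>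
        using conditional_isotropy.J_nonneg[OF isotropy, of n "conj_form t n B" "1 / (t * N n)"] psd_contraction_conj[OF Cn B(2)] t
        by (simp add: conj_form_def)
    qed
    show ?case
    proof (rule ccontr)
      assume neg: "\<not> ?case"
      have gap: "SC.\<phi> B \<le> ?g (mat_trace B / N n) - \<gamma> / 2"
        if B: "B \<in> carrier_mat (q n) (q n)" "psd_contraction (q n) (t \<cdot>\<^sub>m B)" "\<bar>mat_trace B / N n - v\<bar> \<le> \<delta>'" for B
      proof -
        have "\<gamma> \<le> ?J B" using neg B \<delta>'(2) unfolding v_def by (force simp: not_less)
        then show ?thesis using key[OF B(1,2)] \<gamma> by linarith
      qed
      have up: "SC.\<phi> B \<le> ?g (mat_trace B / N n) + \<gamma> / 16"
        if B: "B \<in> carrier_mat (q n) (q n)" "psd_contraction (q n) (t \<cdot>\<^sub>m B)" for B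
        using key[OF B] J0[OF B] by linarith
      have m_eq: "sample_cov_model.m (p n) (q n) (N n) (C n) t Y = mr t n Y" for Y
        using model_m[OF C _ t, of n Y] elim(1) by (simp add: mr_def spectral_law_def q_def)
      have \<delta>N: "1 / (t * N n) \<le> \<delta>' / 2"
        using elim(7) t divide_right_mono[of "1 / real (N n)" "t * \<delta>' / 2" t] by (simp add: mult.commute)
      have "(q n / N n) * (1 - t * (LINT Y|S n. mr t n Y)) \<le> ?g (v + \<delta>') + (1 + \<gamma> / 2) * pr n + \<gamma> / 16 - \<gamma> / 2"
        unfolding pr_def S_def m_eq[symmetric]
      proof (rule SC.resolvent_trace_mean_bound[OF _ _ _ v \<delta>'(1) \<delta>N _ _ up gap])
        show "mono_on {0..} ?g" by (rule mono_onI) (auto intro: mp_G_mono[OF \<rho>_law])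
      qed (use mp_G_bounds[OF \<rho>_law] \<gamma> in auto)
      \<comment> \<open>Five errors of at most \<open>\<gamma> / 16\<close> compete with the gap
        \<open>\<gamma> / 2\<close>: the mean on the left, the shift by \<open>\<delta>'\<close>,
        the convergence of the radial laws, the bad event and the one-sided bound
        \<open>up\<close>.\<close>
      then show False using elim(2,3,4) Gv \<gamma> by linarith
    qed
  qed
qed

text \<open>The order of choices matters: \<kappa> from the tail of \<nu>, then \<tau> small
  relative to \<kappa>, then \<open>t\<close> from \<tau>, and only then \<gamma> and \<delta>,
  which depend on \<open>t\<close>. For large \<open>n\<close> the matrix \<open>B\<close> of small
  gap is fed into \<open>projection_form_bound\<close>.\<close>

lemma projection_limit_coordinates:
  assumes CP: "\<And>n. transpose_mat (C n) * C n = P n"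
  shows "tends_to_0_in_prob M (\<lambda>n \<omega>. Matrix.vec (p n) (x n \<omega>) \<bullet> (P n *\<^sub>v Matrix.vec (p n) (x n \<omega>)) / p n - \<rho> n \<omega> * mat_trace (P n) / p n)"
  unfolding tends_to_0_in_prob_def
proof (intro allI impI)
  fix \<epsilon> :: real assume \<epsilon>: "0 < \<epsilon>"
  define pr where "pr n = measure (M n) {\<omega> \<in> space (M n). \<epsilon> < \<bar>Matrix.vec (p n) (x n \<omega>) \<bullet> (P n *\<^sub>v Matrix.vec (p n) (x n \<omega>)) / p n - \<rho> n \<omega> * mat_trace (P n) / p n\<bar>}" for n
  have "pr \<longlonglongrightarrow> 0"
  proof (rule tendstoI)
    fix r :: real assume r: "0 < r"
    have "(\<lambda>k. mp_modulus \<nu> (1 / real (Suc k))) \<longlonglongrightarrow> 0"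
      by (rule mp_modulus_tendsto_0[OF \<nu> LIMSEQ_Suc[OF lim_const_over_n]]) auto
    then have "eventually (\<lambda>k. mp_modulus \<nu> (1 / real (Suc k)) < r / 8) sequentially"
      by (rule order_tendstoD) (use r in simp)
    then obtain k where k: "mp_modulus \<nu> (1 / real (Suc k)) < r / 8" by (auto dest: eventually_happens)
    define \<kappa> where "\<kappa> = real (Suc k)"
    have \<kappa>: "0 < \<kappa>" by (simp add: \<kappa>_def)
    define \<tau> where "\<tau> = min (\<epsilon> / 3) (\<epsilon> * r / 24) / \<kappa>"
    have \<tau>: "0 < \<tau>" "\<kappa> * \<tau> \<le> \<epsilon> / 3" "\<kappa> * \<tau> \<le> \<epsilon> * r / 24" using \<epsilon> r \<kappa> by (auto simp: \<tau>_def)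
    define e where "e = min (r / 8) (\<epsilon> * r / 24)"
    have e: "0 < e" "e \<le> r / 8" "e \<le> \<epsilon> * r / 24" using \<epsilon> r by (auto simp: e_def)
    have eb: "3 * (e + \<kappa> * \<tau>) / \<epsilon> \<le> r / 4"
    proof -
      have "3 * (e + \<kappa> * \<tau>) \<le> (r / 4) * \<epsilon>" using e(3) \<tau>(3) by (simp add: algebra_simps)
      then show ?thesis using \<epsilon> by (simp add: pos_divide_le_eq)
    qed
    have "(\<lambda>k. mp_modulus \<nu> (d / real (Suc k)) / d) \<longlonglongrightarrow> 0 / d"
      by (intro tendsto_divide tendsto_const mp_modulus_tendsto_0[OF \<nu> LIMSEQ_Suc[OF lim_const_over_n]]) (use d in auto)
    then have "eventually (\<lambda>k. mp_modulus \<nu> (d / real (Suc k)) / d < \<tau> / 4) sequentially"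
      by (rule order_tendstoD) (use \<tau> in simp)
    then obtain i where i: "mp_modulus \<nu> (d / real (Suc i)) / d < \<tau> / 4" by (auto dest: eventually_happens)
    \<comment> \<open>The normalized trace of \<open>t B\<close> is about
      \<open>\<alpha> * t * ms t\<close>, so \<open>1 - t * ms t\<close> is the relative share of
      the trace of the projection that it misses; \<open>mp_real_eq_tail\<close> makes this share
      small.\<close>
    define t where "t = real (Suc i)"
    have t: "0 < t" by (simp add: t_def)
    have tail: "1 - t * ms t < \<tau> / 4"
      using mp_real_eq_tail[OF \<nu> d t _ ms(2,3)[OF t]] ms(1)[OF t] i unfolding t_def by linarith
    have tail0: "0 \<le> 1 - t * ms t" using ms(2)[OF t] t by (simp add: pos_le_divide_eq mult.commute)
    \<comment> \<open>For large \<open>n\<close> the scale \<open>p / (t * N)\<close> lies within a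
      factor 2 of its limit \<open>c / t\<close>.\<close>
    define \<sigma>1 where "\<sigma>1 = c / (2 * t)"
    define \<sigma>2 where "\<sigma>2 = 2 * c / t"
    have \<sigma>: "0 < \<sigma>1" "0 < \<sigma>2" using c t by (auto simp: \<sigma>1_def \<sigma>2_def)
    define \<theta> where "\<theta> = \<sigma>1 * \<epsilon> / 3"
    define j where "j = min 1 (\<theta>\<^sup>2 / ((1 + \<sigma>2 * \<kappa>)\<^sup>2 * (1 + \<sigma>2 * \<kappa> + \<theta>)))"
    have \<theta>: "0 < \<theta>" using \<sigma> \<epsilon> by (simp add: \<theta>_def)
    have "0 < \<sigma>2 * \<kappa>" using \<sigma> \<kappa> by simp
    then have j: "0 < j" using \<theta> by (auto simp: j_def intro!: divide_pos_pos mult_pos_pos add_pos_pos zero_less_power)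
    \<comment> \<open>The Jensen remainder is compared with \<open>j\<close>, so a gap below
      \<gamma> contributes at most \<open>r / 8\<close>.\<close>
    define \<gamma> where "\<gamma> = j * r / 8"
    have \<gamma>: "0 < \<gamma>" using j r by (simp add: \<gamma>_def)
    \<comment> \<open>A trace error of \<open>\<delta> * N\<close> in \<open>B\<close> becomes, in
      the limit, \<open>t * \<delta> / c = \<tau> / 4\<close> in the normalized trace of the
      difference between the projection and \<open>t B\<close>.\<close>
    define \<delta> where "\<delta> = \<tau> * c / (4 * t)"
    have \<delta>: "0 < \<delta>" using \<tau> c t by (simp add: \<delta>_def)
    have Np: "(\<lambda>n. real (N n) / real (p n)) \<longlonglongrightarrow> 1 / c"
      using tendsto_divide[OF tendsto_const[of 1] pN_lim] c by simp
    have "(\<lambda>n. real (q n) / real (p n) - t * (d * ms t - \<delta>) * (real (N n) / real (p n))) \<longlonglongrightarrow> \<alpha> - t * (d * ms t - \<delta>) * (1 / c)"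
      unfolding q_def by (intro tendsto_intros lim Np)
    moreover have "\<alpha> - t * (d * ms t - \<delta>) * (1 / c) < \<tau>"
    proof -
      have e1: "\<alpha> - t * (d * ms t - \<delta>) * (1 / c) = \<alpha> * (1 - t * ms t) + t * \<delta> / c"
        using c by (simp add: d_def field_simps)
      have e2: "\<alpha> * (1 - t * ms t) \<le> 1 * (1 - t * ms t)" by (rule mult_right_mono[OF \<alpha>(2) tail0])
      have e3: "t * \<delta> / c = \<tau> / 4" using c t by (simp add: \<delta>_def)
      have gen: "z \<le> y \<Longrightarrow> y < \<tau> / 4 \<Longrightarrow> z + \<tau> / 4 < \<tau>" for y z :: real using \<tau>(1) by linarith
      show ?thesis unfolding e1 e3 by (rule gen[OF e2[unfolded mult_1] tail])
    qed
    ultimately have E1: "eventually (\<lambda>n. real (q n) / real (p n) - t * (d * ms t - \<delta>) * (real (N n) / real (p n)) < \<tau>) sequentially"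
      by (rule order_tendstoD(2))
    have E2: "eventually (\<lambda>n. mp_modulus (distr (M n) borel (\<rho> n)) (1 / \<kappa>) < r / 8) sequentially"
      by (rule order_tendstoD(2)[OF mp_modulus_weak_conv[OF \<nu> \<rho>_law \<rho>_lim]]) (use k in \<open>auto simp: \<kappa>_def\<close>)
    have E3: "eventually (\<lambda>n. c / 2 < real (p n) / real (N n)) sequentially" "eventually (\<lambda>n. real (p n) / real (N n) < 2 * c) sequentially"
      by (rule order_tendstoD[OF pN_lim], use c in simp)+
    show "eventually (\<lambda>n. dist (pr n) 0 < r) sequentially"
      using q_pos E1 E2 E3 good_eventually[OF e(1)] small_gap_matrix[OF t \<gamma> \<delta>]
    proof eventually_elim
      case (elim n)
      obtain G where good: "conditional_isotropy.good (M n) (H n) (p n) (x n) (\<rho> n) G e" using elim(6) by blast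
      obtain B where B: "B \<in> carrier_mat (q n) (q n)" "psd_contraction (q n) (t \<cdot>\<^sub>m B)"
        "\<bar>mat_trace B / N n - d * ms t\<bar> \<le> \<delta>"
        and J: "(LINT \<omega>|M n. min 1 (conditional_isotropy.J (p n) (x n) (\<rho> n) (1 / (t * N n)) (conj_form t n B) \<omega>)) < \<gamma>"
        using elim(7) by blast
      interpret I: conditional_isotropy "M n" "H n" "p n" "x n" "\<rho> n" by (rule isotropy)
      define A where "A = conj_form t n B"
      have Cn: "C n \<in> carrier_mat (q n) (p n)" "C n * transpose_mat (C n) = 1\<^sub>m (q n)"
        using C[of n] by (auto simp: orthonormal_rows_of_range_def q_def)
      have A: "psd_contraction (p n) A" unfolding A_def conj_form_def by (rule psd_contraction_conj[OF Cn B(2)])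
      have Pc: "P n \<in> carrier_mat (p n) (p n)" using P by (simp add: orth_projection_def)
      have PA: "P n - A = transpose_mat (C n) * (1\<^sub>m (q n) - t \<cdot>\<^sub>m B) * C n"
      proof -
        have "transpose_mat (C n) * (1\<^sub>m (q n) - t \<cdot>\<^sub>m B) = transpose_mat (C n) - transpose_mat (C n) * (t \<cdot>\<^sub>m B)"
          using Cn B(1) by (subst mult_minus_distrib_mat[of _ "p n" "q n" _ "q n"]) auto
        then have "transpose_mat (C n) * (1\<^sub>m (q n) - t \<cdot>\<^sub>m B) * C n = transpose_mat (C n) * C n - transpose_mat (C n) * (t \<cdot>\<^sub>m B) * C n"
          using Cn B(1) by (simp, subst minus_mult_distrib_mat[of _ "p n" "q n" _ _ "p n"]) auto
        then show ?thesis by (simp add: CP A_def conj_form_def)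
      qed
      have PAc: "psd_contraction (p n) (P n - A)"
        unfolding PA by (rule psd_contraction_conj[OF Cn psd_contraction_complement[OF B(2)]])
      have "mat_trace (P n - A) = mat_trace (P n) - t * mat_trace B"
        unfolding mat_trace_minus[OF Pc I.form_pos(3)[OF A]] unfolding A_def conj_form_def mat_trace_conj[OF Cn B(2)]
        by (simp add: mat_trace_smult[OF B(1)])
      then have "mat_trace (P n - A) / p n = real (q n) / real (p n) - t * (mat_trace B / N n) * (real (N n) / real (p n))"
        using orth_projection_trace[OF P, of n] N[of n] by (simp add: q_def diff_divide_distrib)
      also have "\<dots> \<le> real (q n) / real (p n) - t * (d * ms t - \<delta>) * (real (N n) / real (p n))"
        using B(3) t by (intro diff_left_mono mult_right_mono mult_left_mono) auto
      finally have tr: "mat_trace (P n - A) / p n \<le> \<tau>" using elim(2) by linarith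
      have sp: "\<sigma>1 \<le> (1 / (t * N n)) * p n" "(1 / (t * N n)) * p n \<le> \<sigma>2"
        using elim(4,5) t divide_right_mono[of "c / 2" "p n / N n" t] divide_right_mono[of "p n / N n" "2 * c" t]
        by (auto simp: \<sigma>1_def \<sigma>2_def mult.commute)
      have "pr n \<le> I.prob {\<omega> \<in> space (M n). \<kappa> < \<rho> n \<omega>} + e + 3 * (e + \<kappa> * \<tau>) / \<epsilon> + I.expectation (\<lambda>\<omega>. min 1 (I.J (1 / (t * N n)) A \<omega>)) / j"
        unfolding pr_def j_def \<theta>_def
        by (rule I.projection_form_bound[OF good A PAc Pc \<epsilon> less_imp_le[OF \<kappa>] tr \<tau>(2) \<sigma>(1) sp])
      moreover have "I.prob {\<omega> \<in> space (M n). \<kappa> < \<rho> n \<omega>} \<le> r / 8"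
        using prob_gt_le_mp_modulus[OF M \<rho>_measurable I.\<rho>0 \<kappa>] elim(3) by simp
      moreover have "I.expectation (\<lambda>\<omega>. min 1 (I.J (1 / (t * N n)) A \<omega>)) / j \<le> r / 8"
        using J j by (simp add: A_def \<gamma>_def pos_divide_le_eq mult.commute)
      \<comment> \<open>The budget: \<open>r / 8\<close> each for large radii, for the exceptional
        set of (ACI) and for the Jensen remainder, and \<open>r / 4\<close> for the form of the
        missing part.\<close>
      moreover have "u \<le> 5 * r / 8" if "u \<le> a + e + w + b" "a \<le> r / 8" "b \<le> r / 8" "w \<le> r / 4" for a b u w :: real
        using that e(2) by linarith
      ultimately have "pr n \<le> 5 * r / 8" using eb by blast
      moreover have "0 \<le> pr n" by (simp add: pr_def)
      ultimately show ?case using r by (simp add: dist_real_def)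
    qed
  qed
  then show "(\<lambda>n. measure (M n) {\<omega> \<in> space (M n). \<epsilon> < \<bar>Matrix.vec (p n) (x n \<omega>) \<bullet> (P n *\<^sub>v Matrix.vec (p n) (x n \<omega>)) / p n - \<rho> n \<omega> * mat_trace (P n) / p n\<bar>}) \<longlonglongrightarrow> 0"
    unfolding pr_def[abs_def] .
qed

end

lemma projection_limit:
  assumes \<alpha>: "0 < \<alpha>" and P: "\<And>n. orth_projection (p n) (P n)"
    and lim: "(\<lambda>n. mat_trace (P n) / real (p n)) \<longlonglongrightarrow> \<alpha>"
  shows "tends_to_0_in_prob M (\<lambda>n \<omega>. Matrix.vec (p n) (x n \<omega>) \<bullet> (P n *\<^sub>v Matrix.vec (p n) (x n \<omega>)) / p n - \<rho> n \<omega> * mat_trace (P n) / p n)"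
proof -
  have tr: "mat_trace (P n) = mat_rank (P n)" for n by (rule orth_projection_trace[OF P])
  have "\<forall>n. \<exists>C. orthonormal_rows_of_range (p n) (P n) C \<and> transpose_mat C * C = P n"
    using orth_projection_rows[OF P] by metis
  then obtain C where C: "\<And>n. orthonormal_rows_of_range (p n) (P n) (C n)" "\<And>n. transpose_mat (C n) * C n = P n" by metis
  have lim': "(\<lambda>n. real (mat_rank (P n)) / real (p n)) \<longlonglongrightarrow> \<alpha>" using lim unfolding tr .
  have "\<alpha> \<le> 1"
    by (rule LIMSEQ_le_const2[OF lim']) (use orth_projection_rank_le[OF P] p in \<open>auto intro!: exI[of _ 0] simp: divide_le_eq\<close>)
  then show ?thesis by (rule projection_limit_coordinates[OF \<alpha> _ P C(1) lim' C(2)])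
qed

text \<open>The identity has relative rank 1 and its form is the squared norm, so the projection
  limit compares the radius directly with \<rho>.\<close>

lemma R_\<rho>_limit: "tends_to_0_in_prob M (\<lambda>n \<omega>. R_val (p n) (x n \<omega>) - \<rho> n \<omega>)"
proof -
  have "tends_to_0_in_prob M (\<lambda>n \<omega>. Matrix.vec (p n) (x n \<omega>) \<bullet> (1\<^sub>m (p n) *\<^sub>v Matrix.vec (p n) (x n \<omega>)) / p n - \<rho> n \<omega> * mat_trace (1\<^sub>m (p n)) / p n)"
  proof (rule projection_limit[of 1])
    have one: "mat_trace (1\<^sub>m (p n)) / real (p n) = 1" for n using p[of n] by simp
    show "(\<lambda>n. mat_trace (1\<^sub>m (p n)) / real (p n)) \<longlonglongrightarrow> 1" unfolding one by simp
  qed (simp_all add: orth_projection_one)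
  then show ?thesis using p by (simp add: R_val_def)
qed

lemma R_measurable: "(\<lambda>\<omega>. R_val (p n) (x n \<omega>)) \<in> borel_measurable (M n)"
  by (rule measurable_compose[OF x R_val_measurable])

lemma R_limit: "weak_conv_m (\<lambda>n. distr (M n) borel (\<lambda>\<omega>. R_val (p n) (x n \<omega>))) \<nu>"
  by (rule weak_conv_tends_to_0_in_prob[OF M R_measurable \<rho>_measurable R_\<rho>_limit \<rho>_lim prob_on_nonneg_real_distribution[OF \<nu>]])

text \<open>Subtracting \<open>tr P / p\<close> times the limit for the identity removes the
  conditional radius \<rho> and leaves exactly \<open>Q_val\<close>.\<close>

lemma Q_limit:
  assumes \<alpha>: "0 < \<alpha>" and P: "\<And>n. orth_projection (p n) (P n)"
    and lim: "(\<lambda>n. mat_trace (P n) / real (p n)) \<longlonglongrightarrow> \<alpha>"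
  shows "tends_to_0_in_prob M (\<lambda>n \<omega>. Q_val (p n) (P n) (x n \<omega>))"
proof -
  let ?Y = "\<lambda>n \<omega>. Matrix.vec (p n) (x n \<omega>) \<bullet> (P n *\<^sub>v Matrix.vec (p n) (x n \<omega>)) / p n - \<rho> n \<omega> * mat_trace (P n) / p n"
  let ?Z = "\<lambda>n \<omega>. (mat_trace (P n) / p n) * (R_val (p n) (x n \<omega>) - \<rho> n \<omega>)"
  have Pc: "P n \<in> carrier_mat (p n) (p n)" for n using P by (simp add: orth_projection_def)
  have tr: "0 \<le> mat_trace (P n) / p n" "mat_trace (P n) / p n \<le> 1" for n
    using orth_projection_trace[OF P[of n]] orth_projection_rank_le[OF P[of n]] p[of n] by (auto simp: divide_le_eq)
  have Ym: "?Y n \<in> borel_measurable (M n)" for n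
    using measurable_compose[OF x quadratic_measurable[OF Pc]] \<rho>_measurable by simp
  have Zm: "?Z n \<in> borel_measurable (M n)" for n
    using R_measurable \<rho>_measurable by simp
  have Z: "tends_to_0_in_prob M ?Z"
  proof (rule tends_to_0_in_prob_mono[OF M _ R_\<rho>_limit])
    show "(\<lambda>\<omega>. R_val (p n) (x n \<omega>) - \<rho> n \<omega>) \<in> borel_measurable (M n)" for n using R_measurable \<rho>_measurable by simp
    have "\<bar>?Z n \<omega>\<bar> \<le> \<bar>R_val (p n) (x n \<omega>) - \<rho> n \<omega>\<bar>" for n \<omega>
      using mult_right_mono[OF tr(2)[of n] abs_ge_zero[of "R_val (p n) (x n \<omega>) - \<rho> n \<omega>"]]
      by (simp only: abs_mult[of "mat_trace (P n) / p n"] abs_of_nonneg[OF tr(1)] mult_1)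
    then show "eventually (\<lambda>n. \<forall>\<omega>\<in>space (M n). \<bar>?Z n \<omega>\<bar> \<le> \<bar>R_val (p n) (x n \<omega>) - \<rho> n \<omega>\<bar>) sequentially" by simp
  qed
  have "tends_to_0_in_prob M (\<lambda>n \<omega>. ?Y n \<omega> + - 1 * ?Z n \<omega>)"
    by (rule tends_to_0_in_prob_add[OF M Ym projection_limit[OF \<alpha> P lim] _ tends_to_0_in_prob_scale[OF Z]]) (use Zm in simp)
  moreover have "?Y n \<omega> + - 1 * ?Z n \<omega> = Q_val (p n) (P n) (x n \<omega>)" for n \<omega>
    by (simp add: Q_val_def algebra_simps)
  ultimately show ?thesis by simp
qed

lemma Q_val_complement:
  assumes "orth_projection (p n) P"
  shows "Q_val (p n) (1\<^sub>m (p n) - P) y = - Q_val (p n) P y"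
proof -
  have Pc: "P \<in> carrier_mat (p n) (p n)" using assms by (simp add: orth_projection_def)
  let ?v = "Matrix.vec (p n) y"
  have "?v \<bullet> ((1\<^sub>m (p n) - P) *\<^sub>v ?v) = ?v \<bullet> ?v - ?v \<bullet> (P *\<^sub>v ?v)"
    using Pc by (subst minus_mult_distrib_mat_vec[of _ "p n" "p n"]) (auto intro!: scalar_prod_minus_distrib[of _ "p n"])
  moreover have "mat_trace (1\<^sub>m (p n) - P) = p n - mat_trace P" using mat_trace_minus[OF _ Pc, of "1\<^sub>m (p n)"] by simp
  ultimately show ?thesis using p[of n] by (simp add: Q_val_def R_val_def diff_divide_distrib right_diff_distrib)
qed

text \<open>Along a subsequence the relative ranks converge; the remaining terms of the sequence are
  filled with coordinate projections of the right rank. Limit 0 is treated by complements.\<close>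

lemma RQC: "RQC M p x"
  unfolding RQC_def
proof (intro allI impI)
  fix P assume "\<forall>n. orth_projection (p n) (P n)"
  then have P: "\<And>n. orth_projection (p n) (P n)" by blast
  define a where "a n = mat_trace (P n) / real (p n)" for n
  have a: "0 \<le> a n" "a n \<le> 1" for n
    using orth_projection_trace[OF P[of n]] orth_projection_rank_le[OF P[of n]] p[of n] by (auto simp: a_def divide_le_eq)
  show "tends_to_0_in_prob M (\<lambda>n \<omega>. Q_val (p n) (P n) (x n \<omega>))"
    unfolding tends_to_0_in_prob_def
  proof (intro allI impI, rule ccontr)
    fix e :: real assume e: "0 < e"
    define f where "f n = measure (M n) {\<omega> \<in> space (M n). e < \<bar>Q_val (p n) (P n) (x n \<omega>)\<bar>}" for n
    assume "\<not> (\<lambda>n. measure (M n) {\<omega> \<in> space (M n). e < \<bar>Q_val (p n) (P n) (x n \<omega>)\<bar>}) \<longlonglongrightarrow> 0"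
    then have "\<not> f \<longlonglongrightarrow> 0" unfolding f_def[abs_def] .
    then obtain b where b: "0 < b" "\<not> eventually (\<lambda>n. dist (f n) 0 < b) sequentially" by (auto simp: tendsto_iff)
    then have fr: "\<exists>\<^sub>\<infinity>n. b \<le> f n"
      unfolding cofinite_eq_sequentially frequently_def using measure_nonneg by (simp add: f_def dist_real_def not_le)
    define r0 where "r0 = enumerate {n. b \<le> f n}"
    have r0: "strict_mono r0" "\<And>k. b \<le> f (r0 k)"
      using fr enumerate_in_set[of "{n. b \<le> f n}"] unfolding r0_def INFM_iff_infinite by (auto intro!: strict_mono_enumerate)
    have "bounded (range (\<lambda>k. a (r0 k)))"
      using a by (intro boundedI[of _ 1]) auto
    then obtain \<alpha> r1 where r1: "strict_mono (r1 :: nat \<Rightarrow> nat)" "((\<lambda>k. a (r0 k)) \<circ> r1) \<longlonglongrightarrow> \<alpha>"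
      using bounded_imp_convergent_subsequence by blast
    define r where "r = r0 \<circ> r1"
    have r: "strict_mono r" "\<And>k. b \<le> f (r k)" "(\<lambda>k. a (r k)) \<longlonglongrightarrow> \<alpha>"
      using strict_mono_o[OF r0(1) r1(1)] r0(2) r1(2) by (simp_all add: r_def comp_def)
    have \<alpha>01: "0 \<le> \<alpha>" "\<alpha> \<le> 1"
      using LIMSEQ_le_const[OF r(3)] LIMSEQ_le_const2[OF r(3)] a by auto
    \<comment> \<open>Stated for a general \<open>P'\<close> with the same absolute values of
      \<open>Q_val\<close>, so that it applies to the given projections as well as to their
      complements.\<close>
    have main: False if P': "\<And>n. orth_projection (p n) (P' n)" and lim': "(\<lambda>k. mat_trace (P' (r k)) / real (p (r k))) \<longlonglongrightarrow> \<beta>"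
      and \<beta>: "0 < \<beta>" "\<beta> \<le> 1" and Q: "\<And>n \<omega>. \<bar>Q_val (p n) (P' n) (x n \<omega>)\<bar> = \<bar>Q_val (p n) (P n) (x n \<omega>)\<bar>" for P' \<beta>
    proof -
      define R where "R n = (if n \<in> range r then P' n else coord_projection (p n) (nat \<lfloor>\<beta> * p n\<rfloor>))" for n
      have R: "orth_projection (p n) (R n)" for n using P' orth_projection_coord_projection by (simp add: R_def)
      have coord: "\<bar>mat_trace (coord_projection (p n) (nat \<lfloor>\<beta> * p n\<rfloor>)) / p n - \<beta>\<bar> \<le> 1 / real (p n)" for n
      proof -
        define i where "i = nat \<lfloor>\<beta> * p n\<rfloor>"
        have i: "real i = real_of_int \<lfloor>\<beta> * p n\<rfloor>" using \<beta> by (simp add: i_def)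
        have "\<beta> * real (p n) \<le> 1 * real (p n)" using \<beta> by (intro mult_right_mono) auto
        then have "i \<le> p n" unfolding of_nat_le_iff[symmetric, where 'a=real] i by linarith
        then have tr: "mat_trace (coord_projection (p n) i) = i" by (rule mat_trace_coord_projection)
        have "\<bar>real i - \<beta> * p n\<bar> \<le> 1" unfolding i by linarith
        then have "\<bar>real i - \<beta> * p n\<bar> / p n \<le> 1 / p n" by (intro divide_right_mono) auto
        moreover have "real i / p n - \<beta> = (real i - \<beta> * p n) / p n" using p[of n] by (simp add: diff_divide_distrib)
        ultimately show ?thesis using tr by (simp add: i_def)
      qed
      have "(\<lambda>n. mat_trace (R n) / real (p n)) \<longlonglongrightarrow> \<beta>"
      proof (rule tendstoI)
        fix u :: real assume u: "0 < u"
        have "(\<lambda>n. 1 / real (p n)) \<longlonglongrightarrow> 0"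
          by (rule tendsto_divide_0[OF tendsto_const filterlim_at_top_imp_at_infinity[OF filterlim_compose[OF filterlim_real_sequentially p_lim]]])
        then have ev: "eventually (\<lambda>n. 1 / real (p n) < u) sequentially" by (rule order_tendstoD) (rule u)
        obtain K where K: "\<And>k. K \<le> k \<Longrightarrow> dist (mat_trace (P' (r k)) / real (p (r k))) \<beta> < u"
          using tendstoD[OF lim' u] by (auto simp: eventually_sequentially)
        show "eventually (\<lambda>n. dist (mat_trace (R n) / real (p n)) \<beta> < u) sequentially"
          using ev eventually_ge_at_top[of "r K"]
        proof eventually_elim
          case (elim n)
          show ?case
          proof (cases "n \<in> range r")
            case True
            then obtain k where k: "n = r k" by blast
            then have "K \<le> k" using elim(2) strict_mono_less_eq[OF r(1)] by simp
            then show ?thesis using K[of k] True by (simp add: R_def k)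
          qed (use coord[of n] elim(1) in \<open>simp add: R_def dist_real_def\<close>)
        qed
      qed
      from Q_limit[OF \<beta>(1) R this] have "(\<lambda>n. measure (M n) {\<omega> \<in> space (M n). e < \<bar>Q_val (p n) (R n) (x n \<omega>)\<bar>}) \<longlonglongrightarrow> 0"
        using e by (simp add: tends_to_0_in_prob_def)
      from LIMSEQ_subseq_LIMSEQ[OF this r(1)] have "(\<lambda>k. f (r k)) \<longlonglongrightarrow> 0"
        by (simp add: comp_def R_def f_def Q)
      then have "b \<le> 0" by (rule LIMSEQ_le_const) (use r(2) in auto)
      then show False using b(1) by simp
    qed
    show False
    proof (cases "\<alpha> = 0")
      case False
      then show False using main[OF P _ _ \<alpha>01(2)] r(3) \<alpha>01(1) unfolding a_def by simp
    next
      case True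
      have "(\<lambda>k. 1 - a (r k)) \<longlonglongrightarrow> 1 - \<alpha>" by (intro tendsto_intros r(3))
      moreover have "mat_trace (1\<^sub>m (p n) - P n) / real (p n) = 1 - a n" for n
        using mat_trace_minus[of "1\<^sub>m (p n)" "p n" "P n"] P[of n] p[of n] by (simp add: orth_projection_def a_def diff_divide_distrib)
      ultimately show False
        using main[of "\<lambda>n. 1\<^sub>m (p n) - P n" 1, OF orth_projection_complement[OF P]] True Q_val_complement[OF P] by simp
    qed
  qed
qed

end

theorem theorem9p3:
  fixes M :: "nat \<Rightarrow> 'a measure"
    and p N :: "nat \<Rightarrow> nat"
    and c :: real
    and x :: "nat \<Rightarrow> 'a \<Rightarrow> nat \<Rightarrow> real"
    and X :: "nat \<Rightarrow> nat \<Rightarrow> 'a \<Rightarrow> nat \<Rightarrow> real"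
    and \<nu> :: "real measure"
  assumes "\<And>n. 0 < p n" and "\<And>n. 0 < N n"
    and "filterlim p at_top sequentially"
    and "0 < c" and "(\<lambda>n. real (p n) / real (N n)) \<longlonglongrightarrow> c"
    and "\<And>n. prob_space (M n)"
    and "\<And>n. x n \<in> M n \<rightarrow>\<^sub>M vec_borel (p n)"
    and "\<And>n. prob_space.indep_vars (M n) (\<lambda>_. vec_borel (p n)) (X n) {..<N n}"
    and "\<And>n j. j < N n \<Longrightarrow>
           distr (M n) (vec_borel (p n)) (X n j) = distr (M n) (vec_borel (p n)) (x n)"
    and "prob_on_nonneg \<nu>"
  shows "(weak_conv_m (\<lambda>n. distr (M n) borel (\<lambda>\<omega>. R_val (p n) (x n \<omega>))) \<nu> \<and> RQC M p x
            \<longrightarrow> RMP_Pi M p N X c \<nu>) \<and>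
         (\<forall>H \<rho>. ACI_through M p x H \<rho> \<nu> \<longrightarrow>
            ((weak_conv_m (\<lambda>n. distr (M n) borel (\<lambda>\<omega>. R_val (p n) (x n \<omega>))) \<nu> \<and> RQC M p x)
               \<longleftrightarrow> RMP_Pi M p N X c \<nu>) \<and>
            (RMP_Pi M p N X c \<nu> \<longrightarrow>
               tends_to_0_in_prob M (\<lambda>n \<omega>. R_val (p n) (x n \<omega>) - \<rho> n \<omega>)))"
proof -
  interpret sample_sequence M p N c x X by (rule sample_sequence.intro) (fact assms)+
  have 1: "RMP_Pi M p N X c \<nu>"
    if "weak_conv_m (\<lambda>n. distr (M n) borel (\<lambda>\<omega>. R_val (p n) (x n \<omega>))) \<nu> \<and> RQC M p x"
    by (rule RMP_of_RQC[OF assms(10)]) (use that in simp_all)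
  have 2: "aci_sequence M p N c x X H \<rho> \<nu>" if "ACI_through M p x H \<rho> \<nu>" "RMP_Pi M p N X c \<nu>" for H \<rho>
    by (intro aci_sequence.intro aci_sequence_axioms.intro sample_sequence_axioms that assms(10))
  show ?thesis
  proof (intro conjI allI impI)
    fix H \<rho> assume aci: "ACI_through M p x H \<rho> \<nu>"
    show "(weak_conv_m (\<lambda>n. distr (M n) borel (\<lambda>\<omega>. R_val (p n) (x n \<omega>))) \<nu> \<and> RQC M p x) \<longleftrightarrow> RMP_Pi M p N X c \<nu>"
      using 1 aci_sequence.R_limit[OF 2[OF aci]] aci_sequence.RQC[OF 2[OF aci]] by blast
    show "tends_to_0_in_prob M (\<lambda>n \<omega>. R_val (p n) (x n \<omega>) - \<rho> n \<omega>)" if "RMP_Pi M p N X c \<nu>"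
      by (rule aci_sequence.R_\<rho>_limit[OF 2[OF aci that]])
  qed (rule 1)
qed

end
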